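(* Let $(E,\theta)$, $E=\bigoplus_{i=0}^k E^i$ with $k\geq 1$, be a $\mathbb{C}$-VHS over a Kähler manifold, and let $D$ be the $\mathrm{PU}(p,q)$ period domain associated to $E$. Suppose that there is no index $i$ with $0<i<k$ and $\mathrm{rk}\,E^i=1$. Then $\pi_2(D)$ can be generated by superhorizontal $2$-spheres, i.e. $\pi_2(D)$ is generated by classes of smooth superhorizontal maps $S^2\to D$.
   Context: A (polarized) complex variation of Hodge structure ($\mathbb{C}$-VHS) on a connected complex manifold $M$ is a $C^\infty$ complex vector bundle $E$ of finite rank with a decomposition $E=\bigoplus_{i=0}^k E^i$ into (nonzero) $C^\infty$ subbundles, a flat connection $\nabla$ satisfying $$\nabla:E^i\to A^{0,1}(E^{i-1})\oplus A^{1,0}(E^i)\oplus A^{0,1}(E^i)\oplus A^{1,0}(E^{i+1}),$$ and a parallel Hermitian form $h$ for which the decomposition is orthogonal and which is positive definite on $E^i$ for $i$ even and negative definite on $E^i$ for $i$ odd. Its Higgs field is $\theta=\bigoplus_{i=0}^{k-1}\theta_i$, where $\theta_i:E^i\to E^{i+1}\otimes\Omega^1_M$ is the corresponding component of $\nabla$. Set $r_i=\mathrm{rk}\,E^i\ge 1$, $p=\sum_{i\text{ even}}r_i$, $q=\sum_{i\text{ odd}}r_i$. Let $\mathbb{E}=\bigoplus_{i=0}^k\mathbb{E}^i$ be the fiber of $E$ over a base point with its induced Hermitian form $h$ of signature $(p,q)$. Let $D_u$ be the flag manifold of all flags $0=F^{-1}\subset F^0\subset F^1\subset\dots\subset F^{k-1}\subset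 F^k=\mathbb{E}$ with $\dim F^i/F^{i-1}=r_i$. The $\mathrm{PU}(p,q)$ period domain $D$ associated to $E$ is the open subset of $D_u$ consisting of the flags such that for every $0\le i\le k$ the form $(-1)^i h$ is positive definite on the $h$-orthogonal of $F^{i-1}$ in $F^{i}$. It is the orbit of the base flag $\mathbb{F}^s=\bigoplus_{i\le s}\mathbb{E}^i$ under $\mathrm{PU}(\mathbb{E},h)\simeq\mathrm{PU}(p,q)$, so $D\simeq \mathrm{PU}(p,q)/\mathrm{P}(\mathrm{U}(r_0)\times\dots\times\mathrm{U}(r_k))$. The superhorizontal distribution $H_D\subset T_D$ is the holomorphic subbundle whose fiber at a flag $F^\bullet\in D$ is the image in $T_{D,F^\bullet}=\mathrm{End}(\mathbb{E})/\{A: AF^i\subset F^i\ \forall i\}$ of $\{A\in\mathrm{End}(\mathbb{E}): AF^i\subset F^{i+1}\text{ for all }0\le i\le k-1\}$. A smooth map $f:S^2\to D$ is superhorizontal if $df(T_{S^2,x})\subset H_{D,f(x)}$ for all $x\in S^2$. *)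

theory Defs
  imports "HOL-Analysis.Analysis" "HOL-Algebra.Generated_Groups"
begin

section \<open>Smooth maps and complex manifolds\<close>

text \<open>Real \<open>C\<^sup>k\<close> and \<open>C\<^sup>\<infinity>\<close> maps on an open subset of a finite-dimensional normed space.\<close>

primrec Ck_on :: "nat \<Rightarrow> 'a::real_normed_vector set \<Rightarrow> ('a \<Rightarrow> 'b::real_normed_vector) \<Rightarrow> bool" where
  "Ck_on 0 S f \<longleftrightarrow> continuous_on S f"
| "Ck_on (Suc k) S f \<longleftrightarrow>
     f differentiable_on S \<and> (\<forall>v. Ck_on k S (\<lambda>x. frechet_derivative f (at x) v))"

definition smooth_on :: "'a::real_normed_vector set \<Rightarrow> ('a \<Rightarrow> 'b::real_normed_vector) \<Rightarrow> bool" where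
  "smooth_on S f \<longleftrightarrow> (\<forall>k. Ck_on k S f)"

text \<open>A chart is a pair \<open>(V, \<phi>)\<close> of an open set and a coordinate map on it. The model space is a
  finite-dimensional real vector space with a complex structure \<open>J\<close> (so every complex dimension,
  0 included, occurs). A tangent vector at \<open>x\<close> is given by its coordinates \<open>v\<close> in a chart.\<close>

type_synonym ('m, 'c) chart = "'m set \<times> ('m \<Rightarrow> 'c)"

definition transition_map :: "('m, 'c) chart \<Rightarrow> ('m, 'c) chart \<Rightarrow> 'c \<Rightarrow> 'c" where
  "transition_map c c' = snd c' \<circ> inv_into (fst c) (snd c)"

definition chart_deriv ::
  "('m, 'c::real_normed_vector) chart \<Rightarrow> ('m \<Rightarrow> 'b::real_normed_vector) \<Rightarrow> 'm \<Rightarrow> 'c \<Rightarrow> 'b" where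
  "chart_deriv c f x v = frechet_derivative (f \<circ> inv_into (fst c) (snd c)) (at (snd c x)) v"

definition smooth_fun ::
  "('m, 'c::real_normed_vector) chart set \<Rightarrow> 'm set \<Rightarrow> ('m \<Rightarrow> 'b::real_normed_vector) \<Rightarrow> bool" where
  "smooth_fun Atl W f \<longleftrightarrow>
     (\<forall>c\<in>Atl. smooth_on (snd c ` (fst c \<inter> W)) (f \<circ> inv_into (fst c) (snd c)))"

locale complex_manifold =
  fixes X :: "'m topology"
    and Atl :: "('m, 'c::real_normed_vector) chart set"
    and J :: "'c \<Rightarrow> 'c"
  assumes model_finite_dim: "\<exists>B::'c set. finite B \<and> span B = UNIV"
    and J_linear: "linear J"
    and J_square: "J (J v) = - v"
    and Hausdorff: "Hausdorff_space X"
    and second_countable: "second_countable X"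
    and connected: "connected_space X"
    and nonempty: "topspace X \<noteq> {}"
    and chart_open: "c \<in> Atl \<Longrightarrow> openin X (fst c) \<and> open (snd c ` fst c)"
    and chart_homeo: "c \<in> Atl \<Longrightarrow>
      homeomorphic_map (subtopology X (fst c)) (top_of_set (snd c ` fst c)) (snd c)"
    and chart_cover: "topspace X = \<Union> (fst ` Atl)"
    and transition_smooth: "\<lbrakk>c \<in> Atl; c' \<in> Atl\<rbrakk> \<Longrightarrow>
      smooth_on (snd c ` (fst c \<inter> fst c')) (transition_map c c')"
    and transition_holomorphic: "\<lbrakk>c \<in> Atl; c' \<in> Atl; z \<in> snd c ` (fst c \<inter> fst c')\<rbrakk> \<Longrightarrow>
      frechet_derivative (transition_map c c') (at z) (J v) =
      J (frechet_derivative (transition_map c c') (at z) v)"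

text \<open>\<open>\<omega> c x u v\<close> is the value of the Kaehler form at \<open>x\<close> on the tangent vectors with coordinates
  \<open>u\<close>, \<open>v\<close> in the chart \<open>c\<close>. Closedness is \<open>d\<omega>(u,v,w) = 0\<close> for constant coordinate fields.\<close>

locale kaehler_manifold = complex_manifold X Atl J
  for X :: "'m topology" and Atl :: "('m, 'c::real_normed_vector) chart set" and J :: "'c \<Rightarrow> 'c" +
  fixes \<omega> :: "('m, 'c) chart \<Rightarrow> 'm \<Rightarrow> 'c \<Rightarrow> 'c \<Rightarrow> real"
  assumes form_bilinear: "\<lbrakk>c \<in> Atl; x \<in> fst c\<rbrakk> \<Longrightarrow> bilinear (\<omega> c x)"
    and form_alternating: "\<lbrakk>c \<in> Atl; x \<in> fst c\<rbrakk> \<Longrightarrow> \<omega> c x v v = 0"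
    and form_J_invariant: "\<lbrakk>c \<in> Atl; x \<in> fst c\<rbrakk> \<Longrightarrow> \<omega> c x (J u) (J v) = \<omega> c x u v"
    and form_positive: "\<lbrakk>c \<in> Atl; x \<in> fst c; v \<noteq> 0\<rbrakk> \<Longrightarrow> 0 < \<omega> c x v (J v)"
    and form_smooth: "c \<in> Atl \<Longrightarrow> smooth_fun Atl (fst c) (\<lambda>x. \<omega> c x u v)"
    and form_transition: "\<lbrakk>c \<in> Atl; c' \<in> Atl; x \<in> fst c \<inter> fst c'\<rbrakk> \<Longrightarrow>
      \<omega> c' x (frechet_derivative (transition_map c c') (at (snd c x)) u)
             (frechet_derivative (transition_map c c') (at (snd c x)) v) = \<omega> c x u v"
    and form_closed: "\<lbrakk>c \<in> Atl; x \<in> fst c\<rbrakk> \<Longrightarrow>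
      chart_deriv c (\<lambda>y. \<omega> c y v w) x u + chart_deriv c (\<lambda>y. \<omega> c y w u) x v
        + chart_deriv c (\<lambda>y. \<omega> c y u v) x w = 0"

section \<open>Complex variations of Hodge structure\<close>

text \<open>After choosing a basis of every fibre, without any continuity, a complex vector bundle of rank
  \<open>n\<close> has underlying set \<open>M \<times> \<complex>\<^sup>n\<close> with linear fibres, and its \<open>C\<^sup>\<infinity>\<close> structure is recorded by a
  family \<open>Fr\<close> of local frames \<open>(U, e)\<close>, \<open>e : U \<rightarrow> GL\<^sub>n\<close>, differing by smooth \<open>GL\<^sub>n\<close>-valued functions.
  Topologically nontrivial bundles are thus included, since the \<open>e\<close> need not be continuous.\<close>

type_synonym ('m, 'n) frame = "'m set \<times> ('m \<Rightarrow> complex^'n^'n)"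

definition smooth_section ::
  "('m, 'c::real_normed_vector) chart set \<Rightarrow> ('m, 'n::finite) frame set \<Rightarrow> 'm set
     \<Rightarrow> ('m \<Rightarrow> complex^'n) \<Rightarrow> bool" where
  "smooth_section Atl Fr W s \<longleftrightarrow>
     (\<forall>f\<in>Fr. smooth_fun Atl (fst f \<inter> W) (\<lambda>x. matrix_inv (snd f x) *v s x))"

text \<open>A connection is an operator \<open>nab\<close>: \<open>nab s c v x\<close> is the covariant derivative at \<open>x\<close> of the
  local section \<open>s\<close> along the tangent vector with coordinates \<open>v\<close> in the chart \<open>c\<close>.
  Its \<open>(1,0)\<close> and \<open>(0,1)\<close> components are as follows.\<close>

definition nabla10 ::
  "('c \<Rightarrow> 'c) \<Rightarrow> (('m \<Rightarrow> complex^'n) \<Rightarrow> ('m, 'c) chart \<Rightarrow> 'c \<Rightarrow> 'm \<Rightarrow> complex^'n)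
     \<Rightarrow> ('m \<Rightarrow> complex^'n) \<Rightarrow> ('m, 'c) chart \<Rightarrow> 'c \<Rightarrow> 'm \<Rightarrow> complex^'n" where
  "nabla10 J nab s c v x = (1/2) *s (nab s c v x - \<i> *s nab s c (J v) x)"

definition nabla01 ::
  "('c \<Rightarrow> 'c) \<Rightarrow> (('m \<Rightarrow> complex^'n) \<Rightarrow> ('m, 'c) chart \<Rightarrow> 'c \<Rightarrow> 'm \<Rightarrow> complex^'n)
     \<Rightarrow> ('m \<Rightarrow> complex^'n) \<Rightarrow> ('m, 'c) chart \<Rightarrow> 'c \<Rightarrow> 'm \<Rightarrow> complex^'n" where
  "nabla01 J nab s c v x = (1/2) *s (nab s c v x + \<i> *s nab s c (J v) x)"

text \<open>\<open>E i x\<close> is the fibre of \<open>E\<^sup>i\<close> at \<open>x\<close>; \<open>h x\<close> is \<open>\<complex>\<close>-linear in its first argument.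
  \<open>\<theta> c v x\<close> is the endomorphism of the fibre at \<open>x\<close> given by the Higgs field in the direction \<open>v\<close>.\<close>

locale cvhs = complex_manifold X Atl J
  for X :: "'m topology" and Atl :: "('m, 'c::real_normed_vector) chart set" and J :: "'c \<Rightarrow> 'c" +
  fixes Fr :: "('m, 'n::finite) frame set"
    and k :: nat
    and E :: "nat \<Rightarrow> 'm \<Rightarrow> (complex^'n) set"
    and nab :: "('m \<Rightarrow> complex^'n) \<Rightarrow> ('m, 'c) chart \<Rightarrow> 'c \<Rightarrow> 'm \<Rightarrow> complex^'n"
    and h :: "'m \<Rightarrow> complex^'n \<Rightarrow> complex^'n \<Rightarrow> complex"
    and \<theta> :: "('m, 'c) chart \<Rightarrow> 'c \<Rightarrow> 'm \<Rightarrow> complex^'n^'n"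
  assumes \<comment> \<open>the vector bundle\<close>
        frame: "f \<in> Fr \<Longrightarrow> openin X (fst f) \<and> (\<forall>x\<in>fst f. invertible (snd f x))"
    and frame_cover: "topspace X = \<Union> (fst ` Fr)"
    and frame_transition: "\<lbrakk>f \<in> Fr; f' \<in> Fr\<rbrakk> \<Longrightarrow>
      smooth_fun Atl (fst f \<inter> fst f') (\<lambda>x. matrix_inv (snd f' x) ** snd f x)"
    \<comment> \<open>the decomposition into nonzero smooth subbundles, with the convention \<open>E\<^sup>i = 0\<close> for \<open>i > k\<close>\<close>
    and subbundle: "\<lbrakk>i \<le> k; x \<in> topspace X\<rbrakk> \<Longrightarrow>
      \<exists>W (d::nat) s. openin X W \<and> x \<in> W \<and> (\<forall>j<d. smooth_section Atl Fr W (s j)) \<and>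
        (\<forall>y\<in>W. inj_on (\<lambda>j. s j y) {..<d} \<and> vec.independent ((\<lambda>j. s j y) ` {..<d}) \<and>
                vec.span ((\<lambda>j. s j y) ` {..<d}) = E i y)"
    and nonzero: "\<lbrakk>i \<le> k; x \<in> topspace X\<rbrakk> \<Longrightarrow> E i x \<noteq> {0}"
    and beyond: "\<lbrakk>i > k; x \<in> topspace X\<rbrakk> \<Longrightarrow> E i x = {0}"
    and direct_sum: "x \<in> topspace X \<Longrightarrow>
      \<exists>!w. (\<forall>i. w i \<in> E i x) \<and> p = (\<Sum>i\<le>k. w i)"
    \<comment> \<open>the flat connection\<close>
    and nab_smooth: "\<lbrakk>c \<in> Atl; openin X W; W \<subseteq> fst c; smooth_section Atl Fr W s\<rbrakk> \<Longrightarrow>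
      smooth_section Atl Fr W (nab s c v)"
    and nab_local: "\<lbrakk>c \<in> Atl; openin X W; W \<subseteq> fst c; smooth_section Atl Fr W s;
      \<And>y. y \<in> W \<Longrightarrow> s' y = s y; x \<in> W\<rbrakk> \<Longrightarrow> nab s' c v x = nab s c v x"
    and nab_add: "\<lbrakk>c \<in> Atl; openin X W; W \<subseteq> fst c; smooth_section Atl Fr W s;
      smooth_section Atl Fr W s'; x \<in> W\<rbrakk> \<Longrightarrow>
      nab (\<lambda>y. s y + s' y) c v x = nab s c v x + nab s' c v x"
    and nab_Leibniz: "\<lbrakk>c \<in> Atl; openin X W; W \<subseteq> fst c; smooth_section Atl Fr W s;
      smooth_fun Atl W a; x \<in> W\<rbrakk> \<Longrightarrow>
      nab (\<lambda>y. a y *s s y) c v x = chart_deriv c a x v *s s x + a x *s nab s c v x"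
    and nab_linear: "\<lbrakk>c \<in> Atl; openin X W; W \<subseteq> fst c; smooth_section Atl Fr W s; x \<in> W\<rbrakk> \<Longrightarrow>
      linear (\<lambda>v. nab s c v x)"
    and nab_transition: "\<lbrakk>c \<in> Atl; c' \<in> Atl; openin X W; W \<subseteq> fst c \<inter> fst c';
      smooth_section Atl Fr W s; x \<in> W\<rbrakk> \<Longrightarrow>
      nab s c' (frechet_derivative (transition_map c c') (at (snd c x)) v) x = nab s c v x"
    and nab_flat: "\<lbrakk>c \<in> Atl; openin X W; W \<subseteq> fst c; smooth_section Atl Fr W s; x \<in> W\<rbrakk> \<Longrightarrow>
      nab (nab s c u) c v x = nab (nab s c v) c u x"
    \<comment> \<open>\<open>\<nabla>\<^sup>1\<^sup>0 E\<^sup>i \<subseteq> E\<^sup>i \<oplus> E\<^bsup>i+1\<^esup>\<close> and \<open>\<nabla>\<^sup>0\<^sup>1 E\<^sup>i \<subseteq> E\<^sup>i \<oplus> E\<^bsup>i-1\<^esup>\<close>\<close>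
    and transversality10: "\<lbrakk>c \<in> Atl; openin X W; W \<subseteq> fst c; smooth_section Atl Fr W s;
      i \<le> k; \<And>y. y \<in> W \<Longrightarrow> s y \<in> E i y; x \<in> W\<rbrakk> \<Longrightarrow>
      \<exists>a\<in>E i x. \<exists>b\<in>E (Suc i) x. nabla10 J nab s c v x = a + b"
    and transversality01: "\<lbrakk>c \<in> Atl; openin X W; W \<subseteq> fst c; smooth_section Atl Fr W s;
      i \<le> k; \<And>y. y \<in> W \<Longrightarrow> s y \<in> E i y; x \<in> W\<rbrakk> \<Longrightarrow>
      \<exists>a\<in>E i x. \<exists>b\<in>(if i = 0 then {0} else E (i - 1) x). nabla01 J nab s c v x = a + b"
    \<comment> \<open>the parallel Hermitian form\<close>
    and h_add: "x \<in> topspace X \<Longrightarrow> h x (p + p') q = h x p q + h x p' q"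
    and h_scale: "x \<in> topspace X \<Longrightarrow> h x (\<alpha> *s p) q = \<alpha> * h x p q"
    and h_Hermitian: "x \<in> topspace X \<Longrightarrow> h x q p = cnj (h x p q)"
    and h_smooth: "\<lbrakk>openin X W; smooth_section Atl Fr W s; smooth_section Atl Fr W t\<rbrakk> \<Longrightarrow>
      smooth_fun Atl W (\<lambda>x. h x (s x) (t x))"
    and h_parallel: "\<lbrakk>c \<in> Atl; openin X W; W \<subseteq> fst c; smooth_section Atl Fr W s;
      smooth_section Atl Fr W t; x \<in> W\<rbrakk> \<Longrightarrow>
      chart_deriv c (\<lambda>y. h y (s y) (t y)) x v = h x (nab s c v x) (t x) + h x (s x) (nab t c v x)"
    and h_orthogonal: "\<lbrakk>x \<in> topspace X; i \<le> k; j \<le> k; i \<noteq> j; p \<in> E i x; q \<in> E j x\<rbrakk> \<Longrightarrow> h x p q = 0"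
    and h_definite: "\<lbrakk>x \<in> topspace X; i \<le> k; p \<in> E i x; p \<noteq> 0\<rbrakk> \<Longrightarrow> 0 < (-1) ^ i * Re (h x p p)"
    \<comment> \<open>the Higgs field: \<open>\<theta>\<close> on \<open>E\<^sup>i\<close> is the \<open>E\<^bsup>i+1\<^esup>\<close>-component of \<open>\<nabla>\<^sup>1\<^sup>0\<close>\<close>
    and higgs_degree: "\<lbrakk>c \<in> Atl; x \<in> fst c; p \<in> E i x; i \<le> k\<rbrakk> \<Longrightarrow> \<theta> c v x *v p \<in> E (Suc i) x"
    and higgs_component: "\<lbrakk>c \<in> Atl; openin X W; W \<subseteq> fst c; smooth_section Atl Fr W s;
      i \<le> k; \<And>y. y \<in> W \<Longrightarrow> s y \<in> E i y; x \<in> W\<rbrakk> \<Longrightarrow>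
      nabla10 J nab s c v x - \<theta> c v x *v s x \<in> E i x"

section \<open>Flag manifold and period domain\<close>

text \<open>A flag is a function \<open>F\<close> on all of \<open>nat\<close>; it is constantly \<open>\<complex>\<^sup>n\<close> from index \<open>k\<close> on.
  \<open>below F i\<close> is \<open>F\<^bsup>i-1\<^esup>\<close>, with \<open>F\<^bsup>-1\<^esup> = 0\<close>.\<close>

type_synonym 'n flag = "nat \<Rightarrow> (complex^'n) set"

definition below :: "'n::finite flag \<Rightarrow> nat \<Rightarrow> (complex^'n) set" where
  "below F i = (case i of 0 \<Rightarrow> {0} | Suc j \<Rightarrow> F j)"

definition flags :: "nat \<Rightarrow> (nat \<Rightarrow> nat) \<Rightarrow> 'n::finite flag set" where
  "flags k r = {F. (\<forall>i\<le>k. vec.subspace (F i) \<and> below F i \<subseteq> F i \<and>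
                          vec.dim (F i) = vec.dim (below F i) + r i) \<and>
                   (\<forall>i\<ge>k. F i = UNIV)}"

definition flag_act :: "complex^'n^'n \<Rightarrow> 'n::finite flag \<Rightarrow> 'n flag" where
  "flag_act g F = (\<lambda>i. (*v) g ` F i)"

text \<open>The topology and the smooth structure on the flag manifold are those of the homogeneous space
  \<open>GL\<^sub>n / Stab(F)\<close>: the topology is the quotient topology under the orbit maps.\<close>

definition flag_topology :: "nat \<Rightarrow> (nat \<Rightarrow> nat) \<Rightarrow> 'n::finite flag topology" where
  "flag_topology k r = topology (\<lambda>U. U \<subseteq> flags k r \<and>
     (\<forall>F\<in>flags k r. open {g. invertible g \<and> flag_act g F \<in> U}))"

lemma openin_flag_topology:
  "openin (flag_topology k r) U \<longleftrightarrow>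
     U \<subseteq> flags k r \<and> (\<forall>F\<in>flags k r. open {g. invertible g \<and> flag_act g F \<in> U})"
  (is "_ \<longleftrightarrow> ?P U")
proof -
  have "?P (U \<inter> V)" if "?P U" "?P V" for U V
  proof -
    have "{g. invertible g \<and> flag_act g F \<in> U \<inter> V} =
      {g. invertible g \<and> flag_act g F \<in> U} \<inter> {g. invertible g \<and> flag_act g F \<in> V}" for F
      by auto
    with that show ?thesis by auto
  qed
  moreover have "?P (\<Union>\<K>)" if "\<forall>K\<in>\<K>. ?P K" for \<K>
  proof -
    have "{g. invertible g \<and> flag_act g F \<in> \<Union>\<K>} =
      (\<Union>K\<in>\<K>. {g. invertible g \<and> flag_act g F \<in> K})" for F
      by auto
    with that show ?thesis by auto
  qed
  ultimately have "istopology ?P"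
    unfolding istopology_def by blast
  then show ?thesis
    unfolding flag_topology_def by (rule fun_cong[OF topology_inverse'])
qed

definition period_domain ::
  "nat \<Rightarrow> (nat \<Rightarrow> nat) \<Rightarrow> (complex^'n \<Rightarrow> complex^'n \<Rightarrow> complex) \<Rightarrow> 'n::finite flag set" where
  "period_domain k r H = {F \<in> flags k r.
     \<forall>i\<le>k. \<forall>v\<in>F i. (\<forall>w\<in>below F i. H v w = 0) \<longrightarrow> v \<noteq> 0 \<longrightarrow> 0 < (-1) ^ i * Re (H v v)}"

definition period_topology ::
  "nat \<Rightarrow> (nat \<Rightarrow> nat) \<Rightarrow> (complex^'n \<Rightarrow> complex^'n \<Rightarrow> complex) \<Rightarrow> 'n::finite flag topology" where
  "period_topology k r H = subtopology (flag_topology k r) (period_domain k r H)"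

text \<open>\<open>T\<^sub>F = End(\<complex>\<^sup>n) / flag_stab k F\<close>.\<close>

definition flag_stab :: "nat \<Rightarrow> 'n::finite flag \<Rightarrow> (complex^'n^'n) set" where
  "flag_stab k F = {A. \<forall>i\<le>k. (*v) A ` F i \<subseteq> F i}"

definition superhorizontal_endos :: "nat \<Rightarrow> 'n::finite flag \<Rightarrow> (complex^'n^'n) set" where
  "superhorizontal_endos k F = {A. \<forall>i<k. (*v) A ` F i \<subseteq> F (Suc i)}"

text \<open>\<open>g\<close> is a smooth lift of \<open>f\<close> to \<open>GL\<^sub>n\<close> (along the orbit map of some flag) near \<open>x \<in> S\<^sup>2\<close>.
  As orbit maps are submersions, \<open>f\<close> is smooth near \<open>x\<close> iff it has such a lift, and then \<open>df\<^sub>x(v)\<close> is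
  the class of \<open>dg\<^sub>x(v) g(x)\<^sup>-\<^sup>1\<close> modulo \<open>flag_stab k (f x)\<close>, whatever the lift.\<close>

abbreviation sphere2 :: "(real^3) set" where
  "sphere2 \<equiv> sphere 0 1"

definition smooth_lift_at ::
  "nat \<Rightarrow> (nat \<Rightarrow> nat) \<Rightarrow> (real^3 \<Rightarrow> 'n::finite flag) \<Rightarrow> real^3 \<Rightarrow> (real^3 \<Rightarrow> complex^'n^'n) \<Rightarrow> bool" where
  "smooth_lift_at k r f x g \<longleftrightarrow> (\<exists>W. \<exists>B\<in>flags k r. open W \<and> x \<in> W \<and> smooth_on W g \<and>
     (\<forall>y\<in>W \<inter> sphere2. invertible (g y) \<and> f y = flag_act (g y) B))"

definition represents_differential ::
  "nat \<Rightarrow> (nat \<Rightarrow> nat) \<Rightarrow> (real^3 \<Rightarrow> 'n::finite flag) \<Rightarrow> real^3 \<Rightarrow> real^3 \<Rightarrow> complex^'n^'n \<Rightarrow> bool" where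
  "represents_differential k r f x v A \<longleftrightarrow> (\<exists>g. smooth_lift_at k r f x g \<and>
     A - frechet_derivative g (at x) v ** matrix_inv (g x) \<in> flag_stab k (f x))"

definition smooth_sphere_in ::
  "nat \<Rightarrow> (nat \<Rightarrow> nat) \<Rightarrow> 'n::finite flag set \<Rightarrow> (real^3 \<Rightarrow> 'n flag) \<Rightarrow> bool" where
  "smooth_sphere_in k r D f \<longleftrightarrow> f ` sphere2 \<subseteq> D \<and> (\<forall>x\<in>sphere2. \<exists>g. smooth_lift_at k r f x g)"

definition superhorizontal_sphere_in ::
  "nat \<Rightarrow> (nat \<Rightarrow> nat) \<Rightarrow> 'n::finite flag set \<Rightarrow> (real^3 \<Rightarrow> 'n flag) \<Rightarrow> bool" where
  "superhorizontal_sphere_in k r D f \<longleftrightarrow> smooth_sphere_in k r D f \<and>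
     (\<forall>x\<in>sphere2. \<forall>v. x \<bullet> v = 0 \<longrightarrow>
        (\<exists>A\<in>superhorizontal_endos k (f x). represents_differential k r f x v A))"

section \<open>The second homotopy group\<close>

definition unit_square :: "(real \<times> real) set" where
  "unit_square = {0..1} \<times> {0..1}"

definition square_boundary :: "(real \<times> real) set" where
  "square_boundary = {(s, t) \<in> unit_square. s \<in> {0, 1} \<or> t \<in> {0, 1}}"

definition square_maps :: "'a topology \<Rightarrow> 'a \<Rightarrow> (real \<times> real \<Rightarrow> 'a) set" where
  "square_maps Y b =
     {\<gamma>. continuous_map (top_of_set unit_square) Y \<gamma> \<and> \<gamma> ` square_boundary \<subseteq> {b}}"

definition square_homotopic ::
  "'a topology \<Rightarrow> 'a \<Rightarrow> (real \<times> real \<Rightarrow> 'a) \<Rightarrow> (real \<times> real \<Rightarrow> 'a) \<Rightarrow> bool" where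
  "square_homotopic Y b =
     homotopic_with (\<lambda>\<gamma>. \<gamma> ` square_boundary \<subseteq> {b}) (top_of_set unit_square) Y"

definition pi2_class :: "'a topology \<Rightarrow> 'a \<Rightarrow> (real \<times> real \<Rightarrow> 'a) \<Rightarrow> (real \<times> real \<Rightarrow> 'a) set" where
  "pi2_class Y b \<gamma> = {\<delta>. square_homotopic Y b \<gamma> \<delta>}"

definition square_concat ::
  "(real \<times> real \<Rightarrow> 'a) \<Rightarrow> (real \<times> real \<Rightarrow> 'a) \<Rightarrow> real \<times> real \<Rightarrow> 'a" where
  "square_concat \<gamma> \<delta> = (\<lambda>(s, t). if s \<le> 1/2 then \<gamma> (2 * s, t) else \<delta> (2 * s - 1, t))"

definition pi2 :: "'a topology \<Rightarrow> 'a \<Rightarrow> (real \<times> real \<Rightarrow> 'a) set monoid" where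
  "pi2 Y b =
     \<lparr> carrier = pi2_class Y b ` square_maps Y b,
       mult = (\<lambda>P Q. {\<epsilon>. \<exists>\<gamma>\<in>P. \<exists>\<delta>\<in>Q. square_homotopic Y b (square_concat \<gamma> \<delta>) \<epsilon>}),
       one = pi2_class Y b (\<lambda>_. b) \<rparr>"

text \<open>The collapse \<open>unit_square / square_boundary \<cong> S\<^sup>2\<close>: the coordinatewise diffeomorphism
  \<open>(0,1) \<cong> \<real>\<close>, \<open>s \<mapsto> (2 s - 1) / (s (1 - s))\<close>, followed by inverse stereographic projection.\<close>

definition north :: "real^3" where
  "north = vector [0, 0, 1]"

definition square_to_sphere :: "real \<times> real \<Rightarrow> real^3" where
  "square_to_sphere = (\<lambda>(s, t).
     if s \<in> {0, 1} \<or> t \<in> {0, 1} then north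
     else let a = (2 * s - 1) / (s * (1 - s)); b = (2 * t - 1) / (t * (1 - t)) in
       (1 / (a\<^sup>2 + b\<^sup>2 + 1)) *\<^sub>R vector [2 * a, 2 * b, a\<^sup>2 + b\<^sup>2 - 1])"

definition sphere_class :: "'a topology \<Rightarrow> 'a \<Rightarrow> (real^3 \<Rightarrow> 'a) \<Rightarrow> (real \<times> real \<Rightarrow> 'a) set" where
  "sphere_class Y b f = pi2_class Y b (f \<circ> square_to_sphere)"

end

theory Submission
  imports Defs
begin

text \<open>Only the Hermitian form on the fibre and the ranks matter. A flag in the period domain is the
  image of a standard flag under a frame, that is, a matrix mapping the even and the odd coordinates
  to orthogonal subspaces on which the form is positive and negative definite. A sphere lifts to a
  map of the square into the frames which is trivial on three sides and block diagonal on the fourth.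
  Frames retract onto \<open>GL\<^sub>p \<times> GL\<^sub>q\<close>, whose second homotopy group vanishes, so the class of the sphere
  is determined by the winding numbers \<open>w\<^sub>i\<close> of the block determinants on the fourth side. The sum of
  the \<open>w\<^sub>i\<close> over even \<open>i\<close> and that over odd \<open>i\<close> vanish, hence \<open>\<pi>\<^sub>2\<close> is generated by any spheres whose
  winding numbers are \<open>1\<close> at \<open>i + 2\<close>, \<open>-1\<close> at \<open>i\<close> and \<open>0\<close> elsewhere.

  As \<open>E\<^bsup>i+1\<^esup>\<close> has rank at least 2, there is a coordinate subspace of signature \<open>(2, 2)\<close> with one
  coordinate of level \<open>i\<close>, one of level \<open>i + 2\<close> and two of level \<open>i + 1\<close>. Only this subspace moves in
  the superhorizontal sphere constructed for \<open>i\<close>: if \<open>U\<close> spans the first step of the flag in it and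
  \<open>W\<close> the orthogonal complement of the second, superhorizontality means that \<open>dU\<close> is orthogonal to \<open>W\<close>.\<close>

section \<open>The second homotopy group\<close>

text \<open>The obvious spheres with the required winding numbers are the projective lines that join
  level \<open>i\<close> to level \<open>i + 2\<close>. They are tangent to Hom(E^i, E^(i+2)), which
  superhorizontality forbids, while a permitted move joins levels of opposite sign, where
  definiteness limits how far it can go. The line of level \<open>i\<close> therefore reaches level
  \<open>i + 2\<close> by way of the negative vectors of level \<open>i + 1\<close>, in several
  moves of \<open>U\<close> and \<open>W\<close> that keep both positive. Turning the phase at fixed
  height moves \<open>U\<close> as well, and a second negative coordinate is there to cancel the
  resulting component along \<open>W\<close>; this is where rank at least 2 enters. Lifting uses the
  projections of a flag onto its graded pieces: they vary continuously and give transports between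
  nearby flags, in the role of a connection. The two sums of winding numbers vanish because the
  determinants of the even and the odd coordinate block are nonzero on every frame, so the square
  itself contracts their loops.\<close>

lemma square_boundary_subset: "square_boundary \<subseteq> unit_square"
  by (auto simp: square_boundary_def)

lemma mem_unit_square: "(s, t) \<in> unit_square \<longleftrightarrow> 0 \<le> s \<and> s \<le> 1 \<and> 0 \<le> t \<and> t \<le> 1"
  by (auto simp: unit_square_def)

lemma mem_square_boundary:
  "(s, t) \<in> square_boundary \<longleftrightarrow>
     0 \<le> s \<and> s \<le> 1 \<and> 0 \<le> t \<and> t \<le> 1 \<and> (s = 0 \<or> s = 1 \<or> t = 0 \<or> t = 1)"
  by (auto simp: square_boundary_def unit_square_def)

section \<open>Homotopies of maps of the square relative to the boundary\<close>

lemma square_maps_iff: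
  "\<gamma> \<in> square_maps Y b \<longleftrightarrow>
     continuous_map (top_of_set unit_square) Y \<gamma> \<and> (\<forall>z\<in>square_boundary. \<gamma> z = b)"
  by (auto simp: square_maps_def)

text \<open>The relative condition on a slice involves only its values on the square, so a single
  continuous map on \<open>{0..1} \<times> unit_square\<close> carries all the data. Homotopies of
  square maps are given in this form below.\<close>

lemma square_homotopic_iff:
  "square_homotopic Y b \<gamma> \<delta> \<longleftrightarrow>
     (\<exists>h. continuous_map (top_of_set ({0..1::real} \<times> unit_square)) Y h \<and>
          (\<forall>z\<in>unit_square. h (0, z) = \<gamma> z) \<and> (\<forall>z\<in>unit_square. h (1, z) = \<delta> z) \<and>
          (\<forall>u\<in>{0..1}. \<forall>z\<in>square_boundary. h (u, z) = b))"
proof -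
  have eq: "homotopic_with P (top_of_set unit_square) Y \<gamma> \<delta> \<longleftrightarrow>
     (\<exists>h. continuous_map (prod_topology (top_of_set {0..1::real}) (top_of_set unit_square)) Y h \<and>
       (\<forall>x\<in>unit_square. h (0, x) = \<gamma> x) \<and> (\<forall>x\<in>unit_square. h (1, x) = \<delta> x) \<and>
       (\<forall>t\<in>{0..1}. P (\<lambda>x. h (t, x))))"
    if "P = (\<lambda>\<gamma>. \<gamma> ` square_boundary \<subseteq> {b})" for P
    using square_boundary_subset
    by (subst homotopic_with) (auto simp: that image_subset_iff subset_iff simp del: split_paired_All)
  have prod: "prod_topology (top_of_set {0..1::real}) (top_of_set unit_square)
    = top_of_set ({0..1} \<times> unit_square)"
    by (simp add: subtopology_Times)
  show ?thesis
    unfolding square_homotopic_def eq[OF refl] prod by (simp add: image_subset_iff)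
qed

lemma square_homotopic_refl: "\<gamma> \<in> square_maps Y b \<Longrightarrow> square_homotopic Y b \<gamma> \<gamma>"
  by (simp add: square_homotopic_def square_maps_def)

lemma square_homotopic_sym: "square_homotopic Y b \<gamma> \<delta> \<Longrightarrow> square_homotopic Y b \<delta> \<gamma>"
  unfolding square_homotopic_def by (rule homotopic_with_symD)

lemma square_homotopic_trans [trans]:
  "square_homotopic Y b \<gamma> \<delta> \<Longrightarrow> square_homotopic Y b \<delta> \<epsilon> \<Longrightarrow> square_homotopic Y b \<gamma> \<epsilon>"
  unfolding square_homotopic_def by (rule homotopic_with_trans)

lemma square_homotopic_cong:
  assumes "\<gamma> \<in> square_maps Y b" "\<And>z. z \<in> unit_square \<Longrightarrow> \<delta> z = \<gamma> z"
  shows "square_homotopic Y b \<gamma> \<delta>"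
  unfolding square_homotopic_iff
proof (intro exI conjI)
  have "continuous_map (top_of_set ({0..1::real} \<times> unit_square)) (top_of_set unit_square) snd"
    by (auto intro!: continuous_intros)
  then show "continuous_map (top_of_set ({0..1::real} \<times> unit_square)) Y (\<gamma> \<circ> snd)"
    by (rule continuous_map_compose) (use assms in \<open>auto simp: square_maps_iff\<close>)
qed (use assms in \<open>auto simp: square_maps_iff\<close>)

lemma square_homotopic_imp_square_maps:
  assumes "square_homotopic Y b \<gamma> \<delta>"
  shows "\<gamma> \<in> square_maps Y b" "\<delta> \<in> square_maps Y b"
  using homotopic_with_imp_continuous_maps[OF assms[unfolded square_homotopic_def]]
    homotopic_with_imp_property[OF assms[unfolded square_homotopic_def]]
  by (auto simp: square_maps_def)

lemma continuous_map_reparam: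
  assumes "\<gamma> \<in> square_maps Y b" "continuous_on S r" "r ` S \<subseteq> unit_square"
  shows "continuous_map (top_of_set S) Y (\<lambda>x. \<gamma> (r x))"
proof -
  have "continuous_map (top_of_set S) (top_of_set unit_square) r"
    using assms by (auto simp: continuous_map_in_subtopology)
  from continuous_map_compose[OF this] show ?thesis
    using assms(1) by (auto simp: square_maps_iff o_def)
qed

text \<open>The straight line between \<open>\<phi>\<close> and \<open>\<psi>\<close> is the
  homotopy. Their common end values lie in {0, 1}, so the sides s = 0 and s = 1 stay in the boundary
  at all times. Both ends may have the same value, which admits the folded parametrisations behind
  inverses.\<close>

lemma square_homotopic_reparam:
  assumes \<gamma>: "\<gamma> \<in> square_maps Y b"
    and cont: "continuous_on {0..1} \<phi>" "continuous_on {0..1} \<psi>"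
    and range: "\<phi> ` {0..1} \<subseteq> {0..1::real}" "\<psi> ` {0..1} \<subseteq> {0..1}"
    and ends: "\<phi> 0 = \<psi> 0" "\<phi> 1 = \<psi> 1" "\<phi> 0 \<in> {0, 1}" "\<phi> 1 \<in> {0, 1}"
  shows "square_homotopic Y b (\<lambda>(s, t). \<gamma> (\<phi> s, t)) (\<lambda>(s, t). \<gamma> (\<psi> s, t))"
proof -
  define r where "r = (\<lambda>(u, s, t). ((1 - u) * \<phi> s + u * \<psi> s, t :: real))"
  have seg: "(1 - u) * x + u * y \<in> {0..1}" if "u \<in> {0..1}" "x \<in> {0..1}" "y \<in> {0..1}"
    for u x y :: real
    using that convex_bound_le[of x 1 y "1 - u" u] by auto
  have r: "r ` ({0..1} \<times> unit_square) \<subseteq> unit_square"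
  proof (rule image_subsetI)
    fix x :: "real \<times> real \<times> real" assume "x \<in> {0..1} \<times> unit_square"
    then obtain u s t where "x = (u, s, t)" "u \<in> {0..1}" "s \<in> {0..1}" "t \<in> {0..1}"
      by (auto simp: unit_square_def)
    then show "r x \<in> unit_square"
      using seg[of u "\<phi> s" "\<psi> s"] range
      by (auto simp: r_def unit_square_def image_subset_iff simp del: atLeastAtMost_iff)
  qed
  have "continuous_on ({0..1} \<times> unit_square) r"
    unfolding r_def case_prod_unfold unit_square_def
    by (intro continuous_intros continuous_on_compose2[OF cont(1)]
          continuous_on_compose2[OF cont(2)]) auto
  from continuous_map_reparam[OF \<gamma> this r]
  have "continuous_map (top_of_set ({0..1::real} \<times> unit_square)) Y (\<lambda>x. \<gamma> (r x))" .
  moreover have "\<gamma> (r (u, z)) = b" if "u \<in> {0..1}" "z \<in> square_boundary" for u z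
  proof -
    obtain s t where z: "z = (s, t)" by (cases z)
    have "r (u, z) \<in> unit_square"
      using r that square_boundary_subset by (auto simp: image_subset_iff)
    moreover have "s = 0 \<or> s = 1 \<or> t = 0 \<or> t = 1"
      using that z by (auto simp: mem_square_boundary)
    ultimately have "r (u, z) \<in> square_boundary"
      using ends by (auto simp: z r_def mem_square_boundary mem_unit_square algebra_simps)
    with \<gamma> show ?thesis by (auto simp: square_maps_iff)
  qed
  ultimately show ?thesis
    unfolding square_homotopic_iff
    by (intro exI[of _ "\<lambda>x. \<gamma> (r x)"]) (auto simp: r_def)
qed

section \<open>Concatenation and the group laws\<close>

lemma continuous_map_concat:
  fixes p :: "'a::topological_space \<Rightarrow> real"
  assumes p: "continuous_on S p"
    and f: "continuous_map (top_of_set {x\<in>S. p x \<le> 1/2}) Y f"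
    and g: "continuous_map (top_of_set {x\<in>S. 1/2 \<le> p x}) Y g"
    and eq: "\<And>x. x \<in> S \<Longrightarrow> p x = 1/2 \<Longrightarrow> f x = g x"
  shows "continuous_map (top_of_set S) Y (\<lambda>x. if p x \<le> 1/2 then f x else g x)"
proof (rule continuous_map_cases_le)
  show "continuous_map (top_of_set S) euclideanreal p" using p by simp
  have "S \<inter> {x \<in> S. p x \<le> 1/2} = {x\<in>S. p x \<le> 1/2}" "S \<inter> {x \<in> S. 1/2 \<le> p x} = {x\<in>S. 1/2 \<le> p x}"
    by auto
  then show "continuous_map (subtopology (top_of_set S) {x \<in> topspace (top_of_set S). p x \<le> 1/2}) Y f"
    "continuous_map (subtopology (top_of_set S) {x \<in> topspace (top_of_set S). 1/2 \<le> p x}) Y g"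
    using f g by (simp_all add: subtopology_subtopology)
qed (use eq in auto)

lemma square_concat_in_square_maps:
  assumes "\<gamma> \<in> square_maps Y b" "\<delta> \<in> square_maps Y b"
  shows "square_concat \<gamma> \<delta> \<in> square_maps Y b"
proof -
  have "continuous_map (top_of_set unit_square) Y
     (\<lambda>x. if fst x \<le> 1/2 then \<gamma> (2 * fst x, snd x) else \<delta> (2 * fst x - 1, snd x))"
  proof (rule continuous_map_concat)
    show "continuous_map (top_of_set {x \<in> unit_square. fst x \<le> 1/2}) Y (\<lambda>x. \<gamma> (2 * fst x, snd x))"
      by (rule continuous_map_reparam[OF assms(1)])
         (auto intro!: continuous_intros simp: unit_square_def)
    show "continuous_map (top_of_set {x \<in> unit_square. 1/2 \<le> fst x}) Y (\<lambda>x. \<delta> (2 * fst x - 1, snd x))"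
      by (rule continuous_map_reparam[OF assms(2)])
         (auto intro!: continuous_intros simp: unit_square_def)
  qed (use assms in \<open>auto intro!: continuous_intros simp: square_maps_iff mem_square_boundary mem_unit_square\<close>)
  moreover have "square_concat \<gamma> \<delta> =
     (\<lambda>x. if fst x \<le> 1/2 then \<gamma> (2 * fst x, snd x) else \<delta> (2 * fst x - 1, snd x))"
    by (auto simp: square_concat_def)
  moreover have "square_concat \<gamma> \<delta> z = b" if "z \<in> square_boundary" for z
    using that assms by (cases z) (auto simp: square_concat_def square_maps_iff mem_square_boundary)
  ultimately show ?thesis by (auto simp: square_maps_iff)
qed

lemma square_concat_homotopic:
  assumes "square_homotopic Y b \<gamma> \<gamma>'" "square_homotopic Y b \<delta> \<delta>'"
  shows "square_homotopic Y b (square_concat \<gamma> \<delta>) (square_concat \<gamma>' \<delta>')"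
proof -
  obtain h where h: "continuous_map (top_of_set ({0..1::real} \<times> unit_square)) Y h"
    "\<And>z. z \<in> unit_square \<Longrightarrow> h (0, z) = \<gamma> z" "\<And>z. z \<in> unit_square \<Longrightarrow> h (1, z) = \<gamma>' z"
    "\<And>u z. u \<in> {0..1} \<Longrightarrow> z \<in> square_boundary \<Longrightarrow> h (u, z) = b"
    using assms(1) unfolding square_homotopic_iff by blast
  obtain h' where h': "continuous_map (top_of_set ({0..1::real} \<times> unit_square)) Y h'"
    "\<And>z. z \<in> unit_square \<Longrightarrow> h' (0, z) = \<delta> z" "\<And>z. z \<in> unit_square \<Longrightarrow> h' (1, z) = \<delta>' z"
    "\<And>u z. u \<in> {0..1} \<Longrightarrow> z \<in> square_boundary \<Longrightarrow> h' (u, z) = b"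
    using assms(2) unfolding square_homotopic_iff by blast
  have comp: "continuous_map (top_of_set S) Y (\<lambda>x. H (r x))"
    if "continuous_map (top_of_set ({0..1::real} \<times> unit_square)) Y H" "continuous_on S r"
      "r ` S \<subseteq> {0..1} \<times> unit_square" for H :: "real \<times> real \<times> real \<Rightarrow> 'a" and S and
      r :: "real \<times> real \<times> real \<Rightarrow> real \<times> real \<times> real"
  proof -
    have "continuous_map (top_of_set S) (top_of_set ({0..1::real} \<times> unit_square)) r"
      using that by (auto simp: continuous_map_in_subtopology)
    from continuous_map_compose[OF this that(1)] show ?thesis by (simp add: o_def)
  qed
  define k where "k = (\<lambda>x. if fst (snd x) \<le> 1/2 then h (fst x, 2 * fst (snd x), snd (snd x))
     else h' (fst x, 2 * fst (snd x) - 1, snd (snd x)))"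
  have "continuous_map (top_of_set ({0..1::real} \<times> unit_square)) Y k"
    unfolding k_def
  proof (rule continuous_map_concat)
    show "continuous_map (top_of_set {x \<in> {0..1} \<times> unit_square. fst (snd x) \<le> 1/2}) Y
       (\<lambda>x. h (fst x, 2 * fst (snd x), snd (snd x)))"
      by (rule comp[OF h(1)]) (auto intro!: continuous_intros simp: unit_square_def)
    show "continuous_map (top_of_set {x \<in> {0..1} \<times> unit_square. 1/2 \<le> fst (snd x)}) Y
       (\<lambda>x. h' (fst x, 2 * fst (snd x) - 1, snd (snd x)))"
      by (rule comp[OF h'(1)]) (auto intro!: continuous_intros simp: unit_square_def)
    fix x :: "real \<times> real \<times> real" assume "x \<in> {0..1} \<times> unit_square" "fst (snd x) = 1/2"
    then show "h (fst x, 2 * fst (snd x), snd (snd x)) = h' (fst x, 2 * fst (snd x) - 1, snd (snd x))"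
      by (cases x) (auto simp: h h' mem_square_boundary mem_unit_square)
  qed (auto intro!: continuous_intros)
  moreover have "k (u, z) = b" if "u \<in> {0..1}" "z \<in> square_boundary" for u z
    using that by (cases z) (auto simp: k_def mem_square_boundary h h')
  ultimately show ?thesis
    unfolding square_homotopic_iff
    by (intro exI[of _ k])
       (auto simp: k_def square_concat_def h h' unit_square_def)
qed

lemma pi2_class_eq_iff:
  assumes "\<gamma> \<in> square_maps Y b"
  shows "pi2_class Y b \<gamma> = pi2_class Y b \<delta> \<longleftrightarrow> square_homotopic Y b \<gamma> \<delta>"
proof
  assume eq: "pi2_class Y b \<gamma> = pi2_class Y b \<delta>"
  have "\<gamma> \<in> pi2_class Y b \<gamma>"
    using square_homotopic_refl[OF assms] by (simp add: pi2_class_def)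
  with eq show "square_homotopic Y b \<gamma> \<delta>"
    by (auto simp: pi2_class_def intro: square_homotopic_sym)
next
  assume "square_homotopic Y b \<gamma> \<delta>"
  then show "pi2_class Y b \<gamma> = pi2_class Y b \<delta>"
    by (auto simp: pi2_class_def intro: square_homotopic_sym square_homotopic_trans)
qed

lemma pi2_mult:
  assumes "\<gamma> \<in> square_maps Y b" "\<delta> \<in> square_maps Y b"
  shows "pi2_class Y b \<gamma> \<otimes>\<^bsub>pi2 Y b\<^esub> pi2_class Y b \<delta> = pi2_class Y b (square_concat \<gamma> \<delta>)"
proof -
  have "square_homotopic Y b (square_concat \<gamma> \<delta>) \<epsilon>"
    if "square_homotopic Y b \<gamma> \<gamma>'" "square_homotopic Y b \<delta> \<delta>'"
      "square_homotopic Y b (square_concat \<gamma>' \<delta>') \<epsilon>" for \<gamma>' \<delta>' \<epsilon>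
    using square_concat_homotopic[OF that(1,2)] that(3) by (rule square_homotopic_trans)
  then show ?thesis
    using assms by (auto simp: pi2_def pi2_class_def intro: square_homotopic_refl)
qed

lemma const_in_square_maps: "b \<in> topspace Y \<Longrightarrow> (\<lambda>_. b) \<in> square_maps Y b"
  by (auto simp: square_maps_iff)

lemma square_concat_const_right:
  assumes "\<gamma> \<in> square_maps Y b"
  shows "square_homotopic Y b (square_concat \<gamma> (\<lambda>_. b)) \<gamma>"
proof -
  have "square_homotopic Y b (\<lambda>(s, t). \<gamma> (min 1 (2 * s), t)) (\<lambda>(s, t). \<gamma> (s, t))"
    by (rule square_homotopic_reparam[OF assms]) (auto intro!: continuous_intros)
  moreover have "square_homotopic Y b (\<lambda>(s, t). \<gamma> (min 1 (2 * s), t)) (square_concat \<gamma> (\<lambda>_. b))"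
    by (rule square_homotopic_cong[OF square_homotopic_imp_square_maps(1)[OF calculation]])
       (use assms in \<open>auto simp: square_concat_def square_maps_iff mem_square_boundary mem_unit_square min_def\<close>)
  ultimately show ?thesis
    by (auto intro: square_homotopic_sym square_homotopic_trans simp: case_prod_eta)
qed

lemma square_concat_const_left:
  assumes "\<gamma> \<in> square_maps Y b"
  shows "square_homotopic Y b (square_concat (\<lambda>_. b) \<gamma>) \<gamma>"
proof -
  have "square_homotopic Y b (\<lambda>(s, t). \<gamma> (max 0 (2 * s - 1), t)) (\<lambda>(s, t). \<gamma> (s, t))"
    by (rule square_homotopic_reparam[OF assms]) (auto intro!: continuous_intros)
  moreover have "square_homotopic Y b (\<lambda>(s, t). \<gamma> (max 0 (2 * s - 1), t)) (square_concat (\<lambda>_. b) \<gamma>)"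
    by (rule square_homotopic_cong[OF square_homotopic_imp_square_maps(1)[OF calculation]])
       (use assms in \<open>auto simp: square_concat_def square_maps_iff mem_square_boundary mem_unit_square max_def\<close>)
  ultimately show ?thesis
    by (auto intro: square_homotopic_sym square_homotopic_trans simp: case_prod_eta)
qed

definition square_reverse :: "(real \<times> real \<Rightarrow> 'a) \<Rightarrow> real \<times> real \<Rightarrow> 'a" where
  "square_reverse \<gamma> = (\<lambda>(s, t). \<gamma> (1 - s, t))"

lemma square_reverse_in_square_maps:
  assumes "\<gamma> \<in> square_maps Y b"
  shows "square_reverse \<gamma> \<in> square_maps Y b"
proof -
  have "square_homotopic Y b (\<lambda>(s, t). \<gamma> (1 - s, t)) (\<lambda>(s, t). \<gamma> (1 - s, t))"
    by (rule square_homotopic_reparam[OF assms]) (auto intro!: continuous_intros)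
  then show ?thesis
    unfolding square_reverse_def by (rule square_homotopic_imp_square_maps)
qed

text \<open>The product runs through \<open>\<gamma>\<close> along
  \<open>\<bar>2 * s - 1\<bar>\<close>, which starts and ends at 1 and so deforms to the constant 1,
  where \<open>\<gamma>\<close> is \<open>b\<close>.\<close>

lemma square_concat_reverse:
  assumes "\<gamma> \<in> square_maps Y b"
  shows "square_homotopic Y b (square_concat (square_reverse \<gamma>) \<gamma>) (\<lambda>_. b)"
proof -
  have h: "square_homotopic Y b (\<lambda>(s, t). \<gamma> (\<bar>2 * s - 1\<bar>, t)) (\<lambda>(s, t). \<gamma> (1, t))"
    by (rule square_homotopic_reparam[OF assms]) (auto intro!: continuous_intros)
  have "square_homotopic Y b (\<lambda>(s, t). \<gamma> (\<bar>2 * s - 1\<bar>, t)) (square_concat (square_reverse \<gamma>) \<gamma>)"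
    by (rule square_homotopic_cong[OF square_homotopic_imp_square_maps(1)[OF h]])
       (auto simp: square_concat_def square_reverse_def mem_unit_square)
  moreover have "square_homotopic Y b (\<lambda>(s, t). \<gamma> (1, t)) (\<lambda>_. b)"
    by (rule square_homotopic_cong[OF square_homotopic_imp_square_maps(2)[OF h]])
       (use assms in \<open>auto simp: square_maps_iff mem_square_boundary mem_unit_square\<close>)
  ultimately show ?thesis
    using h by (blast intro: square_homotopic_sym square_homotopic_trans)
qed

lemma square_concat_assoc:
  assumes "\<gamma> \<in> square_maps Y b" "\<delta> \<in> square_maps Y b" "\<epsilon> \<in> square_maps Y b"
  shows "square_homotopic Y b (square_concat (square_concat \<gamma> \<delta>) \<epsilon>)
           (square_concat \<gamma> (square_concat \<delta> \<epsilon>))"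
proof -
  define m where "m = square_concat \<gamma> (square_concat \<delta> \<epsilon>)"
  have m: "m \<in> square_maps Y b"
    unfolding m_def by (intro square_concat_in_square_maps assms)
  \<comment> \<open>The piecewise linear homeomorphism of [0, 1] that takes the break points 1/4,
    1/2 of the left bracketing to the break points 1/2, 3/4 of the right one.\<close>
  define \<phi> where "\<phi> s = min (min (2 * s) (s + 1/4)) ((s + 1) / 2)" for s :: real
  have h: "square_homotopic Y b (\<lambda>(s, t). m (\<phi> s, t)) (\<lambda>(s, t). m (s, t))"
  proof (rule square_homotopic_reparam[OF m])
    show "continuous_on {0..1} \<phi>"
      unfolding \<phi>_def by (intro continuous_intros) auto
  qed (auto simp: \<phi>_def min_def max_def)
  have "square_homotopic Y b (\<lambda>(s, t). m (\<phi> s, t)) (square_concat (square_concat \<gamma> \<delta>) \<epsilon>)"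
    by (rule square_homotopic_cong[OF square_homotopic_imp_square_maps(1)[OF h]])
       (auto simp: m_def square_concat_def mem_unit_square \<phi>_def min_def algebra_simps add_divide_distrib diff_divide_distrib)
  with h show ?thesis
    unfolding m_def by (auto intro: square_homotopic_sym square_homotopic_trans simp: case_prod_eta)
qed

lemma carrier_pi2: "carrier (pi2 Y b) = pi2_class Y b ` square_maps Y b"
  by (simp add: pi2_def)

lemma one_pi2: "\<one>\<^bsub>pi2 Y b\<^esub> = pi2_class Y b (\<lambda>_. b)"
  by (simp add: pi2_def)

lemma pi2_reverse_mult:
  assumes "\<gamma> \<in> square_maps Y b"
  shows "pi2_class Y b (square_reverse \<gamma>) \<otimes>\<^bsub>pi2 Y b\<^esub> pi2_class Y b \<gamma> = \<one>\<^bsub>pi2 Y b\<^esub>"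
  using assms square_concat_reverse[OF assms]
  by (simp add: pi2_mult one_pi2 pi2_class_eq_iff square_reverse_in_square_maps
        square_concat_in_square_maps)

lemma group_pi2:
  assumes "b \<in> topspace Y"
  shows "group (pi2 Y b)"
proof (rule groupI)
  fix x y z assume "x \<in> carrier (pi2 Y b)" "y \<in> carrier (pi2 Y b)" "z \<in> carrier (pi2 Y b)"
  then obtain \<gamma> \<delta> \<epsilon> where "\<gamma> \<in> square_maps Y b" "\<delta> \<in> square_maps Y b" "\<epsilon> \<in> square_maps Y b"
    "x = pi2_class Y b \<gamma>" "y = pi2_class Y b \<delta>" "z = pi2_class Y b \<epsilon>"
    unfolding carrier_pi2 by blast
  then show "x \<otimes>\<^bsub>pi2 Y b\<^esub> y \<otimes>\<^bsub>pi2 Y b\<^esub> z = x \<otimes>\<^bsub>pi2 Y b\<^esub> (y \<otimes>\<^bsub>pi2 Y b\<^esub> z)"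
    by (simp add: pi2_mult square_concat_in_square_maps pi2_class_eq_iff square_concat_assoc)
next
  fix x assume "x \<in> carrier (pi2 Y b)"
  then obtain \<gamma> where \<gamma>: "\<gamma> \<in> square_maps Y b" "x = pi2_class Y b \<gamma>"
    unfolding carrier_pi2 by blast
  then show "\<exists>y\<in>carrier (pi2 Y b). y \<otimes>\<^bsub>pi2 Y b\<^esub> x = \<one>\<^bsub>pi2 Y b\<^esub>"
    using pi2_reverse_mult[OF \<gamma>(1)] square_reverse_in_square_maps[OF \<gamma>(1)]
    by (auto simp: carrier_pi2)
  from \<gamma> show "\<one>\<^bsub>pi2 Y b\<^esub> \<otimes>\<^bsub>pi2 Y b\<^esub> x = x"
    by (simp add: one_pi2 pi2_mult const_in_square_maps[OF assms] pi2_class_eq_iff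
        square_concat_in_square_maps square_concat_const_left)
qed (use assms in \<open>auto simp: carrier_pi2 pi2_mult one_pi2 square_concat_in_square_maps
       const_in_square_maps\<close>)

lemma pi2_inv:
  assumes "b \<in> topspace Y" "\<gamma> \<in> square_maps Y b"
  shows "inv\<^bsub>pi2 Y b\<^esub> (pi2_class Y b \<gamma>) = pi2_class Y b (square_reverse \<gamma>)"
  by (rule group.inv_equality[OF group_pi2[OF assms(1)] pi2_reverse_mult[OF assms(2)]])
     (use assms in \<open>auto simp: carrier_pi2 square_reverse_in_square_maps\<close>)

section \<open>Matrices\<close>

lemma continuous_on_matrix_mult [continuous_intros]:
  fixes f :: "'a::topological_space \<Rightarrow> complex^'n^'m" and g :: "'a \<Rightarrow> complex^'p^'n"
  assumes "continuous_on S f" "continuous_on S g"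
  shows "continuous_on S (\<lambda>x. f x ** g x)"
  unfolding matrix_matrix_mult_def using assms by (intro continuous_intros)

lemma continuous_on_matrix_vector_mult' [continuous_intros]:
  fixes f :: "'a::topological_space \<Rightarrow> complex^'n^'m" and g :: "'a \<Rightarrow> complex^'n"
  assumes "continuous_on S f" "continuous_on S g"
  shows "continuous_on S (\<lambda>x. f x *v g x)"
  unfolding matrix_vector_mult_def using assms by (intro continuous_intros)

lemma continuous_on_det' [continuous_intros]:
  fixes f :: "'a::topological_space \<Rightarrow> complex^'n^'n"
  assumes "continuous_on S f"
  shows "continuous_on S (\<lambda>x. det (f x))"
  unfolding det_def using assms by (intro continuous_intros)

lemma continuous_on_matrixI:
  fixes f :: "'a::topological_space \<Rightarrow> complex^'n^'m"
  assumes "\<And>i j. continuous_on S (\<lambda>x. f x $ i $ j)"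
  shows "continuous_on S f"
proof -
  have "continuous_on S (\<lambda>x. \<chi> i j. f x $ i $ j)"
    by (intro continuous_intros assms)
  then show ?thesis by (simp add: vec_lambda_eta)
qed

section \<open>Inverse matrices and their continuity\<close>

lemma
  fixes A :: "complex^'n^'n"
  assumes "invertible A"
  shows matrix_inv_right: "A ** matrix_inv A = mat 1"
    and matrix_inv_left: "matrix_inv A ** A = mat 1"
proof -
  obtain B where "A ** B = mat 1 \<and> B ** A = mat 1"
    using assms unfolding invertible_def by blast
  then have "A ** matrix_inv A = mat 1 \<and> matrix_inv A ** A = mat 1"
    unfolding matrix_inv_def by (rule someI)
  then show "A ** matrix_inv A = mat 1" "matrix_inv A ** A = mat 1" by auto
qed

lemma invertible_matrix_inv:
  fixes A :: "complex^'n^'n"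
  shows "invertible A \<Longrightarrow> invertible (matrix_inv A)"
  using matrix_inv_right matrix_inv_left invertible_def by blast

lemma matrix_inv_unique:
  fixes A B :: "complex^'n^'n"
  assumes "A ** B = mat 1"
  shows "matrix_inv A = B"
proof -
  have "B ** A = mat 1" using assms matrix_left_right_inverse by blast
  then have "invertible A" using assms invertible_def by blast
  then have "matrix_inv A ** (A ** B) = B"
    by (simp add: matrix_mul_assoc matrix_inv_left)
  with assms show ?thesis by simp
qed

lemma invertible_kernelI:
  fixes A :: "complex^'n^'n"
  assumes "\<And>x. A *v x = 0 \<Longrightarrow> x = 0"
  shows "invertible A"
proof -
  have "\<forall>x. A *v x = 0 \<longrightarrow> x = 0" using assms by blast
  then obtain B where "B ** A = mat 1" using matrix_left_invertible_ker[of A] by blast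
  moreover from this have "A ** B = mat 1" by (simp add: matrix_left_right_inverse)
  ultimately show ?thesis unfolding invertible_def by blast
qed

lemma invertible_kernelD:
  fixes A :: "complex^'n^'n"
  assumes "invertible A" "A *v x = 0"
  shows "x = 0"
proof -
  have "matrix_inv A *v (A *v x) = x"
    by (simp add: matrix_vector_mul_assoc matrix_inv_left assms(1))
  with assms(2) show ?thesis by simp
qed

lemma matrix_vector_mult_axis:
  fixes A :: "complex^'n^'m"
  shows "A *v axis j 1 = column j A"
  by (simp add: matrix_vector_mult_def column_def axis_def vec_eq_iff if_distrib[of "(*) _"] cong: if_cong)

lemma matrix_vector_mult_axis_nth:
  fixes A :: "complex^'n^'m"
  shows "(A *v axis j 1) $ i = A $ i $ j"
  by (simp add: matrix_vector_mult_axis column_def)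

text \<open>Cramer's rule for the \<open>j\<close>-th column. The entries are quotients of
  polynomials in \<open>A\<close>, which makes inversion continuous.\<close>

lemma matrix_inv_entry:
  fixes A :: "complex^'n^'n"
  assumes "invertible A"
  shows "matrix_inv A $ i $ j = det (\<chi> k l. if l = i then axis j 1 $ k else A $ k $ l) / det A"
proof -
  have "A *v column j (matrix_inv A) = A *v (matrix_inv A *v axis j 1)"
    by (simp only: matrix_vector_mult_axis)
  also have "\<dots> = axis j 1"
    by (simp only: matrix_vector_mul_assoc matrix_inv_right[OF assms] matrix_vector_mul_lid)
  finally have "A *v column j (matrix_inv A) = axis j 1" .
  then have "column j (matrix_inv A) =
     (\<chi> i. det (\<chi> k l. if l = i then axis j 1 $ k else A $ k $ l) / det A)"
    using assms cramer[of A] by (simp add: invertible_det_nz)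
  then show ?thesis by (simp add: column_def vec_eq_iff)
qed

lemma continuous_on_matrix_inv [continuous_intros]:
  fixes f :: "'a::topological_space \<Rightarrow> complex^'n^'n"
  assumes "continuous_on S f" "\<And>x. x \<in> S \<Longrightarrow> invertible (f x)"
  shows "continuous_on S (\<lambda>x. matrix_inv (f x))"
proof (rule continuous_on_matrixI)
  fix i j
  have "continuous_on S (\<lambda>x. if l = i then axis j 1 $ k else f x $ k $ l)" for k l
    using assms(1) by (cases "l = i") (auto intro!: continuous_intros)
  then have "continuous_on S
    (\<lambda>x. det (\<chi> k l. if l = i then axis j 1 $ k else f x $ k $ l) / det (f x))"
    using assms by (intro continuous_intros) (auto simp: invertible_det_nz)
  then show "continuous_on S (\<lambda>x. matrix_inv (f x) $ i $ j)"
    by (rule continuous_on_eq) (simp add: matrix_inv_entry assms)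
qed

subsection \<open>Block matrices\<close>

text \<open>\<open>L\<close> labels the coordinates. Two labellings occur: by level, where these
  matrices fix the standard flag, and by parity of the level, where they respect the sign of the
  form.\<close>

definition block_mats :: "('n \<Rightarrow> 'l) \<Rightarrow> (complex^'n^'n) set" where
  "block_mats L = {g. invertible g \<and> (\<forall>i j. L i \<noteq> L j \<longrightarrow> g $ i $ j = 0)}"

text \<open>Padding by the identity outside \<open>S\<close> keeps the size fixed, so the minor on
  \<open>S\<close> is an ordinary determinant and is multiplicative on block matrices.\<close>

definition sub_block :: "'n set \<Rightarrow> complex^'n^'n \<Rightarrow> complex^'n^'n" where
  "sub_block S g = (\<chi> i j. if i \<in> S \<and> j \<in> S then g $ i $ j else if i = j then 1 else 0)"

definition block_det :: "'n set \<Rightarrow> complex^'n^'n \<Rightarrow> complex" where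
  "block_det S g = det (sub_block S g)"

definition restrict_vec :: "'n set \<Rightarrow> complex^'n \<Rightarrow> complex^'n" where
  "restrict_vec S x = (\<chi> i. if i \<in> S then x $ i else 0)"

lemma restrict_vec_nth [simp]: "restrict_vec S x $ i = (if i \<in> S then x $ i else 0)"
  by (simp add: restrict_vec_def)

lemma block_matsD:
  assumes "g \<in> block_mats L"
  shows "invertible g" "L i \<noteq> L j \<Longrightarrow> g $ i $ j = 0"
  using assms by (auto simp: block_mats_def)

lemma block_mats_mono:
  assumes "\<And>i j. L i = L j \<Longrightarrow> L' i = L' j"
  shows "block_mats L \<subseteq> block_mats L'"
  using assms unfolding block_mats_def by blast

lemma block_mats_mult:
  assumes "g \<in> block_mats L" "h \<in> block_mats L"
  shows "g ** h \<in> block_mats L"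
proof -
  have "(g ** h) $ i $ j = 0" if "L i \<noteq> L j" for i j
  proof -
    have "g $ i $ k * h $ k $ j = 0" for k
      using that block_matsD(2)[OF assms(1), of i k] block_matsD(2)[OF assms(2), of k j]
      by (cases "L i = L k") auto
    then have "(\<Sum>k\<in>UNIV. g $ i $ k * h $ k $ j) = 0" by (intro sum.neutral ballI)
    then show ?thesis by (simp add: matrix_matrix_mult_def)
  qed
  then show ?thesis
    using assms by (auto simp: block_mats_def invertible_mult)
qed

lemma invertible_mat_1: "invertible (mat 1 :: complex^'n^'n)"
  unfolding invertible_def by (intro exI[of _ "mat 1"]) simp

lemma block_mats_1: "mat 1 \<in> block_mats L"
  using invertible_mat_1 by (auto simp: block_mats_def mat_def)

lemma block_mats_restrict:
  assumes "g \<in> block_mats L" "S = L -` T"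
  shows "g *v restrict_vec S x = restrict_vec S (g *v x)"
proof -
  have "g $ i $ k = 0" if "i \<in> S \<longleftrightarrow> k \<notin> S" for i k
    using that assms(2) by (intro block_matsD(2)[OF assms(1)]) auto
  then show ?thesis
    by (auto simp: vec_eq_iff matrix_vector_mult_def intro!: sum.cong sum.neutral)
qed

text \<open>A block diagonal matrix commutes with the projections onto its blocks, and it is
  injective. So the preimage of a basis vector lies in the block of that vector.\<close>

lemma block_mats_inv:
  assumes "g \<in> block_mats L"
  shows "matrix_inv g \<in> block_mats L"
proof -
  note inv = block_matsD(1)[OF assms]
  have "matrix_inv g $ i $ j = 0" if ij: "L i \<noteq> L j" for i j
  proof -
    let ?y = "matrix_inv g *v axis j 1" and ?S = "L -` {L j}"
    have gy: "g *v ?y = axis j 1"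
      by (simp add: matrix_vector_mul_assoc matrix_inv_right inv)
    have "g *v restrict_vec ?S ?y = restrict_vec ?S (axis j 1)"
      by (simp add: block_mats_restrict[OF assms refl] gy)
    also have "\<dots> = axis j 1" by (auto simp: vec_eq_iff axis_def)
    finally have "g *v (restrict_vec ?S ?y - ?y) = 0"
      by (simp add: matrix_vector_mult_diff_distrib gy)
    from invertible_kernelD[OF inv this] have "?y = restrict_vec ?S ?y" by simp
    then have "?y $ i = restrict_vec ?S ?y $ i" by (rule arg_cong)
    then have "?y $ i = 0" using ij by simp
    then show ?thesis by (simp only: matrix_vector_mult_axis_nth)
  qed
  then show ?thesis
    using invertible_matrix_inv[OF inv] by (auto simp: block_mats_def)
qed

lemma sub_block_1 [simp]: "sub_block S (mat 1) = mat 1"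
  by (auto simp: sub_block_def mat_def vec_eq_iff)

lemma block_det_1 [simp]: "block_det S (mat 1) = 1"
  by (simp add: block_det_def)

lemma sub_block_mult:
  assumes "\<And>i j. i \<in> S \<Longrightarrow> j \<notin> S \<Longrightarrow> g $ i $ j = 0"
  shows "sub_block S (g ** h) = sub_block S g ** sub_block S h"
proof -
  have "(sub_block S g ** sub_block S h) $ i $ j = sub_block S (g ** h) $ i $ j" for i j
  proof (cases "i \<in> S")
    case True
    have "(sub_block S g ** sub_block S h) $ i $ j
       = (\<Sum>k\<in>UNIV. if k \<in> S then g $ i $ k * (if j \<in> S then h $ k $ j else 0) else 0)"
      using True unfolding matrix_matrix_mult_def sub_block_def
      by (auto intro!: sum.cong)
    also have "\<dots> = (if j \<in> S then (g ** h) $ i $ j else 0)"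
      using True assms unfolding matrix_matrix_mult_def
      by (auto intro!: sum.cong sum.neutral)
    finally show ?thesis using True by (auto simp: sub_block_def)
  next
    case False
    have "(sub_block S g ** sub_block S h) $ i $ j
       = (\<Sum>k\<in>UNIV. if k = i then sub_block S h $ i $ j else 0)"
      using False unfolding matrix_matrix_mult_def sub_block_def vec_lambda_beta
      by (intro sum.cong) auto
    then show ?thesis using False by (auto simp: sub_block_def)
  qed
  then show ?thesis by (simp add: vec_eq_iff)
qed

lemma block_det_mult:
  assumes "g \<in> block_mats L"
  shows "block_det (L -` T) (g ** h) = block_det (L -` T) g * block_det (L -` T) h"
proof -
  have "g $ i $ j = 0" if "i \<in> L -` T" "j \<notin> L -` T" for i j
    using that by (intro block_matsD(2)[OF assms]) auto
  from sub_block_mult[of "L -` T" g h, OF this] show ?thesis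
    by (simp add: block_det_def det_mul)
qed

lemma block_det_inv:
  assumes "g \<in> block_mats L"
  shows "block_det (L -` T) g \<noteq> 0"
    and "block_det (L -` T) (matrix_inv g) = inverse (block_det (L -` T) g)"
proof -
  have "block_det (L -` T) g * block_det (L -` T) (matrix_inv g) = 1"
    using block_det_mult[OF assms, of T "matrix_inv g"]
    by (simp add: matrix_inv_right block_matsD(1)[OF assms])
  then show "block_det (L -` T) g \<noteq> 0"
    "block_det (L -` T) (matrix_inv g) = inverse (block_det (L -` T) g)"
    by (auto simp: inverse_unique)
qed

lemma block_det_Un:
  assumes "g \<in> block_mats L" "A = L -` S" "B = L -` T" "S \<inter> T = {}"
  shows "block_det (A \<union> B) g = block_det A g * block_det B g"
proof -
  have dis: "i \<in> B \<Longrightarrow> i \<notin> A" for i using assms by auto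
  have g0: "g $ i $ j = 0" if "i \<in> A \<and> j \<notin> A \<or> j \<in> A \<and> i \<notin> A \<or> i \<in> B \<and> j \<notin> B \<or> j \<in> B \<and> i \<notin> B" for i j
    using that assms(2-) by (intro block_matsD(2)[OF assms(1)]) auto
  have "(sub_block A g ** sub_block B g) $ i $ j = sub_block (A \<union> B) g $ i $ j" for i j
  proof (cases "i \<in> A")
    case True
    have "(sub_block A g ** sub_block B g) $ i $ j
       = (\<Sum>k\<in>UNIV. if k = j then (if j \<in> A then g $ i $ j else 0) else 0)"
      using True dis g0[of i] unfolding matrix_matrix_mult_def sub_block_def vec_lambda_beta
      by (intro sum.cong) auto
    then show ?thesis using True g0[of i j] dis by (auto simp: sub_block_def)
  next
    case False
    have "(sub_block A g ** sub_block B g) $ i $ j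
       = (\<Sum>k\<in>UNIV. if k = i then sub_block B g $ i $ j else 0)"
      using False unfolding matrix_matrix_mult_def sub_block_def vec_lambda_beta
      by (intro sum.cong) auto
    then show ?thesis using False g0[of i j] by (auto simp: sub_block_def)
  qed
  then have "sub_block (A \<union> B) g = sub_block A g ** sub_block B g"
    by (simp add: vec_eq_iff)
  then show ?thesis by (simp add: block_det_def det_mul)
qed

lemma block_det_empty [simp]: "block_det {} g = 1"
proof -
  have "sub_block {} g = mat 1" by (auto simp: sub_block_def mat_def vec_eq_iff)
  then show ?thesis by (simp add: block_det_def)
qed

lemma block_det_prod:
  assumes "g \<in> block_mats L" "finite I"
  shows "block_det (L -` I) g = (\<Prod>i\<in>I. block_det (L -` {i}) g)"
  using assms(2)
proof (induction I)
  case (insert i I)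
  have "L -` insert i I = L -` {i} \<union> L -` I" by auto
  with insert show ?case
    using block_det_Un[OF assms(1) refl refl, of "{i}" I] by simp
qed simp

lemma block_det_diagonal:
  assumes "\<And>i j. i \<noteq> j \<Longrightarrow> g $ i $ j = 0"
  shows "block_det S g = (\<Prod>i\<in>S. g $ i $ i)"
proof -
  have "block_det S g = (\<Prod>i\<in>UNIV. if i \<in> S then g $ i $ i else 1)"
    unfolding block_det_def by (subst det_diagonal) (auto simp: sub_block_def assms intro!: prod.cong)
  then show ?thesis by (simp add: prod.If_cases)
qed

lemma continuous_on_block_det [continuous_intros]:
  fixes f :: "'a::topological_space \<Rightarrow> complex^'n^'n"
  assumes "continuous_on S f"
  shows "continuous_on S (\<lambda>x. block_det T (f x))"
proof -
  have "continuous_on S (\<lambda>x. sub_block T (f x))"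
  proof (rule continuous_on_matrixI)
    fix i j
    show "continuous_on S (\<lambda>x. sub_block T (f x) $ i $ j)"
      using assms by (cases "i \<in> T \<and> j \<in> T") (auto simp: sub_block_def intro!: continuous_intros)
  qed
  then show ?thesis unfolding block_det_def by (intro continuous_intros)
qed

text \<open>The minor is the determinant of the compression of \<open>g\<close> to the coordinates
  in \<open>S\<close>, and the identity padding adds nothing to its kernel.\<close>

lemma block_det_nonzeroI:
  assumes "\<And>x. restrict_vec S x = x \<Longrightarrow> restrict_vec S (g *v x) = 0 \<Longrightarrow> x = 0"
  shows "block_det S g \<noteq> 0"
proof -
  have "invertible (sub_block S g)"
  proof (rule invertible_kernelI)
    fix x assume 0: "sub_block S g *v x = 0"
    have x: "restrict_vec S x = x"
    proof -
      have "x $ i = 0" if "i \<notin> S" for i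
      proof -
        have "(sub_block S g *v x) $ i = (\<Sum>k\<in>UNIV. if k = i then x $ i else 0)"
          using that unfolding matrix_vector_mult_def sub_block_def vec_lambda_beta
          by (intro sum.cong) auto
        with 0 show ?thesis by simp
      qed
      then show ?thesis by (auto simp: vec_eq_iff)
    qed
    have "(g *v x) $ i = 0" if "i \<in> S" for i
    proof -
      have "x $ k = 0" if "k \<notin> S" for k using x that by (metis restrict_vec_nth)
      then have "(sub_block S g *v x) $ i = (g *v x) $ i"
        using \<open>i \<in> S\<close> unfolding matrix_vector_mult_def sub_block_def
        by (auto intro!: sum.cong)
      with 0 show ?thesis by simp
    qed
    then have "restrict_vec S (g *v x) = 0" by (auto simp: vec_eq_iff)
    with x assms show "x = 0" by blast
  qed
  then show ?thesis by (simp add: block_det_def invertible_det_nz)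
qed

subsection \<open>Lifting homotopies to the general linear group\<close>

lemma near_identity_invertible:
  obtains e where "e > 0" "\<And>A :: complex^'n^'n. dist A (mat 1) < e \<Longrightarrow> invertible A"
proof -
  have "open {A :: complex^'n^'n. det A \<noteq> 0}"
    by (rule open_Collect_neq) (auto intro: continuous_intros)
  moreover have "mat 1 \<in> {A :: complex^'n^'n. det A \<noteq> 0}" by simp
  ultimately obtain e where "e > 0" "\<And>A :: complex^'n^'n. dist A (mat 1) < e \<Longrightarrow> det A \<noteq> 0"
    unfolding open_dist by blast
  then show ?thesis using that by (simp add: invertible_det_nz)
qed

text \<open>The lift is the product of the transports \<open>\<tau>\<close> over a subdivision of \<open>[0, s]\<close> so fine that
  each of them is close to the identity.\<close>

lemma path_lifting:
  fixes \<tau> :: "real \<Rightarrow> real \<Rightarrow> 'z::metric_space \<Rightarrow> complex^'n^'n"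
  assumes Z: "compact Z"
    and cont: "continuous_on ({0..1} \<times> {0..1} \<times> Z) (\<lambda>x. \<tau> (fst x) (fst (snd x)) (snd (snd x)))"
    and id: "\<And>s z. s \<in> {0..1} \<Longrightarrow> z \<in> Z \<Longrightarrow> \<tau> s s z = mat 1"
    and P0: "\<And>z. z \<in> Z \<Longrightarrow> P 0 z (mat 1)"
    and step: "\<And>s s' z A. s \<in> {0..1} \<Longrightarrow> s' \<in> {0..1} \<Longrightarrow> z \<in> Z \<Longrightarrow> P s z A \<Longrightarrow>
      invertible (\<tau> s s' z) \<Longrightarrow> P s' z (\<tau> s s' z ** A)"
  obtains g where "continuous_on ({0..1} \<times> Z) g" "\<And>z. z \<in> Z \<Longrightarrow> g (0, z) = mat 1"
    "\<And>s z. s \<in> {0..1} \<Longrightarrow> z \<in> Z \<Longrightarrow> P s z (g (s, z))"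
proof -
  obtain e where e: "e > 0" "\<And>A :: complex^'n^'n. dist A (mat 1) < e \<Longrightarrow> invertible A"
    using near_identity_invertible by blast
  have "compact ({0..1::real} \<times> {0..1::real} \<times> Z)" using Z by (intro compact_Times) auto
  from compact_uniformly_continuous[OF cont this] e(1)
  obtain d where d: "d > 0" "\<And>x y. x \<in> {0..1} \<times> {0..1} \<times> Z \<Longrightarrow> y \<in> {0..1} \<times> {0..1} \<times> Z \<Longrightarrow>
      dist y x < d \<Longrightarrow> dist (\<tau> (fst y) (fst (snd y)) (snd (snd y))) (\<tau> (fst x) (fst (snd x)) (snd (snd x))) < e"
    unfolding uniformly_continuous_on_def by metis
  have inv: "invertible (\<tau> s s' z)" if "s \<in> {0..1}" "s' \<in> {0..1}" "z \<in> Z" "\<bar>s' - s\<bar> < d" for s s' z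
  proof -
    have "dist (s, s', z) (s, s, z) < d"
      using that by (simp add: dist_Pair_Pair dist_real_def)
    with d(2)[of "(s, s, z)" "(s, s', z)"] that show ?thesis
      by (intro e(2)) (simp add: id)
  qed
  obtain N :: nat where N: "N > 0" "inverse (real N) < d"
    using d(1) ex_inverse_of_nat_less by blast
  \<comment> \<open>The subdivision point m / N, stopped at \<open>s\<close>. Stopping makes the
    product of all N transports end exactly at \<open>s\<close> and keeps it continuous in
    \<open>s\<close>.\<close>
  define q where "q m s = min s (real m / real N)" for m s
  have q: "q m s \<in> {0..1}" if "s \<in> {0..1}" for m s
    using that by (auto simp: q_def)
  have q_step: "\<bar>q (Suc m) s - q m s\<bar> < d" for m s
  proof -
    have "\<bar>q (Suc m) s - q m s\<bar> \<le> inverse (real N)"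
      using N(1) by (auto simp: q_def min_def field_simps)
    with N(2) show ?thesis by simp
  qed
  define G where "G = rec_nat (\<lambda>_. mat 1) (\<lambda>m g x. \<tau> (q m (fst x)) (q (Suc m) (fst x)) (snd x) ** g x)"
  have G0: "G 0 = (\<lambda>_. mat 1)" by (simp add: G_def)
  have GS: "G (Suc m) = (\<lambda>x. \<tau> (q m (fst x)) (q (Suc m) (fst x)) (snd x) ** G m x)" for m
    by (simp add: G_def)
  have G_cont: "continuous_on ({0..1} \<times> Z) (G m)" for m
  proof (induction m)
    case (Suc m)
    have "continuous_on ({0..1} \<times> Z) (\<lambda>x. \<tau> (q m (fst x)) (q (Suc m) (fst x)) (snd x))"
    proof (rule continuous_on_compose2[OF cont, of _ "\<lambda>x. (q m (fst x), q (Suc m) (fst x), snd x)", simplified])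
      show "continuous_on ({0..1} \<times> Z) (\<lambda>x. (q m (fst x), q (Suc m) (fst x), snd x))"
        unfolding q_def by (intro continuous_intros)
    qed (use q in \<open>auto simp: image_subset_iff\<close>)
    with Suc show ?case unfolding GS by (intro continuous_intros)
  qed (simp add: G0)
  have G_P: "P (q m s) z (G m (s, z))" if "s \<in> {0..1}" "z \<in> Z" for s z m
  proof (induction m)
    case 0
    have "q 0 s = 0" using that by (simp add: q_def)
    with P0 that show ?case by (simp add: G0)
  next
    case (Suc m)
    show ?case
      unfolding GS using step[OF q[OF that(1)] q[OF that(1)] that(2) Suc inv[OF q[OF that(1)] q[OF that(1)] that(2) q_step]]
      by simp
  qed
  have G_id: "G m (0, z) = mat 1" if "z \<in> Z" for z m
    by (induction m) (use that in \<open>auto simp: G0 GS q_def id\<close>)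
  have "q N s = s" if "s \<in> {0..1}" for s using N that by (auto simp: q_def)
  with G_P[of _ _ N] have "P s z (G N (s, z))" if "s \<in> {0..1}" "z \<in> Z" for s z
    using that by metis
  with G_cont G_id that show ?thesis by blast
qed

subsection \<open>Contracting nonvanishing vector fields\<close>

lemma continuous_on_vsmult [continuous_intros]:
  fixes f :: "'a::topological_space \<Rightarrow> complex" and g :: "'a \<Rightarrow> complex^'n"
  assumes "continuous_on S f" "continuous_on S g"
  shows "continuous_on S (\<lambda>x. f x *s g x)"
  unfolding vector_scalar_mult_def using assms by (intro continuous_intros)

lemma bounded_linear_restrict_vec: "bounded_linear (restrict_vec S)"
  by (intro linear_conv_bounded_linear[THEN iffD1] linearI) (auto simp: vec_eq_iff)

lemma norm_restrict_vec: "norm (restrict_vec S x) \<le> norm x"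
  by (rule norm_le_componentwise_cart) auto

text \<open>The cone over the image of a smooth map from the plane has real dimension 3, so it is negligible
  in a complex vector space of dimension at least 2.\<close>

lemma ray_avoiding_vector:
  fixes p :: "real \<times> real \<Rightarrow> complex^'n"
  assumes p: "polynomial_function p" and ab: "a \<in> S" "b \<in> S" "a \<noteq> b"
  obtains w where "restrict_vec S w = w" "dist w (axis a 1) < 1/2"
    "\<And>t z. w \<noteq> - (t *\<^sub>R restrict_vec S (p z))"
proof -
  let ?e = "axis a 1 :: complex^'n"
  \<comment> \<open>The coordinates \<open>a\<close> and \<open>b\<close> of \<open>y\<close> store
    the parameters of a point of the cone: \<open>y $ a\<close> the point of the plane,
    \<open>Re (y $ b)\<close> the scalar. The remaining real coordinate \<open>Im (y $ b)\<close> is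
    set to 0, and a differentiable map of a space to itself sends that hyperplane to a negligible
    set.\<close>
  define \<Phi> where "\<Phi> y = restrict_vec (- S) y - Re (y $ b) *\<^sub>R restrict_vec S (p (Re (y $ a), Im (y $ a)))"
    for y :: "complex^'n"
  have "(axis b \<i> :: complex^'n) \<noteq> 0" by (simp add: axis_eq_0_iff)
  then have "negligible {y. axis b \<i> \<bullet> y = (0::real)}"
    by (intro negligible_hyperplane) auto
  moreover have "axis b \<i> \<bullet> y = Im (y $ b)" for y :: "complex^'n"
    by (simp add: inner_axis')
  ultimately have neg: "negligible {y :: complex^'n. Im (y $ b) = 0}" by simp
  have diff: "\<Phi> differentiable_on X" for X
  proof -
    have lin: "(\<lambda>y::complex^'n. Re (y $ i)) differentiable at x" "(\<lambda>y::complex^'n. Im (y $ i)) differentiable at x"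
      "restrict_vec T differentiable at x" for T i x
      by (intro bounded_linear_imp_differentiable bounded_linear_restrict_vec
          bounded_linear_compose[OF bounded_linear_Re] bounded_linear_compose[OF bounded_linear_Im]
          bounded_linear_vec_nth)+
    have "(\<lambda>y. p (Re (y $ a), Im (y $ a))) differentiable at x" for x
      by (rule differentiable_compose[where f = p and g = "\<lambda>y. (Re (y $ a), Im (y $ a))"])
         (intro differentiable_Pair lin differentiable_at_polynomial_function[OF p])+
    then have "(\<lambda>y. restrict_vec S (p (Re (y $ a), Im (y $ a)))) differentiable at x" for x
      by (rule differentiable_compose[where f = "restrict_vec S", OF lin(3)])
    then show ?thesis
      unfolding \<Phi>_def
      by (intro differentiable_at_imp_differentiable_on differentiable_diff differentiable_scaleR lin)
  qed
  have "negligible (\<Phi> ` {y. Im (y $ b) = 0})"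
    by (rule negligible_differentiable_image_negligible[OF _ neg diff]) simp
  moreover have "\<not> negligible (ball ?e (1/2))"
    by (rule open_not_negligible) auto
  ultimately obtain w0 where w0: "w0 \<in> ball ?e (1/2)" "w0 \<notin> \<Phi> ` {y. Im (y $ b) = 0}"
    using negligible_subset by blast
  let ?w = "restrict_vec S w0"
  show ?thesis
  proof (rule that[of ?w])
    show "restrict_vec S ?w = ?w" by (auto simp: vec_eq_iff)
    have "?w - ?e = restrict_vec S (w0 - ?e)" using ab by (auto simp: vec_eq_iff axis_def)
    then have "dist ?w ?e \<le> dist w0 ?e" using norm_restrict_vec[of S "w0 - ?e"] by (simp add: dist_norm)
    with w0(1) show "dist ?w ?e < 1/2" by (simp add: dist_commute)
    fix t z
    show "?w \<noteq> - (t *\<^sub>R restrict_vec S (p z))"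
    proof
      assume w: "?w = - (t *\<^sub>R restrict_vec S (p z))"
      define y where "y = restrict_vec (- S) w0 + axis a (Complex (fst z) (snd z)) + axis b (complex_of_real t)"
      have y: "y $ a = Complex (fst z) (snd z)" "y $ b = complex_of_real t"
        using ab by (auto simp: y_def axis_def)
      have "restrict_vec (- S) y = restrict_vec (- S) w0"
        using ab by (auto simp: y_def axis_def vec_eq_iff)
      then have "\<Phi> y = restrict_vec (- S) w0 + ?w"
        by (simp add: \<Phi>_def y w)
      also have "\<dots> = w0" by (auto simp: vec_eq_iff)
      finally have "w0 = \<Phi> y" by simp
      with y w0(2) show False by auto
    qed
  qed
qed

section \<open>Deformations relative to a subset\<close>

lemma rel_homotopyI:
  fixes H :: "real \<times> 'z::topological_space \<Rightarrow> 'a::topological_space"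
  assumes "continuous_on ({0..1} \<times> Z) H" "\<And>u z. u \<in> {0..1} \<Longrightarrow> z \<in> Z \<Longrightarrow> H (u, z) \<in> G"
    and "\<And>z. z \<in> Z \<Longrightarrow> H (0, z) = f z" "\<And>z. z \<in> Z \<Longrightarrow> H (1, z) = g z"
    and "\<And>u z. u \<in> {0..1} \<Longrightarrow> z \<in> Z0 \<Longrightarrow> H (u, z) = c" "Z0 \<subseteq> Z"
  shows "homotopic_with (\<lambda>f. \<forall>z\<in>Z0. f z = c) (top_of_set Z) (top_of_set G) f g"
proof (subst homotopic_with)
  show "\<exists>h. continuous_map (prod_topology (top_of_set {0..1::real}) (top_of_set Z)) (top_of_set G) h \<and>
        (\<forall>x\<in>topspace (top_of_set Z). h (0, x) = f x) \<and>
        (\<forall>x\<in>topspace (top_of_set Z). h (1, x) = g x) \<and> (\<forall>t\<in>{0..1}. \<forall>z\<in>Z0. h (t, z) = c)"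
    using assms by (intro exI[of _ H]) (auto simp: continuous_map_in_subtopology)
qed (use assms(6) in \<open>auto simp: subset_iff\<close>)

lemma rel_homotopyE:
  fixes f :: "'z::topological_space \<Rightarrow> 'a::topological_space"
  assumes "homotopic_with (\<lambda>f. \<forall>z\<in>Z0. f z = c) (top_of_set Z) (top_of_set G) f g"
  obtains H :: "real \<times> 'z \<Rightarrow> 'a" where
    "continuous_on ({0..1} \<times> Z) H" "\<And>u z. u \<in> {0..1} \<Longrightarrow> z \<in> Z \<Longrightarrow> H (u, z) \<in> G"
    "\<And>z. H (0, z) = f z" "\<And>z. H (1, z) = g z"
    "\<And>u z. u \<in> {0..1} \<Longrightarrow> z \<in> Z0 \<Longrightarrow> H (u, z) = c"
  using assms unfolding homotopic_with_def
  by (auto simp: continuous_map_in_subtopology Pi_iff image_subset_iff)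

text \<open>With two elements in \<open>S\<close>, the nonzero vectors supported on \<open>S\<close>
  retract onto a sphere of dimension at least 3, so a family with two real parameters contracts.
  Here it is replaced by a polynomial family and moved along segments to a vector \<open>w\<close>
  close to \<open>axis a 1\<close> for which these segments avoid 0. A final linear correction keeps
  \<open>Z0\<close> fixed.\<close>

lemma contract_nonvanishing:
  fixes v :: "real \<times> real \<Rightarrow> complex^'n"
  assumes Z: "compact Z" and cont: "continuous_on Z v"
    and v: "\<And>z. z \<in> Z \<Longrightarrow> v z \<noteq> 0 \<and> restrict_vec S (v z) = v z"
    and ab: "a \<in> S" "b \<in> S" "a \<noteq> b"
    and Z0: "Z0 \<subseteq> Z" "\<And>z. z \<in> Z0 \<Longrightarrow> v z = axis a 1"
  shows "homotopic_with (\<lambda>f. \<forall>z\<in>Z0. f z = axis a 1) (top_of_set Z)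
     (top_of_set {x. x \<noteq> 0 \<and> restrict_vec S x = x}) v (\<lambda>_. axis a 1)"
proof (cases "Z = {}")
  case False
  let ?e = "axis a 1 :: complex^'n" and ?G = "{x :: complex^'n. x \<noteq> 0 \<and> restrict_vec S x = x}"
  have "continuous_on Z (\<lambda>z. norm (v z))" using cont by (intro continuous_intros)
  from continuous_attains_inf[OF Z False this]
  obtain z0 where "z0 \<in> Z" and z0: "\<And>z. z \<in> Z \<Longrightarrow> norm (v z0) \<le> norm (v z)" by blast
  then have m: "norm (v z0) > 0" using v by simp
  define \<delta> where "\<delta> = min (norm (v z0) / 2) (1/8)"
  have \<delta>: "\<delta> > 0" "\<delta> < norm (v z0)" "\<delta> \<le> 1/8" using m unfolding \<delta>_def by linarith+
  obtain p0 where p0: "polynomial_function p0" "\<And>z. z \<in> Z \<Longrightarrow> norm (v z - p0 z) < \<delta>"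
    using Stone_Weierstrass_polynomial_function[OF Z cont \<delta>(1)] by blast
  define p where "p z = restrict_vec S (p0 z)" for z
  have p_near: "norm (p z - v z) < \<delta>" if "z \<in> Z" for z
  proof -
    have "p z - v z = restrict_vec S (p0 z - v z)"
      using v[OF that] linear_diff[OF bounded_linear.linear[OF bounded_linear_restrict_vec, of S]]
      by (simp add: p_def)
    then show ?thesis
      using norm_restrict_vec[of S "p0 z - v z"] p0(2)[OF that] by (simp add: norm_minus_commute)
  qed
  have p_cont: "continuous_on Z p"
    unfolding p_def
    by (intro bounded_linear.continuous_on[OF bounded_linear_restrict_vec]
        continuous_on_polymonial_function p0)
  have p_S: "restrict_vec S (p z) = p z" for z by (auto simp: p_def vec_eq_iff)
  obtain w where w: "restrict_vec S w = w" "dist w ?e < 1/2" "\<And>t z. w \<noteq> - (t *\<^sub>R p z)"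
    using ray_avoiding_vector[OF p0(1) ab] unfolding p_def by blast
  have S_iff: "restrict_vec S x = x \<longleftrightarrow> (\<forall>i. i \<notin> S \<longrightarrow> x $ i = 0)" for x :: "complex^'n"
    by (auto simp: vec_eq_iff)
  \<comment> \<open>A cut-off: 0 within distance 1/8 of \<open>axis a 1\<close> and 1 beyond
    distance 1/4. The family is unchanged on \<open>Z0\<close>. Where the replacement is only
    partial, \<open>P\<close> is within 1/2 of \<open>axis a 1\<close>, and convexity of that ball
    keeps the segment to \<open>w\<close> away from 0.\<close>
  define \<kappa> where "\<kappa> z = min 1 (max 0 (8 * norm (v z - ?e) - 1))" for z
  have \<kappa>: "0 \<le> \<kappa> z" "\<kappa> z \<le> 1" for z by (auto simp: \<kappa>_def)
  define P where "P z = v z + \<kappa> z *\<^sub>R (p z - v z)" for z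
  have \<kappa>_cont: "continuous_on Z \<kappa>" unfolding \<kappa>_def using cont by (intro continuous_intros)
  have P_cont: "continuous_on Z P"
    unfolding P_def using cont \<kappa>_cont p_cont by (intro continuous_intros)
  have near: "norm (t *\<^sub>R (p z - v z)) < \<delta>" if "0 \<le> t" "t \<le> 1" "z \<in> Z" for t z
  proof -
    have "norm (t *\<^sub>R (p z - v z)) \<le> 1 * norm (p z - v z)"
      unfolding norm_scaleR using that by (intro mult_right_mono) auto
    with p_near[OF that(3)] show ?thesis by simp
  qed
  have P_near: "norm (P z - v z) < \<delta>" if "z \<in> Z" for z
    using near[OF \<kappa> that] by (simp add: P_def)
  have P0: "P z = ?e" if "z \<in> Z0" for z
    using Z0(2)[OF that] by (simp add: P_def \<kappa>_def)
  have "homotopic_with (\<lambda>f. \<forall>z\<in>Z0. f z = ?e) (top_of_set Z) (top_of_set ?G) v P"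
  proof (rule rel_homotopyI[where H = "\<lambda>x. v (snd x) + (fst x * \<kappa> (snd x)) *\<^sub>R (p (snd x) - v (snd x))"])
    show "continuous_on ({0..1} \<times> Z) (\<lambda>x. v (snd x) + (fst x * \<kappa> (snd x)) *\<^sub>R (p (snd x) - v (snd x)))"
      by (intro continuous_intros continuous_on_compose2[OF cont] continuous_on_compose2[OF \<kappa>_cont]
          continuous_on_compose2[OF p_cont]) auto
    fix u z assume uz: "u \<in> {0..1::real}" "z \<in> Z"
    have "norm ((u * \<kappa> z) *\<^sub>R (p z - v z)) < \<delta>"
      by (rule near) (use uz \<kappa>[of z] in \<open>auto intro: mult_le_one\<close>)
    with \<delta>(2) z0[OF uz(2)] have "v z + (u * \<kappa> z) *\<^sub>R (p z - v z) \<noteq> 0"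
      by (metis add_eq_0_iff less_le_trans less_trans norm_minus_cancel order.irrefl)
    moreover have "restrict_vec S (v z + (u * \<kappa> z) *\<^sub>R (p z - v z)) = v z + (u * \<kappa> z) *\<^sub>R (p z - v z)"
      using v[OF uz(2)] p_S[of z] unfolding S_iff by auto
    ultimately show "v (snd (u, z)) + (fst (u, z) * \<kappa> (snd (u, z))) *\<^sub>R (p (snd (u, z)) - v (snd (u, z))) \<in> ?G"
      by simp
  qed (use Z0 in \<open>auto simp: P_def \<kappa>_def\<close>)
  also have "homotopic_with (\<lambda>f. \<forall>z\<in>Z0. f z = ?e) (top_of_set Z) (top_of_set ?G) P (\<lambda>_. ?e)"
  proof -
    define c where "c s = (1 - s) *\<^sub>R ?e + s *\<^sub>R w" for s :: real
    define x where "x y = (1 - fst y) *\<^sub>R P (snd y) + fst y *\<^sub>R w" for y :: "real \<times> real \<times> real"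
    have ball: "dist ((1 - s) *\<^sub>R y + s *\<^sub>R w) ?e < 1/2" if "s \<in> {0..1}" "dist y ?e < 1/2" for s y
    proof -
      have "convex (ball ?e (1/2))" by simp
      from convexD[OF this, of y w "1 - s" s] that w(2) show ?thesis
        by (auto simp: dist_commute)
    qed
    have nz_comp: "y $ a \<noteq> 0" if "dist y ?e < 1/2" for y
    proof
      assume "y $ a = 0"
      moreover have "norm ((y - ?e) $ a) \<le> norm (y - ?e)"
        by (rule Finite_Cartesian_Product.norm_nth_le)
      ultimately show False using that by (simp add: dist_norm)
    qed
    have c_nz: "c s $ a \<noteq> 0" if "s \<in> {0..1}" for s
      unfolding c_def by (rule nz_comp, rule ball[OF that]) simp
    have x_nz: "x (s, z) \<noteq> 0" if s: "s \<in> {0..1}" and z: "z \<in> Z" for s z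
    proof (cases "\<kappa> z = 1")
      case True
      then have Pz: "P z = p z" by (simp add: P_def)
      show ?thesis
      proof
        assume 0: "x (s, z) = 0"
        show False
        proof (cases "s = 0")
          case True
          with 0 have "p z = 0" by (simp add: x_def Pz)
          with p_near[OF z] \<delta>(2) z0[OF z] show False by simp
        next
          case False
          from 0 have "s *\<^sub>R w = - ((1 - s) *\<^sub>R p z)"
            by (simp add: x_def Pz eq_neg_iff_add_eq_0 add.commute)
          then have "(1 / s) *\<^sub>R (s *\<^sub>R w) = (1 / s) *\<^sub>R (- ((1 - s) *\<^sub>R p z))" by simp
          with False have "w = - (((1 - s) / s) *\<^sub>R p z)" by simp
          with w(3) show False by blast
        qed
      qed
    next
      case False
      then have "norm (v z - ?e) < 1/4" by (auto simp: \<kappa>_def min_def max_def split: if_splits)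
      then have "dist (P z) ?e < 1/2"
        using P_near[OF z] \<delta>(3) norm_triangle_ineq[of "P z - v z" "v z - ?e"] by (simp add: dist_norm)
      from nz_comp[OF ball[OF s this]] show ?thesis unfolding x_def fst_conv snd_conv by (metis zero_index)
    qed
    \<comment> \<open>Points of \<open>Z0\<close> follow the segment \<open>c\<close> instead of
      resting. The shear subtracted in \<open>H\<close> sends \<open>c s\<close> back to
      \<open>axis a 1\<close>; it is injective because \<open>c s $ a\<close> is nonzero, so it
      creates no zeros.\<close>
    show ?thesis
    proof (rule rel_homotopyI[where H = "\<lambda>y. x y - (x y $ a / c (fst y) $ a) *s (c (fst y) - ?e)"])
      have "continuous_on ({0..1} \<times> Z) x"
        unfolding x_def by (intro continuous_intros continuous_on_compose2[OF P_cont]) auto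
      moreover have "continuous_on ({0..1} \<times> Z) (\<lambda>y. c (fst y))"
        unfolding c_def by (intro continuous_intros)
      ultimately show "continuous_on ({0..1} \<times> Z) (\<lambda>y. x y - (x y $ a / c (fst y) $ a) *s (c (fst y) - ?e))"
        using c_nz by (intro continuous_intros) auto
      fix s z assume s: "s \<in> {0..1::real}"
      { assume z: "z \<in> Z"
        let ?y = "x (s, z) - (x (s, z) $ a / c s $ a) *s (c s - ?e)"
        have "?y \<noteq> 0"
        proof
          assume 0: "?y = 0"
          then have "?y $ a = 0" by simp
          then have "x (s, z) $ a / c s $ a = 0" using c_nz[OF s] by (simp add: field_simps)
          with 0 have "x (s, z) = 0" by simp
          with x_nz[OF s z] show False by simp
        qed
        moreover have "restrict_vec S (x (s, z)) = x (s, z)"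
          using w(1) v[OF z] p_S[of z] unfolding S_iff x_def P_def by auto
        moreover have "restrict_vec S (c s - ?e) = c s - ?e"
          using w(1) ab unfolding S_iff c_def by (auto simp: axis_def)
        ultimately show "x (s, z) - (x (s, z) $ a / c (fst (s, z)) $ a) *s (c (fst (s, z)) - ?e) \<in> ?G"
          unfolding S_iff by auto }
      { assume z: "z \<in> Z0"
        then have "x (s, z) = c s" by (simp add: x_def c_def P0)
        with c_nz[OF s]
        show "x (s, z) - (x (s, z) $ a / c (fst (s, z)) $ a) *s (c (fst (s, z)) - ?e) = ?e" by simp }
    next
      fix z
      show "x (0, z) - (x (0, z) $ a / c (fst (0, z)) $ a) *s (c (fst (0, z)) - ?e) = P z"
        by (simp add: x_def c_def)
      show "x (1, z) - (x (1, z) $ a / c (fst (1, z)) $ a) *s (c (fst (1, z)) - ?e) = ?e"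
        using c_nz[of 1] by (simp add: x_def c_def)
    qed (use Z0 in auto)
  qed
  finally (homotopic_with_trans) show ?thesis .
next
  case True
  then have "Z0 = {}" using Z0 by simp
  with True show ?thesis
    by (intro rel_homotopyI[where H = "\<lambda>_. axis a 1"]) auto
qed

subsection \<open>Reduction to diagonal matrices\<close>

definition reduced_at :: "'n set \<Rightarrow> complex^'n^'n \<Rightarrow> bool" where
  "reduced_at D g \<longleftrightarrow> (\<forall>d\<in>D. \<forall>i. g $ i $ d = mat 1 $ i $ d \<and> g $ d $ i = mat 1 $ d $ i)"

lemma matrix_mult_column:
  fixes A B :: "complex^'n^'n"
  assumes "\<And>i. B $ i $ d = mat 1 $ i $ d"
  shows "(A ** B) $ i $ d = A $ i $ d"
proof -
  have "(A ** B) $ i $ d = (\<Sum>k\<in>UNIV. if k = d then A $ i $ k else 0)"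
    unfolding matrix_matrix_mult_def vec_lambda_beta
    by (intro sum.cong) (auto simp: assms mat_def)
  then show ?thesis by simp
qed

lemma matrix_mult_row:
  fixes A B :: "complex^'n^'n"
  assumes "\<And>i. A $ d $ i = mat 1 $ d $ i"
  shows "(A ** B) $ d $ i = B $ d $ i"
proof -
  have "(A ** B) $ d $ i = (\<Sum>k\<in>UNIV. if k = d then B $ k $ i else 0)"
    unfolding matrix_matrix_mult_def vec_lambda_beta
    by (intro sum.cong) (auto simp: assms mat_def)
  then show ?thesis by simp
qed

lemma reduced_at_mult:
  assumes "reduced_at D A" "reduced_at D B"
  shows "reduced_at D (A ** B)"
  using assms by (auto simp: reduced_at_def matrix_mult_column matrix_mult_row)

text \<open>The rank one perturbation of the identity that takes \<open>v\<close> to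
  \<open>w\<close> and fixes the Hermitian complement of \<open>v\<close>. It depends continuously
  on both vectors and is the identity for \<open>w = v\<close>.\<close>

definition transport :: "complex^'n \<Rightarrow> complex^'n \<Rightarrow> complex^'n^'n" where
  "transport v w = (\<chi> i j. mat 1 $ i $ j + (w $ i - v $ i) * cnj (v $ j) / complex_of_real ((norm v)\<^sup>2))"

lemma transport_self [simp]: "transport v v = mat 1"
  by (simp add: transport_def vec_eq_iff)

lemma transport_apply:
  assumes "v \<noteq> 0"
  shows "transport v w *v v = w"
proof -
  let ?N = "complex_of_real ((norm v)\<^sup>2)"
  have N: "(\<Sum>j\<in>UNIV. cnj (v $ j) * v $ j) = ?N"
    by (simp add: norm_vec_def L2_set_def sum_nonneg complex_norm_square mult.commute[of "cnj _"] del: of_real_power)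
  have "(transport v w *v v) $ i = w $ i" for i
  proof -
    have "(transport v w *v v) $ i
       = (\<Sum>j\<in>UNIV. mat 1 $ i $ j * v $ j) + (w $ i - v $ i) / ?N * (\<Sum>j\<in>UNIV. cnj (v $ j) * v $ j)"
      unfolding matrix_vector_mult_def transport_def vec_lambda_beta sum_distrib_left sum.distrib[symmetric]
      by (intro sum.cong) (auto simp: algebra_simps)
    also have "(\<Sum>j\<in>UNIV. mat 1 $ i $ j * v $ j) = (mat 1 *v v) $ i"
      by (simp only: matrix_vector_mult_def vec_lambda_beta)
    also have "\<dots> = v $ i" by simp
    finally show ?thesis using assms by (simp only: N) simp
  qed
  then show ?thesis by (simp add: vec_eq_iff)
qed

lemma transport_outside:
  assumes "restrict_vec S v = v" "restrict_vec S w = w" "i \<notin> S \<or> j \<notin> S"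
  shows "transport v w $ i $ j = mat 1 $ i $ j"
proof -
  have "v $ k = 0" "w $ k = 0" if "k \<notin> S" for k
    using that assms(1,2) by (metis restrict_vec_nth)+
  with assms(3) show ?thesis by (auto simp: transport_def)
qed

text \<open>Column \<open>a\<close> is a basis vector, so the rest of row \<open>a\<close> can be
  removed by column operations and has no influence on invertibility.\<close>

lemma clear_row_invertible:
  fixes g :: "complex^'n^'n"
  assumes "invertible g" "\<And>i. g $ i $ a = mat 1 $ i $ a"
  shows "invertible (\<chi> i j. if i = a \<and> j \<noteq> a then u * g $ i $ j else g $ i $ j)"
proof (rule invertible_kernelI)
  let ?h = "(\<chi> i j. if i = a \<and> j \<noteq> a then u * g $ i $ j else g $ i $ j) :: complex^'n^'n"
  fix x assume 0: "?h *v x = 0"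
  define t where "t = (\<Sum>j\<in>UNIV - {a}. g $ a $ j * x $ j)"
  define y :: "complex^'n" where "y = (\<chi> j. if j = a then - t else x $ j)"
  have split: "(A *v z) $ i = A $ i $ a * z $ a + (\<Sum>j\<in>UNIV - {a}. A $ i $ j * z $ j)"
    for A :: "complex^'n^'n" and z i
    by (simp add: matrix_vector_mult_def sum.remove[of UNIV a])
  have "(g *v y) $ i = 0" for i
  proof (cases "i = a")
    case True
    have "(\<Sum>j\<in>UNIV - {a}. g $ a $ j * y $ j) = t" unfolding t_def
      by (intro sum.cong) (auto simp: y_def)
    then show ?thesis using True by (simp add: split assms(2)) (simp add: mat_def y_def)
  next
    case False
    have "(\<Sum>j\<in>UNIV - {a}. g $ i $ j * y $ j) = (\<Sum>j\<in>UNIV - {a}. ?h $ i $ j * x $ j)"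
      using False by (intro sum.cong) (auto simp: y_def)
    also have "\<dots> = (?h *v x) $ i" using False by (simp add: split assms(2)) (simp add: mat_def)
    finally show ?thesis using False 0 by (simp add: split assms(2)) (simp add: mat_def)
  qed
  then have "g *v y = 0" by (simp add: vec_eq_iff)
  then have y: "y = 0" using invertible_kernelD[OF assms(1)] by blast
  have x: "x $ j = 0" if "j \<noteq> a" for j
    using arg_cong[OF y, of "\<lambda>v. v $ j"] that by (simp add: y_def)
  have "(?h *v x) $ a = x $ a"
    unfolding split using x by (simp add: assms(2)) (simp add: mat_def)
  with 0 x show "x = 0" by (metis vec_eq_iff zero_index)
qed

text \<open>Column \<open>a\<close> of \<open>\<sigma>\<close> is a nonvanishing vector supported on
  the coordinates of its block that are not yet reduced, and \<open>b\<close> supplies the second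
  dimension needed to contract it to \<open>axis a 1\<close>. Transports lift this contraction to
  matrices acting from the left; the rest of row \<open>a\<close> is scaled to 0 afterwards.\<close>

lemma reduce_step:
  fixes \<sigma> :: "real \<times> real \<Rightarrow> complex^'n^'n"
  assumes Z: "compact Z" "Z0 \<subseteq> Z" and cont: "continuous_on Z \<sigma>"
    and \<sigma>: "\<And>z. z \<in> Z \<Longrightarrow> \<sigma> z \<in> block_mats L" "\<And>z. z \<in> Z \<Longrightarrow> reduced_at D (\<sigma> z)"
      "\<And>z. z \<in> Z0 \<Longrightarrow> \<sigma> z = mat 1"
    and ab: "a \<notin> D" "b \<notin> D" "a \<noteq> b" "L a = L b"
  obtains \<sigma>' where "homotopic_with (\<lambda>f. \<forall>z\<in>Z0. f z = mat 1) (top_of_set Z) (top_of_set (block_mats L)) \<sigma> \<sigma>'"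
    "\<And>z. z \<in> Z \<Longrightarrow> reduced_at (insert a D) (\<sigma>' z)"
proof -
  define S where "S = {i. i \<notin> D \<and> L i = L a}"
  define v where "v z = column a (\<sigma> z)" for z
  have v_nth: "v z $ i = \<sigma> z $ i $ a" for z i by (simp add: v_def column_def)
  have v_apply: "v z = \<sigma> z *v axis a 1" for z by (simp add: v_def matrix_vector_mult_axis)
  have "continuous_on Z v" unfolding v_apply using cont by (intro continuous_intros)
  moreover have "v z \<noteq> 0 \<and> restrict_vec S (v z) = v z" if z: "z \<in> Z" for z
  proof
    show "v z \<noteq> 0"
    proof
      assume "v z = 0"
      then have "axis a 1 = (0 :: complex^'n)"
        using invertible_kernelD[OF block_matsD(1)[OF \<sigma>(1)[OF z]]] v_apply by metis
      then show False by (simp add: axis_eq_0_iff)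
    qed
    have "v z $ i = 0" if "i \<notin> S" for i
      using that \<sigma>(2)[OF z] block_matsD(2)[OF \<sigma>(1)[OF z], of i a] ab
      by (auto simp: S_def v_nth reduced_at_def mat_def)
    then show "restrict_vec S (v z) = v z" by (auto simp: vec_eq_iff)
  qed
  moreover have "v z = axis a 1" if "z \<in> Z0" for z
    using \<sigma>(3)[OF that] by (simp add: v_apply)
  moreover have "a \<in> S" "b \<in> S" using ab by (auto simp: S_def)
  ultimately have hom: "homotopic_with (\<lambda>f. \<forall>z\<in>Z0. f z = axis a 1) (top_of_set Z)
     (top_of_set {x. x \<noteq> 0 \<and> restrict_vec S x = x}) v (\<lambda>_. axis a 1)"
    using Z ab(3) by (intro contract_nonvanishing)
  obtain V where V: "continuous_on ({0..1::real} \<times> Z) V"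
    "\<And>u z. u \<in> {0..1} \<Longrightarrow> z \<in> Z \<Longrightarrow> V (u, z) \<in> {x. x \<noteq> 0 \<and> restrict_vec S x = x}"
    "\<And>z. V (0, z) = v z" "\<And>z. V (1, z) = axis a 1"
    "\<And>u z. u \<in> {0..1} \<Longrightarrow> z \<in> Z0 \<Longrightarrow> V (u, z) = axis a 1"
  proof (rule rel_homotopyE[OF hom], goal_cases)
    case (1 H)
    then show ?case by (intro that[of H])
  qed
  define \<tau> where "\<tau> s s' z = transport (V (s, z)) (V (s', z))" for s s' z
  \<comment> \<open>\<open>A\<close> carries column \<open>a\<close> from time 0 to time
    \<open>s\<close> and is the identity off \<open>S\<close>. So multiplication by it respects the
    blocks and the coordinates already reduced.\<close>
  define P where "P s z A \<longleftrightarrow> invertible A \<and> A *v V (0, z) = V (s, z) \<and>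
     (\<forall>i j. i \<notin> S \<or> j \<notin> S \<longrightarrow> A $ i $ j = mat 1 $ i $ j) \<and> (z \<in> Z0 \<longrightarrow> A = mat 1)" for s z and A :: "complex^'n^'n"
  obtain T where T: "continuous_on ({0..1} \<times> Z) T" "\<And>z. z \<in> Z \<Longrightarrow> T (0, z) = mat 1"
    "\<And>s z. s \<in> {0..1} \<Longrightarrow> z \<in> Z \<Longrightarrow> P s z (T (s, z))"
  proof (rule path_lifting[of Z \<tau> P])
    have V1: "continuous_on ({0..1} \<times> {0..1} \<times> Z) (\<lambda>x. V (fst x, snd (snd x)))"
      "continuous_on ({0..1} \<times> {0..1} \<times> Z) (\<lambda>x. V (fst (snd x), snd (snd x)))"
      by (auto intro!: continuous_on_compose2[OF V(1)] continuous_intros)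
    show "continuous_on ({0..1} \<times> {0..1} \<times> Z) (\<lambda>x. \<tau> (fst x) (fst (snd x)) (snd (snd x)))"
      unfolding \<tau>_def transport_def
      by (intro continuous_intros V1) (use V(2) in auto)
    show "P s' z (\<tau> s s' z ** A)"
      if s: "s \<in> {0..1}" "s' \<in> {0..1}" "z \<in> Z" and A: "P s z A" and inv: "invertible (\<tau> s s' z)"
      for s s' z A
    proof -
      have *: "V (s, z) \<noteq> 0" "restrict_vec S (V (s, z)) = V (s, z)" "restrict_vec S (V (s', z)) = V (s', z)"
        using V(2)[OF s(1,3)] V(2)[OF s(2,3)] by auto
      have "invertible (\<tau> s s' z ** A)" using A inv by (auto simp: P_def invertible_mult)
      moreover have "(\<tau> s s' z ** A) *v V (0, z) = V (s', z)"
        using A transport_apply[OF *(1)] by (simp add: P_def \<tau>_def flip: matrix_vector_mul_assoc)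
      moreover have "(\<tau> s s' z ** A) $ i $ j = mat 1 $ i $ j" if ij: "i \<notin> S \<or> j \<notin> S" for i j
      proof (cases "i \<in> S")
        case True
        with ij have "A $ l $ j = mat 1 $ l $ j" for l using A by (auto simp: P_def)
        from matrix_mult_column[OF this] show ?thesis
          using transport_outside[OF *(2,3) ij] by (simp add: \<tau>_def)
      next
        case False
        then have "\<tau> s s' z $ i $ l = mat 1 $ i $ l" for l
          using transport_outside[OF *(2,3)] by (simp add: \<tau>_def)
        from matrix_mult_row[OF this] show ?thesis using False A by (auto simp: P_def)
      qed
      moreover have "\<tau> s s' z ** A = mat 1" if "z \<in> Z0"
        using A that V(5)[OF s(1) that] V(5)[OF s(2) that] by (simp add: P_def \<tau>_def)
      ultimately show ?thesis by (simp add: P_def)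
    qed
  qed (use Z in \<open>auto simp: \<tau>_def P_def invertible_mat_1\<close>)
  have TP: "invertible (T (s, z))" "T (s, z) *v v z = V (s, z)"
    "\<And>i j. i \<notin> S \<or> j \<notin> S \<Longrightarrow> T (s, z) $ i $ j = mat 1 $ i $ j" "z \<in> Z0 \<Longrightarrow> T (s, z) = mat 1"
    if "s \<in> {0..1}" "z \<in> Z" for s z
    using T(3)[OF that] by (auto simp: P_def V(3))
  have T_block: "T (s, z) \<in> block_mats L" if "s \<in> {0..1}" "z \<in> Z" for s z
  proof -
    have "T (s, z) $ i $ j = 0" if ij: "L i \<noteq> L j" for i j
    proof -
      have "i \<notin> S \<or> j \<notin> S" using ij by (auto simp: S_def)
      from TP(3)[OF \<open>s \<in> {0..1}\<close> \<open>z \<in> Z\<close> this] ij show ?thesis by (auto simp: mat_def)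
    qed
    with TP(1)[OF that] show ?thesis by (auto simp: block_mats_def)
  qed
  have T_red: "reduced_at D (T (s, z))" if "s \<in> {0..1}" "z \<in> Z" for s z
    using TP(3)[OF that] by (auto simp: reduced_at_def S_def)
  define g where "g z = T (1, z) ** \<sigma> z" for z
  have g_cont: "continuous_on Z g"
    unfolding g_def by (intro continuous_intros cont continuous_on_compose2[OF T(1)]) auto
  have g: "g z \<in> block_mats L" "reduced_at D (g z)" "g z $ i $ a = mat 1 $ i $ a" if "z \<in> Z" for z i
  proof -
    show "g z \<in> block_mats L" "reduced_at D (g z)"
      unfolding g_def using that by (auto intro!: block_mats_mult reduced_at_mult T_block T_red \<sigma>)
    have "g z *v axis a 1 = axis a 1"
      using TP(2)[of 1 z] that by (simp add: g_def V(4) v_apply flip: matrix_vector_mul_assoc)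
    then have "(g z *v axis a 1) $ i = axis a 1 $ i" by simp
    then show "g z $ i $ a = mat 1 $ i $ a"
      unfolding matrix_vector_mult_axis_nth by (auto simp: axis_def mat_def)
  qed
  define h where "h u z = (\<chi> i j. if i = a \<and> j \<noteq> a then complex_of_real (1 - u) * g z $ i $ j else g z $ i $ j)" for u z
  have h_nth: "h u z $ i $ j = (if i = a \<and> j \<noteq> a then complex_of_real (1 - u) * g z $ i $ j else g z $ i $ j)" for u z i j
    by (simp add: h_def)
  have "homotopic_with (\<lambda>f. \<forall>z\<in>Z0. f z = mat 1) (top_of_set Z) (top_of_set (block_mats L)) \<sigma> g"
  proof (rule rel_homotopyI[where H = "\<lambda>x. T x ** \<sigma> (snd x)"])
    show "continuous_on ({0..1} \<times> Z) (\<lambda>x. T x ** \<sigma> (snd x))"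
      by (intro continuous_intros T(1) continuous_on_compose2[OF cont]) auto
  qed (use Z T(2) T_block \<sigma> TP(4) in \<open>auto simp: g_def intro!: block_mats_mult\<close>)
  moreover have "homotopic_with (\<lambda>f. \<forall>z\<in>Z0. f z = mat 1) (top_of_set Z) (top_of_set (block_mats L)) g (h 1)"
  proof (rule rel_homotopyI[where H = "\<lambda>x. h (fst x) (snd x)"])
    have gc: "continuous_on ({0..1::real} \<times> Z) (\<lambda>x. g (snd x) $ i $ j)" for i j
      by (intro continuous_intros continuous_on_compose2[OF g_cont]) auto
    show "continuous_on ({0..1} \<times> Z) (\<lambda>x. h (fst x) (snd x))"
    proof (rule continuous_on_matrixI)
      fix i j
      show "continuous_on ({0..1} \<times> Z) (\<lambda>x. h (fst x) (snd x) $ i $ j)"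
        by (cases "i = a \<and> j \<noteq> a") (auto simp: h_nth intro!: continuous_intros gc)
    qed
    fix u z assume u: "u \<in> {0..1::real}"
    { assume z: "z \<in> Z"
      have "invertible (h u z)"
        unfolding h_def using g[OF z] by (intro clear_row_invertible) (auto simp: block_mats_def)
      then show "h (fst (u, z)) (snd (u, z)) \<in> block_mats L"
        using block_matsD(2)[OF g(1)[OF z]] by (auto simp: block_mats_def h_nth) }
    { assume z: "z \<in> Z0"
      then have "g z = mat 1" using Z(2) TP(4)[of 1 z] \<sigma>(3) by (auto simp: g_def)
      then show "h (fst (u, z)) (snd (u, z)) = mat 1"
        by (auto simp: vec_eq_iff h_nth mat_def) }
  qed (use Z in \<open>auto simp: vec_eq_iff h_nth\<close>)
  ultimately have "homotopic_with (\<lambda>f. \<forall>z\<in>Z0. f z = mat 1) (top_of_set Z) (top_of_set (block_mats L)) \<sigma> (h 1)"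
    by (rule homotopic_with_trans)
  moreover have "reduced_at (insert a D) (h 1 z)" if "z \<in> Z" for z
  proof -
    have gd: "g z $ i $ d = mat 1 $ i $ d" "g z $ d $ i = mat 1 $ d $ i" if "d \<in> D" for d i
      using g(2)[OF \<open>z \<in> Z\<close>] that by (auto simp: reduced_at_def)
    show ?thesis
      using ab(1) gd g(3)[OF that]
      by (auto simp: reduced_at_def h_nth) (auto simp: mat_def)
  qed
  ultimately show ?thesis using that by blast
qed

text \<open>A step is possible as long as some block has two coordinates left. When none has, every
  block contains at most one entry that can differ from the identity, and the matrices are
  diagonal.\<close>

lemma reduce_to_diagonal:
  fixes \<sigma> :: "real \<times> real \<Rightarrow> complex^'n^'n"
  assumes Z: "compact Z" "Z0 \<subseteq> Z" and "continuous_on Z \<sigma>"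
    and "\<And>z. z \<in> Z \<Longrightarrow> \<sigma> z \<in> block_mats L"
    and "\<And>z. z \<in> Z0 \<Longrightarrow> \<sigma> z = mat 1"
  obtains \<sigma>' D where
    "homotopic_with (\<lambda>f. \<forall>z\<in>Z0. f z = mat 1) (top_of_set Z) (top_of_set (block_mats L)) \<sigma> \<sigma>'"
    "\<And>z. z \<in> Z \<Longrightarrow> reduced_at D (\<sigma>' z)"
    "\<And>a b. a \<notin> D \<Longrightarrow> b \<notin> D \<Longrightarrow> L a = L b \<Longrightarrow> a = b"
proof -
  let ?hom = "homotopic_with (\<lambda>f. \<forall>z\<in>Z0. f z = mat 1) (top_of_set Z) (top_of_set (block_mats L))"
  have "\<exists>\<sigma>' D. ?hom \<sigma> \<sigma>' \<and> (\<forall>z\<in>Z. reduced_at D (\<sigma>' z)) \<and>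
     (\<forall>a b. a \<notin> D \<longrightarrow> b \<notin> D \<longrightarrow> L a = L b \<longrightarrow> a = b)"
    if "continuous_on Z \<sigma>" "\<And>z. z \<in> Z \<Longrightarrow> \<sigma> z \<in> block_mats L" "\<And>z. z \<in> Z \<Longrightarrow> reduced_at D (\<sigma> z)"
      "\<And>z. z \<in> Z0 \<Longrightarrow> \<sigma> z = mat 1" for D \<sigma>
    using that
  proof (induction "card (- D)" arbitrary: D \<sigma> rule: less_induct)
    case less
    show ?case
    proof (cases "\<forall>a b. a \<notin> D \<longrightarrow> b \<notin> D \<longrightarrow> L a = L b \<longrightarrow> a = b")
      case True
      have "?hom \<sigma> \<sigma>" using less.prems by (auto simp: continuous_map_in_subtopology)
      with True less.prems(3) show ?thesis by blast
    next
      case False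
      then obtain a b where ab: "a \<notin> D" "b \<notin> D" "a \<noteq> b" "L a = L b" by blast
      obtain \<sigma>' where \<sigma>': "?hom \<sigma> \<sigma>'" "\<And>z. z \<in> Z \<Longrightarrow> reduced_at (insert a D) (\<sigma>' z)"
        using reduce_step[OF Z less.prems(1,2,3,4) ab] by blast
      have "continuous_on Z \<sigma>'" "\<And>z. z \<in> Z \<Longrightarrow> \<sigma>' z \<in> block_mats L" "\<And>z. z \<in> Z0 \<Longrightarrow> \<sigma>' z = mat 1"
        using homotopic_with_imp_continuous_maps[OF \<sigma>'(1)] homotopic_with_imp_property[OF \<sigma>'(1)]
        by (auto simp: continuous_map_in_subtopology image_subset_iff)
      moreover have "card (- insert a D) < card (- D)"
        using ab(1) by (intro psubset_card_mono) auto
      ultimately obtain \<sigma>'' D' where "?hom \<sigma>' \<sigma>''" "\<forall>z\<in>Z. reduced_at D' (\<sigma>'' z)"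
        "\<forall>a b. a \<notin> D' \<longrightarrow> b \<notin> D' \<longrightarrow> L a = L b \<longrightarrow> a = b"
        using less.hyps[of "insert a D" \<sigma>'] \<sigma>'(2) by blast
      with homotopic_with_trans[OF \<sigma>'(1)] show ?thesis by blast
    qed
  qed
  from this[of \<sigma> "{}"] assms(3-) have "\<exists>\<sigma>' D. ?hom \<sigma> \<sigma>' \<and> (\<forall>z\<in>Z. reduced_at D (\<sigma>' z)) \<and>
     (\<forall>a b. a \<notin> D \<longrightarrow> b \<notin> D \<longrightarrow> L a = L b \<longrightarrow> a = b)"
    by (simp add: reduced_at_def)
  then show ?thesis using that by blast
qed

lemma reduced_diagonal:
  assumes "g \<in> block_mats L" "reduced_at D g" "\<And>a b. a \<notin> D \<Longrightarrow> b \<notin> D \<Longrightarrow> L a = L b \<Longrightarrow> a = b" "i \<noteq> j"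
  shows "g $ i $ j = 0"
proof (cases "i \<in> D \<or> j \<in> D")
  case True
  with assms(2,4) show ?thesis by (auto simp: reduced_at_def mat_def)
next
  case False
  with assms(3,4) have "L i \<noteq> L j" by blast
  with assms(1) show ?thesis by (auto simp: block_mats_def)
qed

subsection \<open>Logarithms\<close>

text \<open>The difference is continuous with values in the discrete set of multiples of 2 pi i,
  hence constant on a connected set.\<close>

lemma log_unique:
  fixes f g :: "'a::topological_space \<Rightarrow> complex"
  assumes "connected S" "continuous_on S f" "continuous_on S g"
    and eq: "\<And>x. x \<in> S \<Longrightarrow> exp (f x) = exp (g x)"
  shows "\<exists>n::int. \<forall>x\<in>S. f x = g x + 2 * of_int n * of_real pi * \<i>"
proof -
  have *: "\<exists>n::int. f x - g x = 2 * of_int n * of_real pi * \<i>" if "x \<in> S" for x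
    using eq[OF that] by (auto simp: exp_eq algebra_simps)
  have "(\<lambda>x. f x - g x) constant_on S"
  proof (rule continuous_discrete_range_constant[OF assms(1)])
    show "continuous_on S (\<lambda>x. f x - g x)" using assms by (intro continuous_intros)
    fix x assume x: "x \<in> S"
    have "2 * pi \<le> norm ((f y - g y) - (f x - g x))"
      if y: "y \<in> S" "f y - g y \<noteq> f x - g x" for y
    proof -
      obtain m n :: int where mn: "f y - g y = 2 * of_int m * of_real pi * \<i>" "f x - g x = 2 * of_int n * of_real pi * \<i>"
        using * x y by meson
      then have "m \<noteq> n" using y(2) by auto
      then have "1 \<le> \<bar>real_of_int (m - n)\<bar>" by linarith
      moreover have "(f y - g y) - (f x - g x) = of_real (2 * pi * real_of_int (m - n)) * \<i>"
        unfolding mn by (simp add: algebra_simps)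
      then have "norm ((f y - g y) - (f x - g x)) = 2 * pi * \<bar>real_of_int (m - n)\<bar>"
        by (simp only: norm_mult norm_of_real norm_ii) (simp add: abs_mult)
      ultimately show ?thesis by simp
    qed
    then show "\<exists>e>0. \<forall>y. y \<in> S \<and> f y - g y \<noteq> f x - g x \<longrightarrow> e \<le> norm (f y - g y - (f x - g x))"
      by (intro exI[of _ "2 * pi"]) auto
  qed
  then obtain c where c: "\<And>x. x \<in> S \<Longrightarrow> f x - g x = c" by (auto simp: constant_on_def)
  show ?thesis
  proof (cases "S = {}")
    case False
    then obtain x where "x \<in> S" by blast
    with * c obtain n :: int where "c = 2 * of_int n * of_real pi * \<i>" by metis
    then have "f x = g x + 2 * of_int n * of_real pi * \<i>" if "x \<in> S" for x
      using c[OF that] by (simp add: algebra_simps)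
    then show ?thesis by blast
  qed auto
qed

lemma convex_logarithm:
  fixes f :: "'a::real_normed_vector \<Rightarrow> complex"
  assumes "convex S" "continuous_on S f" "\<And>x. x \<in> S \<Longrightarrow> f x \<noteq> 0"
  obtains g where "continuous_on S g" "\<And>x. x \<in> S \<Longrightarrow> f x = exp (g x)"
  using continuous_logarithm_on_contractible[OF assms(2) convex_imp_contractible[OF assms(1)] assms(3)]
  by blast

text \<open>Winding number 0 is encoded by a logarithm with equal end values. A logarithm of
  \<open>F\<close> exists on the whole square and is constant along the sides where \<open>F\<close>
  is 1, so the difference of its end values is the same for both loops.\<close>

lemma winding_homotopy:
  fixes F :: "real \<times> real \<Rightarrow> complex"
  assumes F: "continuous_on ({0..1} \<times> {0..1}) F" "\<And>x. x \<in> {0..1} \<times> {0..1} \<Longrightarrow> F x \<noteq> 0"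
    and ends: "\<And>u. u \<in> {0..1} \<Longrightarrow> F (u, 0) = 1" "\<And>u. u \<in> {0..1} \<Longrightarrow> F (u, 1) = 1"
    and \<phi>: "continuous_on {0..1} \<phi>" "\<And>t. t \<in> {0..1} \<Longrightarrow> F (0, t) = exp (\<phi> t)" "\<phi> 0 = \<phi> 1"
  obtains \<psi> where "continuous_on {0..1} \<psi>" "\<And>t. t \<in> {0..1} \<Longrightarrow> F (1, t) = exp (\<psi> t)"
    "\<psi> 0 = 0" "\<psi> 1 = 0"
proof -
  obtain G where G: "continuous_on ({0..1} \<times> {0..1}) G" "\<And>x. x \<in> {0..1} \<times> {0..1} \<Longrightarrow> F x = exp (G x)"
    using convex_logarithm[OF convex_Times F] by (metis convex_real_interval(5))
  have G_u: "continuous_on {0..1} (\<lambda>u. G (u, t))" if "t \<in> {0..1}" for t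
    by (rule continuous_on_compose2[OF G(1)]) (use that in \<open>auto intro!: continuous_intros\<close>)
  have G_t: "continuous_on {0..1} (\<lambda>t. G (u, t))" if "u \<in> {0..1}" for u
    by (rule continuous_on_compose2[OF G(1)]) (use that in \<open>auto intro!: continuous_intros\<close>)
  have conn: "connected {0..1::real}" by simp
  have const: "G (1, t) = G (0, t)" if t: "t = 0 \<or> t = 1" for t
  proof -
    have e: "exp (G (u, t)) = exp 0" if "u \<in> {0..1}" for u
      using G(2)[of "(u, t)"] ends that t by auto
    have "continuous_on {0..1} (\<lambda>u. G (u, t))" using t by (intro G_u) auto
    from log_unique[OF conn this continuous_on_const e]
    show ?thesis by force
  qed
  have "exp (G (0, t)) = exp (\<phi> t)" if "t \<in> {0..1}" for t
    using G(2)[of "(0, t)"] \<phi>(2) that by auto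
  from log_unique[OF conn G_t \<phi>(1) this]
  obtain n :: int where n: "\<forall>t\<in>{0..1}. G (0, t) = \<phi> t + 2 * of_int n * of_real pi * \<i>"
    by auto
  then have "G (0, 0) = G (0, 1)" using \<phi>(3) by simp
  then have G01: "G (1, 1) = G (1, 0)" using const by simp
  have "exp (G (1, 0)) = 1" using G(2)[of "(1, 0)"] ends(1)[of 1] by simp
  then have "F (1, t) = exp (G (1, t) - G (1, 0))" if "t \<in> {0..1}" for t
    using G(2)[of "(1, t)"] that by (simp add: exp_diff)
  moreover have "continuous_on {0..1} (\<lambda>t. G (1, t) - G (1, 0))"
    by (intro continuous_intros G_t) auto
  ultimately show ?thesis
    using that[of "\<lambda>t. G (1, t) - G (1, 0)"] G01 by simp
qed

subsection \<open>Loops and spheres of block matrices\<close>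

definition diag_mat :: "('n \<Rightarrow> complex) \<Rightarrow> complex^'n^'n" where
  "diag_mat f = (\<chi> i j. if i = j then f i else 0)"

lemma diag_mat_block:
  assumes "\<And>i. f i \<noteq> 0"
  shows "diag_mat f \<in> block_mats L"
proof -
  have "det (diag_mat f) = (\<Prod>i\<in>UNIV. f i)"
    by (subst det_diagonal) (auto simp: diag_mat_def)
  with assms show ?thesis
    by (auto simp: block_mats_def invertible_det_nz diag_mat_def)
qed

lemma diag_mat_1: "diag_mat (\<lambda>_. 1) = mat 1"
  by (simp add: diag_mat_def mat_def)

lemma continuous_on_diag_mat:
  fixes f :: "'a::topological_space \<Rightarrow> 'n::finite \<Rightarrow> complex"
  assumes "\<And>i. continuous_on S (\<lambda>x. f x i)"
  shows "continuous_on S (\<lambda>x. diag_mat (f x))"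
proof (rule continuous_on_matrixI)
  fix i j
  show "continuous_on S (\<lambda>x. diag_mat (f x) $ i $ j)"
    using assms by (cases "i = j") (auto simp: diag_mat_def)
qed

lemma diagonal_nonzero:
  fixes g :: "complex^'n^'n"
  assumes "invertible g" "\<And>i j. i \<noteq> j \<Longrightarrow> g $ i $ j = 0"
  shows "g $ i $ i \<noteq> 0" "g = diag_mat (\<lambda>i. g $ i $ i)"
proof -
  have "det g = (\<Prod>i\<in>UNIV. g $ i $ i)" using assms(2) by (rule det_diagonal)
  with assms(1) show "g $ i $ i \<noteq> 0" by (auto simp: invertible_det_nz)
  show "g = diag_mat (\<lambda>i. g $ i $ i)" using assms(2) by (auto simp: vec_eq_iff diag_mat_def)
qed

lemma connected_square_boundary: "connected square_boundary"
proof -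
  have eq: "square_boundary = ({0..1} \<times> {0} \<union> {0} \<times> {0..1}) \<union> ({0..1} \<times> {1} \<union> {1} \<times> {0..1})"
    by (auto simp: mem_square_boundary)
  have c: "connected ({0..1} \<times> {c::real} \<union> {c} \<times> {0..1::real})" if "c = 0 \<or> c = 1" for c :: real
  proof (rule connected_Un)
    have "(c, c) \<in> {0..1} \<times> {c} \<inter> {c} \<times> {0..1}"
      by (rule disjE[OF that]) simp_all
    then show "{0..1} \<times> {c} \<inter> {c} \<times> {0..1} \<noteq> {}" by blast
  qed (auto intro!: connected_Times)
  show ?thesis
    unfolding eq
  proof (rule connected_Un)
    have "(0, 1::real) \<in> ({0..1::real} \<times> {0} \<union> {0} \<times> {0..1}) \<inter> ({0..1} \<times> {1} \<union> {1} \<times> {0..1::real})" by auto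
    then show "({0..1::real} \<times> {0} \<union> {0} \<times> {0..1}) \<inter> ({0..1} \<times> {1} \<union> {1} \<times> {0..1::real}) \<noteq> {}" by blast
  qed (auto intro!: c)
qed

lemma convex_unit_square: "convex unit_square"
  unfolding unit_square_def by (intro convex_Times) auto

text \<open>After reduction only diagonal entries remain. Each has a logarithm on the square; it is
  one constant multiple of 2 pi i on the connected boundary, and subtracting that multiple makes it
  0 there. Scaling the logarithms to 0 is the contraction.\<close>

lemma block_sphere_null:
  fixes \<sigma> :: "real \<times> real \<Rightarrow> complex^'n^'n"
  assumes "continuous_on unit_square \<sigma>" "\<And>z. z \<in> unit_square \<Longrightarrow> \<sigma> z \<in> block_mats L"
    and "\<And>z. z \<in> square_boundary \<Longrightarrow> \<sigma> z = mat 1"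
  shows "homotopic_with (\<lambda>f. \<forall>z\<in>square_boundary. f z = mat 1) (top_of_set unit_square)
     (top_of_set (block_mats L)) \<sigma> (\<lambda>_. mat 1)"
proof -
  let ?hom = "homotopic_with (\<lambda>f. \<forall>z\<in>square_boundary. f z = mat 1) (top_of_set unit_square)
     (top_of_set (block_mats L))"
  have "compact unit_square" unfolding unit_square_def by (intro compact_Times) auto
  from reduce_to_diagonal[OF this square_boundary_subset assms]
  obtain \<sigma>' D where \<sigma>': "?hom \<sigma> \<sigma>'" "\<And>z. z \<in> unit_square \<Longrightarrow> reduced_at D (\<sigma>' z)"
    and D: "\<And>a b. a \<notin> D \<Longrightarrow> b \<notin> D \<Longrightarrow> L a = L b \<Longrightarrow> a = b" by blast
  have c: "continuous_on unit_square \<sigma>'" and bl: "\<And>z. z \<in> unit_square \<Longrightarrow> \<sigma>' z \<in> block_mats L"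
    and bd: "\<And>z. z \<in> square_boundary \<Longrightarrow> \<sigma>' z = mat 1"
    using homotopic_with_imp_continuous_maps[OF \<sigma>'(1)] homotopic_with_imp_property[OF \<sigma>'(1)]
    by (auto simp: continuous_map_in_subtopology image_subset_iff)
  note dg = diagonal_nonzero[OF block_matsD(1)[OF bl] reduced_diagonal[OF bl \<sigma>'(2) D]]
  have "\<exists>\<psi>. continuous_on unit_square \<psi> \<and> (\<forall>z\<in>unit_square. \<sigma>' z $ i $ i = exp (\<psi> z)) \<and>
     (\<forall>z\<in>square_boundary. \<psi> z = 0)" for i
  proof -
    have "continuous_on unit_square (\<lambda>z. \<sigma>' z $ i $ i)" using c by (intro continuous_intros)
    from convex_logarithm[OF convex_unit_square this dg(1)]
    obtain \<psi> where \<psi>: "continuous_on unit_square \<psi>" "\<And>z. z \<in> unit_square \<Longrightarrow> \<sigma>' z $ i $ i = exp (\<psi> z)"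
      by blast
    have e: "exp (\<psi> z) = exp 0" if "z \<in> square_boundary" for z
      using \<psi>(2)[of z] that square_boundary_subset bd[OF that] by (auto simp: mat_def)
    obtain n :: int where n: "\<forall>z\<in>square_boundary. \<psi> z = 0 + 2 * of_int n * of_real pi * \<i>"
      using log_unique[OF connected_square_boundary continuous_on_subset[OF \<psi>(1) square_boundary_subset]
          continuous_on_const e] by blast
    let ?c = "2 * of_int n * of_real pi * \<i> :: complex"
    have "exp ?c = 1" using exp_integer_2pi[of "of_int n"] by (simp add: mult_ac)
    with \<psi> n show ?thesis
      by (intro exI[of _ "\<lambda>z. \<psi> z - ?c"]) (auto intro!: continuous_intros simp: exp_diff)
  qed
  then obtain \<psi> where \<psi>: "\<And>i. continuous_on unit_square (\<psi> i)"
    "\<And>i z. z \<in> unit_square \<Longrightarrow> \<sigma>' z $ i $ i = exp (\<psi> i z)"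
    "\<And>i z. z \<in> square_boundary \<Longrightarrow> \<psi> i z = 0" by metis
  have "?hom \<sigma>' (\<lambda>_. mat 1)"
  proof (rule rel_homotopyI[where H = "\<lambda>x. diag_mat (\<lambda>i. exp (of_real (1 - fst x) * \<psi> i (snd x)))"])
    show "continuous_on ({0..1} \<times> unit_square) (\<lambda>x. diag_mat (\<lambda>i. exp (of_real (1 - fst x) * \<psi> i (snd x))))"
      by (intro continuous_on_diag_mat continuous_intros continuous_on_compose2[OF \<psi>(1)]) auto
    fix z assume "z \<in> unit_square"
    then show "diag_mat (\<lambda>i. exp (of_real (1 - fst (0, z)) * \<psi> i (snd (0, z)))) = \<sigma>' z"
      by (subst dg(2)) (simp_all add: \<psi>(2))
  next
    fix u :: real and z assume "z \<in> square_boundary"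
    then show "diag_mat (\<lambda>i. exp (of_real (1 - fst (u, z)) * \<psi> i (snd (u, z)))) = mat 1"
      by (simp add: \<psi>(3) diag_mat_1)
  qed (auto intro!: diag_mat_block square_boundary_subset simp: diag_mat_1)
  with \<sigma>'(1) show ?thesis by (rule homotopic_with_trans)
qed

text \<open>After reduction each block has at most one entry different from 1, and this entry is the
  block determinant. Winding number 0 survives the reduction, so the entry has a logarithm vanishing
  at both ends, which can be scaled to 0.\<close>

lemma block_loop_null:
  fixes \<sigma> :: "real \<Rightarrow> complex^'n^'n"
  assumes cont: "continuous_on {0..1} \<sigma>" and \<sigma>: "\<And>t. t \<in> {0..1} \<Longrightarrow> \<sigma> t \<in> block_mats L"
    "\<sigma> 0 = mat 1" "\<sigma> 1 = mat 1"
    and wind: "\<And>l. \<exists>\<phi>. continuous_on {0..1} \<phi> \<and> (\<forall>t\<in>{0..1}. block_det (L -` {l}) (\<sigma> t) = exp (\<phi> t)) \<and> \<phi> 0 = \<phi> 1"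
  shows "homotopic_with (\<lambda>f. \<forall>t\<in>{0, 1}. f t = mat 1) (top_of_set {0..1})
     (top_of_set (block_mats L)) \<sigma> (\<lambda>_. mat 1)"
proof -
  \<comment> \<open>The loop is placed on a segment of the plane, where the two-parameter reduction
    applies to it.\<close>
  let ?Z = "{0..1} \<times> {0} :: (real \<times> real) set" and ?E = "{0, 1} \<times> {0} :: (real \<times> real) set"
  let ?hom = "homotopic_with (\<lambda>f. \<forall>z\<in>?E. f z = mat 1) (top_of_set ?Z) (top_of_set (block_mats L))"
  have "compact ?Z" by (intro compact_Times) auto
  moreover have "?E \<subseteq> ?Z" by auto
  moreover have "continuous_on ?Z (\<lambda>z. \<sigma> (fst z))"
    by (rule continuous_on_compose2[OF cont]) (auto intro!: continuous_intros)
  moreover have "\<sigma> (fst z) \<in> block_mats L" if "z \<in> ?Z" for z using that \<sigma>(1) by auto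
  moreover have "\<sigma> (fst z) = mat 1" if "z \<in> ?E" for z using that \<sigma>(2,3) by auto
  ultimately have "\<exists>\<sigma>' D. ?hom (\<lambda>z. \<sigma> (fst z)) \<sigma>' \<and> (\<forall>z\<in>?Z. reduced_at D (\<sigma>' z)) \<and>
      (\<forall>a b. a \<notin> D \<longrightarrow> b \<notin> D \<longrightarrow> L a = L b \<longrightarrow> a = b)"
    by (rule reduce_to_diagonal) (assumption | rule exI | rule conjI | blast)+
  then obtain \<sigma>' D where \<sigma>': "?hom (\<lambda>z. \<sigma> (fst z)) \<sigma>'" "\<And>z. z \<in> ?Z \<Longrightarrow> reduced_at D (\<sigma>' z)"
    and D: "\<And>a b. a \<notin> D \<Longrightarrow> b \<notin> D \<Longrightarrow> L a = L b \<Longrightarrow> a = b"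
    by blast
  obtain H where H: "continuous_on ({0..1::real} \<times> ?Z) H"
    "\<And>u z. u \<in> {0..1} \<Longrightarrow> z \<in> ?Z \<Longrightarrow> H (u, z) \<in> block_mats L"
    "\<And>z. H (0, z) = \<sigma> (fst z)" "\<And>z. H (1, z) = \<sigma>' z"
    "\<And>u z. u \<in> {0..1} \<Longrightarrow> z \<in> ?E \<Longrightarrow> H (u, z) = mat 1"
  proof (rule rel_homotopyE[OF \<sigma>'(1)], goal_cases)
    case (1 H)
    then show ?case by (intro that[of H])
  qed
  let ?H = "\<lambda>x. H (fst x, snd x, 0)"
  have Hc: "continuous_on ({0..1} \<times> {0..1}) ?H"
    by (rule continuous_on_compose2[OF H(1)]) (auto intro!: continuous_intros)
  have "\<exists>\<psi>. continuous_on {0..1} \<psi> \<and> (\<forall>t\<in>{0..1}. block_det (L -` {l}) (\<sigma>' (t, 0)) = exp (\<psi> t)) \<and>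
      \<psi> 0 = 0 \<and> \<psi> 1 = 0" for l
  proof -
    obtain \<phi> where \<phi>: "continuous_on {0..1} \<phi>" "\<And>t. t\<in>{0..1} \<Longrightarrow> block_det (L -` {l}) (\<sigma> t) = exp (\<phi> t)" "\<phi> 0 = \<phi> 1"
      using wind by blast
    have Fc: "continuous_on ({0..1} \<times> {0..1}) (\<lambda>x. block_det (L -` {l}) (?H x))"
      by (intro continuous_intros Hc)
    have nz: "block_det (L -` {l}) (?H x) \<noteq> 0" if "x \<in> {0..1} \<times> {0..1}" for x
      using that by (intro block_det_inv(1)[of _ L] H(2)) auto
    show ?thesis
      by (rule winding_homotopy[OF Fc nz _ _ \<phi>(1)])
         (use H(3,4,5) \<phi>(2,3) in \<open>auto 0 4\<close>)
  qed
  then obtain \<psi> where \<psi>: "\<And>l. continuous_on {0..1} (\<psi> l)"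
    "\<And>l t. t\<in>{0..1} \<Longrightarrow> block_det (L -` {l}) (\<sigma>' (t, 0)) = exp (\<psi> l t)"
    "\<And>l. \<psi> l 0 = 0" "\<And>l. \<psi> l 1 = 0" by metis
  have bl: "\<sigma>' (t, 0) \<in> block_mats L" if "t \<in> {0..1}" for t
    using H(2)[of 1 "(t, 0)"] that by (simp add: H(4))
  have dg: "\<sigma>' (t, 0) = diag_mat (\<lambda>i. if i \<in> D then 1 else exp (\<psi> (L i) t))" if t: "t \<in> {0..1}" for t
  proof -
    have red: "reduced_at D (\<sigma>' (t, 0))" using \<sigma>'(2)[of "(t, 0)"] t by simp
    note off = reduced_diagonal[OF bl[OF t] red D]
    have e: "\<sigma>' (t, 0) $ i $ i = (if i \<in> D then 1 else exp (\<psi> (L i) t))" for i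
    proof (cases "i \<in> D")
      case True
      with red have "\<sigma>' (t, 0) $ i $ i = mat 1 $ i $ i" unfolding reduced_at_def by blast
      with True show ?thesis by (simp add: mat_def)
    next
      case False
      have "exp (\<psi> (L i) t) = (\<Prod>j\<in>L -` {L i}. \<sigma>' (t, 0) $ j $ j)"
        by (rule trans[OF sym[OF \<psi>(2)[OF t]] block_det_diagonal[OF off]])
      also have "\<dots> = (\<Prod>j\<in>L -` {L i}. if j = i then \<sigma>' (t, 0) $ i $ i else 1)"
      proof (intro prod.cong refl)
        fix j assume j: "j \<in> L -` {L i}"
        show "\<sigma>' (t, 0) $ j $ j = (if j = i then \<sigma>' (t, 0) $ i $ i else 1)"
        proof (cases "j = i")
          case False
          with j D[of i j] \<open>i \<notin> D\<close> have "j \<in> D" by auto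
          with red have "\<sigma>' (t, 0) $ j $ j = mat 1 $ j $ j" unfolding reduced_at_def by blast
          with False show ?thesis by (simp add: mat_def)
        qed simp
      qed
      also have "\<dots> = \<sigma>' (t, 0) $ i $ i" by simp
      finally show ?thesis using False by simp
    qed
    have "\<sigma>' (t, 0) = diag_mat (\<lambda>i. \<sigma>' (t, 0) $ i $ i)"
      by (rule diagonal_nonzero(2)[OF block_matsD(1)[OF bl[OF t]] off])
    also have "\<dots> = diag_mat (\<lambda>i. if i \<in> D then 1 else exp (\<psi> (L i) t))"
      by (simp only: e)
    finally show ?thesis .
  qed
  let ?hom1 = "homotopic_with (\<lambda>f. \<forall>t\<in>{0, 1}. f t = mat 1) (top_of_set {0..1}) (top_of_set (block_mats L))"
  have "?hom1 \<sigma> (\<lambda>t. \<sigma>' (t, 0))"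
    by (rule rel_homotopyI[where H = ?H, OF Hc]) (use H in auto)
  also have "?hom1 (\<lambda>t. \<sigma>' (t, 0)) (\<lambda>_. mat 1)"
  proof (rule rel_homotopyI[where H = "\<lambda>x. diag_mat (\<lambda>i. if i \<in> D then 1 else exp (of_real (1 - fst x) * \<psi> (L i) (snd x)))"])
    show "continuous_on ({0..1} \<times> {0..1}) (\<lambda>x. diag_mat (\<lambda>i. if i \<in> D then 1 else exp (of_real (1 - fst x) * \<psi> (L i) (snd x))))"
    proof (rule continuous_on_diag_mat)
      fix i
      have "continuous_on ({0..1} \<times> {0..1}) (\<lambda>x. exp (of_real (1 - fst x) * \<psi> (L i) (snd x)))"
        by (intro continuous_intros continuous_on_compose2[OF \<psi>(1)]) auto
      then show "continuous_on ({0..1} \<times> {0..1}) (\<lambda>x. if i \<in> D then 1 else exp (of_real (1 - fst x) * \<psi> (L i) (snd x)))"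
        by (cases "i \<in> D") auto
    qed
  qed (use \<psi>(3,4) dg in \<open>auto intro!: diag_mat_block simp: diag_mat_1 cong: if_cong split: if_splits\<close>)
  finally (homotopic_with_trans) show ?thesis .
qed

section \<open>Frames adapted to a splitting into a positive and a negative part\<close>

definition split_form :: "'n set \<Rightarrow> complex^'n \<Rightarrow> complex^'n \<Rightarrow> complex" where
  "split_form Q x y = (\<Sum>i\<in>UNIV. (if i \<in> Q then 1 else -1) * x $ i * cnj (y $ i))"

text \<open>Stated for vectors supported on \<open>Q\<close> and on \<open>- Q\<close> rather than
  for columns, so that the invariance under right multiplication by parity block matrices is
  immediate. Columns with indices of the same parity class need not be orthogonal.\<close>

definition split_frames :: "'n set \<Rightarrow> (complex^'n^'n) set" where
  "split_frames Q = {g. \<forall>x y. restrict_vec Q x = x \<longrightarrow> restrict_vec (- Q) y = y \<longrightarrow>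
     split_form Q (g *v x) (g *v y) = 0 \<and>
     (x \<noteq> 0 \<longrightarrow> 0 < Re (split_form Q (g *v x) (g *v x))) \<and>
     (y \<noteq> 0 \<longrightarrow> Re (split_form Q (g *v y) (g *v y)) < 0)}"

lemma split_form_add_left: "split_form Q (x + x') y = split_form Q x y + split_form Q x' y"
  by (simp add: split_form_def algebra_simps sum.distrib)

lemma split_form_scale_left: "split_form Q (c *s x) y = c * split_form Q x y"
  by (simp add: split_form_def sum_distrib_left mult_ac)

lemma split_form_commute: "split_form Q y x = cnj (split_form Q x y)"
  by (simp add: split_form_def if_distrib mult_ac) (intro sum.cong, auto)

lemma split_form_add_right: "split_form Q x (y + y') = split_form Q x y + split_form Q x y'"
  by (simp add: split_form_def algebra_simps sum.distrib)

lemma split_form_scale_right: "split_form Q x (c *s y) = cnj c * split_form Q x y"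
  by (simp add: split_form_def sum_distrib_left mult_ac)

lemma split_form_zero [simp]: "split_form Q 0 y = 0" "split_form Q x 0 = 0"
  by (simp_all add: split_form_def)

lemma split_form_self:
  "split_form Q x x = complex_of_real (\<Sum>i\<in>UNIV. (if i \<in> Q then 1 else -1) * (cmod (x $ i))\<^sup>2)"
  unfolding split_form_def of_real_sum
  by (intro sum.cong) (auto simp: complex_norm_square simp del: of_real_power)

lemma Re_split_form_self:
  "Re (split_form Q x x) = (\<Sum>i\<in>UNIV. (if i \<in> Q then 1 else -1) * (cmod (x $ i))\<^sup>2)"
  by (simp add: split_form_self)

lemma split_form_pos:
  assumes "restrict_vec Q x = x" "x \<noteq> 0"
  shows "0 < Re (split_form Q x x)"
proof -
  have z: "x $ i = 0" if "i \<notin> Q" for i using assms(1) that by (metis restrict_vec_nth)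
  obtain j where "x $ j \<noteq> 0" using assms(2) by (auto simp: vec_eq_iff)
  then have "0 < (\<Sum>i\<in>UNIV. (cmod (x $ i))\<^sup>2)" by (intro sum_pos2[of _ j]) auto
  also have "\<dots> = Re (split_form Q x x)"
    unfolding Re_split_form_self by (intro sum.cong) (auto simp: z)
  finally show ?thesis .
qed

lemma split_form_neg:
  assumes "restrict_vec (- Q) x = x" "x \<noteq> 0"
  shows "Re (split_form Q x x) < 0"
proof -
  have z: "x $ i = 0" if "i \<in> Q" for i using assms(1) that by (metis restrict_vec_nth ComplD)
  obtain j where "x $ j \<noteq> 0" using assms(2) by (auto simp: vec_eq_iff)
  then have "0 < (\<Sum>i\<in>UNIV. (cmod (x $ i))\<^sup>2)" by (intro sum_pos2[of _ j]) auto
  also have "\<dots> = - Re (split_form Q x x)"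
    unfolding Re_split_form_self sum_negf[symmetric] by (intro sum.cong) (auto simp: z)
  finally show ?thesis by simp
qed

lemma split_form_orthogonal:
  assumes "restrict_vec Q x = x" "restrict_vec (- Q) y = y"
  shows "split_form Q x y = 0"
proof -
  have "x $ i = 0 \<or> y $ i = 0" for i using assms by (metis restrict_vec_nth ComplD)
  then show ?thesis unfolding split_form_def by (intro sum.neutral) auto
qed

lemma split_framesD:
  fixes g :: "complex^'n^'n"
  assumes "g \<in> split_frames Q"
  shows "restrict_vec Q x = x \<Longrightarrow> restrict_vec (- Q) y = y \<Longrightarrow> split_form Q (g *v x) (g *v y) = 0"
    and "restrict_vec Q x = x \<Longrightarrow> x \<noteq> 0 \<Longrightarrow> 0 < Re (split_form Q (g *v x) (g *v x))"
    and "restrict_vec (- Q) y = y \<Longrightarrow> y \<noteq> 0 \<Longrightarrow> Re (split_form Q (g *v y) (g *v y)) < 0"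
proof -
  have 0: "restrict_vec S 0 = (0 :: complex^'n)" for S :: "'n set" by (auto simp: vec_eq_iff)
  show "restrict_vec Q x = x \<Longrightarrow> restrict_vec (- Q) y = y \<Longrightarrow> split_form Q (g *v x) (g *v y) = 0"
    using assms by (auto simp: split_frames_def)
  show "restrict_vec Q x = x \<Longrightarrow> x \<noteq> 0 \<Longrightarrow> 0 < Re (split_form Q (g *v x) (g *v x))"
    using assms 0 unfolding split_frames_def by blast
  show "restrict_vec (- Q) y = y \<Longrightarrow> y \<noteq> 0 \<Longrightarrow> Re (split_form Q (g *v y) (g *v y)) < 0"
    using assms 0 unfolding split_frames_def by blast
qed

lemma restrict_vec_decompose: "x = restrict_vec Q x + restrict_vec (- Q) x"
  by (auto simp: vec_eq_iff)

lemma restrict_vec_idem [simp]: "restrict_vec Q (restrict_vec Q x) = restrict_vec Q x"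
  by (auto simp: vec_eq_iff)

lemma split_frames_invertible:
  fixes g :: "complex^'n^'n"
  assumes "g \<in> split_frames Q"
  shows "invertible g"
proof (rule invertible_kernelI)
  fix x assume 0: "g *v x = 0"
  let ?p = "restrict_vec Q x" and ?n = "restrict_vec (- Q) x"
  have sum: "g *v ?p + g *v ?n = 0"
    using 0 by (metis restrict_vec_decompose matrix_vector_right_distrib)
  have orth: "split_form Q (g *v ?p) (g *v ?n) = 0" by (rule split_framesD(1)[OF assms]) simp_all
  have "split_form Q (g *v ?p) (g *v ?p) = split_form Q (g *v ?p) (g *v ?p + g *v ?n)"
    using orth by (simp add: split_form_add_right)
  then have p: "?p = 0" using split_framesD(2)[OF assms, of ?p] sum by force
  with sum have "g *v ?n = 0" by simp
  then have "?n = 0" using split_framesD(3)[OF assms, of ?n] by force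
  with p show "x = 0" using restrict_vec_decompose[of x Q] by simp
qed

lemma parity_block_restrict:
  fixes g :: "complex^'n^'n"
  assumes "g \<in> block_mats (\<lambda>i. i \<in> Q)"
  shows "g *v restrict_vec Q x = restrict_vec Q (g *v x)"
    "g *v restrict_vec (- Q) x = restrict_vec (- Q) (g *v x)"
  by (rule block_mats_restrict[OF assms, of _ "{True}"], auto)
     (rule block_mats_restrict[OF assms, of _ "{False}"], auto)

lemma split_frames_mult_block:
  fixes g k :: "complex^'n^'n"
  assumes "g \<in> split_frames Q" "k \<in> block_mats (\<lambda>i. i \<in> Q)"
  shows "g ** k \<in> split_frames Q"
proof -
  note r = parity_block_restrict[OF assms(2)]
  have k: "k *v x \<noteq> 0" if "x \<noteq> 0" for x
    using invertible_kernelD[OF block_matsD(1)[OF assms(2)]] that by blast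
  show ?thesis
    unfolding split_frames_def mem_Collect_eq matrix_vector_mul_assoc[symmetric]
    using split_framesD[OF assms(1)] r k by metis
qed

lemma mat_1_split_frames: "mat 1 \<in> split_frames Q"
  unfolding split_frames_def by (auto intro: split_form_orthogonal split_form_pos split_form_neg)

lemma block_mats_split_frames: "k \<in> block_mats (\<lambda>i. i \<in> Q) \<Longrightarrow> k \<in> split_frames Q"
  using split_frames_mult_block[OF mat_1_split_frames, of k Q] by simp

text \<open>A kernel vector of the compression to \<open>Q\<close> would be mapped to a vector
  supported on \<open>- Q\<close>, where the form is negative, although it comes from the positive
  part. The same holds with the signs exchanged.\<close>

lemma split_frames_block_det:
  fixes g :: "complex^'n^'n"
  assumes "g \<in> split_frames Q"
  shows "block_det Q g \<noteq> 0" "block_det (- Q) g \<noteq> 0"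
proof -
  have pos: "x = 0" if "restrict_vec Q x = x" "restrict_vec Q (g *v x) = 0" for x
  proof (rule ccontr)
    assume x: "x \<noteq> 0"
    have "restrict_vec (- Q) (g *v x) = g *v x"
      using that(2) restrict_vec_decompose[of "g *v x" Q] by simp
    from split_form_neg[OF this] split_framesD(2)[OF assms that(1) x] show False
      by (cases "g *v x = 0") auto
  qed
  have neg: "x = 0" if "restrict_vec (- Q) x = x" "restrict_vec (- Q) (g *v x) = 0" for x
  proof (rule ccontr)
    assume x: "x \<noteq> 0"
    have "restrict_vec Q (g *v x) = g *v x"
      using that(2) restrict_vec_decompose[of "g *v x" Q] by simp
    from split_form_pos[OF this] split_framesD(3)[OF assms that(1) x] show False
      by (cases "g *v x = 0") auto
  qed
  show "block_det Q g \<noteq> 0" "block_det (- Q) g \<noteq> 0"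
    using pos neg by (auto intro!: block_det_nonzeroI)
qed

text \<open>Shrinking the two off-diagonal blocks keeps the positive and the negative part orthogonal and
  definite, so the frames retract onto the block diagonal ones.\<close>

definition shrink :: "'n set \<Rightarrow> real \<Rightarrow> complex^'n^'n \<Rightarrow> complex^'n^'n" where
  "shrink Q s g = (\<chi> i j. if (i \<in> Q) = (j \<in> Q) then g $ i $ j else complex_of_real s * g $ i $ j)"

lemma shrink_apply_pos:
  fixes g :: "complex^'n^'n"
  assumes "restrict_vec Q x = x"
  shows "(shrink Q s g *v x) $ i = (if i \<in> Q then 1 else complex_of_real s) * (g *v x) $ i"
proof -
  have "x $ j = 0" if "j \<notin> Q" for j using assms that by (metis restrict_vec_nth)
  then show ?thesis
    unfolding matrix_vector_mult_def shrink_def vec_lambda_beta sum_distrib_left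
    by (intro sum.cong) auto
qed

lemma shrink_apply_neg:
  fixes g :: "complex^'n^'n"
  assumes "restrict_vec (- Q) x = x"
  shows "(shrink Q s g *v x) $ i = (if i \<in> Q then complex_of_real s else 1) * (g *v x) $ i"
proof -
  have "x $ j = 0" if "j \<in> Q" for j using assms that by (metis restrict_vec_nth ComplD)
  then show ?thesis
    unfolding matrix_vector_mult_def shrink_def vec_lambda_beta sum_distrib_left
    by (intro sum.cong) auto
qed

text \<open>On the positive part shrinking multiplies exactly the coordinates that count negatively,
  so the value of the form can only grow; dually on the negative part. In a mixed product every
  coordinate acquires the same single factor \<open>s\<close>, so orthogonality survives.\<close>

lemma shrink_split_frames:
  fixes g :: "complex^'n^'n"
  assumes g: "g \<in> split_frames Q" and s: "0 \<le> s" "s \<le> 1"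
  shows "shrink Q s g \<in> split_frames Q"
proof -
  have s2: "s\<^sup>2 \<le> 1" using s by (simp add: power_le_one)
  have le: "s\<^sup>2 * (cmod a)\<^sup>2 \<le> (cmod a)\<^sup>2" for a using s2 by (simp add: mult_left_le_one_le)
  show ?thesis
    unfolding split_frames_def
  proof (intro CollectI allI impI conjI)
    fix x y :: "complex^'n" assume x: "restrict_vec Q x = x" and y: "restrict_vec (- Q) y = y"
    have "split_form Q (shrink Q s g *v x) (shrink Q s g *v y) = complex_of_real s * split_form Q (g *v x) (g *v y)"
      unfolding split_form_def sum_distrib_left shrink_apply_pos[OF x] shrink_apply_neg[OF y]
      by (intro sum.cong) auto
    then show "split_form Q (shrink Q s g *v x) (shrink Q s g *v y) = 0"
      by (simp add: split_framesD(1)[OF g x y])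
    { assume "x \<noteq> 0"
      from split_framesD(2)[OF g x this]
      have "0 < (\<Sum>i\<in>UNIV. (if i \<in> Q then 1 else -1) * (cmod ((g *v x) $ i))\<^sup>2)"
        by (simp only: Re_split_form_self)
      also have "\<dots> \<le> Re (split_form Q (shrink Q s g *v x) (shrink Q s g *v x))"
        unfolding Re_split_form_self shrink_apply_pos[OF x]
        using le by (intro sum_mono) (auto simp: norm_mult power_mult_distrib)
      finally show "0 < Re (split_form Q (shrink Q s g *v x) (shrink Q s g *v x))" . }
    { assume "y \<noteq> 0"
      have "Re (split_form Q (shrink Q s g *v y) (shrink Q s g *v y))
          \<le> (\<Sum>i\<in>UNIV. (if i \<in> Q then 1 else -1) * (cmod ((g *v y) $ i))\<^sup>2)"
        unfolding Re_split_form_self shrink_apply_neg[OF y]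
        using le by (intro sum_mono) (auto simp: norm_mult power_mult_distrib)
      also have "\<dots> < 0"
        using split_framesD(3)[OF g y \<open>y \<noteq> 0\<close>] by (simp only: Re_split_form_self)
      finally show "Re (split_form Q (shrink Q s g *v y) (shrink Q s g *v y)) < 0" . }
  qed
qed

lemma split_frames_sphere_null:
  fixes \<sigma> :: "real \<times> real \<Rightarrow> complex^'n^'n"
  assumes cont: "continuous_on unit_square \<sigma>" and \<sigma>: "\<And>z. z \<in> unit_square \<Longrightarrow> \<sigma> z \<in> split_frames Q"
    and bd: "\<And>z. z \<in> square_boundary \<Longrightarrow> \<sigma> z = mat 1"
  shows "homotopic_with (\<lambda>f. \<forall>z\<in>square_boundary. f z = mat 1) (top_of_set unit_square)
     (top_of_set (split_frames Q)) \<sigma> (\<lambda>_. mat 1)"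
proof -
  let ?hom = "homotopic_with (\<lambda>f. \<forall>z\<in>square_boundary. f z = mat 1) (top_of_set unit_square)
     (top_of_set (split_frames Q))"
  have sh1: "shrink Q 1 g = g" and shm: "shrink Q s (mat 1) = mat 1" for g s
    by (auto simp: shrink_def vec_eq_iff mat_def)
  have sc: "continuous_on X (\<lambda>x. shrink Q (f x) (g x))" if "continuous_on X f" "continuous_on X g"
    for X :: "'z::topological_space set" and f g
  proof (rule continuous_on_matrixI)
    fix i j
    show "continuous_on X (\<lambda>x. shrink Q (f x) (g x) $ i $ j)"
      using that by (cases "(i \<in> Q) = (j \<in> Q)") (auto simp: shrink_def intro!: continuous_intros)
  qed
  have "?hom \<sigma> (\<lambda>z. shrink Q 0 (\<sigma> z))"
  proof (rule rel_homotopyI[where H = "\<lambda>x. shrink Q (1 - fst x) (\<sigma> (snd x))"])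
    show "continuous_on ({0..1} \<times> unit_square) (\<lambda>x. shrink Q (1 - fst x) (\<sigma> (snd x)))"
      by (intro sc continuous_intros continuous_on_compose2[OF cont]) auto
  qed (use \<sigma> bd square_boundary_subset in \<open>auto simp: sh1 shm intro!: shrink_split_frames\<close>)
  also have "?hom (\<lambda>z. shrink Q 0 (\<sigma> z)) (\<lambda>_. mat 1)"
  proof -
    have "shrink Q 0 (\<sigma> z) \<in> block_mats (\<lambda>i. i \<in> Q)" if "z \<in> unit_square" for z
      using split_frames_invertible[OF shrink_split_frames[OF \<sigma>[OF that], of 0]]
      by (auto simp: block_mats_def shrink_def)
    then have "homotopic_with (\<lambda>f. \<forall>z\<in>square_boundary. f z = mat 1) (top_of_set unit_square)
     (top_of_set (block_mats (\<lambda>i. i \<in> Q))) (\<lambda>z. shrink Q 0 (\<sigma> z)) (\<lambda>_. mat 1)"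
      using bd by (intro block_sphere_null sc cont continuous_intros) (auto simp: shm)
    then show ?thesis
      by (rule homotopic_with_subset_right) (auto intro: block_mats_split_frames)
  qed
  finally (homotopic_with_trans) show ?thesis .
qed

section \<open>Frames of period domains\<close>

lemma linear_matrix: "Vector_Spaces.linear (*s) (*s) ((*v) (A :: complex^'n^'m))"
  by (rule matrix_vector_mul_linear_gen)

lemma flag_act_mult: "flag_act g (flag_act h F) = flag_act (g ** h) F"
  by (simp add: flag_act_def image_image matrix_vector_mul_assoc)

lemma flag_act_1 [simp]: "flag_act (mat 1) F = F"
  by (simp add: flag_act_def)

lemma matrix_vector_mult_columns:
  fixes A :: "complex^'n^'m"
  shows "A *v x = (\<Sum>j\<in>UNIV. x $ j *s column j A)"
  by (simp add: vec_eq_iff matrix_vector_mult_def column_def mult.commute sum_component)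

lemma column_matrix_mult: "column j (A ** B) = (A :: complex^'n^'m) *v column j B"
  by (simp add: vec_eq_iff matrix_vector_mult_def matrix_matrix_mult_def column_def)

lemma column_chi [simp]: "column j (\<chi> a b. c b $ a) = c j"
  by (simp add: vec_eq_iff column_def)

section \<open>Hermitian forms and frames adapted to a flag\<close>

locale hermitian_form =
  fixes H :: "complex^'n::finite \<Rightarrow> complex^'n \<Rightarrow> complex"
  assumes add_left: "H (p + p') q = H p q + H p' q"
    and scale_left: "H (\<alpha> *s p) q = \<alpha> * H p q"
    and Hermitian: "H q p = cnj (H p q)"
begin

lemma add_right: "H p (q + q') = H p q + H p q'"
  by (metis Hermitian add_left complex_cnj_add)

lemma scale_right: "H p (\<alpha> *s q) = cnj \<alpha> * H p q"
  by (metis Hermitian scale_left complex_cnj_mult)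

lemma zero_left [simp]: "H 0 q = 0"
  using scale_left[of 0 0 q] by simp

lemma zero_right [simp]: "H p 0 = 0"
  using scale_right[of p 0 0] by simp

lemma diff_left: "H (p - p') q = H p q - H p' q"
  using add_left[of "p - p'" p' q] by (simp add: algebra_simps)

lemma sum_left: "H (\<Sum>i\<in>I. f i) q = (\<Sum>i\<in>I. H (f i) q)"
  by (induction I rule: infinite_finite_induct) (auto simp: add_left)

lemma sum_right: "H p (\<Sum>i\<in>I. f i) = (\<Sum>i\<in>I. H p (f i))"
  by (induction I rule: infinite_finite_induct) (auto simp: add_right)

lemma self_real: "Im (H p p) = 0"
  using arg_cong[OF Hermitian[of p p], of Im] by simp

lemma expand: "H x y = (\<Sum>a\<in>UNIV. \<Sum>b\<in>UNIV. x $ a * cnj (y $ b) * H (axis a 1) (axis b 1))"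
proof -
  have x: "x = (\<Sum>a\<in>UNIV. x $ a *s axis a 1)" for x :: "complex^'n"
    by (simp add: basis_expansion)
  have l: "H x z = (\<Sum>a\<in>UNIV. x $ a * H (axis a 1) z)" for z
    using arg_cong[OF x[of x], of "\<lambda>u. H u z"] by (simp only: sum_left scale_left)
  have r: "H z y = (\<Sum>b\<in>UNIV. cnj (y $ b) * H z (axis b 1))" for z
    using arg_cong[OF x[of y], of "\<lambda>u. H z u"] by (simp only: sum_right scale_right)
  show ?thesis
    unfolding l[of y] r[of "axis _ 1"] by (simp add: sum_distrib_left mult.assoc)
qed

lemma continuous:
  fixes f g :: "'a::t2_space \<Rightarrow> complex^'n"
  assumes "continuous F f" "continuous F g"
  shows "continuous F (\<lambda>x. H (f x) (g x))"
proof -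
  have "continuous F (\<lambda>x. \<Sum>a\<in>UNIV. \<Sum>b\<in>UNIV. f x $ a * cnj (g x $ b) * H (axis a 1) (axis b 1))"
    using assms by (intro continuous_intros)
  then show ?thesis by (simp flip: expand)
qed

lemma orthogonal_frame:
  assumes "\<And>i j. i \<noteq> j \<Longrightarrow> H (column i M) (column j M) = 0"
  shows "H (M *v x) (M *v y) = (\<Sum>j\<in>UNIV. x $ j * cnj (y $ j) * H (column j M) (column j M))"
proof -
  have "H (M *v x) (M *v y) = (\<Sum>i\<in>UNIV. \<Sum>j\<in>UNIV. if j = i then x $ i * cnj (y $ i) * H (column i M) (column i M) else 0)"
    unfolding matrix_vector_mult_columns sum_left sum_right scale_left scale_right sum_distrib_left
    by (intro sum.cong) (auto simp: assms mult_ac)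
  then show ?thesis by simp
qed

end

locale period_frames = hermitian_form H
  for H :: "complex^'n::finite \<Rightarrow> complex^'n \<Rightarrow> complex" +
  fixes k :: nat and lev :: "'n \<Rightarrow> nat"
  assumes lev_le: "lev j \<le> k"
begin

definition rk :: "nat \<Rightarrow> nat" where
  "rk i = card {j. lev j = i}"

text \<open>The condition is written with the set \<open>{l. lev l \<le> i}\<close> to fit
  \<open>dim_substandard_cart\<close>, the dimension of a coordinate subspace.\<close>

definition std_flag :: "'n flag" where
  "std_flag i = {v. \<forall>j. j \<notin> {l. lev l \<le> i} \<longrightarrow> v $ j = 0}"

text \<open>The columns of level \<open>i\<close> form an orthogonal basis of the complement of
  \<open>F^(i-1)\<close> in \<open>F^i\<close>, that is, of the \<open>i\<close>-th Hodge summand of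
  the flag.\<close>

definition adapted :: "complex^'n^'n \<Rightarrow> 'n flag \<Rightarrow> bool" where
  "adapted M F \<longleftrightarrow> invertible M \<and> F = flag_act M std_flag \<and>
     (\<forall>i j. i \<noteq> j \<longrightarrow> H (column i M) (column j M) = 0) \<and>
     (\<forall>j. 0 < (-1) ^ lev j * Re (H (column j M) (column j M)))"

abbreviation D :: "'n flag set" where "D \<equiv> period_domain k rk H"

abbreviation T\<^sub>D :: "'n flag topology" where "T\<^sub>D \<equiv> period_topology k rk H"

lemma below_std_flag: "below std_flag i = {v. \<forall>j. j \<notin> {l. lev l < i} \<longrightarrow> v $ j = 0}"
  by (auto simp: below_def std_flag_def vec_eq_iff less_Suc_eq_le split: nat.split)

lemma below_flag_act: "below (flag_act M F) i = (*v) M ` below F i"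
  by (auto simp: below_def flag_act_def split: nat.split)

lemma card_lev_le: "card {l. lev l \<le> i} = card {l. lev l < i} + rk i"
proof -
  have "{l. lev l \<le> i} = {l. lev l < i} \<union> {l. lev l = i}" by auto
  then show ?thesis by (simp add: rk_def card_Un_disjoint disjoint_iff)
qed

lemma dim_matrix_image:
  fixes M :: "complex^'n^'n"
  assumes "invertible M"
  shows "vec.dim ((*v) M ` V) = vec.dim V"
proof (rule vec.dim_image_eq[OF linear_matrix])
  have "inj ((*v) M)"
  proof (rule injI)
    fix x y assume "M *v x = M *v y"
    then have "M *v (x - y) = 0" by (simp add: matrix_vector_mult_diff_distrib)
    then show "x = y" using invertible_kernelD[OF assms] by fastforce
  qed
  then show "inj_on ((*v) M) (vec.span V)" by (rule inj_on_subset) simp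
qed

lemma flag_act_std_flags:
  assumes M: "invertible M"
  shows "flag_act M std_flag \<in> flags k rk"
proof -
  have sub: "vec.subspace (std_flag i)" for i
    by (auto simp: std_flag_def vec.subspace_def)
  have "vec.subspace ((*v) M ` std_flag i)" for i
    by (rule vec.linear_subspace_image[OF linear_matrix sub])
  moreover have "below std_flag i \<subseteq> std_flag i" for i
    unfolding below_std_flag by (auto simp: std_flag_def)
  moreover have "vec.dim (std_flag i) = vec.dim (below std_flag i) + rk i" for i
    unfolding below_std_flag unfolding std_flag_def dim_substandard_cart card_lev_le ..
  moreover have "(*v) M ` std_flag i = UNIV" if "i \<ge> k" for i
  proof -
    have "std_flag i = UNIV" using lev_le that by (auto simp: std_flag_def intro: le_trans)
    moreover have "y \<in> range ((*v) M)" for y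
      by (rule range_eqI[of _ _ "matrix_inv M *v y"]) (simp add: matrix_vector_mul_assoc matrix_inv_right M)
    ultimately show ?thesis by auto
  qed
  ultimately show ?thesis
    unfolding flags_def mem_Collect_eq below_flag_act
    by (auto simp: flag_act_def dim_matrix_image[OF M])
qed

lemma flagsD:
  assumes "F \<in> flags k rk" "i \<le> k"
  shows "vec.subspace (F i)" "below F i \<subseteq> F i" "vec.dim (F i) = card {l. lev l \<le> i}"
    "vec.dim (below F i) = card {l. lev l < i}" "vec.subspace (below F i)"
proof -
  show s: "vec.subspace (F i)" "below F i \<subseteq> F i" using assms by (auto simp: flags_def)
  have "vec.subspace (below F i) \<and> vec.dim (below F i) = card {l. lev l < i}"
    using assms(2)
  proof (induction i)
    case 0
    show ?case by (simp add: below_def)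
  next
    case (Suc i)
    then have "vec.dim (F i) = card {l. lev l < i} + rk i" "vec.subspace (F i)"
      using assms by (auto simp: flags_def)
    then show ?case using card_lev_le[of i] by (simp add: below_def less_Suc_eq_le)
  qed
  then show d: "vec.dim (below F i) = card {l. lev l < i}" "vec.subspace (below F i)" by auto
  show "vec.dim (F i) = card {l. lev l \<le> i}"
    using d(1) card_lev_le[of i] assms by (simp add: flags_def)
qed

lemma flags_mono:
  assumes "F \<in> flags k rk" "i \<le> j"
  shows "F i \<subseteq> F j"
  using assms(2)
proof (induction j rule: dec_induct)
  case (step j)
  have "F j \<subseteq> F (Suc j)"
  proof (cases "Suc j \<le> k")
    case True
    from flagsD(2)[OF assms(1) this] show ?thesis by (simp add: below_def)
  next
    case False
    then show ?thesis using assms(1) by (auto simp: flags_def)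
  qed
  with step show ?case by blast
qed simp

lemma image_std_flag:
  "(*v) A ` std_flag i = vec.span ((\<lambda>j. column j A) ` {l. lev l \<le> i})"
proof
  show "(*v) A ` std_flag i \<subseteq> vec.span ((\<lambda>j. column j A) ` {l. lev l \<le> i})"
  proof (rule image_subsetI)
    fix x assume x: "x \<in> std_flag i"
    show "A *v x \<in> vec.span ((\<lambda>j. column j A) ` {l. lev l \<le> i})"
      unfolding matrix_vector_mult_columns
    proof (rule vec.span_sum)
      fix j
      show "x $ j *s column j A \<in> vec.span ((\<lambda>j. column j A) ` {l. lev l \<le> i})"
        using x by (cases "lev j \<le> i") (auto simp: std_flag_def vec.span_zero intro: vec.span_scale vec.span_base)
    qed
  qed
  have "vec.subspace (std_flag i)" by (auto simp: std_flag_def vec.subspace_def)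
  then have "vec.subspace ((*v) A ` std_flag i)" by (rule vec.linear_subspace_image[OF linear_matrix])
  moreover have "column j A \<in> (*v) A ` std_flag i" if "lev j \<le> i" for j
    unfolding matrix_vector_mult_axis[symmetric] using that by (intro imageI) (auto simp: std_flag_def axis_def)
  ultimately show "vec.span ((\<lambda>j. column j A) ` {l. lev l \<le> i}) \<subseteq> (*v) A ` std_flag i"
    by (intro vec.span_minimal) auto
qed

lemma orthogonal_independent:
  fixes A :: "'n set" and c :: "'n \<Rightarrow> complex^'n"
  assumes "\<And>i j. i \<in> A \<Longrightarrow> j \<in> A \<Longrightarrow> i \<noteq> j \<Longrightarrow> H (c i) (c j) = 0"
    and "\<And>j. j \<in> A \<Longrightarrow> H (c j) (c j) \<noteq> 0"
  shows "inj_on c A" "vec.independent (c ` A)"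
proof -
  show inj: "inj_on c A"
    using assms by (intro inj_onI) metis
  show "vec.independent (c ` A)"
  proof (rule vec.independent_if_scalars_zero)
    fix f x assume 0: "(\<Sum>x\<in>c ` A. f x *s x) = 0" and x: "x \<in> c ` A"
    then obtain j where j: "j \<in> A" "x = c j" by auto
    have "0 = H (\<Sum>l\<in>A. f (c l) *s c l) (c j)"
      using 0 inj by (simp add: sum.reindex)
    also have "\<dots> = (\<Sum>l\<in>A. if l = j then f (c j) * H (c j) (c j) else 0)"
      unfolding sum_left scale_left using assms(1) j by (intro sum.cong) auto
    also have "\<dots> = f (c j) * H (c j) (c j)" using j by (simp add: sum.delta)
    finally show "f x = 0" using assms(2) j by simp
  qed (rule finite_imageI, rule finite)
qed

text \<open>The basis grows one vector at a time, in order of level. A vector of \<open>F^i\<close>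
  outside the span of those already chosen is made orthogonal to them. They already span
  \<open>F^(i-1)\<close>, so the condition defining the period domain supplies the sign of the new
  vector, and its nonzero square lets the process go on.\<close>

lemma adapted_ex:
  assumes F: "F \<in> D"
  obtains M where "adapted M F"
proof -
  have Ff: "F \<in> flags k rk" using F by (simp add: period_domain_def)
  define good where "good A c \<longleftrightarrow> (\<forall>j\<in>A. \<forall>l. lev l < lev j \<longrightarrow> l \<in> A) \<and>
     (\<forall>j\<in>A. c j \<in> F (lev j) \<and> 0 < (-1) ^ lev j * Re (H (c j) (c j))) \<and>
     (\<forall>i\<in>A. \<forall>j\<in>A. i \<noteq> j \<longrightarrow> H (c i) (c j) = 0)" for A :: "'n set" and c
  have nz: "H (c j) (c j) \<noteq> 0" if "good A c" "j \<in> A" for A c j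
    using that by (auto simp: good_def)
  have span: "V \<subseteq> vec.span (c ` {l. P l})"
    if g: "good A c" and sub: "{l. P l} \<subseteq> A" "\<And>l. P l \<Longrightarrow> c l \<in> V" "vec.dim V = card {l. P l}" for A c P V
  proof -
    have "inj_on c {l. P l}" "vec.independent (c ` {l. P l})"
      using orthogonal_independent[of "{l. P l}" c] g sub(1) nz[OF g] by (auto simp: good_def subset_iff)
    then show ?thesis using sub by (intro vec.card_ge_dim_independent) (auto simp: card_image)
  qed
  have "\<exists>A c. card A = m \<and> good A c" if "m \<le> CARD('n)" for m
    using that
  proof (induction m)
    case 0
    show ?case by (rule exI[of _ "{}"]) (simp add: good_def)
  next
    case (Suc m)
    then obtain A c where A: "card A = m" and g: "good A c" by auto
    have closed: "l \<in> A" if "j \<in> A" "lev l < lev j" for j l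
      using g that by (simp add: good_def)
    have c_F: "c j \<in> F (lev j)" if "j \<in> A" for j
      using g that by (simp add: good_def)
    have "A \<noteq> UNIV" using A Suc.prems by auto
    then have ne: "- A \<noteq> {}" by auto
    \<comment> \<open>The minimality of the level ensures that all lower levels are already in
      \<open>A\<close>, so that \<open>c\<close> on \<open>A\<close> spans
      \<open>F^(i-1)\<close>.\<close>
    obtain j where "j \<in> - A" "\<And>l. l \<in> - A \<Longrightarrow> lev j \<le> lev l"
      using arg_min_if_finite(1)[OF _ ne, of lev] arg_min_least[OF _ ne, of _ lev]
        that[of "arg_min_on lev (- A)"] by simp
    then have j: "j \<notin> A" "\<And>l. l \<notin> A \<Longrightarrow> lev j \<le> lev l" by auto
    let ?i = "lev j"
    have ik: "?i \<le> k" by (rule lev_le)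
    note Fi = flagsD[OF Ff ik]
    have A_le: "A \<subseteq> {l. lev l \<le> ?i} - {j}"
    proof
      fix l assume l: "l \<in> A"
      have "\<not> lev j < lev l" using closed[OF l, of j] j(1) by auto
      with l j(1) show "l \<in> {l. lev l \<le> ?i} - {j}" by auto
    qed
    have cF: "c l \<in> F ?i" if "l \<in> A" for l
      using that A_le c_F[OF that] flags_mono[OF Ff, of "lev l" ?i] by auto
    have "card A < card {l. lev l \<le> ?i}"
      using A_le by (intro psubset_card_mono) auto
    moreover have "vec.dim (vec.span (c ` A)) \<le> card A"
      using vec.dim_le_card'[of "c ` A"] card_image_le[of A c] by simp
    ultimately have "\<not> F ?i \<subseteq> vec.span (c ` A)"
      using vec.dim_subset[of "F ?i" "vec.span (c ` A)"] Fi(3) by linarith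
    then obtain v where v: "v \<in> F ?i" "v \<notin> vec.span (c ` A)" by blast
    define w where "w = v - (\<Sum>l\<in>A. (H v (c l) / H (c l) (c l)) *s c l)"
    have sum_span: "(\<Sum>l\<in>A. (H v (c l) / H (c l) (c l)) *s c l) \<in> vec.span (c ` A)"
      by (intro vec.span_sum vec.span_scale vec.span_base) auto
    have sum_F: "(\<Sum>l\<in>A. (H v (c l) / H (c l) (c l)) *s c l) \<in> F ?i"
      by (intro vec.subspace_sum[OF Fi(1)] vec.subspace_scale[OF Fi(1)] cF)
    have wF: "w \<in> F ?i" unfolding w_def by (intro vec.subspace_diff[OF Fi(1)] v sum_F)
    have w0: "w \<noteq> 0" using v(2) sum_span by (auto simp: w_def)
    have orth: "H w (c l) = 0" if l: "l \<in> A" for l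
    proof -
      have "H w (c l) = H v (c l) - (\<Sum>m\<in>A. if m = l then H v (c l) else 0)"
        unfolding w_def diff_left sum_left scale_left
        using l g nz[OF g] by (intro arg_cong2[of _ _ _ _ "(-)"] sum.cong) (auto simp: good_def)
      then show ?thesis using l by simp
    qed
    have "below F ?i \<subseteq> vec.span (c ` {l. lev l < ?i})"
    proof (rule span[OF g])
      show "{l. lev l < ?i} \<subseteq> A" using j(2) by (auto simp: not_le dest: leD)
      fix l assume l: "lev l < ?i"
      then have "l \<in> A" using j(2) by (meson leD)
      then have "c l \<in> F (lev l)" using g by (simp add: good_def)
      moreover obtain i' where "?i = Suc i'" using l by (cases ?i) auto
      ultimately show "c l \<in> below F ?i"
        using l flags_mono[OF Ff, of "lev l" i'] by (auto simp: below_def)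
    qed (rule Fi(4))
    moreover have "c ` {l. lev l < ?i} \<subseteq> c ` A" using j(2) by (intro image_mono) (auto dest: leD)
    ultimately have bel: "below F ?i \<subseteq> vec.span (c ` A)" using vec.span_mono by blast
    have "H w u = 0" if "u \<in> vec.span (c ` A)" for u
      using that by (induction rule: vec.span_induct_alt) (auto simp: add_right scale_right orth)
    with bel have "\<forall>u\<in>below F ?i. H w u = 0" by blast
    with wF w0 F ik have pos: "0 < (-1) ^ ?i * Re (H w w)"
      unfolding period_domain_def by blast
    have "good (insert j A) (c(j := w))"
      unfolding good_def
    proof (intro conjI ballI allI impI)
      fix i l assume "i \<in> insert j A" "lev l < lev i"
      then show "l \<in> insert j A" using closed[of i l] j(2)[of l] by auto
    next
      fix i l assume "i \<in> insert j A" "l \<in> insert j A" "i \<noteq> l"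
      moreover have "H (c l) w = 0" if "l \<in> A" for l using Hermitian[of "c l" w] orth[OF that] by simp
      ultimately show "H ((c(j := w)) i) ((c(j := w)) l) = 0"
        using g orth j(1) by (auto simp: good_def)
    qed (use g pos wF j(1) in \<open>auto simp: good_def\<close>)
    moreover have "card (insert j A) = Suc m" using A j(1) by simp
    ultimately show ?case by blast
  qed
  from this[of "CARD('n)"] obtain A c where "card A = CARD('n)" and gA: "good A c" by auto
  then have "A = UNIV" by (metis card_eq_UNIV_imp_eq_UNIV finite)
  with gA have g: "good UNIV c" by simp
  define M where "M = (\<chi> a b. c b $ a)"
  have col: "column j M = c j" for j by (simp add: M_def)
  have orth: "H (column i M) (column j M) = 0" if "i \<noteq> j" for i j
    using g that by (auto simp: good_def col)
  have pos: "0 < (-1) ^ lev j * Re (H (column j M) (column j M))" for j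
    using g by (auto simp: good_def col)
  have form: "H (M *v x) (M *v y) =
      (\<Sum>j\<in>UNIV. x $ j * cnj (y $ j) * H (column j (M)) (column j (M)))" for x y
    by (rule orthogonal_frame) (rule orth)
  have inv: "invertible M"
  proof (rule invertible_kernelI)
    fix x assume 0: "M *v x = 0"
    have "x $ j = 0" for j
    proof -
      have "0 = H (M *v x) (M *v axis j 1)" by (simp add: 0)
      also have "\<dots> = (\<Sum>i\<in>UNIV. if i = j then x $ j * H (c j) (c j) else 0)"
        unfolding form by (intro sum.cong) (auto simp: axis_def col)
      finally show ?thesis using nz[OF g] by simp
    qed
    then show "x = 0" by (simp add: vec_eq_iff)
  qed
  have "F i = (*v) M ` std_flag i" for i
  proof (cases "i \<le> k")
    case True
    have c_F: "c l \<in> F i" if "lev l \<le> i" for l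
      using g flags_mono[OF Ff that] by (auto simp: good_def)
    have "F i \<subseteq> vec.span (c ` {l. lev l \<le> i})"
      by (rule span[OF g]) (use flagsD[OF Ff True] c_F in auto)
    moreover have "vec.span (c ` {l. lev l \<le> i}) \<subseteq> F i"
      using c_F by (intro vec.span_minimal flagsD(1)[OF Ff True]) auto
    ultimately show ?thesis unfolding image_std_flag col by simp
  next
    case False
    then have "flag_act M std_flag i = UNIV" "F i = UNIV"
      using flag_act_std_flags[OF inv] Ff by (auto simp: flags_def)
    then show ?thesis by (simp add: flag_act_def)
  qed
  then have "F = flag_act M std_flag" by (auto simp: flag_act_def)
  with inv orth pos have "adapted M F" by (simp add: adapted_def)
  then show ?thesis by (rule that)
qed

lemma adaptedD:
  assumes "adapted M F"
  shows "invertible M" "F = flag_act M std_flag"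
    "i \<noteq> j \<Longrightarrow> H (column i M) (column j M) = 0"
    "0 < (-1) ^ lev j * Re (H (column j M) (column j M))" "H (column j M) (column j M) \<noteq> 0"
proof -
  show "invertible M" "F = flag_act M std_flag" "i \<noteq> j \<Longrightarrow> H (column i M) (column j M) = 0"
    and *: "0 < (-1) ^ lev j * Re (H (column j M) (column j M))"
    using assms by (auto simp: adapted_def)
  from * show "H (column j M) (column j M) \<noteq> 0" by auto
qed

lemma adapted_form:
  assumes "adapted M F"
  shows "H (M *v x) (M *v y) = (\<Sum>j\<in>UNIV. x $ j * cnj (y $ j) * H (column j M) (column j M))"
  by (rule orthogonal_frame) (rule adaptedD[OF assms])

lemma adapted_form_axis:
  assumes "adapted M F"
  shows "H (M *v x) (column l M) = x $ l * H (column l M) (column l M)"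
proof -
  have "H (M *v x) (M *v axis l 1) = (\<Sum>j\<in>UNIV. if j = l then x $ l * H (column l M) (column l M) else 0)"
    unfolding adapted_form[OF assms] by (intro sum.cong) (auto simp: axis_def)
  then show ?thesis by (simp add: matrix_vector_mult_axis)
qed

text \<open>The left side does not mention \<open>M\<close> except through the vector: it describes
  the graded piece of \<open>F\<close> intrinsically. Two adapted frames of one flag must therefore
  agree up to a matrix that is block diagonal by level.\<close>

lemma adapted_level:
  assumes M: "adapted M F"
  shows "(M *v x \<in> F i \<and> (\<forall>w\<in>below F i. H (M *v x) w = 0)) \<longleftrightarrow> (\<forall>j. lev j \<noteq> i \<longrightarrow> x $ j = 0)"
proof -
  note inv = adaptedD(1)[OF M]
  have inj: "M *v x = M *v y \<longleftrightarrow> x = y" for x y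
    using invertible_kernelD[OF inv, of "x - y"] by (auto simp: matrix_vector_mult_diff_distrib)
  have F: "F = flag_act M std_flag" by (rule adaptedD[OF M])
  have 1: "M *v x \<in> F i \<longleftrightarrow> (\<forall>j. i < lev j \<longrightarrow> x $ j = 0)" for x i
    unfolding F by (auto simp: flag_act_def std_flag_def inj image_iff not_le)
  have bel: "below F i = (*v) M ` {v. \<forall>j. j \<notin> {l. lev l < i} \<longrightarrow> v $ j = 0}"
    unfolding F below_flag_act below_std_flag ..
  have 2: "(\<forall>w\<in>below F i. H (M *v x) w = 0) \<longleftrightarrow> (\<forall>j. lev j < i \<longrightarrow> x $ j = 0)"
  proof (intro iffI allI impI)
    fix j assume *: "\<forall>w\<in>below F i. H (M *v x) w = 0" "lev j < i"
    then have "column j M \<in> below F i"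
      unfolding bel matrix_vector_mult_axis[symmetric] by (intro imageI) (auto simp: axis_def)
    with * have "x $ j * H (column j M) (column j M) = 0"
      by (simp add: adapted_form_axis[OF M, symmetric])
    then show "x $ j = 0" using adaptedD(5)[OF M] by simp
  next
    assume *: "\<forall>j. lev j < i \<longrightarrow> x $ j = 0"
    show "\<forall>w\<in>below F i. H (M *v x) w = 0"
    proof
      fix w assume "w \<in> below F i"
      then obtain y where y: "w = M *v y" "\<And>j. \<not> lev j < i \<Longrightarrow> y $ j = 0" unfolding bel by auto
      have "x $ j = 0 \<or> y $ j = 0" for j using * y(2) by blast
      then show "H (M *v x) w = 0"
        unfolding y(1) adapted_form[OF M] by (intro sum.neutral) auto
    qed
  qed
  show ?thesis unfolding 1 2 by (metis linorder_neqE_nat less_irrefl)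
qed

lemma adapted_in_D:
  assumes M: "adapted M F"
  shows "F \<in> D"
proof -
  have "0 < (-1) ^ i * Re (H v v)"
    if v: "v \<in> F i" "\<forall>w\<in>below F i. H v w = 0" "v \<noteq> 0" for i v
  proof -
    define x where "x = matrix_inv M *v v"
    have vx: "v = M *v x"
      by (simp add: x_def matrix_vector_mul_assoc matrix_inv_right adaptedD(1)[OF M])
    have x: "x $ j = 0" if "lev j \<noteq> i" for j
      using adapted_level[OF M, of x i] v that by (simp add: vx)
    have "x \<noteq> 0" using v(3) by (auto simp: vx)
    then obtain l where l: "x $ l \<noteq> 0" by (auto simp: vec_eq_iff)
    have "(-1) ^ i * Re (H v v) = (\<Sum>j\<in>UNIV. (cmod (x $ j))\<^sup>2 * ((-1) ^ lev j * Re (H (column j M) (column j M))))"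
      unfolding vx adapted_form[OF M] Re_sum sum_distrib_left
    proof (intro sum.cong refl)
      fix j
      have "x $ j * cnj (x $ j) = complex_of_real ((cmod (x $ j))\<^sup>2)"
        by (simp add: complex_norm_square del: of_real_power)
      then show "(- 1) ^ i * Re (x $ j * cnj (x $ j) * H (column j M) (column j M)) =
         (cmod (x $ j))\<^sup>2 * ((- 1) ^ lev j * Re (H (column j M) (column j M)))"
        using x[of j] by (cases "lev j = i") (simp_all del: of_real_power)
    qed
    also have "\<dots> > 0"
    proof (rule sum_pos2[of _ l])
      show "0 < (cmod (x $ l))\<^sup>2 * ((-1) ^ lev l * Re (H (column l M) (column l M)))"
        by (rule mult_pos_pos[OF _ adaptedD(4)[OF M]]) (use l in simp)
      show "0 \<le> (cmod (x $ j))\<^sup>2 * ((-1) ^ lev j * Re (H (column j M) (column j M)))" for j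
        by (rule mult_nonneg_nonneg[OF _ less_imp_le[OF adaptedD(4)[OF M]]]) simp
    qed auto
    finally show ?thesis .
  qed
  moreover have "F \<in> flags k rk"
    using flag_act_std_flags adaptedD(1,2)[OF M] by auto
  ultimately show ?thesis by (auto simp: period_domain_def)
qed

lemma adapted_transition:
  assumes M: "adapted M F" and N: "adapted N F"
  shows "matrix_inv N ** M \<in> block_mats lev"
proof -
  note invN = adaptedD(1)[OF N]
  have "(matrix_inv N ** M) $ i $ j = 0" if "lev i \<noteq> lev j" for i j
  proof -
    let ?x = "column j (matrix_inv N ** M)"
    have "N *v ?x = column j M"
      by (simp add: column_matrix_mult matrix_vector_mul_assoc matrix_inv_right invN)
    also have "\<dots> = M *v axis j 1" by (simp add: matrix_vector_mult_axis)
    finally have "N *v ?x = M *v axis j 1" .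
    moreover have "M *v axis j 1 \<in> F (lev j) \<and> (\<forall>w\<in>below F (lev j). H (M *v axis j 1) w = 0)"
      by (subst adapted_level[OF M]) (auto simp: axis_def)
    ultimately have "\<forall>i. lev i \<noteq> lev j \<longrightarrow> ?x $ i = 0"
      using adapted_level[OF N, of ?x "lev j"] by simp
    with that show ?thesis by (simp add: column_def)
  qed
  moreover have "invertible (matrix_inv N ** M)"
    by (intro invertible_mult invertible_matrix_inv invN adaptedD(1)[OF M])
  ultimately show ?thesis by (simp add: block_mats_def)
qed

end

lemma isCont_matrixI:
  fixes f :: "'a::t2_space \<Rightarrow> complex^'n^'m"
  assumes "\<And>i j. isCont (\<lambda>x. f x $ i $ j) x"
  shows "isCont f x"
  using assms unfolding isCont_def by (intro vec_tendstoI)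

lemma eventually_nhds_isCont:
  assumes "isCont f a" "open S" "f a \<in> S"
  shows "\<forall>\<^sub>F x in nhds a. f x \<in> S"
  using assms tendsto_at_iff_tendsto_nhds[of f a] topological_tendstoD[of f "f a" "nhds a" S]
  by (simp add: isCont_def)

lemma open_invertible: "open {A :: complex^'n^'n. invertible A}"
  unfolding invertible_det_nz
  by (rule open_Collect_neq) (auto intro: continuous_intros)

section \<open>Projections of a flag onto its graded pieces\<close>

context period_frames
begin

definition lev_diag :: "nat \<Rightarrow> complex^'n^'n" where
  "lev_diag i = diag_mat (\<lambda>j. if lev j = i then 1 else 0)"

text \<open>The orthogonal projection onto the \<open>i\<close>-th Hodge summand. Any adapted frame
  gives the same matrix, since \<open>lev_diag\<close> commutes with level block matrices. These
  projections are the continuous matrix-valued functions of the flag from which lifts are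
  built.\<close>

definition level_proj :: "nat \<Rightarrow> 'n flag \<Rightarrow> complex^'n^'n" where
  "level_proj i F = (let M = (SOME M. adapted M F) in M ** lev_diag i ** matrix_inv M)"

lemma lev_diag_mult:
  "(u ** lev_diag i) $ a $ b = (if lev b = i then u $ a $ b else 0)"
  "(lev_diag i ** u) $ a $ b = (if lev a = i then u $ a $ b else 0)"
proof -
  have "(u ** lev_diag i) $ a $ b = (\<Sum>c\<in>UNIV. if c = b then if lev b = i then u $ a $ b else 0 else 0)"
    unfolding matrix_matrix_mult_def lev_diag_def diag_mat_def vec_lambda_beta
    by (intro sum.cong) auto
  then show "(u ** lev_diag i) $ a $ b = (if lev b = i then u $ a $ b else 0)" by simp
  have "(lev_diag i ** u) $ a $ b = (\<Sum>c\<in>UNIV. if c = a then if lev a = i then u $ a $ b else 0 else 0)"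
    unfolding matrix_matrix_mult_def lev_diag_def diag_mat_def vec_lambda_beta
    by (intro sum.cong) auto
  then show "(lev_diag i ** u) $ a $ b = (if lev a = i then u $ a $ b else 0)" by simp
qed

lemma lev_diag_commute:
  assumes "\<And>i j. lev i \<noteq> lev j \<Longrightarrow> u $ i $ j = 0"
  shows "u ** lev_diag i = lev_diag i ** u"
  using assms by (auto simp: vec_eq_iff lev_diag_mult)

lemma level_proj_eq:
  assumes M: "adapted M F"
  shows "level_proj i F = M ** lev_diag i ** matrix_inv M"
proof -
  define N where "N = (SOME M. adapted M F)"
  have N: "adapted N F" unfolding N_def using M by (rule someI)
  note iM = adaptedD(1)[OF M] and iN = adaptedD(1)[OF N]
  define u where "u = matrix_inv N ** M"
  have u: "u \<in> block_mats lev" unfolding u_def by (rule adapted_transition[OF M N])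
  have MN: "M = N ** u"
    by (simp add: u_def matrix_mul_assoc matrix_inv_right iN)
  have "matrix_inv M = matrix_inv u ** matrix_inv N"
  proof (rule matrix_inv_unique)
    have "M ** (matrix_inv u ** matrix_inv N) = N ** (u ** matrix_inv u) ** matrix_inv N"
      by (simp add: MN matrix_mul_assoc)
    then show "M ** (matrix_inv u ** matrix_inv N) = mat 1"
      by (simp add: matrix_inv_right block_matsD(1)[OF u] iN)
  qed
  then have "M ** lev_diag i ** matrix_inv M = N ** (u ** lev_diag i) ** matrix_inv u ** matrix_inv N"
    by (simp add: MN matrix_mul_assoc)
  also have "u ** lev_diag i = lev_diag i ** u"
    by (rule lev_diag_commute) (rule block_matsD(2)[OF u])
  also have "N ** (lev_diag i ** u) ** matrix_inv u ** matrix_inv N = N ** lev_diag i ** (u ** matrix_inv u) ** matrix_inv N"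
    by (simp add: matrix_mul_assoc)
  also have "\<dots> = N ** lev_diag i ** matrix_inv N"
    by (simp add: matrix_inv_right block_matsD(1)[OF u])
  finally show ?thesis unfolding level_proj_def Let_def N_def[symmetric] by simp
qed

lemma level_proj_mult:
  assumes "F \<in> D"
  shows "level_proj i F ** level_proj j F = (if i = j then level_proj i F else 0)"
proof -
  obtain M where M: "adapted M F" using adapted_ex[OF assms] .
  have "lev_diag i ** lev_diag j = (if i = j then lev_diag i else 0)"
    by (auto simp: vec_eq_iff lev_diag_mult) (auto simp: lev_diag_def diag_mat_def)
  moreover have "level_proj i F ** level_proj j F = M ** lev_diag i ** (matrix_inv M ** M) ** lev_diag j ** matrix_inv M"
    by (simp add: level_proj_eq[OF M] matrix_mul_assoc)
  moreover have "\<dots> = M ** (lev_diag i ** lev_diag j) ** matrix_inv M"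
    by (simp add: matrix_inv_left adaptedD(1)[OF M] matrix_mul_assoc)
  ultimately show ?thesis
    by (simp add: level_proj_eq[OF M] matrix_matrix_mult_def zero_vec_def)
qed

lemma matrix_add_rdistrib':
  fixes A B C :: "complex^'n^'n"
  shows "(A + B) ** C = A ** C + B ** C"
  by (simp add: matrix_matrix_mult_def vec_eq_iff algebra_simps sum.distrib)

lemma matrix_mult_sum:
  fixes f :: "'i \<Rightarrow> complex^'n^'n"
  shows "(\<Sum>i\<in>I. f i) ** B = (\<Sum>i\<in>I. f i ** B)" "B ** (\<Sum>i\<in>I. f i) = (\<Sum>i\<in>I. B ** f i)"
  by (induction I rule: infinite_finite_induct)
     (auto simp: matrix_add_rdistrib' matrix_add_ldistrib)

lemma sum_level_proj:
  assumes "F \<in> D"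
  shows "(\<Sum>i\<le>k. level_proj i F) = mat 1"
proof -
  obtain M where M: "adapted M F" using adapted_ex[OF assms] .
  have "(\<Sum>i\<le>k. lev_diag i) $ a $ b = mat 1 $ a $ b" for a b
  proof -
    have "(\<Sum>i\<le>k. lev_diag i) $ a $ b = (\<Sum>i\<le>k. if lev a = i then mat 1 $ a $ b else 0)"
      unfolding sum_component by (intro sum.cong) (auto simp: lev_diag_def diag_mat_def mat_def)
    then show ?thesis using lev_le[of a] by simp
  qed
  then have "(\<Sum>i\<le>k. lev_diag i) = mat 1" by (simp add: vec_eq_iff)
  then show ?thesis
    by (simp add: level_proj_eq[OF M] matrix_inv_right adaptedD(1)[OF M] flip: matrix_mult_sum)
qed

subsection \<open>Gram-Schmidt orthogonalisation\<close>

text \<open>A strict total order of the coordinates that refines the order by level: the second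
  summand is below \<open>CARD('n)\<close>, so it never outweighs a level.\<close>

definition ix :: "'n \<Rightarrow> nat" where
  "ix j = lev j * CARD('n) + (SOME f. bij_betw f UNIV {0..<CARD('n)}) j"

lemma ix: "ix l < ix j \<Longrightarrow> lev l \<le> lev j" "ix l = ix j \<longleftrightarrow> l = j"
proof -
  define f :: "'n \<Rightarrow> nat" where "f = (SOME f. bij_betw f UNIV {0..<CARD('n)})"
  have "\<exists>f :: 'n \<Rightarrow> nat. bij_betw f UNIV {0..<CARD('n)}"
    by (rule ex_bij_betw_finite_nat) simp
  then have f: "bij_betw f UNIV {0..<CARD('n)}" unfolding f_def by (rule someI_ex)
  then have lt: "f j < CARD('n)" for j by (auto simp: bij_betw_def)
  have "lev l \<le> lev j" if "ix l \<le> ix j" for l j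
  proof (rule ccontr)
    assume "\<not> lev l \<le> lev j"
    then have "Suc (lev j) * CARD('n) \<le> lev l * CARD('n)" by (intro mult_right_mono) auto
    with that lt[of j] show False by (simp add: ix_def f_def[symmetric])
  qed
  note mono = this
  then show "ix l < ix j \<Longrightarrow> lev l \<le> lev j" by simp
  show "ix l = ix j \<longleftrightarrow> l = j"
  proof
    assume eq: "ix l = ix j"
    then have "lev l = lev j" using mono[of l j] mono[of j l] by simp
    with eq have "f l = f j" by (simp add: ix_def f_def)
    then show "l = j" using f by (auto simp: bij_betw_def dest: injD)
  qed simp
qed

text \<open>Gram-Schmidt in the order of \<open>ix\<close>, without normalisation. As the form is
  indefinite a square \<open>H (gs c l) (gs c l)\<close> may vanish; the quotient is then 0 and
  orthogonality may fail, so nonvanishing is assumed where orthogonality is derived.\<close>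

function gs :: "('n \<Rightarrow> complex^'n) \<Rightarrow> 'n \<Rightarrow> complex^'n" where
  "gs c j = c j - (\<Sum>l\<in>{l. ix l < ix j}. (H (c j) (gs c l) / H (gs c l) (gs c l)) *s gs c l)"
  by pat_completeness auto
termination by (relation "Wellfounded.measure (\<lambda>(c, j). ix j)") auto

declare gs.simps [simp del]

lemma gs_orthogonal:
  assumes nz: "\<And>l. H (gs c l) (gs c l) \<noteq> 0" and "i \<noteq> j"
  shows "H (gs c i) (gs c j) = 0"
proof -
  have *: "H (gs c i) (gs c j) = 0" if "ix j < ix i" for i j
    using that
  proof (induction "ix i" arbitrary: i j rule: less_induct)
    case less
    have "H (gs c i) (gs c j) = H (c i) (gs c j) -
       (\<Sum>l\<in>{l. ix l < ix i}. H (c i) (gs c l) / H (gs c l) (gs c l) * H (gs c l) (gs c j))"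
      by (subst (1) gs.simps) (simp add: diff_left sum_left scale_left)
    also have "(\<Sum>l\<in>{l. ix l < ix i}. H (c i) (gs c l) / H (gs c l) (gs c l) * H (gs c l) (gs c j))
       = (\<Sum>l\<in>{l. ix l < ix i}. if l = j then H (c i) (gs c j) else 0)"
    proof (intro sum.cong refl)
      fix l assume l: "l \<in> {l. ix l < ix i}"
      have "H (gs c l) (gs c j) = 0" if "l \<noteq> j"
      proof (cases "ix j < ix l")
        case True
        with less.hyps l show ?thesis by simp
      next
        case False
        with that have "ix l < ix j" using ix(2)[of l j] by linarith
        then have "H (gs c j) (gs c l) = 0" using less.hyps less.prems by simp
        then show ?thesis using Hermitian[of "gs c l" "gs c j"] by simp
      qed
      then show "H (c i) (gs c l) / H (gs c l) (gs c l) * H (gs c l) (gs c j) =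
          (if l = j then H (c i) (gs c j) else 0)"
        using nz by auto
    qed
    finally show ?case using less.prems by simp
  qed
  show ?thesis
  proof (cases "ix j < ix i")
    case False
    then have "ix i < ix j" using ix(2)[of i j] assms(2) by linarith
    then show ?thesis using *[of i j] Hermitian[of "gs c i" "gs c j"] by simp
  qed (rule *)
qed

lemma gs_span:
  "vec.span (gs c ` {l. lev l \<le> i}) = vec.span (c ` {l. lev l \<le> i})"
proof -
  have "gs c j \<in> vec.span (c ` {l. lev l \<le> i})" if "lev j \<le> i" for j
    using that
  proof (induction "ix j" arbitrary: j rule: less_induct)
    case less
    have "gs c l \<in> vec.span (c ` {l. lev l \<le> i})" if "ix l < ix j" for l
      using less.hyps[OF that] ix(1)[OF that] less.prems by simp
    moreover have "c j \<in> vec.span (c ` {l. lev l \<le> i})"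
      using less.prems by (intro vec.span_base) auto
    ultimately show ?case
      by (subst gs.simps) (intro vec.span_diff vec.span_sum vec.span_scale, auto)
  qed
  moreover have "c j \<in> vec.span (gs c ` {l. lev l \<le> i})" if "lev j \<le> i" for j
  proof -
    have "c j = gs c j + (\<Sum>l\<in>{l. ix l < ix j}. (H (c j) (gs c l) / H (gs c l) (gs c l)) *s gs c l)"
      by (subst gs.simps) simp
    moreover have g: "gs c l \<in> vec.span (gs c ` {l. lev l \<le> i})" if "lev l \<le> i" for l
      using that by (intro vec.span_base) auto
    have "gs c j + (\<Sum>l\<in>{l. ix l < ix j}. (H (c j) (gs c l) / H (gs c l) (gs c l)) *s gs c l)
        \<in> vec.span (gs c ` {l. lev l \<le> i})"
    proof (intro vec.span_add vec.span_sum vec.span_scale g that)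
      fix l assume "l \<in> {l. ix l < ix j}"
      with ix(1)[of l j] that show "lev l \<le> i" by simp
    qed
    ultimately show ?thesis by simp
  qed
  ultimately show ?thesis
    by (intro equalityI vec.span_minimal vec.subspace_span) auto
qed

definition gs_frame :: "complex^'n^'n \<Rightarrow> complex^'n^'n" where
  "gs_frame A = (\<chi> a b. gs (\<lambda>j. column j A) b $ a)"

lemma column_gs_frame: "column j (gs_frame A) = gs (\<lambda>j. column j A) j"
  by (simp add: gs_frame_def vec_eq_iff column_def)

text \<open>An order refining the levels leaves the span of every initial set of levels, hence the
  flag, unchanged. Only the signs of the new columns remain to be required, and they are an open
  condition.\<close>

lemma gs_frame_adapted:
  assumes inv: "invertible A"
    and pos: "\<And>j. 0 < (-1) ^ lev j * Re (H (column j (gs_frame A)) (column j (gs_frame A)))"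
  shows "adapted (gs_frame A) (flag_act A std_flag)"
proof -
  have nz: "H (column j (gs_frame A)) (column j (gs_frame A)) \<noteq> 0" for j
    using pos[of j] by auto
  have orth: "H (column i (gs_frame A)) (column j (gs_frame A)) = 0" if "i \<noteq> j" for i j
    using gs_orthogonal[OF _ that] nz by (simp add: column_gs_frame)
  have form: "H (gs_frame A *v x) (gs_frame A *v y) =
      (\<Sum>j\<in>UNIV. x $ j * cnj (y $ j) * H (column j (gs_frame A)) (column j (gs_frame A)))" for x y
    by (rule orthogonal_frame) (rule orth)
  have "invertible (gs_frame A)"
  proof (rule invertible_kernelI)
    fix x assume 0: "gs_frame A *v x = 0"
    have "x $ j = 0" for j
    proof -
      have "0 = H (gs_frame A *v x) (gs_frame A *v axis j 1)" by (simp add: 0)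
      also have "\<dots> = (\<Sum>i\<in>UNIV. if i = j then x $ j * H (column j (gs_frame A)) (column j (gs_frame A)) else 0)"
        unfolding form by (intro sum.cong) (auto simp: axis_def)
      finally show ?thesis using nz by simp
    qed
    then show "x = 0" by (simp add: vec_eq_iff)
  qed
  moreover have "flag_act A std_flag = flag_act (gs_frame A) std_flag"
    unfolding flag_act_def image_std_flag column_gs_frame using gs_span[of "\<lambda>j. column j A"] by simp
  ultimately show ?thesis using orth pos by (simp add: adapted_def)
qed

lemma gs_frame_of_adapted:
  assumes M: "adapted M F"
  shows "gs_frame M = M"
proof -
  have "gs (\<lambda>j. column j M) j = column j M" for j
  proof (induction "ix j" arbitrary: j rule: less_induct)
    case less
    have "(\<Sum>l\<in>{l. ix l < ix j}. (H (column j M) (gs (\<lambda>j. column j M) l) /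
        H (gs (\<lambda>j. column j M) l) (gs (\<lambda>j. column j M) l)) *s gs (\<lambda>j. column j M) l) = 0"
    proof (intro sum.neutral ballI)
      fix l assume "l \<in> {l. ix l < ix j}"
      then have "gs (\<lambda>j. column j M) l = column l M" "l \<noteq> j" using less by auto
      then show "(H (column j M) (gs (\<lambda>j. column j M) l) /
          H (gs (\<lambda>j. column j M) l) (gs (\<lambda>j. column j M) l)) *s gs (\<lambda>j. column j M) l = 0"
        using adaptedD(3)[OF M, of j l] by simp
    qed
    then show ?case by (subst gs.simps) simp
  qed
  then show ?thesis by (simp add: gs_frame_def vec_eq_iff column_def)
qed

lemma isCont_gs_frame:
  assumes M: "adapted M F"
  shows "isCont gs_frame M"
proof -
  have eq: "gs (\<lambda>j. column j M) j = column j M" for j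
    using gs_frame_of_adapted[OF M] column_gs_frame[of j M] by simp
  have col: "isCont (\<lambda>A :: complex^'n^'n. column j A) x" for j x
    unfolding column_def isCont_def by (intro tendsto_intros)
  have "isCont (\<lambda>A. gs (\<lambda>j. column j A) j) M" for j
  proof (induction "ix j" arbitrary: j rule: less_induct)
    case less
    have vs: "isCont (\<lambda>A. f A *s v A) M" if "isCont f M" "isCont v M"
      for f :: "complex^'n^'n \<Rightarrow> complex" and v :: "complex^'n^'n \<Rightarrow> complex^'n"
      using that unfolding vector_scalar_mult_def isCont_def by (intro tendsto_intros)
    have "isCont (\<lambda>A. column j A - (\<Sum>l\<in>{l. ix l < ix j}. (H (column j A) (gs (\<lambda>j. column j A) l) /
        H (gs (\<lambda>j. column j A) l) (gs (\<lambda>j. column j A) l)) *s gs (\<lambda>j. column j A) l)) M"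
      using less adaptedD(5)[OF M]
      by (intro continuous_intros vs continuous col) (auto simp: eq)
    then show ?case by (subst gs.simps)
  qed
  then show ?thesis
    unfolding gs_frame_def by (intro isCont_matrixI) (auto intro: continuous_intros)
qed

text \<open>For \<open>g\<close> near the identity, Gram-Schmidt applied to \<open>g ** M\<close> is
  continuous at the identity, where it returns \<open>M\<close>, so the signs persist. The result is
  an adapted frame of \<open>flag_act g F\<close> from which its projections are read off.\<close>

lemma level_proj_near:
  assumes "F \<in> D" "open U" "level_proj i F \<in> U"
  shows "\<forall>\<^sub>F g in nhds (mat 1). flag_act g F \<in> D \<and> level_proj i (flag_act g F) \<in> U"
proof -
  obtain M where M: "adapted M F" using adapted_ex[OF assms(1)] .
  have gM: "isCont (\<lambda>g. g ** M) (mat 1)"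
    by (rule continuous_on_interior[of UNIV]) (auto intro!: continuous_intros)
  have M': "isCont (\<lambda>g. gs_frame (g ** M)) (mat 1)"
    by (rule isCont_o2[OF gM]) (simp add: isCont_gs_frame[OF M])
  have M1: "gs_frame (mat 1 ** M) = M" by (simp add: gs_frame_of_adapted[OF M])
  have col: "isCont (\<lambda>g. column j (gs_frame (g ** M))) (mat 1)" for j
    using M' unfolding column_def isCont_def by (intro tendsto_intros)
  have "isCont (\<lambda>g. (-1) ^ lev j * Re (H (column j (gs_frame (g ** M))) (column j (gs_frame (g ** M))))) (mat 1)" for j
    by (intro continuous_intros continuous_Re continuous col)
  from eventually_nhds_isCont[OF this, where S = "{0<..}"]
  have "\<forall>\<^sub>F g in nhds (mat 1). 0 < (-1) ^ lev j * Re (H (column j (gs_frame (g ** M))) (column j (gs_frame (g ** M))))" for j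
    using adaptedD(4)[OF M] M1 by simp
  then have ev1: "\<forall>\<^sub>F g in nhds (mat 1). \<forall>j. 0 < (-1) ^ lev j * Re (H (column j (gs_frame (g ** M))) (column j (gs_frame (g ** M))))"
    by (rule eventually_all_finite)
  have ev2: "\<forall>\<^sub>F g in nhds (mat 1 :: complex^'n^'n). invertible g"
    using eventually_nhds_in_open[OF open_invertible, of "mat 1"] invertible_mat_1 by auto
  have "continuous_on {A :: complex^'n^'n. invertible A} matrix_inv"
    using continuous_on_matrix_inv[OF continuous_on_id, of "{A. invertible A}"] by simp
  then have "continuous_on {A :: complex^'n^'n. invertible A} (\<lambda>A. A ** lev_diag i ** matrix_inv A)"
    by (intro continuous_intros) auto
  then have "isCont (\<lambda>A. A ** lev_diag i ** matrix_inv A) M"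
    using continuous_on_eq_continuous_at[OF open_invertible] adaptedD(1)[OF M] by blast
  then have "isCont (\<lambda>g. gs_frame (g ** M) ** lev_diag i ** matrix_inv (gs_frame (g ** M))) (mat 1)"
    by (intro isCont_o2[OF M', where g = "\<lambda>A. A ** lev_diag i ** matrix_inv A"]) (simp only: M1)
  from eventually_nhds_isCont[OF this assms(2)] assms(3)
  have ev3: "\<forall>\<^sub>F g in nhds (mat 1). gs_frame (g ** M) ** lev_diag i ** matrix_inv (gs_frame (g ** M)) \<in> U"
    by (simp only: M1 level_proj_eq[OF M])
  from ev1 ev2 ev3 show ?thesis
  proof eventually_elim
    case (elim g)
    have "adapted (gs_frame (g ** M)) (flag_act (g ** M) std_flag)"
      using elim by (intro gs_frame_adapted invertible_mult adaptedD(1)[OF M]) auto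
    moreover have "flag_act (g ** M) std_flag = flag_act g F"
      by (simp add: adaptedD(2)[OF M] flag_act_mult)
    ultimately have "adapted (gs_frame (g ** M)) (flag_act g F)" by simp
    with elim(3) show ?case by (auto simp: adapted_in_D level_proj_eq)
  qed
qed

subsection \<open>The topology of the period domain\<close>

text \<open>In the quotient topology openness is tested on each orbit map. Writing \<open>g\<close>
  as \<open>(g ** matrix_inv g1) ** g1\<close> moves the test at \<open>g1\<close> to the identity.
  For \<open>U = UNIV\<close> this is openness of the period domain.\<close>

lemma openin_level_proj:
  assumes "open U"
  shows "openin (flag_topology k rk) {F \<in> D. level_proj i F \<in> U}"
  unfolding openin_flag_topology
proof (intro conjI ballI)
  show "{F \<in> D. level_proj i F \<in> U} \<subseteq> flags k rk" by (auto simp: period_domain_def)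
  fix F0 :: "'n flag" assume "F0 \<in> flags k rk"
  let ?S = "{g. invertible g \<and> flag_act g F0 \<in> {F \<in> D. level_proj i F \<in> U}}"
  have "\<exists>T. open T \<and> g1 \<in> T \<and> T \<subseteq> ?S" if g1: "g1 \<in> ?S" for g1
  proof -
    let ?F = "flag_act g1 F0"
    have i1: "invertible g1" using g1 by simp
    have "isCont (\<lambda>g. g ** matrix_inv g1) g1"
      by (rule continuous_on_interior[of UNIV]) (auto intro!: continuous_intros)
    then have lim: "filterlim (\<lambda>g. g ** matrix_inv g1) (nhds (mat 1)) (nhds g1)"
      using tendsto_at_iff_tendsto_nhds[of "\<lambda>g. g ** matrix_inv g1" g1]
      by (simp add: isCont_def matrix_inv_right i1)
    have "\<forall>\<^sub>F g in nhds (mat 1). flag_act g ?F \<in> D \<and> level_proj i (flag_act g ?F) \<in> U"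
      using g1 by (intro level_proj_near assms) auto
    from eventually_compose_filterlim[OF this lim]
    have "\<forall>\<^sub>F g in nhds g1. flag_act g F0 \<in> D \<and> level_proj i (flag_act g F0) \<in> U"
      by (simp add: flag_act_mult matrix_inv_left i1 flip: matrix_mul_assoc)
    moreover have "\<forall>\<^sub>F g in nhds g1. invertible g"
      using eventually_nhds_in_open[OF open_invertible, of g1] i1 by auto
    ultimately have "\<forall>\<^sub>F g in nhds g1. g \<in> ?S" by eventually_elim auto
    then show ?thesis by (auto simp: eventually_nhds)
  qed
  then show "open ?S" by (subst open_subopen) blast
qed

lemma openin_D: "openin (flag_topology k rk) D"
  using openin_level_proj[of UNIV 0] by simp

lemma topspace_T\<^sub>D: "topspace T\<^sub>D = D"
  using openin_subset[OF openin_D] by (auto simp: period_topology_def topspace_subtopology)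

lemma continuous_map_level_proj: "continuous_map T\<^sub>D euclidean (level_proj i)"
  unfolding continuous_map_def topspace_T\<^sub>D
proof (intro conjI allI impI)
  fix U :: "(complex^'n^'n) set" assume "openin euclidean U"
  then have "openin (flag_topology k rk) {F \<in> D. level_proj i F \<in> U}"
    using openin_level_proj open_openin by blast
  then show "openin T\<^sub>D {F \<in> D. level_proj i F \<in> U}"
    unfolding period_topology_def openin_subtopology by (intro exI[of _ "{F \<in> D. level_proj i F \<in> U}"]) auto
qed auto

lemma continuous_map_flag_act:
  fixes g :: "'a::topological_space \<Rightarrow> complex^'n^'n"
  assumes g: "continuous_on S g" "\<And>x. x \<in> S \<Longrightarrow> invertible (g x)" and B: "B \<in> flags k rk"
    and D: "\<And>x. x \<in> S \<Longrightarrow> flag_act (g x) B \<in> D"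
  shows "continuous_map (top_of_set S) T\<^sub>D (\<lambda>x. flag_act (g x) B)"
  unfolding continuous_map_def topspace_T\<^sub>D
proof (intro conjI allI impI)
  show "(\<lambda>x. flag_act (g x) B) \<in> topspace (top_of_set S) \<rightarrow> D" using D by auto
  fix U assume "openin T\<^sub>D U"
  then obtain V where V: "openin (flag_topology k rk) V" "U = V \<inter> D"
    by (auto simp: period_topology_def openin_subtopology)
  have "open {h. invertible h \<and> flag_act h B \<in> V}"
    using V(1) B by (auto simp: openin_flag_topology)
  with g(1) have "openin (top_of_set S) (S \<inter> g -` {h. invertible h \<and> flag_act h B \<in> V})"
    by (rule continuous_openin_preimage_gen)
  moreover have "S \<inter> g -` {h. invertible h \<and> flag_act h B \<in> V} = {x \<in> topspace (top_of_set S). flag_act (g x) B \<in> U}"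
    using g(2) D V(2) by auto
  ultimately show "openin (top_of_set S) {x \<in> topspace (top_of_set S). flag_act (g x) B \<in> U}" by simp
qed

end

section \<open>Frames in normalised coordinates and their flags\<close>

context period_frames
begin

definition Q :: "'n set" where "Q = {j. even (lev j)}"

lemma flag_act_block:
  assumes "u \<in> block_mats lev"
  shows "flag_act u std_flag = std_flag"
proof -
  have sub: "(*v) u ` std_flag i \<subseteq> std_flag i" if u: "u \<in> block_mats lev" for u i
  proof (rule image_subsetI)
    fix x assume x: "x \<in> std_flag i"
    have "(u *v x) $ j = 0" if "j \<notin> {l. lev l \<le> i}" for j
    proof -
      have "u $ j $ l * x $ l = 0" for l
        using that x block_matsD(2)[OF u, of j l] by (cases "lev l = lev j") (auto simp: std_flag_def)
      then have "(\<Sum>l\<in>UNIV. u $ j $ l * x $ l) = 0" by (intro sum.neutral ballI)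
      then show ?thesis by (simp add: matrix_vector_mult_def)
    qed
    then show "u *v x \<in> std_flag i" by (simp add: std_flag_def)
  qed
  have "std_flag i \<subseteq> (*v) u ` std_flag i" for i
  proof
    fix x assume "x \<in> std_flag i"
    then have "matrix_inv u *v x \<in> std_flag i" using sub[OF block_mats_inv[OF assms]] by blast
    moreover have "x = u *v (matrix_inv u *v x)"
      by (simp add: matrix_vector_mul_assoc matrix_inv_right block_matsD(1)[OF assms])
    ultimately show "x \<in> (*v) u ` std_flag i" by blast
  qed
  with sub[OF assms] show ?thesis unfolding flag_act_def by (intro ext equalityI)
qed

lemma diag_mat_apply: "diag_mat f *v x = (\<chi> j. f j * x $ j)"
proof -
  have "(diag_mat f *v x) $ j = (\<Sum>l\<in>UNIV. if l = j then f j * x $ j else 0)" for j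
    unfolding matrix_vector_mult_def diag_mat_def vec_lambda_beta by (intro sum.cong) auto
  then show ?thesis by (simp add: vec_eq_iff)
qed

text \<open>Dividing the columns of an adapted frame by the square roots of their absolute squares
  does not change the flag and leaves the signs, which are positive exactly at the even
  levels.\<close>

lemma normalised_frame:
  assumes "b \<in> D"
  obtains M where "invertible M" "b = flag_act M std_flag"
    "\<And>x y. H (M *v x) (M *v y) = split_form Q x y"
proof -
  obtain N where N: "adapted N b" using adapted_ex[OF assms] .
  define d where "d j = Re (H (column j N) (column j N))" for j
  have Hd: "H (column j N) (column j N) = complex_of_real (d j)" for j
    using self_real[of "column j N"] by (simp add: d_def complex_eq_iff)
  have dpos: "0 < (-1) ^ lev j * d j" for j using adaptedD(4)[OF N] by (simp add: d_def)
  then have d0: "d j \<noteq> 0" for j by (metis mult_zero_right less_irrefl)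
  define s where "s j = complex_of_real (1 / sqrt \<bar>d j\<bar>)" for j
  have s: "s j \<noteq> 0" "s j * cnj (s j) * complex_of_real (d j) = (if j \<in> Q then 1 else - 1)" for j
  proof -
    show "s j \<noteq> 0" using d0 by (simp add: s_def)
    have "s j * cnj (s j) * complex_of_real (d j) = complex_of_real (1 / \<bar>d j\<bar> * d j)"
      by (simp add: s_def flip: of_real_mult)
    also have "1 / \<bar>d j\<bar> * d j = (if j \<in> Q then 1 else - 1)"
      using dpos[of j] d0[of j] by (auto simp: Q_def minus_one_power_iff abs_if split: if_splits)
    finally show "s j * cnj (s j) * complex_of_real (d j) = (if j \<in> Q then 1 else - 1)" by simp
  qed
  have bl: "diag_mat s \<in> block_mats lev" using s(1) by (rule diag_mat_block)
  let ?M = "N ** diag_mat s"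
  show ?thesis
  proof (rule that[of ?M])
    show "invertible ?M" by (intro invertible_mult adaptedD(1)[OF N] block_matsD(1)[OF bl])
    show "b = flag_act ?M std_flag"
      using adaptedD(2)[OF N] flag_act_block[OF bl] by (simp flip: flag_act_mult)
    fix x y
    have "H (?M *v x) (?M *v y) = (\<Sum>j\<in>UNIV. (s j * x $ j) * cnj (s j * y $ j) * complex_of_real (d j))"
      by (simp add: adapted_form[OF N] diag_mat_apply Hd flip: matrix_vector_mul_assoc)
    also have "\<dots> = (\<Sum>j\<in>UNIV. (s j * cnj (s j) * complex_of_real (d j)) * x $ j * cnj (y $ j))"
      by (intro sum.cong) auto
    also have "\<dots> = split_form Q x y" unfolding s(2) split_form_def ..
    finally show "H (?M *v x) (?M *v y) = split_form Q x y" .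
  qed
qed

end

locale based_period_frames = period_frames H k lev
  for H :: "complex^'n::finite \<Rightarrow> complex^'n \<Rightarrow> complex" and k lev +
  fixes M :: "complex^'n^'n" and b :: "'n flag"
  assumes M_inv: "invertible M" and b_eq: "b = flag_act M std_flag"
    and M_form: "H (M *v x) (M *v y) = split_form Q x y"
begin

abbreviation frames :: "(complex^'n^'n) set" where "frames \<equiv> split_frames Q"

definition orbit :: "complex^'n^'n \<Rightarrow> 'n flag" where
  "orbit g = flag_act (M ** g) std_flag"

lemma adapted_M: "adapted M b"
proof -
  have col: "column j M = M *v axis j 1" for j by (simp add: matrix_vector_mult_axis)
  have "split_form Q (axis i 1) (axis j 1) = (if i = j then if i \<in> Q then 1 else - 1 else 0)" for i j
  proof -
    have "split_form Q (axis i 1) (axis j 1) =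
       (\<Sum>l\<in>UNIV. if l = i then if i = j then if i \<in> Q then 1 else - 1 else 0 else 0)"
      unfolding split_form_def by (intro sum.cong) (auto simp: axis_def)
    then show ?thesis by simp
  qed
  then show ?thesis
    unfolding adapted_def col M_form using M_inv b_eq by (auto simp: Q_def minus_one_power_iff)
qed

lemma b_in_D: "b \<in> D" by (rule adapted_in_D[OF adapted_M])

lemma lev_block_parity: "block_mats lev \<subseteq> block_mats (\<lambda>i. i \<in> Q)"
  by (rule block_mats_mono) (simp add: Q_def)

lemma frames_mult_block:
  assumes "g \<in> frames" "u \<in> block_mats lev"
  shows "g ** u \<in> frames"
  using split_frames_mult_block assms lev_block_parity by blast

lemma block_in_frames: "u \<in> block_mats lev \<Longrightarrow> u \<in> frames"
  using block_mats_split_frames lev_block_parity by blast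

lemma orbit_mult_block:
  assumes "u \<in> block_mats lev"
  shows "orbit (g ** u) = orbit g"
  using flag_act_block[OF assms] by (simp add: orbit_def matrix_mul_assoc flip: flag_act_mult)

lemma orbit_block: "u \<in> block_mats lev \<Longrightarrow> orbit u = b"
  using orbit_mult_block[of u "mat 1"] by (simp add: orbit_def b_eq)

text \<open>Within \<open>F^i\<close> the coordinates of the parity opposite to \<open>i\<close>
  have level below \<open>i\<close>, so they span a part of \<open>F^(i-1)\<close>. Orthogonality to
  \<open>F^(i-1)\<close> forces these components of \<open>v\<close> to vanish, because the two
  parity parts of a frame are orthogonal and definite. What remains has the sign belonging to
  \<open>i\<close>.\<close>

lemma orbit_in_D:
  assumes g: "g \<in> frames"
  shows "orbit g \<in> D"
proof -
  have inv: "invertible (M ** g)" by (intro invertible_mult M_inv split_frames_invertible[OF g])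
  have "0 < (-1) ^ i * Re (H v v)"
    if v: "v \<in> orbit g i" "\<forall>w\<in>below (orbit g) i. H v w = 0" "v \<noteq> 0" for i v
  proof -
    obtain x where x: "v = M *v (g *v x)" "x \<in> std_flag i"
      using v(1) by (auto simp: orbit_def flag_act_def matrix_vector_mul_assoc)
    let ?P = "if even i then Q else - Q"
    have PP: "- ?P = (if even i then - Q else Q)" by simp
    let ?y = "restrict_vec (- ?P) x"
    have "?y \<in> below std_flag i"
    proof -
      have lt: "lev j < i" if "j \<notin> ?P" "lev j \<le> i" for j
        using that by (cases "lev j = i") (auto simp: Q_def split: if_splits)
      have "?y $ j = 0" if "\<not> lev j < i" for j
      proof (cases "j \<in> ?P")
        case False
        then have "\<not> lev j \<le> i" using lt[of j] that by blast
        then show ?thesis using x(2) by (simp add: std_flag_def)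
      qed simp
      then show ?thesis by (simp add: below_std_flag)
    qed
    then have "M *v (g *v ?y) \<in> below (orbit g) i"
      by (auto simp: orbit_def below_flag_act matrix_vector_mul_assoc)
    with v(2) have "H v (M *v (g *v ?y)) = 0" by blast
    then have 0: "split_form Q (g *v x) (g *v ?y) = 0" by (simp only: x(1) M_form)
    have gx: "g *v x = g *v restrict_vec ?P x + g *v ?y"
      by (metis restrict_vec_decompose matrix_vector_right_distrib)
    have orth: "split_form Q (g *v restrict_vec ?P x) (g *v ?y) = 0"
    proof (cases "even i")
      case True
      then show ?thesis by (simp add: split_framesD(1)[OF g])
    next
      case False
      then show ?thesis
        using split_framesD(1)[OF g, of ?y "restrict_vec ?P x"] split_form_commute[of Q "g *v restrict_vec ?P x" "g *v ?y"]
        by simp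
    qed
    have "split_form Q (g *v ?y) (g *v ?y) = 0"
      using 0 orth by (simp add: gx split_form_add_left)
    then have y0: "?y = 0"
      using split_framesD(2,3)[OF g, of ?y] by (cases "even i") (auto simp del: restrict_vec_nth)
    then have xP: "restrict_vec ?P x = x" using restrict_vec_decompose[of x ?P] by simp
    have "x \<noteq> 0" using v(3) x(1) by auto
    with xP show ?thesis
      unfolding x(1) M_form using split_framesD(2,3)[OF g, of x] by (cases "even i") auto
  qed
  moreover have "orbit g \<in> flags k rk" unfolding orbit_def by (rule flag_act_std_flags[OF inv])
  ultimately show ?thesis by (auto simp: period_domain_def)
qed

lemma continuous_map_orbit:
  fixes g :: "'a::topological_space \<Rightarrow> complex^'n^'n"
  assumes "continuous_on S g" "\<And>x. x \<in> S \<Longrightarrow> g x \<in> frames"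
  shows "continuous_map (top_of_set S) T\<^sub>D (\<lambda>x. orbit (g x))"
  unfolding orbit_def
proof (rule continuous_map_flag_act)
  show "continuous_on S (\<lambda>x. M ** g x)" using assms(1) by (intro continuous_intros)
  show "std_flag \<in> flags k rk" using flag_act_std_flags[OF invertible_mat_1] by simp
  fix x assume "x \<in> S"
  then have gx: "g x \<in> frames" by (rule assms(2))
  show "invertible (M ** g x)" by (rule invertible_mult[OF M_inv split_frames_invertible[OF gx]])
  show "flag_act (M ** g x) std_flag \<in> D" using orbit_in_D[OF gx] by (simp add: orbit_def)
qed

lemma square_homotopic_orbit:
  assumes "homotopic_with (\<lambda>f. \<forall>z\<in>square_boundary. f z = mat 1) (top_of_set unit_square) (top_of_set frames) g g'"
  shows "square_homotopic T\<^sub>D b (\<lambda>z. orbit (g z)) (\<lambda>z. orbit (g' z))"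
proof -
  obtain h where h: "continuous_on ({0..1::real} \<times> unit_square) h"
    "\<And>u z. u \<in> {0..1} \<Longrightarrow> z \<in> unit_square \<Longrightarrow> h (u, z) \<in> frames"
    "\<And>z. h (0, z) = g z" "\<And>z. h (1, z) = g' z"
    "\<And>u z. u \<in> {0..1} \<Longrightarrow> z \<in> square_boundary \<Longrightarrow> h (u, z) = mat 1"
  proof (rule rel_homotopyE[OF assms], goal_cases)
    case (1 h)
    then show ?case by (intro that[of h])
  qed
  have "continuous_map (top_of_set ({0..1::real} \<times> unit_square)) T\<^sub>D (\<lambda>x. orbit (h x))"
    using h(2) by (intro continuous_map_orbit h(1)) auto
  then show ?thesis
    unfolding square_homotopic_iff
    by (intro exI[of _ "\<lambda>x. orbit (h x)"]) (auto simp: h(3,4,5) orbit_block[OF block_mats_1])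
qed

subsection \<open>Lifting spheres to frames\<close>

text \<open>A sphere in the period domain lifts to a map of the square into the frames. On the last side of the
  square the lift is a loop of block diagonal matrices, and the sphere is recorded by the winding
  numbers of its block determinants.\<close>

definition degree_lift ::
  "(real \<times> real \<Rightarrow> 'n flag) \<Rightarrow> (nat \<Rightarrow> int) \<Rightarrow> (real \<times> real \<Rightarrow> complex^'n^'n) \<Rightarrow>
     (nat \<Rightarrow> real \<Rightarrow> complex) \<Rightarrow> bool" where
  "degree_lift \<gamma> w g \<phi> \<longleftrightarrow> continuous_on unit_square g \<and>
     (\<forall>z\<in>unit_square. g z \<in> frames) \<and> (\<forall>z\<in>unit_square. \<gamma> z = orbit (g z)) \<and>
     (\<forall>t\<in>{0..1}. g (0, t) = mat 1) \<and> (\<forall>t\<in>{0..1}. g (1, t) \<in> block_mats lev) \<and>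
     (\<forall>s\<in>{0..1}. g (s, 0) = mat 1) \<and> (\<forall>s\<in>{0..1}. g (s, 1) = mat 1) \<and>
     (\<forall>i. continuous_on {0..1} (\<phi> i)) \<and>
     (\<forall>i. \<forall>t\<in>{0..1}. block_det (lev -` {i}) (g (1, t)) = exp (\<phi> i t)) \<and>
     (\<forall>i. \<phi> i 0 = 0) \<and> (\<forall>i. \<phi> i 1 = 2 * of_int (w i) * of_real pi * \<i>)"

definition has_degrees :: "(real \<times> real \<Rightarrow> 'n flag) \<Rightarrow> (nat \<Rightarrow> int) \<Rightarrow> bool" where
  "has_degrees \<gamma> w \<longleftrightarrow> (\<exists>g \<phi>. degree_lift \<gamma> w g \<phi>)"

lemma degree_liftD:
  assumes "degree_lift \<gamma> w g \<phi>"
  shows "continuous_on unit_square g"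
    "\<And>z. z \<in> unit_square \<Longrightarrow> g z \<in> frames" "\<And>z. z \<in> unit_square \<Longrightarrow> \<gamma> z = orbit (g z)"
    "\<And>t. t \<in> {0..1} \<Longrightarrow> g (0, t) = mat 1" "\<And>t. t \<in> {0..1} \<Longrightarrow> g (1, t) \<in> block_mats lev"
    "\<And>s. s \<in> {0..1} \<Longrightarrow> g (s, 0) = mat 1" "\<And>s. s \<in> {0..1} \<Longrightarrow> g (s, 1) = mat 1"
    "\<And>i. continuous_on {0..1} (\<phi> i)"
    "\<And>i t. t \<in> {0..1} \<Longrightarrow> block_det (lev -` {i}) (g (1, t)) = exp (\<phi> i t)"
    "\<And>i. \<phi> i 0 = 0" "\<And>i. \<phi> i 1 = 2 * of_int (w i) * of_real pi * \<i>"
  using assms by (simp_all add: degree_lift_def)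

lemma has_degrees_square_maps:
  assumes "has_degrees \<gamma> w"
  shows "\<gamma> \<in> square_maps T\<^sub>D b"
proof -
  obtain g \<phi> where dl: "degree_lift \<gamma> w g \<phi>" using assms unfolding has_degrees_def by blast
  note g = degree_liftD[OF dl]
  have "continuous_map (top_of_set unit_square) T\<^sub>D (\<lambda>z. orbit (g z))"
    by (intro continuous_map_orbit g(1,2))
  then have "continuous_map (top_of_set unit_square) T\<^sub>D \<gamma>"
    by (rule continuous_map_eq) (simp add: g(3))
  moreover have "\<gamma> z = b" if z: "z \<in> square_boundary" for z
  proof -
    have "g z \<in> block_mats lev"
      using z g(4-7) block_mats_1 by (cases z) (auto simp: mem_square_boundary)
    then show ?thesis using z square_boundary_subset g(3)[of z] by (auto simp: orbit_block)
  qed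
  ultimately show ?thesis by (simp add: square_maps_iff)
qed

lemma frame_lift:
  assumes \<gamma>: "\<gamma> \<in> square_maps T\<^sub>D b"
  obtains g where "continuous_on unit_square g"
    "\<And>z. z \<in> unit_square \<Longrightarrow> g z \<in> frames \<and> \<gamma> z = orbit (g z)"
    "\<And>t. t \<in> {0..1} \<Longrightarrow> g (0, t) = mat 1 \<and> g (1, t) \<in> block_mats lev"
    "\<And>s. s \<in> {0..1} \<Longrightarrow> g (s, 0) = mat 1 \<and> g (s, 1) = mat 1"
proof -
  have bd: "\<gamma> z = b" if "z \<in> square_boundary" for z using \<gamma> that by (simp add: square_maps_iff)
  have \<gamma>D: "\<gamma> z \<in> D" if "z \<in> unit_square" for z
    using \<gamma> that unfolding square_maps_iff continuous_map_def topspace_T\<^sub>D by auto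
  have pc: "continuous_on unit_square (\<lambda>z. level_proj i (\<gamma> z))" for i
    using continuous_map_compose[OF _ continuous_map_level_proj, of "top_of_set unit_square" \<gamma> i] \<gamma>
    by (simp add: square_maps_iff o_def)
  text \<open>\<open>\<tau> s s' t\<close> maps the \<open>i\<close>-th graded piece of \<open>\<gamma> (s, t)\<close> to that of \<open>\<gamma> (s', t)\<close>.\<close>
  define \<tau> where "\<tau> s s' t = (\<Sum>i\<le>k. level_proj i (\<gamma> (s', t)) ** level_proj i (\<gamma> (s, t)))" for s s' t
  have \<tau>_same: "\<tau> s s' t = mat 1" if "(s, t) \<in> unit_square" "\<gamma> (s', t) = \<gamma> (s, t)" for s s' t
    using that by (simp add: \<tau>_def level_proj_mult[OF \<gamma>D] sum_level_proj[OF \<gamma>D])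
  \<comment> \<open>\<open>A\<close> carries the graded pieces of the base flag to those of
    \<open>\<gamma> (s, t)\<close>. On the sides t = 0 and t = 1 the map is constantly
    \<open>b\<close>, and there the lift is kept equal to the identity.\<close>
  define P where "P s t A \<longleftrightarrow> invertible A \<and>
      (\<forall>i\<le>k. level_proj i (\<gamma> (s, t)) ** A = A ** level_proj i b) \<and> (t \<in> {0, 1} \<longrightarrow> A = mat 1)"
    for s t :: real and A
  obtain A where A: "continuous_on ({0..1} \<times> {0..1}) A" "\<And>t. t \<in> {0..1} \<Longrightarrow> A (0, t) = mat 1"
    "\<And>s t. s \<in> {0..1} \<Longrightarrow> t \<in> {0..1} \<Longrightarrow> P s t (A (s, t))"
  proof (rule path_lifting[of "{0..1}" \<tau> P])
    show "continuous_on ({0..1} \<times> {0..1} \<times> {0..1}) (\<lambda>x. \<tau> (fst x) (fst (snd x)) (snd (snd x)))"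
      unfolding \<tau>_def
      by (intro continuous_intros continuous_on_compose2[OF pc]) (auto simp: unit_square_def)
    show "\<tau> s s t = mat 1" if "s \<in> {0..1}" "t \<in> {0..1}" for s t
      using that by (intro \<tau>_same) (auto simp: unit_square_def)
    show "P 0 t (mat 1)" if "t \<in> {0..1}" for t
      using that bd[of "(0, t)"] by (simp add: P_def invertible_mat_1 mem_square_boundary)
    fix s s' t A
    assume st: "s \<in> {0..1}" "s' \<in> {0..1}" "t \<in> {0..1}" and A: "P s t A" and inv: "invertible (\<tau> s s' t)"
    have in_sq: "(s, t) \<in> unit_square" "(s', t) \<in> unit_square" using st by (auto simp: unit_square_def)
    have 1: "level_proj i (\<gamma> (s', t)) ** \<tau> s s' t = \<tau> s s' t ** level_proj i (\<gamma> (s, t))" if "i \<le> k" for i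
    proof -
      have "level_proj i (\<gamma> (s', t)) ** \<tau> s s' t =
         (\<Sum>j\<le>k. if j = i then level_proj i (\<gamma> (s', t)) ** level_proj i (\<gamma> (s, t)) else 0)"
        unfolding \<tau>_def matrix_mult_sum matrix_mul_assoc level_proj_mult[OF \<gamma>D[OF in_sq(2)]]
        by (intro sum.cong) (auto simp: matrix_matrix_mult_def zero_vec_def)
      also have "\<dots> = \<tau> s s' t ** level_proj i (\<gamma> (s, t))"
        unfolding \<tau>_def matrix_mult_sum matrix_mul_assoc[symmetric] level_proj_mult[OF \<gamma>D[OF in_sq(1)]]
        by (intro sum.cong) (auto simp: matrix_matrix_mult_def zero_vec_def)
      finally show ?thesis .
    qed
    have 2: "level_proj i (\<gamma> (s', t)) ** (\<tau> s s' t ** A) = (\<tau> s s' t ** A) ** level_proj i b" if i: "i \<le> k" for i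
    proof -
      have "level_proj i (\<gamma> (s', t)) ** (\<tau> s s' t ** A) = \<tau> s s' t ** (level_proj i (\<gamma> (s, t)) ** A)"
        by (simp add: matrix_mul_assoc 1[OF i])
      also have "level_proj i (\<gamma> (s, t)) ** A = A ** level_proj i b" using A i by (simp add: P_def)
      finally show ?thesis by (simp add: matrix_mul_assoc)
    qed
    have 3: "\<tau> s s' t ** A = mat 1" if "t \<in> {0, 1}"
    proof -
      have "(s, t) \<in> square_boundary" "(s', t) \<in> square_boundary"
        using that st by (auto simp: mem_square_boundary)
      then have "\<tau> s s' t = mat 1" using in_sq by (intro \<tau>_same) (auto simp: bd)
      with A that show ?thesis by (auto simp: P_def)
    qed
    show "P s' t (\<tau> s s' t ** A)"
      using A inv 2 3 by (simp add: P_def invertible_mult)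
  qed (use that in auto)
  \<comment> \<open>\<open>A\<close> acts on the fibre itself; conjugation by \<open>M\<close>
    passes to the coordinates in which the form is \<open>split_form Q\<close>.\<close>
  define g where "g z = matrix_inv M ** A z ** M" for z
  have Mg: "M ** g z = A z ** M" for z
    by (simp add: g_def matrix_mul_assoc matrix_inv_right M_inv)
  \<comment> \<open>The intertwining of projections says that \<open>A (s, t) ** M\<close> and any
    adapted frame of \<open>\<gamma> (s, t)\<close> differ by a matrix commuting with all
    \<open>lev_diag\<close>, hence by a level block matrix.\<close>
  have key: "\<exists>u. u \<in> block_mats lev \<and> A (s, t) ** M = N ** u"
    if st: "s \<in> {0..1}" "t \<in> {0..1}" and N: "adapted N (\<gamma> (s, t))" for s t N
  proof -
    note PA = A(3)[OF st, unfolded P_def]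
    note iN = adaptedD(1)[OF N]
    define u where "u = matrix_inv N ** A (s, t) ** M"
    have u: "A (s, t) ** M = N ** u"
      by (simp add: u_def matrix_mul_assoc matrix_inv_right iN)
    have "u ** lev_diag i = lev_diag i ** u" if i: "i \<le> k" for i
    proof -
      have "(N ** lev_diag i ** matrix_inv N) ** A (s, t) = A (s, t) ** (M ** lev_diag i ** matrix_inv M)"
        using PA i by (simp add: level_proj_eq[OF N] level_proj_eq[OF adapted_M])
      then have "matrix_inv N ** ((N ** lev_diag i ** matrix_inv N) ** A (s, t)) ** M
         = matrix_inv N ** (A (s, t) ** (M ** lev_diag i ** matrix_inv M)) ** M" by simp
      moreover have "matrix_inv N ** ((N ** lev_diag i ** matrix_inv N) ** A (s, t)) ** M = lev_diag i ** u"
        by (simp add: u_def matrix_mul_assoc matrix_inv_left iN)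
      moreover have "matrix_inv N ** (A (s, t) ** (M ** lev_diag i ** matrix_inv M)) ** M
          = u ** lev_diag i ** (matrix_inv M ** M)"
        by (simp add: u_def matrix_mul_assoc)
      ultimately show ?thesis by (simp add: matrix_inv_left M_inv)
    qed
    note comm = this
    have "u $ a $ c = 0" if "lev a \<noteq> lev c" for a c
      using arg_cong[OF comm[OF lev_le[of a]], of "\<lambda>m. m $ a $ c"] that
      by (simp add: lev_diag_mult)
    moreover have "invertible u"
      unfolding u_def using PA by (intro invertible_mult invertible_matrix_inv iN M_inv) auto
    ultimately have "u \<in> block_mats lev" by (simp add: block_mats_def)
    with u show ?thesis by blast
  qed
  have g_frames: "g (s, t) \<in> frames \<and> \<gamma> (s, t) = orbit (g (s, t))" if st: "s \<in> {0..1}" "t \<in> {0..1}" for s t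
  proof -
    have "(s, t) \<in> unit_square" using st by (simp add: unit_square_def)
    then obtain N where N: "adapted N (\<gamma> (s, t))" using adapted_ex[OF \<gamma>D] by blast
    obtain u where u: "u \<in> block_mats lev" "A (s, t) ** M = N ** u" using key[OF st N] by blast
    have form: "split_form Q (g (s, t) *v x) (g (s, t) *v y) =
       (\<Sum>j\<in>UNIV. (u *v x) $ j * cnj ((u *v y) $ j) * H (column j N) (column j N))" for x y
    proof -
      have "split_form Q (g (s, t) *v x) (g (s, t) *v y) = H ((M ** g (s, t)) *v x) ((M ** g (s, t)) *v y)"
        by (simp add: M_form flip: matrix_vector_mul_assoc)
      also have "\<dots> = H (N *v (u *v x)) (N *v (u *v y))"
        unfolding Mg u(2) by (simp add: matrix_vector_mul_assoc)
      finally show ?thesis by (simp add: adapted_form[OF N])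
    qed
    have uP: "u \<in> block_mats (\<lambda>i. i \<in> Q)" using u(1) lev_block_parity by blast
    note rs = parity_block_restrict[OF uP]
    have u0: "u *v x \<noteq> 0" if "x \<noteq> 0" for x
      using invertible_kernelD[OF block_matsD(1)[OF u(1)]] that by blast
    have re: "Re (z * cnj z * c) = (cmod z)\<^sup>2 * Re c" for z c :: complex
      by (simp flip: complex_norm_square of_real_power)
    have "g (s, t) \<in> frames"
      unfolding split_frames_def
    proof (intro CollectI allI impI conjI)
      fix x y :: "complex^'n" assume x: "restrict_vec Q x = x" and y: "restrict_vec (- Q) y = y"
      have ux: "restrict_vec Q (u *v x) = u *v x" and uy: "restrict_vec (- Q) (u *v y) = u *v y"
        using rs(1)[of x] rs(2)[of y] x y by simp_all
      have ux0: "(u *v x) $ j = 0" if "j \<notin> Q" for j using ux that by (metis restrict_vec_nth)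
      have uy0: "(u *v y) $ j = 0" if "j \<in> Q" for j using uy that by (metis restrict_vec_nth ComplD)
      have "(u *v x) $ j * cnj ((u *v y) $ j) * H (column j N) (column j N) = 0" for j
        using ux0[of j] uy0[of j] by (cases "j \<in> Q") auto
      then show "split_form Q (g (s, t) *v x) (g (s, t) *v y) = 0"
        unfolding form by (intro sum.neutral) auto
      { assume "x \<noteq> 0"
        then obtain l where l: "(u *v x) $ l \<noteq> 0" using u0 by (metis vec_eq_iff zero_index)
        then have "l \<in> Q" using ux0 by blast
        show "0 < Re (split_form Q (g (s, t) *v x) (g (s, t) *v x))"
          unfolding form Re_sum re
        proof (rule sum_pos2[of _ l])
          show "0 < (cmod ((u *v x) $ l))\<^sup>2 * Re (H (column l N) (column l N))"
            using adaptedD(4)[OF N, of l] \<open>l \<in> Q\<close> l by (simp add: Q_def minus_one_power_iff)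
          show "0 \<le> (cmod ((u *v x) $ j))\<^sup>2 * Re (H (column j N) (column j N))" for j
            using adaptedD(4)[OF N, of j] ux0[of j] by (cases "j \<in> Q") (auto simp: Q_def minus_one_power_iff)
        qed auto }
      { assume "y \<noteq> 0"
        then obtain l where l: "(u *v y) $ l \<noteq> 0" using u0 by (metis vec_eq_iff zero_index)
        then have "l \<notin> Q" using uy0 by blast
        have "0 < (\<Sum>j\<in>UNIV. - ((cmod ((u *v y) $ j))\<^sup>2 * Re (H (column j N) (column j N))))"
        proof (rule sum_pos2[of _ l])
          show "0 < - ((cmod ((u *v y) $ l))\<^sup>2 * Re (H (column l N) (column l N)))"
            using adaptedD(4)[OF N, of l] \<open>l \<notin> Q\<close> l by (simp add: Q_def minus_one_power_iff mult_pos_neg)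
          show "0 \<le> - ((cmod ((u *v y) $ j))\<^sup>2 * Re (H (column j N) (column j N)))" for j
            using adaptedD(4)[OF N, of j] uy0[of j]
            by (cases "j \<in> Q") (auto simp: Q_def minus_one_power_iff mult_nonneg_nonpos)
        qed auto
        then show "Re (split_form Q (g (s, t) *v y) (g (s, t) *v y)) < 0"
          unfolding form Re_sum re sum_negf by simp }
    qed
    moreover have "\<gamma> (s, t) = orbit (g (s, t))"
    proof -
      have "orbit (g (s, t)) = flag_act N (flag_act u std_flag)"
        unfolding orbit_def Mg u(2) flag_act_mult ..
      then show ?thesis by (simp add: flag_act_block[OF u(1)] adaptedD(2)[OF N, symmetric])
    qed
    ultimately show ?thesis ..
  qed
  have g1: "g (1, t) \<in> block_mats lev" if t: "t \<in> {0..1}" for t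
  proof -
    have "\<gamma> (1, t) = b" using t by (intro bd) (auto simp: mem_square_boundary)
    then obtain u where u: "u \<in> block_mats lev" "A (1, t) ** M = M ** u"
      using key[of 1 t M] t adapted_M by auto
    have "g (1, t) = u"
      by (simp add: g_def u(2) matrix_inv_left M_inv matrix_mul_assoc flip: matrix_mul_assoc[of "matrix_inv M" "A (1, t)" M])
    with u show ?thesis by simp
  qed
  have gid: "g z = mat 1" if "A z = mat 1" for z
    by (simp add: g_def that matrix_inv_left M_inv)
  show ?thesis
  proof (rule that[of g])
    show "continuous_on unit_square g"
      unfolding g_def unit_square_def by (intro continuous_intros A(1))
    show "g z \<in> frames \<and> \<gamma> z = orbit (g z)" if "z \<in> unit_square" for z
      using g_frames that by (cases z) (auto simp: unit_square_def)
    show "g (0, t) = mat 1 \<and> g (1, t) \<in> block_mats lev" if "t \<in> {0..1}" for t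
      using A(2)[OF that] g1[OF that] by (auto intro: gid)
    show "g (s, 0) = mat 1 \<and> g (s, 1) = mat 1" if "s \<in> {0..1}" for s
      using A(3)[OF that, of 0] A(3)[OF that, of 1] by (auto intro!: gid simp: P_def)
  qed
qed

end

text \<open>Radial projection from the point \<open>(2, 1/2)\<close> retracts the unit square onto the union of the
  sides \<open>s = 0\<close>, \<open>t = 0\<close> and \<open>t = 1\<close>.\<close>

definition retract_three_sides :: "real \<times> real \<Rightarrow> real \<times> real" where
  "retract_three_sides = (\<lambda>(s, t). let c = max ((2 - s) / 2) \<bar>2 * t - 1\<bar> in
     (2 - (2 - s) / c, 1/2 + (t - 1/2) / c))"

lemma continuous_on_retract_three_sides: "continuous_on unit_square retract_three_sides"
proof -
  have "max ((2 - fst z) / 2) \<bar>2 * snd z - 1\<bar> \<noteq> 0" if "z \<in> unit_square" for z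
  proof -
    have "(2 - fst z) / 2 > 0" using that by (auto simp: unit_square_def)
    then show ?thesis by linarith
  qed
  then show ?thesis
    unfolding retract_three_sides_def case_prod_unfold Let_def by (intro continuous_intros) auto
qed

text \<open>Moving outwards from (2, 1/2), the ray meets s = 0 at scale (2 - s) / 2 and one of t =
  0, t = 1 at scale \<open>\<bar>2 * t - 1\<bar>\<close>. The larger scale is the point that is met
  earlier, so the image stays in the square.\<close>

lemma retract_three_sides:
  assumes "(s, t) \<in> unit_square"
  obtains s' t' where "retract_three_sides (s, t) = (s', t')" "(s', t') \<in> unit_square"
    "s' = 0 \<or> t' = 0 \<or> t' = 1"
proof -
  let ?c = "max ((2 - s) / 2) \<bar>2 * t - 1\<bar>"
  have st: "0 \<le> s" "s \<le> 1" "0 \<le> t" "t \<le> 1" using assms by (auto simp: mem_unit_square)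
  have c: "?c > 0" "?c \<le> 1" "(2 - s) / 2 \<le> ?c" "\<bar>2 * t - 1\<bar> \<le> ?c"
    using st by (auto simp: max_def abs_if)
  have 1: "(2 - s) / ?c \<le> 2"
  proof -
    have "2 - s \<le> 2 * m" if "(2 - s) / 2 \<le> m" for m using that by simp
    from this[OF c(3)] have "2 - s \<le> 2 * ?c" .
    then show ?thesis by (simp only: pos_divide_le_eq[OF c(1)])
  qed
  have 2: "1 \<le> (2 - s) / ?c"
  proof -
    have "?c \<le> 2 - s" using c(2) st by linarith
    then show ?thesis using c(1) by (simp add: le_divide_eq)
  qed
  have 3: "\<bar>(t - 1/2) / ?c\<bar> \<le> 1/2"
  proof -
    have "\<bar>t - 1/2\<bar> \<le> 1/2 * m" if "\<bar>2 * t - 1\<bar> \<le> m" for m using that by linarith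
    from this[OF c(4)] have "\<bar>t - 1/2\<bar> \<le> 1/2 * ?c" .
    then show ?thesis using c(1) by (simp add: abs_divide divide_le_eq)
  qed
  have "(2 - s) / ?c = 2 \<or> \<bar>2 * t - 1\<bar> = ?c"
    using c(1) by (cases "(2 - s) / 2 \<le> \<bar>2 * t - 1\<bar>") (auto simp: max_def field_simps)
  moreover have "1/2 + (t - 1/2) / ?c = 0 \<or> 1/2 + (t - 1/2) / ?c = 1" if "\<bar>2 * t - 1\<bar> = ?c"
  proof -
    have "1/2 + x / m = 0 \<or> 1/2 + x / m = 1" if "2 * \<bar>x\<bar> = m" "m > 0" for x m :: real
    proof -
      have "x = m / 2 \<or> x = - m / 2" using that(1) by linarith
      then show ?thesis using that(2) by auto
    qed
    moreover have "2 * \<bar>t - 1/2\<bar> = \<bar>2 * t - 1\<bar>" by (simp add: abs_if)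
    ultimately show ?thesis using that c(1) by metis
  qed
  ultimately have "2 - (2 - s) / ?c = 0 \<or> 1/2 + (t - 1/2) / ?c = 0 \<or> 1/2 + (t - 1/2) / ?c = 1"
    by linarith
  moreover have "(2 - (2 - s) / ?c, 1/2 + (t - 1/2) / ?c) \<in> unit_square"
    unfolding mem_unit_square using 1 2 3 by (intro conjI; linarith)
  moreover have "retract_three_sides (s, t) = (2 - (2 - s) / ?c, 1/2 + (t - 1/2) / ?c)"
    by (simp add: retract_three_sides_def Let_def)
  ultimately show ?thesis by (intro that)
qed

lemma retract_three_sides_id:
  assumes "(s, t) \<in> unit_square" "s = 0 \<or> t = 0 \<or> t = 1"
  shows "retract_three_sides (s, t) = (s, t)"
proof -
  have "max ((2 - s) / 2) \<bar>2 * t - 1\<bar> = 1"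
    using assms by (auto simp: mem_unit_square max_def abs_if)
  then show ?thesis by (simp add: retract_three_sides_def)
qed

lemma homotopic_with_loopE:
  assumes "homotopic_with (\<lambda>f. \<forall>t\<in>{0, 1}. f t = c) (top_of_set {0..1::real}) (top_of_set G) f g"
  obtains H :: "real \<times> real \<Rightarrow> 'a::topological_space" where "continuous_on ({0..1} \<times> {0..1}) H"
    "\<And>u t. u \<in> {0..1} \<Longrightarrow> t \<in> {0..1} \<Longrightarrow> H (u, t) \<in> G"
    "\<And>t. H (0, t) = f t" "\<And>t. H (1, t) = g t"
    "\<And>u. u \<in> {0..1} \<Longrightarrow> H (u, 0) = c" "\<And>u. u \<in> {0..1} \<Longrightarrow> H (u, 1) = c"
proof (rule rel_homotopyE[OF assms], goal_cases)
  case (1 H)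
  then show ?case by (intro that[of H]) auto
qed

section \<open>Winding numbers determine the class\<close>

context based_period_frames
begin

lemma has_degreesI:
  assumes "continuous_on unit_square g"
    "\<And>z. z \<in> unit_square \<Longrightarrow> g z \<in> frames" "\<And>z. z \<in> unit_square \<Longrightarrow> \<gamma> z = orbit (g z)"
    "\<And>t. t \<in> {0..1} \<Longrightarrow> g (0, t) = mat 1" "\<And>t. t \<in> {0..1} \<Longrightarrow> g (1, t) \<in> block_mats lev"
    "\<And>s. s \<in> {0..1} \<Longrightarrow> g (s, 0) = mat 1" "\<And>s. s \<in> {0..1} \<Longrightarrow> g (s, 1) = mat 1"
    "\<And>i. continuous_on {0..1} (\<phi> i)"
    "\<And>i t. t \<in> {0..1} \<Longrightarrow> block_det (lev -` {i}) (g (1, t)) = exp (\<phi> i t)"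
    "\<And>i. \<phi> i 0 = 0" "\<And>i. \<phi> i 1 = 2 * of_int (w i) * of_real pi * \<i>"
  shows "has_degrees \<gamma> w"
proof -
  have "degree_lift \<gamma> w g \<phi>" using assms by (simp add: degree_lift_def)
  then show ?thesis by (auto simp: has_degrees_def)
qed

lemma degrees_ex:
  assumes "\<gamma> \<in> square_maps T\<^sub>D b"
  obtains w where "has_degrees \<gamma> w"
proof -
  obtain g where g: "continuous_on unit_square g"
    "\<And>z. z \<in> unit_square \<Longrightarrow> g z \<in> frames \<and> \<gamma> z = orbit (g z)"
    "\<And>t. t \<in> {0..1} \<Longrightarrow> g (0, t) = mat 1 \<and> g (1, t) \<in> block_mats lev"
    "\<And>s. s \<in> {0..1} \<Longrightarrow> g (s, 0) = mat 1 \<and> g (s, 1) = mat 1"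
  proof (rule frame_lift[OF assms], goal_cases)
    case (1 g)
    then show ?case by (intro that[of g])
  qed
  have "\<exists>\<phi> n. continuous_on {0..1} \<phi> \<and> (\<forall>t\<in>{0..1}. block_det (lev -` {i}) (g (1, t)) = exp (\<phi> t)) \<and>
        \<phi> 0 = 0 \<and> \<phi> 1 = 2 * of_int n * of_real pi * \<i>" for i
  proof -
    have c: "continuous_on {0..1} (\<lambda>t. block_det (lev -` {i}) (g (1, t)))"
      by (intro continuous_intros continuous_on_compose2[OF g(1)]) (auto simp: unit_square_def)
    have nz: "block_det (lev -` {i}) (g (1, t)) \<noteq> 0" if "t \<in> {0..1}" for t
      using g(3)[OF that] by (intro block_det_inv(1)) auto
    obtain \<psi> where \<psi>: "continuous_on {0..1} \<psi>"
      "\<And>t. t \<in> {0..1} \<Longrightarrow> block_det (lev -` {i}) (g (1, t)) = exp (\<psi> t)"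
      using convex_logarithm[OF convex_real_interval(5) c nz] by blast
    have e: "exp (\<psi> 0) = 1" "exp (\<psi> 1) = 1"
      using \<psi>(2)[of 0] \<psi>(2)[of 1] g(4)[of 1] by auto
    then have "exp (\<psi> 1) = exp (\<psi> 0)" by simp
    then obtain n :: int where n: "\<psi> 1 = \<psi> 0 + of_real (real_of_int (2 * n) * pi) * \<i>"
      using exp_eq[of "\<psi> 1" "\<psi> 0"] by auto
    show ?thesis
    proof (intro exI conjI ballI)
      show "continuous_on {0..1} (\<lambda>t. \<psi> t - \<psi> 0)" by (intro continuous_intros \<psi>)
      show "block_det (lev -` {i}) (g (1, t)) = exp (\<psi> t - \<psi> 0)" if "t \<in> {0..1}" for t
        by (simp only: \<psi>(2)[OF that] exp_diff e(1) div_by_1)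
      show "\<psi> 1 - \<psi> 0 = 2 * of_int n * of_real pi * \<i>" by (simp add: n)
    qed simp
  qed
  then obtain \<phi> w where "\<And>i. continuous_on {0..1} (\<phi> i) \<and> (\<forall>t\<in>{0..1}. block_det (lev -` {i}) (g (1, t)) = exp (\<phi> i t)) \<and>
        \<phi> i 0 = 0 \<and> \<phi> i 1 = 2 * of_int (w i) * of_real pi * \<i>" by metis
  note \<phi> = this
  have "has_degrees \<gamma> w"
  proof (rule has_degreesI[of g \<gamma> \<phi> w])
    show "continuous_on unit_square g" by (rule g(1))
  qed (use g(2-) \<phi> in blast)+
  then show ?thesis by (rule that)
qed

text \<open>The determinant of a whole parity block is nonzero on every frame, so over the square it
  is a homotopy from the constant loop on s = 0 to its loop on s = 1. There it is the product of the
  level determinants, whose winding numbers add up.\<close>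

lemma degrees_sum:
  assumes "has_degrees \<gamma> w" and S: "S = Q \<and> I = {i. i \<le> k \<and> even i} \<or> S = - Q \<and> I = {i. i \<le> k \<and> odd i}"
  shows "(\<Sum>i\<in>I. w i) = 0"
proof -
  obtain g \<phi> where dl: "degree_lift \<gamma> w g \<phi>" using assms(1) unfolding has_degrees_def by blast
  note g = degree_liftD(1-7)[OF dl] and \<phi> = degree_liftD(8-11)[OF dl]
  have SI: "S = lev -` I" "finite I" using S lev_le by (auto simp: Q_def)
  have c: "continuous_on ({0..1} \<times> {0..1}) (\<lambda>x. block_det S (g x))"
    by (intro continuous_intros g(1)[unfolded unit_square_def])
  have nz: "block_det S (g x) \<noteq> 0" if "x \<in> {0..1} \<times> {0..1}" for x
    using S split_frames_block_det[OF g(2), of x] that by (auto simp: unit_square_def)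
  obtain \<psi> where \<psi>: "continuous_on {0..1} \<psi>" "\<And>t. t \<in> {0..1} \<Longrightarrow> block_det S (g (1, t)) = exp (\<psi> t)"
    "\<psi> 0 = 0" "\<psi> 1 = 0"
  proof (rule winding_homotopy[OF c nz, where \<phi> = "\<lambda>_. 0"])
  qed (use g that in auto)
  have e: "exp (\<psi> t) = exp (\<Sum>i\<in>I. \<phi> i t)" if t: "t \<in> {0..1}" for t
    using \<psi>(2)[OF t] block_det_prod[OF g(5)[OF t] SI(2)] \<phi>(2)[OF t] by (simp add: SI exp_sum)
  have "continuous_on {0..1} (\<lambda>t. \<Sum>i\<in>I. \<phi> i t)" by (intro continuous_intros \<phi>)
  from log_unique[OF _ \<psi>(1) this e]
  obtain n :: int where n: "\<forall>t\<in>{0..1}. \<psi> t = (\<Sum>i\<in>I. \<phi> i t) + 2 * of_int n * of_real pi * \<i>" by auto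
  then have "n = 0" using bspec[OF n, of 0] \<psi>(3) \<phi>(3) by simp
  with bspec[OF n, of 1] \<psi>(4) have "0 = (\<Sum>i\<in>I. 2 * of_int (w i) * of_real pi * \<i>)" by (simp add: \<phi>(4))
  also have "\<dots> = of_int (\<Sum>i\<in>I. w i) * (2 * of_real pi * \<i>)"
    unfolding of_int_sum sum_distrib_right by (intro sum.cong) auto
  finally have "of_int (\<Sum>i\<in>I. w i) = (0 :: complex)" by (simp del: of_int_sum)
  then show ?thesis by (simp only: of_int_eq_0_iff)
qed

lemma degrees_beyond:
  assumes "has_degrees \<gamma> w" "i > k"
  shows "w i = 0"
proof -
  obtain g \<phi> where dl: "degree_lift \<gamma> w g \<phi>" using assms(1) unfolding has_degrees_def by blast
  note g = degree_liftD(1-7)[OF dl] and \<phi> = degree_liftD(8-11)[OF dl]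
  have "lev -` {i} = {}" using assms(2) lev_le by (metis disjoint_iff_not_equal less_le_not_le vimage_singleton_eq all_not_in_conv)
  then have e: "exp (\<phi> i t) = exp 0" if "t \<in> {0..1}" for t using \<phi>(2)[OF that, of i] by simp
  from log_unique[OF _ \<phi>(1) continuous_on_const e]
  obtain n :: int where n: "\<forall>t\<in>{0..1}. \<phi> i t = 0 + 2 * of_int n * of_real pi * \<i>" by auto
  from bspec[OF n, of 0] bspec[OF n, of 1] have "\<phi> i 1 = 0" by (simp add: \<phi>(3))
  then show ?thesis by (simp add: \<phi>(4))
qed

lemma continuous_on_concat:
  fixes p :: "'z::topological_space \<Rightarrow> real" and f g :: "'z \<Rightarrow> 'y::topological_space"
  assumes "continuous_on S p" "continuous_on {x\<in>S. p x \<le> 1/2} f" "continuous_on {x\<in>S. 1/2 \<le> p x} g"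
    "\<And>x. x \<in> S \<Longrightarrow> p x = 1/2 \<Longrightarrow> f x = g x"
  shows "continuous_on S (\<lambda>x. if p x \<le> 1/2 then f x else g x)"
  using continuous_map_concat[OF assms(1), of euclidean f g] assms(2-4) by simp

lemma has_degrees_concat:
  assumes "has_degrees \<gamma> w" "has_degrees \<gamma>' w'"
  shows "has_degrees (square_concat \<gamma> \<gamma>') (\<lambda>i. w i + w' i)"
proof -
  obtain g \<phi> where dl: "degree_lift \<gamma> w g \<phi>" using assms(1) unfolding has_degrees_def by blast
  note g = degree_liftD(1-7)[OF dl] and \<phi> = degree_liftD(8-11)[OF dl]
  obtain g' \<phi>' where dl': "degree_lift \<gamma>' w' g' \<phi>'" using assms(2) unfolding has_degrees_def by blast
  note g' = degree_liftD(1-7)[OF dl'] and \<phi>' = degree_liftD(8-11)[OF dl']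
  \<comment> \<open>The second lift is multiplied on the right by the loop in which the first one
    ends, so that the halves match at s = 1/2. This does not change the flags, since the loop
    consists of level block matrices.\<close>
  define h where "h = (\<lambda>x. if fst x \<le> 1/2 then g (2 * fst x, snd x) else g' (2 * fst x - 1, snd x) ** g (1, snd x))"
  show ?thesis
  proof (rule has_degreesI[of h _ "\<lambda>i t. \<phi> i t + \<phi>' i t"])
    show "continuous_on unit_square h"
      unfolding h_def
    proof (rule continuous_on_concat)
      show "continuous_on {x \<in> unit_square. fst x \<le> 1/2} (\<lambda>x. g (2 * fst x, snd x))"
        by (rule continuous_on_compose2[OF g(1)]) (auto intro!: continuous_intros simp: unit_square_def)
      show "continuous_on {x \<in> unit_square. 1/2 \<le> fst x} (\<lambda>x. g' (2 * fst x - 1, snd x) ** g (1, snd x))"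
        by (intro continuous_intros continuous_on_compose2[OF g(1)] continuous_on_compose2[OF g'(1)])
           (auto simp: unit_square_def)
      fix x :: "real \<times> real" assume "x \<in> unit_square" "fst x = 1/2"
      then obtain t where "x = (1/2, t)" "t \<in> {0..1}" by (cases x) (auto simp: unit_square_def)
      then show "g (2 * fst x, snd x) = g' (2 * fst x - 1, snd x) ** g (1, snd x)"
        by (simp add: g'(4))
    qed (intro continuous_intros)
    fix z :: "real \<times> real" assume "z \<in> unit_square"
    then obtain s t where z: "z = (s, t)" "0 \<le> s" "s \<le> 1" "0 \<le> t" "t \<le> 1" by (auto simp: unit_square_def)
    show "h z \<in> frames"
      using z g(2) g'(2) g(5) by (auto simp: h_def unit_square_def intro!: frames_mult_block)
    show "square_concat \<gamma> \<gamma>' z = orbit (h z)"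
      using z g(3) g'(3) g(5) by (auto simp: h_def square_concat_def unit_square_def orbit_mult_block)
  next
    fix i and t :: real assume t: "t \<in> {0..1}"
    show "block_det (lev -` {i}) (h (1, t)) = exp (\<phi> i t + \<phi>' i t)"
      using t by (simp add: h_def block_det_mult[OF g'(5)] \<phi>(2) \<phi>'(2) exp_add)
  qed (use g g' in \<open>auto simp: h_def \<phi>(3,4) \<phi>'(3,4) algebra_simps intro!: continuous_intros \<phi>(1) \<phi>'(1) block_mats_mult\<close>)
qed

lemma has_degrees_reverse:
  assumes "has_degrees \<gamma> w"
  shows "has_degrees (square_reverse \<gamma>) (\<lambda>i. - w i)"
proof -
  obtain g \<phi> where dl: "degree_lift \<gamma> w g \<phi>" using assms(1) unfolding has_degrees_def by blast
  note g = degree_liftD(1-7)[OF dl] and \<phi> = degree_liftD(8-11)[OF dl]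
  \<comment> \<open>The inverse of the last-side loop makes the reversed lift start at the identity;
    the loop that remains at s = 1 is the inverse loop, with opposite winding numbers.\<close>
  define h where "h x = g (1 - fst x, snd x) ** matrix_inv (g (1, snd x))" for x
  have inv1: "matrix_inv (mat 1) = (mat 1 :: complex^'n^'n)" by (rule matrix_inv_unique) simp
  show ?thesis
  proof (rule has_degreesI[of h _ "\<lambda>i t. - \<phi> i t"])
    have "invertible (g (1, snd x))" if "x \<in> unit_square" for x
      using that by (intro block_matsD(1)[OF g(5)]) (auto simp: unit_square_def)
    then show "continuous_on unit_square h"
      unfolding h_def
      by (intro continuous_intros continuous_on_compose2[OF g(1)]) (auto simp: unit_square_def)
    fix z :: "real \<times> real" assume "z \<in> unit_square"
    then obtain s t where z: "z = (s, t)" "0 \<le> s" "s \<le> 1" "0 \<le> t" "t \<le> 1" by (auto simp: unit_square_def)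
    show "h z \<in> frames"
      using z g(2,5) by (auto simp: h_def unit_square_def intro!: frames_mult_block block_mats_inv)
    show "square_reverse \<gamma> z = orbit (h z)"
      using z g(3,5) by (auto simp: h_def square_reverse_def unit_square_def orbit_mult_block block_mats_inv)
  next
    fix i and t :: real assume t: "t \<in> {0..1}"
    show "block_det (lev -` {i}) (h (1, t)) = exp (- \<phi> i t)"
      using t by (simp add: h_def g(4) block_det_inv(2)[OF g(5)] \<phi>(2) exp_minus)
    show "h (0, t) = mat 1"
      using t by (simp add: h_def matrix_inv_right block_matsD(1)[OF g(5)])
    show "h (1, t) \<in> block_mats lev"
      using t by (simp add: h_def g(4) block_mats_inv g(5))
  qed (use g in \<open>auto simp: h_def \<phi>(3,4) inv1 intro!: continuous_intros \<phi>(1)\<close>)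
qed

text \<open>The loop on the last side contracts inside the level block matrices. Appending this
  contraction to the lift gives a square of frames that is trivial on all four sides and hence null;
  its flags are \<open>\<gamma>\<close> followed by the constant \<open>b\<close>.\<close>

lemma has_degrees_zero_null:
  assumes "has_degrees \<gamma> (\<lambda>_. 0)"
  shows "square_homotopic T\<^sub>D b \<gamma> (\<lambda>_. b)"
proof -
  obtain g \<phi> where dl: "degree_lift \<gamma> (\<lambda>_. 0) g \<phi>" using assms(1) unfolding has_degrees_def by blast
  note g = degree_liftD(1-7)[OF dl] and \<phi> = degree_liftD(8-11)[OF dl]
  have gc: "continuous_on {0..1} (\<lambda>t. g (1, t))"
    by (rule continuous_on_compose2[OF g(1)]) (auto intro!: continuous_intros simp: unit_square_def)
  have "\<exists>\<phi>. continuous_on {0..1} \<phi> \<and> (\<forall>t\<in>{0..1}. block_det (lev -` {i}) (g (1, t)) = exp (\<phi> t)) \<and> \<phi> 0 = \<phi> 1" for i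
    using \<phi> by (intro exI[of _ "\<phi> i"]) auto
  then have hom: "homotopic_with (\<lambda>f. \<forall>t\<in>{0, 1}. f t = mat 1) (top_of_set {0..1})
     (top_of_set (block_mats lev)) (\<lambda>t. g (1, t)) (\<lambda>_. mat 1)"
    using g(5,6,7) by (intro block_loop_null gc) auto
  obtain H where H: "continuous_on ({0..1::real} \<times> {0..1::real}) H"
    "\<And>u t. u \<in> {0..1} \<Longrightarrow> t \<in> {0..1} \<Longrightarrow> H (u, t) \<in> block_mats lev"
    "\<And>t. H (0, t) = g (1, t)" "\<And>t. H (1, t) = mat 1"
    "\<And>u. u \<in> {0..1} \<Longrightarrow> H (u, 0) = mat 1" "\<And>u. u \<in> {0..1} \<Longrightarrow> H (u, 1) = mat 1"
  proof (rule homotopic_with_loopE[OF hom], goal_cases)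
    case (1 H)
    then show ?case by (intro that[of H])
  qed
  define h where "h = (\<lambda>x. if fst x \<le> 1/2 then g (2 * fst x, snd x) else H (2 * fst x - 1, snd x))"
  have "homotopic_with (\<lambda>f. \<forall>z\<in>square_boundary. f z = mat 1) (top_of_set unit_square)
     (top_of_set frames) h (\<lambda>_. mat 1)"
  proof (rule split_frames_sphere_null)
    show "continuous_on unit_square h"
      unfolding h_def
    proof (rule continuous_on_concat)
      show "continuous_on {x \<in> unit_square. fst x \<le> 1/2} (\<lambda>x. g (2 * fst x, snd x))"
        by (rule continuous_on_compose2[OF g(1)]) (auto intro!: continuous_intros simp: unit_square_def)
      show "continuous_on {x \<in> unit_square. 1/2 \<le> fst x} (\<lambda>x. H (2 * fst x - 1, snd x))"
        by (rule continuous_on_compose2[OF H(1)]) (auto intro!: continuous_intros simp: unit_square_def)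
      fix x :: "real \<times> real" assume "fst x = 1/2"
      then obtain t where "x = (1/2, t)" by (cases x) auto
      then show "g (2 * fst x, snd x) = H (2 * fst x - 1, snd x)" by (simp add: H(3))
    qed (intro continuous_intros)
    show "h z \<in> frames" if "z \<in> unit_square" for z
      using that g(2) H(2) by (cases z) (auto simp: h_def unit_square_def intro!: block_in_frames)
    show "h z = mat 1" if "z \<in> square_boundary" for z
      using that g H by (cases z) (auto simp: h_def mem_square_boundary)
  qed
  from square_homotopic_orbit[OF this]
  have 1: "square_homotopic T\<^sub>D b (\<lambda>z. orbit (h z)) (\<lambda>_. b)" by (simp add: orbit_block[OF block_mats_1])
  have "square_homotopic T\<^sub>D b (\<lambda>z. orbit (h z)) (square_concat \<gamma> (\<lambda>_. b))"
  proof (rule square_homotopic_cong[OF square_homotopic_imp_square_maps(1)[OF 1]])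
    fix z :: "real \<times> real" assume "z \<in> unit_square"
    then obtain s t where z: "z = (s, t)" "0 \<le> s" "s \<le> 1" "0 \<le> t" "t \<le> 1" by (auto simp: unit_square_def)
    show "square_concat \<gamma> (\<lambda>_. b) z = orbit (h z)"
      using z g(3) H(2) by (auto simp: h_def square_concat_def unit_square_def orbit_block)
  qed
  moreover have "square_homotopic T\<^sub>D b (square_concat \<gamma> (\<lambda>_. b)) \<gamma>"
    by (rule square_concat_const_right[OF has_degrees_square_maps[OF assms]])
  ultimately show ?thesis
    using 1 by (blast intro: square_homotopic_trans square_homotopic_sym)
qed

text \<open>Degrees add under concatenation, so the reverse of \<open>\<delta>\<close> followed by
  \<open>\<gamma>\<close> has all degrees 0 and is null.\<close>

lemma has_degrees_unique_class:
  assumes "has_degrees \<gamma> w" "has_degrees \<delta> w"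
  shows "pi2_class T\<^sub>D b \<gamma> = pi2_class T\<^sub>D b \<delta>"
proof -
  note sm = has_degrees_square_maps[OF assms(1)] has_degrees_square_maps[OF assms(2)]
  have b: "b \<in> topspace T\<^sub>D" by (simp add: topspace_T\<^sub>D b_in_D)
  interpret G: group "pi2 T\<^sub>D b" by (rule group_pi2[OF b])
  have car: "pi2_class T\<^sub>D b \<gamma> \<in> carrier (pi2 T\<^sub>D b)" "pi2_class T\<^sub>D b \<delta> \<in> carrier (pi2 T\<^sub>D b)"
    using sm by (auto simp: carrier_pi2)
  have "has_degrees (square_concat (square_reverse \<delta>) \<gamma>) (\<lambda>i. - w i + w i)"
    by (intro has_degrees_concat has_degrees_reverse assms)
  then have "square_homotopic T\<^sub>D b (square_concat (square_reverse \<delta>) \<gamma>) (\<lambda>_. b)"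
    by (intro has_degrees_zero_null) simp
  then have "inv\<^bsub>pi2 T\<^sub>D b\<^esub> (pi2_class T\<^sub>D b \<delta>) \<otimes>\<^bsub>pi2 T\<^sub>D b\<^esub> pi2_class T\<^sub>D b \<gamma> = \<one>\<^bsub>pi2 T\<^sub>D b\<^esub>"
    using sm by (simp add: pi2_inv[OF b] pi2_mult square_reverse_in_square_maps one_pi2
        pi2_class_eq_iff square_concat_in_square_maps)
  then show ?thesis
    using car by (metis G.inv_closed G.inv_inv G.inv_equality)
qed

text \<open>An explicitly constructed lift is only block diagonal on the boundary. Right
  multiplication by the inverse of its value at the retracted point trivialises three sides. On the
  fourth it leaves the block determinants relative to those along the retracted path, and these are
  what \<open>\<phi>\<close> measures.\<close>

lemma has_degrees_normalise:
  assumes g: "continuous_on unit_square g" "\<And>z. z \<in> unit_square \<Longrightarrow> g z \<in> frames"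
    "\<And>z. z \<in> unit_square \<Longrightarrow> \<gamma> z = orbit (g z)" "\<And>z. z \<in> square_boundary \<Longrightarrow> g z \<in> block_mats lev"
    and \<phi>: "\<And>i. continuous_on {0..1} (\<phi> i)"
    "\<And>i t. t \<in> {0..1} \<Longrightarrow> block_det (lev -` {i}) (g (1, t)) =
        exp (\<phi> i t) * block_det (lev -` {i}) (g (retract_three_sides (1, t)))"
    "\<And>i. \<phi> i 0 = 0" "\<And>i. \<phi> i 1 = 2 * of_int (w i) * of_real pi * \<i>"
  shows "has_degrees \<gamma> w"
proof -
  have r: "retract_three_sides z \<in> square_boundary" if "z \<in> unit_square" for z
  proof (cases z)
    case (Pair s t)
    with that retract_three_sides[of s t] show ?thesis
      by (metis mem_square_boundary mem_unit_square)
  qed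
  define h where "h z = g z ** matrix_inv (g (retract_three_sides z))" for z
  have bl: "g (retract_three_sides z) \<in> block_mats lev" if "z \<in> unit_square" for z
    using g(4) r[OF that] by blast
  have h1: "h (s, t) = mat 1" if "(s, t) \<in> unit_square" "s = 0 \<or> t = 0 \<or> t = 1" for s t
    using bl[OF that(1)] that by (simp add: h_def retract_three_sides_id matrix_inv_right block_matsD(1))
  show ?thesis
  proof (rule has_degreesI[of h _ \<phi>])
    show "continuous_on unit_square h"
      unfolding h_def
      by (intro continuous_intros g(1) continuous_on_compose2[OF g(1) continuous_on_retract_three_sides])
         (use r square_boundary_subset block_matsD(1)[OF bl] in auto)
    show "h z \<in> frames" "\<gamma> z = orbit (h z)" if "z \<in> unit_square" for z
      using that bl[OF that] by (simp_all add: h_def frames_mult_block block_mats_inv g(2,3) orbit_mult_block)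
    fix i and t :: real assume t: "t \<in> {0..1}"
    have sq: "(1, t) \<in> unit_square" "(1, t) \<in> square_boundary" "(0, t) \<in> unit_square"
      using t by (auto simp: mem_unit_square mem_square_boundary)
    show "h (1, t) \<in> block_mats lev"
      unfolding h_def using sq by (intro block_mats_mult block_mats_inv bl g(4))
    show "block_det (lev -` {i}) (h (1, t)) = exp (\<phi> i t)"
      using block_det_inv[OF bl[OF sq(1)], of "{i}"]
      by (simp add: h_def block_det_mult[OF g(4)[OF sq(2)]] \<phi>(2)[OF t])
    show "h (0, t) = mat 1" using sq by (intro h1) auto
  qed (use \<phi> in \<open>auto intro!: h1 simp: mem_unit_square\<close>)
qed

text \<open>\<open>W\<close>, the set of degree functions attained in the generated subgroup, is
  closed under integer combinations. The generator at \<open>j\<close> removes the lowest nonzero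
  entry of a degree function at the expense of entry \<open>j + 2\<close>, so induction on the
  lowest entry shows that all admissible degree functions lie in \<open>W\<close>.\<close>

lemma generate_pi2:
  assumes S: "S \<subseteq> carrier (pi2 T\<^sub>D b)"
    and gen: "\<And>i. i + 2 \<le> k \<Longrightarrow> \<exists>\<gamma>. has_degrees \<gamma> (\<lambda>l. of_bool (l = i + 2) - of_bool (l = i)) \<and> pi2_class T\<^sub>D b \<gamma> \<in> S"
  shows "generate (pi2 T\<^sub>D b) S = carrier (pi2 T\<^sub>D b)"
proof -
  have b: "b \<in> topspace T\<^sub>D" by (simp add: topspace_T\<^sub>D b_in_D)
  interpret G: group "pi2 T\<^sub>D b" by (rule group_pi2[OF b])
  define W where "W = {w. \<exists>\<gamma>. has_degrees \<gamma> w \<and> pi2_class T\<^sub>D b \<gamma> \<in> generate (pi2 T\<^sub>D b) S}"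
  have W_add: "(\<lambda>i. w i + w' i) \<in> W" if ww: "w \<in> W" "w' \<in> W" for w w'
  proof -
    obtain \<gamma> \<gamma>' where \<gamma>: "has_degrees \<gamma> w" "pi2_class T\<^sub>D b \<gamma> \<in> generate (pi2 T\<^sub>D b) S"
      "has_degrees \<gamma>' w'" "pi2_class T\<^sub>D b \<gamma>' \<in> generate (pi2 T\<^sub>D b) S"
      using ww by (auto simp: W_def)
    then show ?thesis
      using has_degrees_concat[OF \<gamma>(1,3)] generate.eng[OF \<gamma>(2,4)]
      by (auto simp: W_def pi2_mult has_degrees_square_maps)
  qed
  have W_neg: "(\<lambda>i. - w i) \<in> W" if w: "w \<in> W" for w
  proof -
    obtain \<gamma> where \<gamma>: "has_degrees \<gamma> w" "pi2_class T\<^sub>D b \<gamma> \<in> generate (pi2 T\<^sub>D b) S"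
      using w by (auto simp: W_def)
    then show ?thesis
      using has_degrees_reverse[OF \<gamma>(1)] G.generate_m_inv_closed[OF S \<gamma>(2)]
      by (auto simp: W_def pi2_inv[OF b] has_degrees_square_maps)
  qed
  have W_0: "(\<lambda>_. 0) \<in> W"
  proof -
    have "has_degrees (\<lambda>_. b) (\<lambda>_. 0)"
      by (rule has_degreesI[of "\<lambda>_. mat 1" _ "\<lambda>_ _. 0"])
         (auto simp: mat_1_split_frames orbit_block block_mats_1)
    moreover have "pi2_class T\<^sub>D b (\<lambda>_. b) \<in> generate (pi2 T\<^sub>D b) S"
      using generate.one[of "pi2 T\<^sub>D b" S] by (simp add: one_pi2)
    ultimately show ?thesis by (auto simp: W_def)
  qed
  have W_nat: "(\<lambda>i. int m * w i) \<in> W" if "w \<in> W" for w m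
  proof (induction m)
    case (Suc m)
    from W_add[OF this that] show ?case by (simp add: algebra_simps)
  qed (simp add: W_0)
  have W_int: "(\<lambda>i. m * w i) \<in> W" if "w \<in> W" for w and m :: int
  proof (cases m)
    case (nonneg n)
    with W_nat[OF that, of n] show ?thesis by simp
  next
    case (neg n)
    have "(\<lambda>i. m * w i) = (\<lambda>i. - (int (Suc n) * w i))" by (rule ext) (subst neg, simp add: algebra_simps)
    with W_neg[OF W_nat[OF that, of "Suc n"]] show ?thesis by simp
  qed
  have W_gen: "(\<lambda>l. of_bool (l = i + 2) - of_bool (l = i)) \<in> W" if "i + 2 \<le> k" for i
    using gen[OF that] generate.incl[of _ S "pi2 T\<^sub>D b"] by (auto simp: W_def)
  have W_all: "w \<in> W"
    if "\<And>i. i > k \<Longrightarrow> w i = 0" "(\<Sum>i\<in>{i. i \<le> k \<and> even i}. w i) = 0" "(\<Sum>i\<in>{i. i \<le> k \<and> odd i}. w i) = 0"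
      "\<And>i. i < j \<Longrightarrow> w i = 0" "j \<le> Suc k" for w :: "nat \<Rightarrow> int" and j
    using that(5,1-4)
  proof (induction j arbitrary: w rule: inc_induct)
    case base
    have "w i = 0" for i using base(1)[of i] base(4)[of i] by (cases "i > k") auto
    then have "w = (\<lambda>_. 0)" by auto
    then show ?case using W_0 by simp
  next
    case (step j)
    let ?e = "\<lambda>l. of_bool (l = j + 2) - of_bool (l = j) :: int"
    show ?case
    proof (cases "j + 2 \<le> k")
      case True
      define v where "v l = w l + w j * ?e l" for l
      have sum_e: "(\<Sum>l\<in>{l. l \<le> k \<and> P l}. ?e l) = 0" if P: "P = even \<or> P = odd" for P :: "nat \<Rightarrow> bool"
      proof -
        have "P (j + 2) \<longleftrightarrow> P j" using P by auto
        then show ?thesis using True by (simp add: sum_subtractf sum.If_cases of_bool_def)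
      qed
      have "v \<in> W"
      proof (rule step.IH)
        show "v i = 0" if "i < Suc j" for i
          using step.prems(4)[of i] that by (auto simp: v_def less_Suc_eq)
        show "(\<Sum>i\<in>{i. i \<le> k \<and> even i}. v i) = 0" "(\<Sum>i\<in>{i. i \<le> k \<and> odd i}. v i) = 0"
          using step.prems(2,3) sum_e[of even] sum_e[of odd]
          by (simp_all only: v_def sum.distrib sum_distrib_left[symmetric]) simp_all
      qed (use step.prems(1) True in \<open>auto simp: v_def\<close>)
      from W_add[OF this W_int[OF W_gen[OF True], of "- w j"]]
      show ?thesis by (simp add: v_def)
    next
      case False
      \<comment> \<open>Since j + 2 exceeds \<open>k\<close>, the entry at \<open>j\<close> is the
        only one of its parity that is left, and the sum over that parity vanishes.\<close>
      have "w j = 0"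
      proof -
        let ?P = "\<lambda>i. even i = even j"
        have "(\<Sum>i\<in>{i. i \<le> k \<and> ?P i}. w i) = 0"
          using step.prems(2,3) by (cases "even j") auto
        moreover have "(\<Sum>i\<in>{i. i \<le> k \<and> ?P i}. w i) = (\<Sum>i\<in>{i. i \<le> k \<and> ?P i}. if i = j then w j else 0)"
        proof (intro sum.cong refl)
          fix i assume i: "i \<in> {i. i \<le> k \<and> ?P i}"
          show "w i = (if i = j then w j else 0)"
          proof (cases "i < j \<or> i = j")
            case True
            then show ?thesis using step.prems(4) by auto
          next
            assume "\<not> (i < j \<or> i = j)"
            then have "i = Suc j" using i False by auto
            then show ?thesis using i by auto
          qed
        qed
        moreover have "\<dots> = w j" using step.hyps by simp
        ultimately show ?thesis by simp
      qed
      then show ?thesis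
        using step.prems by (intro step.IH) (auto simp: less_Suc_eq)
    qed
  qed
  show ?thesis
  proof
    show "generate (pi2 T\<^sub>D b) S \<subseteq> carrier (pi2 T\<^sub>D b)" by (rule G.generate_incl[OF S])
    show "carrier (pi2 T\<^sub>D b) \<subseteq> generate (pi2 T\<^sub>D b) S"
    proof
      fix x assume "x \<in> carrier (pi2 T\<^sub>D b)"
      then obtain \<gamma> where \<gamma>: "\<gamma> \<in> square_maps T\<^sub>D b" "x = pi2_class T\<^sub>D b \<gamma>" by (auto simp: carrier_pi2)
      obtain w where w: "has_degrees \<gamma> w" by (rule degrees_ex[OF \<gamma>(1)])
      have "w \<in> W"
        by (rule W_all[of _ 0])
           (use degrees_beyond[OF w] degrees_sum[OF w, of Q] degrees_sum[OF w, of "- Q"] in auto)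
      then obtain \<delta> where "has_degrees \<delta> w" "pi2_class T\<^sub>D b \<delta> \<in> generate (pi2 T\<^sub>D b) S"
        by (auto simp: W_def)
      with has_degrees_unique_class[OF w] \<gamma>(2) show "x \<in> generate (pi2 T\<^sub>D b) S" by metis
    qed
  qed
qed

end

section \<open>Smooth maps\<close>

lemma Ck_on_cong:
  assumes "open S" "\<And>x. x \<in> S \<Longrightarrow> f x = g x" "Ck_on k S f"
  shows "Ck_on k S g"
  using assms(2,3)
proof (induction k arbitrary: f g)
  case 0
  then show ?case by (simp cong: continuous_on_cong)
next
  case (Suc k)
  have fd: "f differentiable at x" if "x \<in> S" for x
    using Suc.prems(2) that assms(1) by (simp add: differentiable_on_eq_differentiable_at)
  have eq: "frechet_derivative f (at x) = frechet_derivative g (at x)" if "x \<in> S" for x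
    by (rule frechet_derivative_transform_within_open[OF fd[OF that] assms(1) that]) (rule Suc.prems)
  have "g differentiable at x" if x: "x \<in> S" for x
  proof -
    have "(g has_derivative frechet_derivative f (at x)) (at x)"
      by (rule has_derivative_transform_within_open[OF frechet_derivative_works[THEN iffD1, OF fd[OF x]] assms(1) x])
         (rule Suc.prems)
    then show ?thesis by (auto simp: differentiable_def)
  qed
  moreover have "Ck_on k S (\<lambda>x. frechet_derivative g (at x) v)" for v
    by (rule Suc.IH[of "\<lambda>x. frechet_derivative f (at x) v"]) (use eq Suc.prems in auto)
  ultimately show ?case using assms(1) by (simp add: differentiable_on_eq_differentiable_at)
qed

lemma Ck_on_SucI:
  assumes "open S" "\<And>x. x \<in> S \<Longrightarrow> (f has_derivative F x) (at x)" "\<And>v. Ck_on k S (\<lambda>x. F x v)"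
  shows "Ck_on (Suc k) S f"
proof -
  have "Ck_on k S (\<lambda>x. frechet_derivative f (at x) v)" for v
    by (rule Ck_on_cong[OF assms(1) _ assms(3)[of v]]) (simp add: frechet_derivative_at[OF assms(2)])
  moreover have "f differentiable_on S"
    using assms(1,2) by (auto simp: differentiable_on_eq_differentiable_at differentiable_def)
  ultimately show ?thesis by simp
qed

lemma Ck_on_SucD:
  assumes "open S" "Ck_on (Suc k) S f"
  shows "x \<in> S \<Longrightarrow> (f has_derivative frechet_derivative f (at x)) (at x)"
    and "Ck_on k S (\<lambda>x. frechet_derivative f (at x) v)"
  using assms by (auto simp: differentiable_on_eq_differentiable_at frechet_derivative_works)

lemma Ck_on_Suc:
  assumes "open S" "Ck_on (Suc k) S f"
  shows "Ck_on k S f"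
  using assms(2)
proof (induction k arbitrary: f)
  case 0
  then show ?case by (auto intro: differentiable_imp_continuous_on)
next
  case (Suc k)
  then show ?case by auto
qed

lemma Ck_on_subset:
  assumes "Ck_on k S f" "T \<subseteq> S"
  shows "Ck_on k T f"
  using assms by (induction k arbitrary: f) (auto intro: continuous_on_subset differentiable_on_subset)

lemma Ck_on_const:
  assumes "open S"
  shows "Ck_on k S (\<lambda>_. c)"
  by (induction k arbitrary: c) (auto intro!: Ck_on_SucI[OF assms] derivative_eq_intros simp del: Ck_on.simps(2))

lemma Ck_on_linear:
  assumes "open S" "bounded_linear L"
  shows "Ck_on k S L"
proof (cases k)
  case 0
  then show ?thesis using assms(2) by (simp add: linear_continuous_on)
next
  case (Suc n)
  show ?thesis unfolding Suc
    by (rule Ck_on_SucI[OF assms(1) bounded_linear_imp_has_derivative[OF assms(2)]]) (rule Ck_on_const[OF assms(1)])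
qed

lemma Ck_on_linear_comp:
  assumes "open S" "bounded_linear L" "Ck_on k S f"
  shows "Ck_on k S (\<lambda>x. L (f x))"
  using assms(3)
proof (induction k arbitrary: f)
  case 0
  then show ?case using assms(2) by (simp add: bounded_linear.continuous_on)
next
  case (Suc k)
  show ?case
  proof (rule Ck_on_SucI[OF assms(1)])
    fix x assume "x \<in> S"
    from bounded_linear.has_derivative[OF assms(2) Ck_on_SucD(1)[OF assms(1) Suc.prems this]]
    show "((\<lambda>x. L (f x)) has_derivative (\<lambda>v. L (frechet_derivative f (at x) v))) (at x)" .
  qed (use Suc in auto)
qed

lemma Ck_on_add:
  assumes "open S" "Ck_on k S f" "Ck_on k S g"
  shows "Ck_on k S (\<lambda>x. f x + g x)"
  using assms(2,3)
proof (induction k arbitrary: f g)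
  case 0
  then show ?case by (auto intro: continuous_intros)
next
  case (Suc k)
  show ?case
  proof (rule Ck_on_SucI[OF assms(1)])
    fix x assume "x \<in> S"
    then show "((\<lambda>x. f x + g x) has_derivative
        (\<lambda>v. frechet_derivative f (at x) v + frechet_derivative g (at x) v)) (at x)"
      by (intro has_derivative_add Ck_on_SucD(1)[OF assms(1) Suc.prems(1)]
          Ck_on_SucD(1)[OF assms(1) Suc.prems(2)])
  qed (use Suc in auto)
qed

lemma Ck_on_bilinear:
  assumes "open S" "bounded_bilinear B" "Ck_on k S f" "Ck_on k S g"
  shows "Ck_on k S (\<lambda>x. B (f x) (g x))"
  using assms(3,4)
proof (induction k arbitrary: f g)
  case 0
  then show ?case using bounded_bilinear.continuous_on[OF assms(2)] by auto
next
  case (Suc k)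
  show ?case
  proof (rule Ck_on_SucI[OF assms(1)])
    fix x assume x: "x \<in> S"
    show "((\<lambda>x. B (f x) (g x)) has_derivative
        (\<lambda>v. B (f x) (frechet_derivative g (at x) v) + B (frechet_derivative f (at x) v) (g x))) (at x)"
      by (rule bounded_bilinear.FDERIV[OF assms(2) Ck_on_SucD(1)[OF assms(1) Suc.prems(1) x]
            Ck_on_SucD(1)[OF assms(1) Suc.prems(2) x]])
  next
    fix v
    show "Ck_on k S (\<lambda>x. B (f x) (frechet_derivative g (at x) v) + B (frechet_derivative f (at x) v) (g x))"
      by (intro Ck_on_add[OF assms(1)] Suc.IH Ck_on_SucD(2)[OF assms(1) Suc.prems(1)]
          Ck_on_SucD(2)[OF assms(1) Suc.prems(2)] Ck_on_Suc[OF assms(1) Suc.prems(1)]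
          Ck_on_Suc[OF assms(1) Suc.prems(2)])
  qed
qed

text \<open>The derivative of a map on the line is multiplication by its value at 1. The chain rule
  thus takes the form of a bilinear expression in functions covered by the induction hypothesis and
  the product rule.\<close>

lemma Ck_on_compose_real:
  fixes F :: "real \<Rightarrow> 'b::real_normed_vector"
  assumes "open S" "open T" "u ` S \<subseteq> T" "Ck_on k T F" "Ck_on k S u"
  shows "Ck_on k S (\<lambda>x. F (u x))"
  using assms(4,5)
proof (induction k arbitrary: F)
  case 0
  then show ?case using assms(3) by (auto intro: continuous_on_compose2)
next
  case (Suc k)
  show ?case
  proof (rule Ck_on_SucI[OF assms(1)])
    fix x assume x: "x \<in> S"
    then have "u x \<in> T" using assms(3) by auto
    note F' = Ck_on_SucD(1)[OF assms(2) Suc.prems(1) this]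
    have "((\<lambda>x. F (u x)) has_derivative (\<lambda>v. frechet_derivative F (at (u x)) (frechet_derivative u (at x) v))) (at x)"
      by (rule has_derivative_compose[OF Ck_on_SucD(1)[OF assms(1) Suc.prems(2) x] F'])
    moreover have "frechet_derivative F (at (u x)) r = r *\<^sub>R frechet_derivative F (at (u x)) 1" for r
      using linear_scale[OF has_derivative_linear[OF F'], of r 1] by simp
    then have "(\<lambda>v. frechet_derivative F (at (u x)) (frechet_derivative u (at x) v)) =
        (\<lambda>v. frechet_derivative u (at x) v *\<^sub>R frechet_derivative F (at (u x)) 1)"
      by (rule ext)
    ultimately show "((\<lambda>x. F (u x)) has_derivative
        (\<lambda>v. frechet_derivative u (at x) v *\<^sub>R frechet_derivative F (at (u x)) 1)) (at x)"
      by simp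
  next
    fix v
    show "Ck_on k S (\<lambda>x. frechet_derivative u (at x) v *\<^sub>R frechet_derivative F (at (u x)) 1)"
    proof (rule Ck_on_bilinear[OF assms(1) bounded_bilinear_scaleR])
      show "Ck_on k S (\<lambda>x. frechet_derivative u (at x) v)"
        by (rule Ck_on_SucD(2)[OF assms(1) Suc.prems(2)])
      show "Ck_on k S (\<lambda>x. frechet_derivative F (at (u x)) 1)"
        by (rule Suc.IH[of "\<lambda>r. frechet_derivative F (at r) 1"])
           (rule Ck_on_SucD(2)[OF assms(2) Suc.prems(1)], rule Ck_on_Suc[OF assms(1) Suc.prems(2)])
    qed
  qed
qed

lemma smooth_onD: "smooth_on S f \<Longrightarrow> Ck_on k S f"
  by (simp add: smooth_on_def)

lemma smooth_on_continuous: "smooth_on S f \<Longrightarrow> continuous_on S f"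
  using smooth_onD[of S f 0] by simp

lemma smooth_on_has_derivative:
  assumes "open S" "smooth_on S f" "x \<in> S"
  shows "(f has_derivative frechet_derivative f (at x)) (at x)"
  using Ck_on_SucD(1)[OF assms(1) smooth_onD[OF assms(2)] assms(3)] .

named_theorems smooth_intros

lemma smooth_on_const [smooth_intros]: "open S \<Longrightarrow> smooth_on S (\<lambda>_. c)"
  by (simp add: smooth_on_def Ck_on_const)

lemma smooth_on_linear: "open S \<Longrightarrow> bounded_linear L \<Longrightarrow> smooth_on S L"
  by (simp add: smooth_on_def Ck_on_linear)

lemma smooth_on_linear_comp: "open S \<Longrightarrow> bounded_linear L \<Longrightarrow> smooth_on S f \<Longrightarrow> smooth_on S (\<lambda>x. L (f x))"
  by (simp add: smooth_on_def Ck_on_linear_comp)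

lemma smooth_on_add [smooth_intros]:
  "open S \<Longrightarrow> smooth_on S f \<Longrightarrow> smooth_on S g \<Longrightarrow> smooth_on S (\<lambda>x. f x + g x)"
  by (simp add: smooth_on_def Ck_on_add)

lemma smooth_on_bilinear:
  "open S \<Longrightarrow> bounded_bilinear B \<Longrightarrow> smooth_on S f \<Longrightarrow> smooth_on S g \<Longrightarrow> smooth_on S (\<lambda>x. B (f x) (g x))"
  by (simp add: smooth_on_def Ck_on_bilinear)

lemma smooth_on_compose_real:
  fixes F :: "real \<Rightarrow> 'b::real_normed_vector"
  assumes "open S" "open T" "u ` S \<subseteq> T" "smooth_on T F" "smooth_on S u"
  shows "smooth_on S (\<lambda>x. F (u x))"
  using assms by (simp add: smooth_on_def Ck_on_compose_real)

lemma smooth_on_subset: "smooth_on S f \<Longrightarrow> T \<subseteq> S \<Longrightarrow> smooth_on T f"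
  unfolding smooth_on_def using Ck_on_subset by blast

lemma smooth_on_mult [smooth_intros]:
  fixes f g :: "'a::real_normed_vector \<Rightarrow> 'b::real_normed_algebra"
  shows "open S \<Longrightarrow> smooth_on S f \<Longrightarrow> smooth_on S g \<Longrightarrow> smooth_on S (\<lambda>x. f x * g x)"
  by (rule smooth_on_bilinear[OF _ bounded_bilinear_mult])

lemma smooth_on_minus [smooth_intros]: "open S \<Longrightarrow> smooth_on S f \<Longrightarrow> smooth_on S (\<lambda>x. - f x)"
  by (rule smooth_on_linear_comp[OF _ bounded_linear_minus[OF bounded_linear_ident]])

lemma smooth_on_diff [smooth_intros]:
  "open S \<Longrightarrow> smooth_on S f \<Longrightarrow> smooth_on S g \<Longrightarrow> smooth_on S (\<lambda>x. f x - g x)"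
  using smooth_on_add[OF _ _ smooth_on_minus] by fastforce

lemma smooth_on_cnj [smooth_intros]: "open S \<Longrightarrow> smooth_on S f \<Longrightarrow> smooth_on S (\<lambda>x. cnj (f x))"
  by (rule smooth_on_linear_comp[OF _ bounded_linear_cnj])

lemma smooth_on_of_real [smooth_intros]:
  fixes f :: "'a::real_normed_vector \<Rightarrow> real"
  shows "open S \<Longrightarrow> smooth_on S f \<Longrightarrow> smooth_on S (\<lambda>x. complex_of_real (f x))"
  by (rule smooth_on_linear_comp[OF _ bounded_linear_of_real])

lemma smooth_on_sum [smooth_intros]:
  "open S \<Longrightarrow> (\<And>i. i \<in> I \<Longrightarrow> smooth_on S (f i)) \<Longrightarrow> smooth_on S (\<lambda>x. \<Sum>i\<in>I. f i x)"
  by (induction I rule: infinite_finite_induct) (auto intro: smooth_on_const smooth_on_add)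

lemma smooth_on_vec:
  fixes f :: "'a::real_normed_vector \<Rightarrow> 'b::euclidean_space^'n"
  assumes "open S" "\<And>i. smooth_on S (\<lambda>x. f x $ i)"
  shows "smooth_on S f"
proof -
  have bl: "bounded_linear (axis i :: 'b \<Rightarrow> 'b^'n)" for i
    by (intro linear_conv_bounded_linear[THEN iffD1] linearI) (auto simp: vec_eq_iff axis_def)
  have "smooth_on S (\<lambda>x. \<Sum>i\<in>UNIV. axis i (f x $ i))"
    by (rule smooth_on_sum[OF assms(1)], rule smooth_on_linear_comp[OF assms(1) bl assms(2)])
  moreover have "(\<Sum>i\<in>UNIV. axis i (f x $ i)) = f x" for x
    by (simp add: vec_eq_iff axis_def sum_component)
  ultimately show ?thesis by simp
qed

section \<open>Smooth transition functions\<close>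

lemma smooth_on_inverse_real: "smooth_on {0<..} (inverse :: real \<Rightarrow> real)"
proof -
  have "Ck_on k {0<..} (inverse :: real \<Rightarrow> real)" for k
  proof (induction k)
    case 0
    show ?case by (auto intro!: continuous_intros)
  next
    case (Suc k)
    show ?case
    proof (rule Ck_on_SucI)
      show "(inverse has_derivative (\<lambda>v. - (inverse x * v * inverse x))) (at x)" if "x \<in> {0<..}" for x :: real
        using that by (intro has_derivative_inverse') auto
      show "Ck_on k {0<..} (\<lambda>x. - (inverse x * v * inverse x))" for v :: real
        by (intro Ck_on_linear_comp[OF _ bounded_linear_minus[OF bounded_linear_ident]]
            Ck_on_bilinear[OF _ bounded_bilinear_mult] Suc Ck_on_const) auto
    qed simp
  qed
  then show ?thesis by (simp add: smooth_on_def)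
qed

text \<open>The derivative is expressed by \<open>sqrt\<close> itself, as half of its inverse, so
  each order of differentiability yields the next one.\<close>

lemma smooth_on_sqrt: "smooth_on {0<..} sqrt"
proof -
  have "Ck_on k {0<..} sqrt" for k
  proof (induction k)
    case 0
    show ?case by (auto intro!: continuous_intros)
  next
    case (Suc k)
    show ?case
    proof (rule Ck_on_SucI)
      show "(sqrt has_derivative (\<lambda>v. (inverse (sqrt x) / 2) * v)) (at x)" if "x \<in> {0<..}" for x
        using DERIV_real_sqrt[of x] that by (simp add: has_field_derivative_def del: times_divide_eq_left)
      have "Ck_on k {0<..} (\<lambda>x. inverse (sqrt x))"
        by (rule Ck_on_compose_real[OF _ _ _ smooth_onD[OF smooth_on_inverse_real] Suc]) auto
      then show "Ck_on k {0<..} (\<lambda>x. (inverse (sqrt x) / 2) * v)" for v :: real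
        by (intro Ck_on_linear_comp[OF _ bounded_linear_mult_left] Ck_on_linear_comp[OF _ bounded_linear_divide]) auto
    qed simp
  qed
  then show ?thesis by (simp add: smooth_on_def)
qed

text \<open>The powers of \<open>inverse r\<close> make the family closed under differentiation up
  to linear combinations, so smoothness at 0 is proved for all \<open>m\<close> at once.\<close>

definition flat_exp :: "nat \<Rightarrow> real \<Rightarrow> real" where
  "flat_exp m r = (if r > 0 then inverse r ^ m * exp (- inverse r) else 0)"

lemma flat_exp_tendsto: "(flat_exp m \<longlongrightarrow> 0) (at 0)"
proof -
  have "((\<lambda>x::real. x ^ m / exp x) \<longlongrightarrow> 0) at_top" by (rule tendsto_power_div_exp_0)
  from filterlim_compose[OF this filterlim_inverse_at_top_right]
  have "((\<lambda>r::real. inverse r ^ m / exp (inverse r)) \<longlongrightarrow> 0) (at_right 0)" .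
  then have "(flat_exp m \<longlongrightarrow> 0) (at_right 0)"
    by (rule Lim_transform_eventually)
       (auto simp: flat_exp_def exp_minus divide_inverse eventually_at_right_less intro: eventually_mono[OF eventually_at_right_less])
  moreover have "(flat_exp m \<longlongrightarrow> 0) (at_left 0)"
    by (rule Lim_transform_eventually[OF tendsto_const])
       (auto simp: flat_exp_def eventually_at_filter)
  ultimately show ?thesis by (simp add: filterlim_split_at_real)
qed

lemma flat_exp_derivative:
  "(flat_exp m has_real_derivative flat_exp (m + 2) r - real m * flat_exp (m + 1) r) (at r)"
proof -
  consider "r > 0" | "r < 0" | "r = 0" by linarith
  then show ?thesis
  proof cases
    case 1
    have "((\<lambda>r. inverse r ^ m * exp (- inverse r)) has_real_derivative
        flat_exp (m + 2) r - real m * flat_exp (m + 1) r) (at r)"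
    proof -
      have "((\<lambda>r. inverse r ^ m * exp (- inverse r)) has_real_derivative
        (real m * inverse r ^ (m - 1) * (- (inverse r ^ 2))) * exp (- inverse r)
         + exp (- inverse r) * (inverse r ^ 2) * inverse r ^ m) (at r)"
        using 1 by (auto intro!: derivative_eq_intros simp: power2_eq_square numeral_2_eq_2)
      moreover have "(real m * inverse r ^ (m - 1) * (- (inverse r ^ 2))) * exp (- inverse r)
         + exp (- inverse r) * (inverse r ^ 2) * inverse r ^ m
        = flat_exp (m + 2) r - real m * flat_exp (m + 1) r"
        using 1 by (cases m) (auto simp: flat_exp_def power2_eq_square algebra_simps)
      ultimately show ?thesis by simp
    qed
    then show ?thesis
      by (rule has_field_derivative_transform_within_open[where S = "{0<..}"])
         (use 1 in \<open>auto simp: flat_exp_def\<close>)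
  next
    case 2
    have "((\<lambda>r. 0) has_real_derivative flat_exp (m + 2) r - real m * flat_exp (m + 1) r) (at r)"
      using 2 by (simp add: flat_exp_def)
    then show ?thesis
      by (rule has_field_derivative_transform_within_open[where S = "{..<0}"])
         (use 2 in \<open>auto simp: flat_exp_def\<close>)
  next
    case 3
    have "(\<lambda>h. (flat_exp m (0 + h) - flat_exp m 0) / h) = flat_exp (Suc m)"
      by (auto simp: flat_exp_def fun_eq_iff divide_inverse mult_ac)
    then have "(flat_exp m has_real_derivative 0) (at 0)"
      using flat_exp_tendsto[of "Suc m"] by (simp add: DERIV_def)
    then show ?thesis using 3 by (simp add: flat_exp_def)
  qed
qed

lemma smooth_on_flat_exp: "smooth_on UNIV (flat_exp m)"
proof -
  have "Ck_on k UNIV (flat_exp m)" for k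
  proof (induction k arbitrary: m)
    case 0
    have "isCont (flat_exp m) r" for r
      using flat_exp_derivative by (rule DERIV_isCont)
    then show ?case by (simp add: continuous_at_imp_continuous_on)
  next
    case (Suc k)
    show ?case
    proof (rule Ck_on_SucI)
      show "(flat_exp m has_derivative (\<lambda>v. (flat_exp (m + 2) r + (- real m) * flat_exp (m + 1) r) * v)) (at r)" for r
        using flat_exp_derivative[of m r] by (simp add: has_field_derivative_def)
      show "Ck_on k UNIV (\<lambda>r. (flat_exp (m + 2) r + (- real m) * flat_exp (m + 1) r) * v)" for v
        by (intro Ck_on_linear_comp[OF _ bounded_linear_mult_left] Ck_on_add
            Ck_on_linear_comp[OF _ bounded_linear_mult_right] Suc) auto
    qed simp
  qed
  then show ?thesis by (simp add: smooth_on_def)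
qed

definition smooth_step :: "real \<Rightarrow> real" where
  "smooth_step r = flat_exp 0 r * inverse (flat_exp 0 r + flat_exp 0 (1 - r))"

lemma flat_exp_sum_pos: "flat_exp 0 r + flat_exp 0 (1 - r) > 0"
proof -
  have "flat_exp 0 s \<ge> 0" "s > 0 \<Longrightarrow> flat_exp 0 s > 0" for s by (auto simp: flat_exp_def)
  then show ?thesis by (cases "r > 0") (auto intro: add_pos_nonneg add_nonneg_pos)
qed

lemma smooth_step:
  "0 \<le> smooth_step r" "smooth_step r \<le> 1" "r \<le> 0 \<Longrightarrow> smooth_step r = 0" "1 \<le> r \<Longrightarrow> smooth_step r = 1"
proof -
  have "flat_exp 0 s \<ge> 0" for s by (auto simp: flat_exp_def)
  note nn = this[of r] this[of "1 - r"]
  show "0 \<le> smooth_step r"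
    unfolding smooth_step_def using nn flat_exp_sum_pos[of r] by (intro mult_nonneg_nonneg) auto
  show "smooth_step r \<le> 1"
    using nn flat_exp_sum_pos[of r] by (simp add: smooth_step_def divide_simps flip: divide_inverse)
  show "r \<le> 0 \<Longrightarrow> smooth_step r = 0" by (simp add: smooth_step_def flat_exp_def)
  show "1 \<le> r \<Longrightarrow> smooth_step r = 1" by (simp add: smooth_step_def flat_exp_def)
qed

lemma smooth_on_smooth_step: "smooth_on UNIV smooth_step"
proof -
  have "bounded_linear (\<lambda>r::real. - r)" by (rule bounded_linear_minus[OF bounded_linear_ident])
  then have "smooth_on UNIV (\<lambda>r::real. 1 - r)"
    using smooth_on_add[OF open_UNIV smooth_on_const[OF open_UNIV] smooth_on_linear[OF open_UNIV], of "\<lambda>r. - r" 1] by simp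
  then have f: "smooth_on UNIV (\<lambda>r. flat_exp 0 (1 - r))"
    by (intro smooth_on_compose_real[OF _ _ _ smooth_on_flat_exp]) auto
  have "smooth_on UNIV (\<lambda>r. inverse (flat_exp 0 r + flat_exp 0 (1 - r)))"
    by (rule smooth_on_compose_real[OF _ _ _ smooth_on_inverse_real])
       (use flat_exp_sum_pos in \<open>auto intro!: smooth_on_add f smooth_on_flat_exp\<close>)
  then show ?thesis
    unfolding smooth_step_def[abs_def] by (intro smooth_on_mult smooth_on_flat_exp) auto
qed

lemma smooth_step_composed:
  fixes u :: "'a::real_normed_vector \<Rightarrow> real"
  assumes "open S" "smooth_on S u"
  shows "smooth_on S (\<lambda>x. smooth_step (u x))"
  by (rule smooth_on_compose_real[OF assms(1) open_UNIV _ smooth_on_smooth_step assms(2)]) simp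

section \<open>Superhorizontal spheres\<close>

text \<open>Stage \<open>j\<close> rises from 0 to 1 while the height runs over an interval of
  length 1/4. Stages 1 to 5 follow each other without overlap and fill the heights from -5/8 to 5/8;
  below and above, all five are 0 and 1 respectively.\<close>

definition stage :: "nat \<Rightarrow> real^3 \<Rightarrow> real" where
  "stage j x = smooth_step (4 * x $ 3 + 7/2 - real j)"

text \<open>The longitude as a point of the unit circle. On the axis, where it is undefined, the
  value is 0. Near the south pole this does no harm, as all terms containing the phase have
  coefficient 0 there; hence the alternative \<open>c 1 = 0\<close> in the hypotheses below.\<close>

definition phase :: "real^3 \<Rightarrow> complex" where
  "phase x = complex_of_real (inverse (sqrt ((x $ 1)\<^sup>2 + (x $ 2)\<^sup>2))) * Complex (x $ 1) (x $ 2)"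

definition off_axis :: "(real^3) set" where
  "off_axis = {x. (x $ 1)\<^sup>2 + (x $ 2)\<^sup>2 > 0}"

text \<open>In the coordinates \<open>(a, c, p, q)\<close> of signature \<open>(+, +, -, -)\<close> \<open>U\<close> spans the first step of
  the flag and \<open>W\<close> the orthogonal complement of the second. For \<open>c\<^sub>1, \<dots>, c\<^sub>5\<close> running one after the other from 0 to 1 with a
  constant phase, the pair \<open>(U, W)\<close> is, up to the last coordinate, a broken path of real flags in
  signature \<open>(2, 1)\<close> along which alternately only \<open>U\<close> and only \<open>W\<close> moves. The last coordinate, which
  rotates twice as fast, compensates the component of \<open>dU\<close> along \<open>W\<close> that the rotation of the phase \<open>e\<close>
  creates.\<close>

definition U_coord :: "(nat \<Rightarrow> real) \<Rightarrow> complex \<Rightarrow> nat \<Rightarrow> complex" where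
  "U_coord c e = (\<lambda>_. 0)(
     0 := of_real (c 2) * cnj e,
     1 := of_real (1 - c 4),
     2 := of_real (5/4 * c 2 * (1 - c 4)) * cnj e,
     3 := of_real (3/5 * c 1 * (1 - c 4)) * e)"

definition W_coord :: "(nat \<Rightarrow> real) \<Rightarrow> complex \<Rightarrow> nat \<Rightarrow> complex" where
  "W_coord c e = (\<lambda>_. 0)(
     0 := of_real (c 3 - 1),
     1 := of_real (2 * c 3) * e,
     2 := of_real (4/5 * (c 3 * (1 - c 5) - c 1 * (1 - c 3))),
     3 := of_real (5/3 * c 3 * (1 - c 5)) * (e * e))"

definition form22 :: "(nat \<Rightarrow> complex) \<Rightarrow> (nat \<Rightarrow> complex) \<Rightarrow> complex" where
  "form22 x y = x 0 * cnj (y 0) + x 1 * cnj (y 1) - x 2 * cnj (y 2) - x 3 * cnj (y 3)"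

definition staged :: "(nat \<Rightarrow> real) \<Rightarrow> bool" where
  "staged c \<longleftrightarrow> (\<forall>j. 0 \<le> c j \<and> c j \<le> 1) \<and> (\<forall>j. c (Suc j) \<noteq> 0 \<longrightarrow> c j = 1)"

lemma stagedD:
  assumes "staged c"
  shows "0 \<le> c j" "c j \<le> 1" "c 2 \<noteq> 0 \<Longrightarrow> c 1 = 1" "c 3 \<noteq> 0 \<Longrightarrow> c 2 = 1"
    "c 4 \<noteq> 0 \<Longrightarrow> c 3 = 1" "c 5 \<noteq> 0 \<Longrightarrow> c 4 = 1"
proof -
  show "0 \<le> c j" "c j \<le> 1" using assms by (auto simp: staged_def)
  have "c (Suc j) \<noteq> 0 \<longrightarrow> c j = 1" for j using assms by (simp add: staged_def)
  from this[of 1] this[of 2] this[of 3] this[of 4]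
  show "c 2 \<noteq> 0 \<Longrightarrow> c 1 = 1" "c 3 \<noteq> 0 \<Longrightarrow> c 2 = 1"
    "c 4 \<noteq> 0 \<Longrightarrow> c 3 = 1" "c 5 \<noteq> 0 \<Longrightarrow> c 4 = 1"
    by (simp_all add: numeral_eq_Suc)
qed

text \<open>\<open>start\<close> covers stages 1 and 2, \<open>middle\<close> stage 3,
  \<open>late\<close> stages 4 and 5; the disjunctions express that one of the two stages
  rests.\<close>

lemma staged_cases:
  assumes "staged c"
  obtains (start) "c 3 = 0" "c 4 = 0" "c 5 = 0" "c 2 = 0 \<or> c 1 = 1"
    | (middle) "c 1 = 1" "c 2 = 1" "c 4 = 0" "c 5 = 0"
    | (late) "c 1 = 1" "c 2 = 1" "c 3 = 1" "c 5 = 0 \<or> c 4 = 1"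
  using stagedD(3-6)[OF assms] by (metis zero_neq_one)

lemma U_coord_nth:
  "U_coord c e 0 = of_real (c 2) * cnj e" "U_coord c e 1 = of_real (1 - c 4)"
  "U_coord c e 2 = of_real (5/4 * c 2 * (1 - c 4)) * cnj e"
  "U_coord c e 3 = of_real (3/5 * c 1 * (1 - c 4)) * e"
  by (simp_all add: U_coord_def)

lemma W_coord_nth:
  "W_coord c e 0 = of_real (c 3 - 1)" "W_coord c e 1 = of_real (2 * c 3) * e"
  "W_coord c e 2 = of_real (4/5 * (c 3 * (1 - c 5) - c 1 * (1 - c 3)))"
  "W_coord c e 3 = of_real (5/3 * c 3 * (1 - c 5)) * (e * e)"
  by (simp_all add: W_coord_def)

text \<open>All products are real multiples of \<open>cnj e\<close>, so only the factor
  \<open>r\<close> has to vanish. Coordinate 1 contributes \<open>2 * c 3 * (1 - c 4)\<close>, while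
  coordinates 0 and 2 together and coordinate 3 alone each contribute
  \<open>- c 3 * (1 - c 4)\<close>. This even split is the reason for the factor 2 in
  \<open>W_coord\<close>.\<close>

lemma U_W_orthogonal:
  assumes c: "staged c" and e: "c 1 = 0 \<or> e * cnj e = 1"
  shows "form22 (U_coord c e) (W_coord c e) = 0"
proof -
  define K where "K = c 3 * (1 - c 5) - c 1 * (1 - c 3)"
  define r where "r = (c 3 - 1) * c 2 + 2 * c 3 * (1 - c 4) - K * c 2 * (1 - c 4) - c 3 * (1 - c 5) * c 1 * (1 - c 4)"
  have t: "of_real (c 1) * (e * (cnj e * cnj e)) = of_real (c 1) * cnj e"
    using e by (auto simp flip: mult.assoc)
  have "form22 (U_coord c e) (W_coord c e) =
     of_real ((c 3 - 1) * c 2 + 2 * c 3 * (1 - c 4) - K * c 2 * (1 - c 4)) * cnj e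
       - of_real (c 3 * (1 - c 5) * (1 - c 4)) * (of_real (c 1) * (e * (cnj e * cnj e)))"
    unfolding form22_def U_coord_nth W_coord_nth K_def by (simp add: field_simps)
  also have "\<dots> = of_real r * cnj e"
    unfolding t r_def by (simp add: algebra_simps)
  also have "r = 0"
    using c by (cases rule: staged_cases) (auto simp: r_def K_def algebra_simps)
  finally show ?thesis by simp
qed

lemma mult_of_real_cnj:
  "complex_of_real r * z * cnj (complex_of_real r * z) = complex_of_real (r\<^sup>2 * (cmod z)\<^sup>2)"
  "complex_of_real r * cnj (complex_of_real r) = complex_of_real (r\<^sup>2)"
proof -
  have "complex_of_real r * z * cnj (complex_of_real r * z) = of_real r * of_real r * (z * cnj z)"
    by (simp add: mult_ac)
  also have "z * cnj z = complex_of_real ((cmod z)\<^sup>2)" by (rule complex_norm_square[symmetric])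
  finally show "complex_of_real r * z * cnj (complex_of_real r * z) = complex_of_real (r\<^sup>2 * (cmod z)\<^sup>2)"
    by (simp add: power2_eq_square)
qed (simp add: power2_eq_square)

text \<open>For a phase of modulus 1 the value is at least 2 - 25/16 - 9/25 = 31/400, attained
  throughout stage 3. Orthogonality makes the constants of \<open>U\<close> and \<open>W\<close>
  reciprocal: u = 5/4 with 4/5, v = 3/5 with 5/3. Positivity demands u^2 + v^2 < 2 for
  \<open>U\<close>, and u > 1 and 1/u^2 + 1/v^2 < 4 for \<open>W\<close>.\<close>

lemma U_positive:
  assumes c: "staged c" and e: "c 1 = 0 \<or> cmod e = 1"
  shows "0 < Re (form22 (U_coord c e) (U_coord c e))"
proof -
  have "Re (form22 (U_coord c e) (U_coord c e)) =
     (c 2)\<^sup>2 * (cmod e)\<^sup>2 + (1 - c 4)\<^sup>2 - 25/16 * (c 2)\<^sup>2 * (1 - c 4)\<^sup>2 * (cmod e)\<^sup>2 - 9/25 * (c 1)\<^sup>2 * (1 - c 4)\<^sup>2 * (cmod e)\<^sup>2"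
    unfolding form22_def U_coord_nth mult_of_real_cnj
    by (simp only: complex_mod_cnj Re_complex_of_real plus_complex.sel minus_complex.sel power_mult_distrib power_divide)
       (simp add: power2_eq_square)
  moreover have "0 < (c 2)\<^sup>2 * (cmod e)\<^sup>2 + (1 - c 4)\<^sup>2 - 25/16 * (c 2)\<^sup>2 * (1 - c 4)\<^sup>2 * (cmod e)\<^sup>2 - 9/25 * (c 1)\<^sup>2 * (1 - c 4)\<^sup>2 * (cmod e)\<^sup>2"
    using c
  proof (cases rule: staged_cases)
    case start
    show ?thesis
    proof (cases "c 1 = 0")
      case True
      then show ?thesis using start by auto
    next
      case False
      then have "cmod e = 1" using e by auto
      moreover have "(c 1)\<^sup>2 \<le> 1" "(c 2)\<^sup>2 \<le> 1" using stagedD(1,2)[OF c] by (auto simp: power_le_one)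
      ultimately show ?thesis using start by simp
    qed
  next
    case middle
    then show ?thesis using e by simp
  next
    case late
    then have "cmod e = 1" using e by auto
    moreover have "(1 - c 4)\<^sup>2 \<le> 1" using stagedD(1,2)[OF c, of 4] by (intro power_le_one) auto
    ultimately show ?thesis using late by simp
  qed
  ultimately show ?thesis by simp
qed

text \<open>Stages 1 and 2 leave at least 1 - 16/25, stages 4 and 5 at least 4 - 16/25 - 25/9. In
  stage 3 the vector passes from one end to the other and the bound is a quadratic inequality in
  \<open>c 3\<close>.\<close>

lemma W_positive:
  assumes c: "staged c" and e: "c 1 = 0 \<or> cmod e = 1"
  shows "0 < Re (form22 (W_coord c e) (W_coord c e))"
proof -
  have "Re (form22 (W_coord c e) (W_coord c e)) =
     (c 3 - 1)\<^sup>2 + 4 * (c 3)\<^sup>2 * (cmod e)\<^sup>2 - 16/25 * (c 3 * (1 - c 5) - c 1 * (1 - c 3))\<^sup>2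
       - 25/9 * (c 3)\<^sup>2 * (1 - c 5)\<^sup>2 * (cmod (e * e))\<^sup>2"
    unfolding form22_def W_coord_nth mult_of_real_cnj
    by (simp only: complex_mod_cnj Re_complex_of_real plus_complex.sel minus_complex.sel power_mult_distrib power_divide)
       (simp add: power2_eq_square)
  moreover have "0 < (c 3 - 1)\<^sup>2 + 4 * (c 3)\<^sup>2 * (cmod e)\<^sup>2 - 16/25 * (c 3 * (1 - c 5) - c 1 * (1 - c 3))\<^sup>2
       - 25/9 * (c 3)\<^sup>2 * (1 - c 5)\<^sup>2 * (cmod (e * e))\<^sup>2"
    using c
  proof (cases rule: staged_cases)
    case start
    have "(c 1)\<^sup>2 \<le> 1" using stagedD(1,2)[OF c] by (auto simp: power_le_one)
    then show ?thesis using start by simp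
  next
    case middle
    \<comment> \<open>The quadratic is a combination of 1, t (1 - t) and the square of t with
      positive coefficients.\<close>
    have *: "0 < (t - 1)\<^sup>2 + 4 * t\<^sup>2 - 16/25 * (2 * t - 1)\<^sup>2 - 25/9 * t\<^sup>2" if "0 \<le> t" "t \<le> 1" for t :: real
    proof -
      have "(t - 1)\<^sup>2 + 4 * t\<^sup>2 - 16/25 * (2 * t - 1)\<^sup>2 - 25/9 * t\<^sup>2 = 9/25 + 14/25 * (t * (1 - t)) + 2/9 * t\<^sup>2"
        by (simp add: power2_eq_square field_simps)
      moreover have "0 \<le> t * (1 - t)" using that by simp
      ultimately show ?thesis by (simp add: add_pos_nonneg)
    qed
    have "c 3 * (1 - c 5) - c 1 * (1 - c 3) = 2 * c 3 - 1" "cmod e = 1"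
      using middle e by (auto simp: algebra_simps)
    with middle *[of "c 3"] stagedD(1,2)[OF c, of 3] show ?thesis
      by (simp add: norm_mult)
  next
    case late
    then have "cmod e = 1" using e by auto
    moreover have "(1 - c 5)\<^sup>2 \<le> 1" using stagedD(1,2)[OF c, of 5] by (intro power_le_one) auto
    ultimately show ?thesis using late by (simp add: norm_mult)
  qed
  ultimately show ?thesis by simp
qed

definition dU_coord :: "(nat \<Rightarrow> real) \<Rightarrow> (nat \<Rightarrow> real) \<Rightarrow> complex \<Rightarrow> complex \<Rightarrow> nat \<Rightarrow> complex" where
  "dU_coord c d e de = (\<lambda>_. 0)(
     0 := of_real (c 2) * cnj de + of_real (d 2) * cnj e,
     1 := of_real (- d 4),
     2 := of_real (5/4 * c 2 * (1 - c 4)) * cnj de + of_real (5/4 * (d 2 * (1 - c 4) - c 2 * d 4)) * cnj e,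
     3 := of_real (3/5 * c 1 * (1 - c 4)) * de + of_real (3/5 * (d 1 * (1 - c 4) - c 1 * d 4)) * e)"

text \<open>\<open>r1\<close> is the effect of turning the phase. Coordinates 0 and 2 of
  \<open>U\<close> turn with \<open>cnj e\<close> and coordinate 3 with \<open>e\<close>, in the
  opposite sense, so their equal contributions to the product of \<open>U\<close> and
  \<open>W\<close> now cancel. \<open>r2\<close> is the effect of the stages. In stage 1 only
  coordinate 3 of \<open>U\<close> moves, where \<open>W\<close> is 0. In stages 2 and 4
  \<open>W\<close> is at rest, so that persistent orthogonality of \<open>U\<close> to
  \<open>W\<close> settles the claim. In stages 3 and 5 \<open>U\<close> is at rest.\<close>

lemma dU_W_orthogonal:
  fixes c d :: "nat \<Rightarrow> real" and e de :: complex
  assumes c: "staged c" and e: "e * cnj e = 1" and de: "cnj e * de + e * cnj de = 0"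
    and d: "c 3 \<noteq> 0 \<Longrightarrow> d 1 = 0 \<and> d 2 = 0" "c 3 \<noteq> 1 \<Longrightarrow> d 4 = 0" "c 2 \<noteq> 0 \<Longrightarrow> d 1 = 0"
      "c 1 \<noteq> 1 \<Longrightarrow> d 2 = 0" "c 5 \<noteq> 0 \<Longrightarrow> d 4 = 0"
  shows "form22 (dU_coord c d e de) (W_coord c e) = 0"
proof -
  have e2: "cnj e * cnj e * de = - cnj de"
  proof -
    have "cnj e * (cnj e * de + e * cnj de) = 0" using de by simp
    then have "cnj e * cnj e * de + (e * cnj e) * cnj de = 0" by (simp add: algebra_simps)
    then show ?thesis by (simp add: e eq_neg_iff_add_eq_0)
  qed
  have e3: "cnj e * cnj e * e = cnj e" using e by (simp add: mult.assoc mult.commute[of "cnj e" e])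
  define K where "K = c 3 * (1 - c 5) - c 1 * (1 - c 3)"
  define r1 where "r1 = (c 3 - 1) * c 2 - K * c 2 * (1 - c 4) + c 3 * (1 - c 5) * c 1 * (1 - c 4)"
  define r2 where "r2 = (c 3 - 1) * d 2 - 2 * c 3 * d 4 - K * (d 2 * (1 - c 4) - c 2 * d 4)
        - c 3 * (1 - c 5) * (d 1 * (1 - c 4) - c 1 * d 4)"
  have "form22 (dU_coord c d e de) (W_coord c e) =
     of_real (c 3 - 1) * (of_real (c 2) * cnj de + of_real (d 2) * cnj e) - of_real (2 * c 3 * d 4) * cnj e
     - of_real K * (of_real (c 2 * (1 - c 4)) * cnj de + of_real (d 2 * (1 - c 4) - c 2 * d 4) * cnj e)
     - of_real (c 3 * (1 - c 5)) * (of_real (c 1 * (1 - c 4)) * (cnj e * cnj e * de)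
        + of_real (d 1 * (1 - c 4) - c 1 * d 4) * (cnj e * cnj e * e))"
    unfolding form22_def W_coord_nth dU_coord_def K_def by (simp add: field_simps)
  also have "\<dots> = of_real r1 * cnj de + of_real r2 * cnj e"
    unfolding e2 e3 r1_def r2_def
    by (simp only: of_real_add of_real_diff of_real_mult of_real_1) (simp add: algebra_simps)
  also have "r1 = 0"
    using c by (cases rule: staged_cases) (auto simp: r1_def K_def algebra_simps)
  also have "r2 = 0"
    using c
  proof (cases rule: staged_cases)
    case start
    then show ?thesis using d(2,4) by (cases "c 1 = 1") (auto simp: r2_def K_def algebra_simps)
  next
    case middle
    show ?thesis
    proof (cases "c 3 = 0")
      case True
      then show ?thesis using middle d(2) by (simp add: K_def r2_def)
    next
      case False
      then have "d 1 = 0" "d 2 = 0" using d(1) by auto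
      then show ?thesis using middle d(2)
        by (cases "c 3 = 1") (auto simp: K_def r2_def algebra_simps)
    qed
  next
    case late
    then have "d 1 = 0" "d 2 = 0" using d(1) by auto
    with late d(5) show ?thesis by (cases "c 5 = 0") (auto simp: K_def r2_def algebra_simps)
  qed
  finally show ?thesis by simp
qed

section \<open>Stages and phase as functions on the sphere, and their derivatives\<close>

lemma staged_stage: "staged (\<lambda>j. stage j x)"
proof -
  have "stage j x = 1" if "stage (Suc j) x \<noteq> 0" for j
  proof -
    have "\<not> 4 * x $ 3 + 7/2 - real (Suc j) \<le> 0"
      using that smooth_step(3)[of "4 * x $ 3 + 7/2 - real (Suc j)"] unfolding stage_def by blast
    then have "1 \<le> 4 * x $ 3 + 7/2 - real j" by simp
    then show ?thesis unfolding stage_def by (rule smooth_step(4))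
  qed
  then show ?thesis by (simp add: staged_def smooth_step(1,2) stage_def)
qed

lemma open_off_axis: "open off_axis"
  unfolding off_axis_def by (intro open_Collect_less continuous_intros)

lemma norm_phase:
  assumes "x \<in> off_axis"
  shows "phase x * cnj (phase x) = 1" "cmod (phase x) = 1"
proof -
  have "cmod (Complex (x $ 1) (x $ 2)) = sqrt ((x $ 1)\<^sup>2 + (x $ 2)\<^sup>2)" by (simp add: cmod_def)
  moreover have "sqrt ((x $ 1)\<^sup>2 + (x $ 2)\<^sup>2) > 0" using assms by (simp add: off_axis_def)
  ultimately show n: "cmod (phase x) = 1"
    by (simp only: phase_def norm_mult norm_of_real abs_inverse abs_of_pos) (rule left_inverse, linarith)
  show "phase x * cnj (phase x) = 1"
    using complex_norm_square[of "phase x"] by (simp add: n)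
qed

lemma smooth_coord: "open S \<Longrightarrow> smooth_on S (\<lambda>x :: real^3. x $ i)"
  by (rule smooth_on_linear[OF _ bounded_linear_vec_nth])

lemma smooth_stage: "open S \<Longrightarrow> smooth_on S (stage j)"
  unfolding stage_def[abs_def]
  by (intro smooth_step_composed smooth_on_diff smooth_on_add smooth_on_mult smooth_on_const smooth_coord)

lemma smooth_phase: "smooth_on off_axis phase"
proof -
  note o = open_off_axis
  have r: "smooth_on off_axis (\<lambda>x :: real^3. (x $ 1)\<^sup>2 + (x $ 2)\<^sup>2)"
    unfolding power2_eq_square by (intro smooth_intros smooth_coord o)
  have "smooth_on off_axis (\<lambda>x :: real^3. sqrt ((x $ 1)\<^sup>2 + (x $ 2)\<^sup>2))"
    by (rule smooth_on_compose_real[OF o _ _ smooth_on_sqrt r]) (auto simp: off_axis_def)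
  then have "smooth_on off_axis (\<lambda>x :: real^3. inverse (sqrt ((x $ 1)\<^sup>2 + (x $ 2)\<^sup>2)))"
    by (rule smooth_on_compose_real[OF o _ _ smooth_on_inverse_real, rotated -1]) (auto simp: off_axis_def)
  moreover have "bounded_linear (\<lambda>x :: real^3. Complex (x $ 1) (x $ 2))"
    by (intro linear_conv_bounded_linear[THEN iffD1] linearI) (auto simp: complex_eq_iff)
  ultimately show ?thesis
    unfolding phase_def[abs_def]
    by (intro smooth_on_mult[OF o smooth_on_of_real[OF o] smooth_on_linear[OF o]])
qed

definition step_deriv :: "real \<Rightarrow> real" where
  "step_deriv r = frechet_derivative smooth_step (at r) 1"

lemma step_deriv:
  "(smooth_step has_real_derivative step_deriv r) (at r)"
  "r < 0 \<Longrightarrow> step_deriv r = 0" "r > 1 \<Longrightarrow> step_deriv r = 0"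
proof -
  note D = smooth_on_has_derivative[OF open_UNIV smooth_on_smooth_step, of r]
  have "frechet_derivative smooth_step (at r) v = v * step_deriv r" for v
    using linear_scale[OF has_derivative_linear[OF D], of v 1] by (simp add: step_deriv_def)
  then show DD: "(smooth_step has_real_derivative step_deriv r) (at r)"
    using D by (simp add: has_field_derivative_def mult_commute_abs ext[of "frechet_derivative smooth_step (at r)" "\<lambda>v. v * step_deriv r"])
  show "step_deriv r = 0" if "r < 0"
  proof -
    have "(smooth_step has_real_derivative 0) (at r)"
      by (rule has_field_derivative_transform_within_open[of "\<lambda>_. 0" _ _ "{..<0}"])
         (use that smooth_step(3) in auto)
    with DD show ?thesis by (rule DERIV_unique)
  qed
  show "step_deriv r = 0" if "r > 1"
  proof -
    have "(smooth_step has_real_derivative 0) (at r)"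
      by (rule has_field_derivative_transform_within_open[of "\<lambda>_. 1" _ _ "{1<..}"])
         (use that smooth_step(4) in auto)
    with DD show ?thesis by (rule DERIV_unique)
  qed
qed

definition stage_deriv :: "nat \<Rightarrow> real^3 \<Rightarrow> real^3 \<Rightarrow> real" where
  "stage_deriv j x v = step_deriv (4 * x $ 3 + 7/2 - real j) * (4 * v $ 3)"

lemma stage_has_derivative: "(stage j has_derivative stage_deriv j x) (at x)"
proof -
  have "((\<lambda>x :: real^3. 4 * x $ 3 + 7/2 - real j) has_derivative (\<lambda>v. 4 * v $ 3)) (at x)"
    by (auto intro!: derivative_eq_intros bounded_linear_imp_has_derivative bounded_linear_vec_nth)
  from has_derivative_compose[OF this step_deriv(1)[unfolded has_field_derivative_def]]
  show ?thesis by (simp add: stage_def[abs_def] stage_deriv_def[abs_def])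
qed

text \<open>Stages occupy disjoint height intervals: once a stage has begun the earlier ones are at
  rest, and until it is complete the later ones are.\<close>

lemma stage_deriv_zero:
  assumes "stage j x \<noteq> 0 \<and> i < j \<or> stage j x \<noteq> 1 \<and> j < i"
  shows "stage_deriv i x v = 0"
  using assms
proof
  assume *: "stage j x \<noteq> 0 \<and> i < j"
  have "\<not> 4 * x $ 3 + 7/2 - real j \<le> 0"
    using * smooth_step(3)[of "4 * x $ 3 + 7/2 - real j"] unfolding stage_def by blast
  moreover have "real i + 1 \<le> real j" using * by linarith
  ultimately have "4 * x $ 3 + 7/2 - real i > 1" by linarith
  then show ?thesis by (simp add: stage_deriv_def step_deriv(3))
next
  assume *: "stage j x \<noteq> 1 \<and> j < i"
  have "\<not> 1 \<le> 4 * x $ 3 + 7/2 - real j"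
    using * smooth_step(4)[of "4 * x $ 3 + 7/2 - real j"] unfolding stage_def by blast
  moreover have "real j + 1 \<le> real i" using * by linarith
  ultimately have "4 * x $ 3 + 7/2 - real i < 0" by linarith
  then show ?thesis by (simp add: stage_deriv_def step_deriv(2))
qed

lemma phase_deriv:
  assumes x: "x \<in> off_axis"
  shows "(phase has_derivative frechet_derivative phase (at x)) (at x)"
    "cnj (phase x) * frechet_derivative phase (at x) v + phase x * cnj (frechet_derivative phase (at x) v) = 0"
proof -
  show D: "(phase has_derivative frechet_derivative phase (at x)) (at x)"
    by (rule smooth_on_has_derivative[OF open_off_axis smooth_phase x])
  have "((\<lambda>x. phase x * cnj (phase x)) has_derivative
     (\<lambda>v. phase x * cnj (frechet_derivative phase (at x) v) + frechet_derivative phase (at x) v * cnj (phase x))) (at x)"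
    by (intro has_derivative_mult D bounded_linear.has_derivative[OF bounded_linear_cnj])
  moreover have "((\<lambda>x. phase x * cnj (phase x)) has_derivative (\<lambda>v. 0)) (at x)"
    by (rule has_derivative_transform_within_open[OF has_derivative_const[of 1] open_off_axis x])
       (simp add: norm_phase)
  ultimately have "(\<lambda>v. phase x * cnj (frechet_derivative phase (at x) v) + frechet_derivative phase (at x) v * cnj (phase x)) = (\<lambda>v. 0)"
    by (rule has_derivative_unique)
  from fun_cong[OF this, of v]
  show "cnj (phase x) * frechet_derivative phase (at x) v + phase x * cnj (frechet_derivative phase (at x) v) = 0"
    by (simp add: algebra_simps)
qed

section \<open>Frames built from an orthogonal pair of positive vectors\<close>

lemma split_form_compl: "split_form (- Q) x y = - split_form Q x y"
  unfolding split_form_def sum_negf[symmetric] by (intro sum.cong) auto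

text \<open>Exchanging \<open>Q\<close> with its complement negates the form and exchanges the two
  parts. This allows odd \<open>i\<close> to be treated like even \<open>i\<close>.\<close>

lemma split_frames_compl: "split_frames (- Q) = split_frames Q"
proof -
  have "split_form Q x y = 0 \<longleftrightarrow> split_form Q y x = 0" for x y
    using split_form_commute[of Q x y] by auto
  then show ?thesis unfolding split_frames_def split_form_compl by auto
qed

lemma split_form_diff_left: "split_form Q (x - x') y = split_form Q x y - split_form Q x' y"
  by (simp add: split_form_def algebra_simps sum_subtractf)

lemma split_form_supports:
  assumes "\<And>j. j \<notin> K \<Longrightarrow> x $ j = 0" "\<And>j. j \<in> K \<Longrightarrow> y $ j = 0"
  shows "split_form R x y = 0"
  unfolding split_form_def using assms by (intro sum.neutral) (metis mult_zero_left mult_zero_right complex_cnj_zero)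

lemma smooth_on_split_form:
  assumes "open S" "smooth_on S f" "smooth_on S g"
  shows "smooth_on S (\<lambda>x. split_form R (f x) (g x))"
proof -
  have comp: "smooth_on S (\<lambda>x. h x $ j)" if "smooth_on S h" for h :: "'a \<Rightarrow> complex^'b" and j
    by (rule smooth_on_linear_comp[OF assms(1) bounded_linear_vec_nth that])
  show ?thesis
    unfolding split_form_def using assms by (intro smooth_intros comp)
qed

locale split_block =
  fixes R :: "'n::finite set" and a c p q :: 'n
  assumes a: "a \<in> R" and c: "c \<in> R" and ac: "a \<noteq> c"
    and p: "p \<notin> R" and q: "q \<notin> R" and pq: "p \<noteq> q"
begin

abbreviation K :: "'n set" where "K \<equiv> {a, c, p, q}"

lemma distinct_block [simp]:
  "a \<noteq> c" "c \<noteq> a" "a \<noteq> p" "p \<noteq> a" "a \<noteq> q" "q \<noteq> a" "c \<noteq> p" "p \<noteq> c" "c \<noteq> q" "q \<noteq> c" "p \<noteq> q" "q \<noteq> p"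
  using a c ac p q pq by auto

definition block_vec :: "(nat \<Rightarrow> complex) \<Rightarrow> complex^'n" where
  "block_vec y = (\<chi> j. if j = a then y 0 else if j = c then y 1 else if j = p then y 2 else if j = q then y 3 else 0)"

lemma split_form_block_vec: "split_form R (block_vec x) (block_vec y) = form22 x y"
proof -
  have "split_form R (block_vec x) (block_vec y) =
     (\<Sum>j\<in>K. (if j \<in> R then 1 else -1) * block_vec x $ j * cnj (block_vec y $ j))"
    unfolding split_form_def by (intro sum.mono_neutral_right) (auto simp: block_vec_def)
  then show ?thesis by (simp add: block_vec_def form22_def a c p q)
qed

lemma block_vec_outside: "j \<notin> K \<Longrightarrow> block_vec y $ j = 0"
  by (simp add: block_vec_def)

text \<open>The orthogonal projection off \<open>U\<close> and \<open>W\<close>, multiplied by the product of their norms so that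
  no division occurs.\<close>

definition proj_off :: "complex^'n \<Rightarrow> complex^'n \<Rightarrow> complex^'n \<Rightarrow> complex^'n" where
  "proj_off U W y = of_real (Re (split_form R U U) * Re (split_form R W W)) *s y
     - (split_form R y U * of_real (Re (split_form R W W))) *s U
     - (split_form R y W * of_real (Re (split_form R U U))) *s W"

text \<open>The negative complement of \<open>U\<close> and \<open>W\<close> in the block needs a
  basis depending smoothly on them. Projecting the negative axes \<open>p\<close> and
  \<open>q\<close> provides one, because no negative vector lies in the positive span of
  \<open>U\<close> and \<open>W\<close>.\<close>

definition pair_frame :: "complex^'n \<Rightarrow> complex^'n \<Rightarrow> complex^'n^'n" where
  "pair_frame U W = (\<chi> l j. if j = a then U $ l else if j = c then W $ l
     else if j = p \<or> j = q then proj_off U W (axis j 1) $ l else axis j 1 $ l)"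

lemma proj_off_linear: "proj_off U W (x *s y + x' *s y') = x *s proj_off U W y + x' *s proj_off U W y'"
  by (simp add: proj_off_def split_form_add_left split_form_scale_left vec_eq_iff algebra_simps)

lemma pair_frame_apply:
  "pair_frame U W *v x = x $ a *s U + x $ c *s W + proj_off U W (restrict_vec {p, q} x) + restrict_vec (- K) x"
proof -
  have r: "restrict_vec {p, q} x = x $ p *s axis p 1 + x $ q *s axis q 1"
    by (auto simp: vec_eq_iff axis_def)
  have "(pair_frame U W *v x) $ l = x $ a * U $ l + x $ c * W $ l
     + (x $ p * proj_off U W (axis p 1) $ l + x $ q * proj_off U W (axis q 1) $ l) + restrict_vec (- K) x $ l" for l
  proof -
    have "(pair_frame U W *v x) $ l = (\<Sum>j\<in>UNIV. pair_frame U W $ l $ j * x $ j)"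
      by (simp add: matrix_vector_mult_def)
    also have "\<dots> = (\<Sum>j\<in>K. pair_frame U W $ l $ j * x $ j) + (\<Sum>j\<in>- K. pair_frame U W $ l $ j * x $ j)"
      by (subst sum.union_disjoint[symmetric]) (auto intro: sum.cong)
    also have "(\<Sum>j\<in>- K. pair_frame U W $ l $ j * x $ j) = (\<Sum>j\<in>- K. if j = l then x $ l else 0)"
      by (intro sum.cong) (auto simp: pair_frame_def axis_def)
    also have "\<dots> = restrict_vec (- K) x $ l" by simp
    finally show ?thesis by (simp add: pair_frame_def algebra_simps)
  qed
  then show ?thesis unfolding r proj_off_linear by (simp add: vec_eq_iff)
qed

definition good_pair :: "complex^'n \<Rightarrow> complex^'n \<Rightarrow> bool" where
  "good_pair U W \<longleftrightarrow> (\<forall>j. j \<notin> K \<longrightarrow> U $ j = 0 \<and> W $ j = 0) \<and> split_form R U W = 0 \<and>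
     0 < Re (split_form R U U) \<and> 0 < Re (split_form R W W)"

lemma good_pair_norms:
  "split_form R U U = of_real (Re (split_form R U U))"
  by (simp add: split_form_self)

lemma proj_off_orthogonal:
  assumes "good_pair U W"
  shows "split_form R (proj_off U W y) U = 0" "split_form R (proj_off U W y) W = 0"
proof -
  have UW: "split_form R U W = 0" "split_form R W U = 0"
    using assms split_form_commute[of R W U] by (auto simp: good_pair_def)
  have "split_form R (proj_off U W y) U = of_real (Re (split_form R U U) * Re (split_form R W W)) * split_form R y U
     - split_form R y U * of_real (Re (split_form R W W)) * split_form R U U"
    by (simp add: proj_off_def split_form_diff_left split_form_scale_left UW)
  then show "split_form R (proj_off U W y) U = 0"
    by (subst (asm) (4) good_pair_norms) simp
  have "split_form R (proj_off U W y) W = of_real (Re (split_form R U U) * Re (split_form R W W)) * split_form R y W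
     - split_form R y W * of_real (Re (split_form R U U)) * split_form R W W"
    by (simp add: proj_off_def split_form_diff_left split_form_scale_left UW)
  then show "split_form R (proj_off U W y) W = 0"
    by (subst (asm) (4) good_pair_norms) simp
qed

lemma proj_off_outside:
  assumes "good_pair U W" "\<And>j. j \<notin> K \<Longrightarrow> y $ j = 0" "j \<notin> K"
  shows "proj_off U W y $ j = 0"
  using assms by (simp add: proj_off_def good_pair_def)

lemma split_form_two_terms:
  assumes "split_form R u v = 0"
  shows "Re (split_form R (u + v) (u + v)) = Re (split_form R u u) + Re (split_form R v v)"
  using assms split_form_commute[of R v u] by (simp add: split_form_add_left split_form_add_right)

lemma Re_split_form_scale: "Re (split_form R (z *s u) (z *s u)) = (cmod z)\<^sup>2 * Re (split_form R u u)"
proof -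
  have "split_form R (z *s u) (z *s u) = z * cnj z * split_form R u u"
    by (simp add: split_form_scale_left split_form_scale_right)
  also have "z * cnj z = of_real ((cmod z)\<^sup>2)" by (rule complex_norm_square[symmetric])
  finally show ?thesis by (simp del: of_real_power)
qed

lemma pair_positive:
  assumes "good_pair U W"
  shows "Re (split_form R (z *s U + w *s W) (z *s U + w *s W)) =
    (cmod z)\<^sup>2 * Re (split_form R U U) + (cmod w)\<^sup>2 * Re (split_form R W W)"
proof -
  have "split_form R (z *s U) (w *s W) = 0"
    using assms by (simp add: good_pair_def split_form_scale_left split_form_scale_right)
  from split_form_two_terms[OF this] show ?thesis by (simp only: Re_split_form_scale)
qed

text \<open>A positive multiple of \<open>y\<close> is the orthogonal sum of its projection and a
  vector \<open>P\<close> in the positive span of \<open>U\<close> and \<open>W\<close>. The value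
  on \<open>y\<close> is negative and that on \<open>P\<close> nonnegative, which leaves a negative
  value for the projection.\<close>

lemma proj_off_negative:
  assumes g: "good_pair U W" and y: "restrict_vec (- R) y = y" "y \<noteq> 0"
  shows "Re (split_form R (proj_off U W y) (proj_off U W y)) < 0"
proof -
  define P where "P = (split_form R y U * of_real (Re (split_form R W W))) *s U
     + (split_form R y W * of_real (Re (split_form R U U))) *s W"
  let ?n = "Re (split_form R U U) * Re (split_form R W W)"
  have pos: "0 < Re (split_form R U U)" "0 < Re (split_form R W W)" using g by (auto simp: good_pair_def)
  have "of_real ?n *s y = proj_off U W y + P" by (simp add: proj_off_def P_def)
  moreover have "split_form R (proj_off U W y) P = 0"
    by (simp add: P_def split_form_add_right split_form_scale_right proj_off_orthogonal[OF g])
  ultimately have "(cmod (of_real ?n))\<^sup>2 * Re (split_form R y y) =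
      Re (split_form R (proj_off U W y) (proj_off U W y)) + Re (split_form R P P)"
    using split_form_two_terms Re_split_form_scale by metis
  moreover have "Re (split_form R P P) \<ge> 0"
    unfolding P_def pair_positive[OF g] using pos by simp
  moreover have "(cmod (of_real ?n))\<^sup>2 * Re (split_form R y y) < 0"
    using pos split_form_neg[OF y] by (intro mult_pos_neg) auto
  ultimately show ?thesis by linarith
qed

lemma pair_frame_split_frames:
  assumes g: "good_pair U W"
  shows "pair_frame U W \<in> split_frames R"
  unfolding split_frames_def
proof (intro CollectI allI impI conjI)
  have KK: "split_form R u v = 0" if "\<And>j. j \<notin> K \<Longrightarrow> u $ j = 0" "\<And>j. j \<in> K \<Longrightarrow> v $ j = 0" for u v
    by (rule split_form_supports[of K]) (use that in blast)+
  fix x y :: "complex^'n" assume x: "restrict_vec R x = x" and y: "restrict_vec (- R) y = y"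
  have x0: "x $ j = 0" if "j \<notin> R" for j using x that by (metis restrict_vec_nth)
  have y0: "y $ j = 0" if "j \<in> R" for j using y that by (metis restrict_vec_nth ComplD)
  define x1 where "x1 = x $ a *s U + x $ c *s W"
  define x2 where "x2 = restrict_vec (- K) x"
  define y1 where "y1 = proj_off U W (restrict_vec {p, q} y)"
  define y2 where "y2 = restrict_vec (- K) y"
  have "restrict_vec {p, q} x = 0" using x0 p q by (auto simp: vec_eq_iff)
  then have fx: "pair_frame U W *v x = x1 + x2"
    by (simp add: pair_frame_apply x1_def x2_def proj_off_def)
  have fy: "pair_frame U W *v y = y1 + y2"
    using a c by (simp add: pair_frame_apply y0 y1_def y2_def)
  have supp: "x1 $ j = 0" "y1 $ j = 0" if "j \<notin> K" for j
    using that g proj_off_outside[OF g _ that, of "restrict_vec {p, q} y"] by (auto simp: x1_def y1_def good_pair_def)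
  have "split_form R x1 y2 = 0" "split_form R x1 x2 = 0" "split_form R y1 y2 = 0" "split_form R y1 x2 = 0"
    by (rule KK; use supp in \<open>auto simp: x2_def y2_def\<close>)+
  moreover have "split_form R x2 y2 = 0"
    by (rule split_form_supports[of R]) (auto simp: x2_def y2_def x0 y0)
  moreover have "split_form R y1 x1 = 0"
    by (simp add: x1_def y1_def split_form_add_right split_form_scale_right proj_off_orthogonal[OF g])
  ultimately have o: "split_form R x1 y2 = 0" "split_form R x1 x2 = 0" "split_form R y1 y2 = 0"
     "split_form R x2 y1 = 0" "split_form R x2 y2 = 0" "split_form R x1 y1 = 0"
    using split_form_commute[of R] by (metis complex_cnj_zero)+
  show "split_form R (pair_frame U W *v x) (pair_frame U W *v y) = 0"
    by (simp add: fx fy split_form_add_left split_form_add_right o)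
  have x2R: "restrict_vec R x2 = x2" and y2R: "restrict_vec (- R) y2 = y2"
    by (auto simp: vec_eq_iff x2_def y2_def x0 y0)
  have posUW: "0 < Re (split_form R U U)" "0 < Re (split_form R W W)" using g by (auto simp: good_pair_def)
  show "0 < Re (split_form R (pair_frame U W *v x) (pair_frame U W *v x))" if "x \<noteq> 0"
  proof -
    have x2n: "0 \<le> Re (split_form R x2 x2)" using split_form_pos[OF x2R] by (cases "x2 = 0") auto
    have e: "Re (split_form R (pair_frame U W *v x) (pair_frame U W *v x)) =
        (cmod (x $ a))\<^sup>2 * Re (split_form R U U) + (cmod (x $ c))\<^sup>2 * Re (split_form R W W) + Re (split_form R x2 x2)"
      unfolding fx split_form_two_terms[OF o(2)] unfolding x1_def pair_positive[OF g] by simp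
    have "x $ a \<noteq> 0 \<or> x $ c \<noteq> 0 \<or> x2 \<noteq> 0"
    proof (rule ccontr)
      assume "\<not> (x $ a \<noteq> 0 \<or> x $ c \<noteq> 0 \<or> x2 \<noteq> 0)"
      then have z: "x $ a = 0" "x $ c = 0" "x2 = 0" by auto
      have "restrict_vec (- K) x $ j = 0" for j using z(3) by (simp add: x2_def)
      from this[unfolded restrict_vec_nth] have "x $ j = 0" for j
        using z(1,2) x0[OF p] x0[OF q] by (metis ComplI insertE singletonD)
      with that show False by (auto simp: vec_eq_iff)
    qed
    then consider "x $ a \<noteq> 0" | "x $ c \<noteq> 0" | "x2 \<noteq> 0" by blast
    moreover have "0 \<le> (cmod (x $ a))\<^sup>2 * Re (split_form R U U)" "0 \<le> (cmod (x $ c))\<^sup>2 * Re (split_form R W W)"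
      "x $ a \<noteq> 0 \<Longrightarrow> 0 < (cmod (x $ a))\<^sup>2 * Re (split_form R U U)"
      "x $ c \<noteq> 0 \<Longrightarrow> 0 < (cmod (x $ c))\<^sup>2 * Re (split_form R W W)"
      using posUW by auto
    ultimately show ?thesis unfolding e
      using x2n split_form_pos[OF x2R] by cases linarith+
  qed
  show "Re (split_form R (pair_frame U W *v y) (pair_frame U W *v y)) < 0" if "y \<noteq> 0"
  proof -
    have y2n: "Re (split_form R y2 y2) \<le> 0" using split_form_neg[OF y2R] by (cases "y2 = 0") auto
    let ?z = "restrict_vec {p, q} y"
    have zR: "restrict_vec (- R) ?z = ?z" using p q by (auto simp: vec_eq_iff)
    have y1n: "Re (split_form R y1 y1) \<le> 0"
      using proj_off_negative[OF g zR] by (cases "?z = 0") (auto simp: y1_def proj_off_def)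
    have e: "Re (split_form R (pair_frame U W *v y) (pair_frame U W *v y)) = Re (split_form R y1 y1) + Re (split_form R y2 y2)"
      unfolding fy by (rule split_form_two_terms[OF o(3)])
    have "?z \<noteq> 0 \<or> y2 \<noteq> 0"
    proof (rule ccontr)
      assume "\<not> (?z \<noteq> 0 \<or> y2 \<noteq> 0)"
      then have z: "?z = 0" "y2 = 0" by auto
      have "y $ j = 0" for j
        using y0 a c arg_cong[OF z(1), of "\<lambda>v. v $ j"] arg_cong[OF z(2), of "\<lambda>v. v $ j"]
        by (cases "j \<in> {a, c}"; cases "j \<in> {p, q}") (auto simp: y2_def)
      with that show False by (auto simp: vec_eq_iff)
    qed
    then show ?thesis
      using y1n y2n split_form_neg[OF y2R] proj_off_negative[OF g zR] unfolding e y1_def by fastforce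
  qed
qed

text \<open>All other columns that can enter are orthogonal to \<open>W\<close>, so the coefficient
  of \<open>W\<close> in \<open>u\<close> is the quotient of the products of \<open>u\<close> and of
  \<open>W\<close> with \<open>W\<close>. It vanishes for \<open>u\<close> orthogonal to
  \<open>W\<close>.\<close>

lemma pair_frame_preimage:
  assumes g: "good_pair U W" and u: "\<And>j. j \<notin> K \<Longrightarrow> u $ j = 0"
  obtains z where "pair_frame U W *v z = u" "\<And>j. j \<notin> K \<Longrightarrow> z $ j = 0" "split_form R u W = 0 \<Longrightarrow> z $ c = 0"
proof -
  have inv: "invertible (pair_frame U W)"
    by (rule split_frames_invertible[OF pair_frame_split_frames[OF g]])
  define z where "z = matrix_inv (pair_frame U W) *v u"
  have z: "pair_frame U W *v z = u"
    by (simp add: z_def matrix_vector_mul_assoc matrix_inv_right[OF inv])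
  have out: "z $ j = 0" if "j \<notin> K" for j
  proof -
    have "(pair_frame U W *v z) $ j = z $ j"
      using that g proj_off_outside[OF g _ that, of "restrict_vec {p, q} z"]
      by (simp add: pair_frame_apply good_pair_def)
    then show ?thesis using u[OF that] z by simp
  qed
  have "restrict_vec (- K) z = 0" using out by (auto simp: vec_eq_iff)
  then have "split_form R u W = z $ c * split_form R W W"
    using g by (simp add: z[symmetric] pair_frame_apply split_form_add_left split_form_scale_left
        proj_off_orthogonal[OF g] good_pair_def)
  then have "z $ c = 0" if "split_form R u W = 0" using that g by (auto simp: good_pair_def)
  with z out show thesis by (intro that) auto
qed

lemma pair_frame_nth:
  "pair_frame U W $ l $ a = U $ l" "j \<notin> K \<Longrightarrow> pair_frame U W $ l $ j = (if l = j then 1 else 0)"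
  by (auto simp: pair_frame_def axis_def)

lemma pair_frame_outside:
  assumes "\<And>j. j \<notin> K \<Longrightarrow> U $ j = 0 \<and> W $ j = 0" "l \<notin> K"
  shows "pair_frame U W $ l $ j = (if l = j then 1 else 0)"
  using assms by (auto simp: pair_frame_def axis_def proj_off_def)

lemma smooth_on_pair_frame:
  assumes S: "open S" and U: "smooth_on S U" and W: "smooth_on S W"
  shows "smooth_on S (\<lambda>x. pair_frame (U x) (W x))"
proof -
  have comp: "smooth_on S (\<lambda>x. h x $ j)" if "smooth_on S h" for h :: "_ \<Rightarrow> complex^'n" and j
    by (rule smooth_on_linear_comp[OF S bounded_linear_vec_nth that])
  have R: "smooth_on S (\<lambda>x. complex_of_real (Re (split_form R (h x) (h x))))" if "smooth_on S h" for h
    by (intro smooth_on_of_real[OF S] smooth_on_linear_comp[OF S bounded_linear_Re] smooth_on_split_form[OF S] that)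
  have P: "smooth_on S (\<lambda>x. proj_off (U x) (W x) y $ l)" for y l
    unfolding proj_off_def vector_minus_component vector_smult_component of_real_mult
    by (intro smooth_intros R comp smooth_on_split_form S U W)
  show ?thesis
  proof (intro smooth_on_vec S)
    fix l j
    consider "j = a" | "j = c" | "j = p \<or> j = q" | "j \<notin> K" by blast
    then show "smooth_on S (\<lambda>x. pair_frame (U x) (W x) $ l $ j)"
      by cases (auto simp: pair_frame_def intro: comp U W P smooth_on_const S)
  qed
qed

end

section \<open>The superhorizontal sphere through levels i, i + 1 and i + 2\<close>

lemma sphere2_coord: "x \<in> sphere2 \<Longrightarrow> (x $ 1)\<^sup>2 + (x $ 2)\<^sup>2 + (x $ 3)\<^sup>2 = (1 :: real)"
  by (simp add: norm_eq_1 inner_vec_def sum_3 power2_eq_square)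

lemma sphere2_off_axis:
  assumes "x \<in> sphere2" "\<bar>x $ 3\<bar> < 1"
  shows "x \<in> off_axis"
proof -
  have "(x $ 3)\<^sup>2 < 1" using assms(2) by (simp add: abs_square_less_1)
  then show ?thesis using sphere2_coord[OF assms(1)] by (simp add: off_axis_def)
qed

lemma stage_low: "x $ 3 \<le> - 5/8 \<Longrightarrow> 1 \<le> j \<Longrightarrow> stage j x = 0"
  unfolding stage_def by (rule smooth_step(3)) simp

lemma stage_high: "x $ 3 \<ge> 5/8 \<Longrightarrow> j \<le> 5 \<Longrightarrow> stage j x = 1"
  unfolding stage_def by (rule smooth_step(4)) simp

text \<open>The two distinct coordinates \<open>p\<close> and \<open>q\<close> of level
  \<open>i + 1\<close> are what the hypothesis on the ranks provides.\<close>

locale higgs_step = based_period_frames H k lev M b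
  for H :: "complex^'n::finite \<Rightarrow> complex^'n \<Rightarrow> complex" and k lev M b +
  fixes i :: nat and a c p q :: 'n
  assumes lev_a: "lev a = i" and lev_c: "lev c = i + 2"
    and lev_p: "lev p = i + 1" and lev_q: "lev q = i + 1" and p_q: "p \<noteq> q"
begin

text \<open>The coordinates of the parity of \<open>i\<close>. With respect to \<open>R\<close> the
  levels \<open>i\<close> and \<open>i + 2\<close> are positive whatever that parity is.\<close>

definition R :: "'n set" where "R = (if even i then Q else - Q)"

sublocale split_block R a c p q
  using lev_a lev_c lev_p lev_q p_q by unfold_locales (auto simp: R_def Q_def)

lemma split_frames_R: "split_frames R = frames"
  by (simp add: R_def split_frames_compl)

definition U_vec :: "real^3 \<Rightarrow> complex^'n" where
  "U_vec x = block_vec (U_coord (\<lambda>j. stage j x) (phase x))"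

definition W_vec :: "real^3 \<Rightarrow> complex^'n" where
  "W_vec x = block_vec (W_coord (\<lambda>j. stage j x) (phase x))"

definition G :: "real^3 \<Rightarrow> complex^'n^'n" where
  "G x = pair_frame (U_vec x) (W_vec x)"

lemma good_pair_G:
  assumes "x \<in> off_axis \<or> x $ 3 \<le> - 5/8"
  shows "good_pair (U_vec x) (W_vec x)"
proof -
  have e: "stage 1 x = 0 \<or> phase x * cnj (phase x) = 1" "stage 1 x = 0 \<or> cmod (phase x) = 1"
    using assms norm_phase[of x] stage_low[of x 1] by auto
  show ?thesis
    unfolding good_pair_def U_vec_def W_vec_def split_form_block_vec
    using block_vec_outside U_W_orthogonal[OF staged_stage e(1)] U_positive[OF staged_stage e(2)]
      W_positive[OF staged_stage e(2)] by auto
qed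

lemma G_frames: "x \<in> off_axis \<or> x $ 3 \<le> - 5/8 \<Longrightarrow> G x \<in> frames"
  unfolding G_def split_frames_R[symmetric] by (rule pair_frame_split_frames[OF good_pair_G])

lemma G_low:
  assumes "x $ 3 \<le> - 5/8" "y $ 3 \<le> - 5/8"
  shows "G x = G y"
proof -
  have "U_coord (\<lambda>j. stage j x) (phase x) = U_coord (\<lambda>j. stage j y) (phase y)"
    "W_coord (\<lambda>j. stage j x) (phase x) = W_coord (\<lambda>j. stage j y) (phase y)"
    unfolding U_coord_def W_coord_def using stage_low[OF assms(1)] stage_low[OF assms(2)] by simp_all
  then show ?thesis by (simp add: G_def U_vec_def W_vec_def)
qed

text \<open>All stages are complete, so \<open>U\<close> and \<open>W\<close> lie along the axes of
  levels \<open>i\<close> and \<open>i + 2\<close> and only the phases still turn, with opposite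
  sense in the two levels. The 4 at \<open>p\<close> and \<open>q\<close> is the product of the
  squares 1 and 4 of \<open>U\<close> and \<open>W\<close> kept in \<open>proj_off\<close>.\<close>

lemma G_high:
  assumes x: "x \<in> off_axis" and 3: "x $ 3 \<ge> 5/8"
  shows "G x = diag_mat (\<lambda>j. if j = a then cnj (phase x) else if j = c then 2 * phase x
     else if j = p \<or> j = q then 4 else 1)"
proof -
  let ?e = "phase x"
  have U: "U_vec x = cnj ?e *s axis a 1" and W: "W_vec x = (2 * ?e) *s axis c 1"
    using stage_high[OF 3] by (auto simp: U_vec_def W_vec_def block_vec_def U_coord_def W_coord_def vec_eq_iff axis_def)
  have ax: "split_form R (axis j 1) (axis l 1) = (if j = l then if j \<in> R then 1 else -1 else 0)" for j l
  proof -
    have "split_form R (axis j 1) (axis l 1) = (\<Sum>m\<in>UNIV. if m = j then (if j = l then if j \<in> R then 1 else -1 else 0) else 0)"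
      unfolding split_form_def by (intro sum.cong) (auto simp: axis_def)
    then show ?thesis by simp
  qed
  have N: "Re (split_form R (U_vec x) (U_vec x)) = 1" "Re (split_form R (W_vec x) (W_vec x)) = 4"
    unfolding U W Re_split_form_scale ax using a c by (auto simp: norm_mult norm_phase[OF x])
  have P: "proj_off (U_vec x) (W_vec x) (axis j 1) = 4 *s axis j 1" if "j = p \<or> j = q" for j
  proof -
    have "split_form R (axis j 1) (U_vec x) = 0" "split_form R (axis j 1) (W_vec x) = 0"
      unfolding U W split_form_scale_right ax using that by auto
    then show ?thesis by (simp add: proj_off_def N)
  qed
  have "G x $ l $ j = diag_mat (\<lambda>j. if j = a then cnj ?e else if j = c then 2 * ?e
     else if j = p \<or> j = q then 4 else 1) $ l $ j" for l j
  proof -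
    consider "j = a" | "j = c" | "j = p \<or> j = q" | "j \<notin> K" by blast
    then show ?thesis
    proof cases
      case 3
      then show ?thesis using P[OF 3] by (auto simp: G_def pair_frame_def diag_mat_def axis_def)
    qed (auto simp: G_def pair_frame_def U W diag_mat_def axis_def)
  qed
  then show ?thesis by (simp add: vec_eq_iff)
qed

lemma G_high_block:
  assumes "x \<in> off_axis" "x $ 3 \<ge> 5/8"
  shows "G x \<in> block_mats lev"
proof -
  have "invertible (G x)" using assms by (intro split_frames_invertible[OF G_frames]) auto
  moreover have "G x $ l $ j = 0" if "lev l \<noteq> lev j" for l j
  proof -
    have "l \<noteq> j" using that by metis
    then show ?thesis by (simp add: G_high[OF assms] diag_mat_def)
  qed
  ultimately show ?thesis by (simp add: block_mats_def)
qed

lemma smooth_coords: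
  "smooth_on off_axis U_vec" "smooth_on off_axis W_vec"
proof -
  note o = open_off_axis
  note s = smooth_intros o smooth_stage[OF o] smooth_phase
  show "smooth_on off_axis U_vec"
  proof (intro smooth_on_vec o)
    fix j consider "j = a" | "j = c" | "j = p" | "j = q" | "j \<notin> K" by blast
    then show "smooth_on off_axis (\<lambda>x. U_vec x $ j)"
      by cases (simp_all only: U_vec_def block_vec_def U_coord_nth vec_lambda_beta distinct_block if_True if_False refl,
        (intro s)+, auto intro: s)
  qed
  show "smooth_on off_axis W_vec"
  proof (intro smooth_on_vec o)
    fix j consider "j = a" | "j = c" | "j = p" | "j = q" | "j \<notin> K" by blast
    then show "smooth_on off_axis (\<lambda>x. W_vec x $ j)"
      by cases (simp_all only: W_vec_def block_vec_def W_coord_nth vec_lambda_beta distinct_block if_True if_False refl,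
        (intro s)+, auto intro: s)
  qed
qed

lemma smooth_G: "smooth_on off_axis G"
  unfolding G_def[abs_def] by (intro smooth_on_pair_frame open_off_axis smooth_coords)

lemma G_derivative:
  assumes "x \<in> off_axis"
  shows "((\<lambda>x. G x $ l $ j) has_derivative (\<lambda>v. frechet_derivative G (at x) v $ l $ j)) (at x)"
  using smooth_on_has_derivative[OF open_off_axis smooth_G assms]
  by (intro bounded_linear.has_derivative[OF bounded_linear_vec_nth])

lemma dG_outside:
  assumes "x \<in> off_axis" "l \<notin> K \<or> j \<notin> K"
  shows "frechet_derivative G (at x) v $ l $ j = 0"
proof -
  have "G y $ l $ j = (if l = j then 1 else 0)" for y
    using assms(2) pair_frame_nth(2)[of j] pair_frame_outside[of "U_vec y" "W_vec y" l]
    by (auto simp: G_def U_vec_def W_vec_def block_vec_outside)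
  then have "((\<lambda>x. G x $ l $ j) has_derivative (\<lambda>v. 0)) (at x)" by simp
  from has_derivative_unique[OF G_derivative[OF assms(1)] this] show ?thesis by (rule fun_cong)
qed

lemma U_vec_derivative:
  assumes "x \<in> off_axis"
  shows "((\<lambda>x. U_vec x $ l) has_derivative (\<lambda>v. block_vec
    (dU_coord (\<lambda>j. stage j x) (\<lambda>j. stage_deriv j x v) (phase x) (frechet_derivative phase (at x) v)) $ l)) (at x)"
proof -
  have st: "((\<lambda>x. stage j x) has_derivative (\<lambda>v. stage_deriv j x v)) (at x)" for j
    using stage_has_derivative[of j x] .
  have ph: "((\<lambda>x. phase x) has_derivative (\<lambda>v. frechet_derivative phase (at x) v)) (at x)"
    using phase_deriv(1)[OF assms] .
  note intros = derivative_eq_intros st ph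
  consider "l = a" | "l = c" | "l = p" | "l = q" | "l \<notin> K" by blast
  then show ?thesis
  proof cases
    case 1
    show ?thesis unfolding U_vec_def block_vec_def vec_lambda_beta
      by (simp add: 1 U_coord_nth dU_coord_def) (rule intros refl | simp add: field_simps)+
  next
    case 2
    show ?thesis unfolding U_vec_def block_vec_def vec_lambda_beta
      by (simp add: 2 U_coord_def dU_coord_def) (rule intros refl | simp add: algebra_simps)+
  next
    case 3
    show ?thesis unfolding U_vec_def block_vec_def vec_lambda_beta
      by (simp add: 3 U_coord_nth dU_coord_def) (rule intros refl | simp add: field_simps)+
  next
    case 4
    show ?thesis unfolding U_vec_def block_vec_def vec_lambda_beta
      by (simp add: 4 U_coord_nth dU_coord_def) (rule intros refl | simp add: field_simps)+
  next
    case 5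
    then show ?thesis by (simp add: U_vec_def block_vec_outside)
  qed
qed

lemma dG_first:
  assumes x: "x \<in> off_axis"
  shows "split_form R (column a (frechet_derivative G (at x) v)) (W_vec x) = 0"
proof -
  let ?dU = "block_vec (dU_coord (\<lambda>j. stage j x) (\<lambda>j. stage_deriv j x v) (phase x) (frechet_derivative phase (at x) v))"
  have "frechet_derivative G (at x) v $ l $ a = ?dU $ l" for l
    using fun_cong[OF has_derivative_unique[OF G_derivative[OF x, of l a]], of _ v] U_vec_derivative[OF x, of l]
    by (simp add: G_def pair_frame_nth)
  then have "column a (frechet_derivative G (at x) v) = ?dU" by (simp add: vec_eq_iff column_def)
  moreover have "form22 (dU_coord (\<lambda>j. stage j x) (\<lambda>j. stage_deriv j x v) (phase x) (frechet_derivative phase (at x) v))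
      (W_coord (\<lambda>j. stage j x) (phase x)) = 0"
  proof (intro dU_W_orthogonal staged_stage norm_phase(1)[OF x] phase_deriv(2)[OF x])
    note z = stage_deriv_zero[of _ x _ v]
    show "stage 3 x \<noteq> 0 \<Longrightarrow> stage_deriv 1 x v = 0 \<and> stage_deriv 2 x v = 0"
      using z[of 3 1] z[of 3 2] by simp
    show "stage 3 x \<noteq> 1 \<Longrightarrow> stage_deriv 4 x v = 0" using z[of 3 4] by simp
    show "stage 2 x \<noteq> 0 \<Longrightarrow> stage_deriv 1 x v = 0" using z[of 2 1] by simp
    show "stage 1 x \<noteq> 1 \<Longrightarrow> stage_deriv 2 x v = 0" using z[of 1 2] by simp
    show "stage 5 x \<noteq> 0 \<Longrightarrow> stage_deriv 4 x v = 0" using z[of 5 4] by simp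
  qed
  ultimately show ?thesis by (simp add: W_vec_def split_form_block_vec)
qed

text \<open>Superhorizontality in frame coordinates. Below level \<open>i\<close> nothing moves, and
  from level \<open>i + 1\<close> on the next step already contains the whole block. The only
  condition is at level \<open>i\<close>, where the derivative of the column \<open>U\<close> must
  have no component along the column \<open>W\<close> of level \<open>i + 2\<close>; this is
  orthogonality to \<open>W\<close>.\<close>

lemma dG_std_flag:
  assumes x: "x \<in> off_axis" and y: "y \<in> std_flag l"
  obtains z where "z \<in> std_flag (Suc l)" "frechet_derivative G (at x) v *v y = G x *v z"
proof -
  let ?dG = "frechet_derivative G (at x) v"
  have g: "good_pair (U_vec x) (W_vec x)" using good_pair_G x by blast
  have y0: "y $ j = 0" if "lev j > l" for j using y that by (simp add: std_flag_def)
  have out: "(?dG *v y) $ j = 0" if "j \<notin> K" for j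
    using that dG_outside[OF x] by (simp add: matrix_vector_mult_def)
  obtain z where z: "G x *v z = ?dG *v y" "\<And>j. j \<notin> K \<Longrightarrow> z $ j = 0"
    "split_form R (?dG *v y) (W_vec x) = 0 \<Longrightarrow> z $ c = 0"
    by (rule pair_frame_preimage[OF g, where u = "?dG *v y"]) (use out in \<open>auto simp: G_def\<close>)
  have dy: "?dG *v y = (\<Sum>j\<in>K. y $ j *s column j ?dG)"
  proof -
    have "column j ?dG = 0" if "j \<notin> K" for j using dG_outside[OF x, of _ j v] that by (simp add: column_def vec_eq_iff)
    then show ?thesis
      unfolding matrix_vector_mult_columns by (intro sum.mono_neutral_right) auto
  qed
  consider "l < i" | "l = i" | "l > i" by linarith
  then show thesis
  proof cases
    case 1
    then have "?dG *v y = 0" unfolding dy using y0 lev_a lev_c lev_p lev_q by simp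
    then show thesis by (intro that[of 0]) (auto simp: std_flag_def)
  next
    case 2
    then have "?dG *v y = y $ a *s column a ?dG" unfolding dy using y0 lev_c lev_p lev_q by simp
    then have "z $ c = 0" by (intro z(3)) (simp add: split_form_scale_left dG_first[OF x])
    then have "z $ j = 0" if "lev j > Suc l" for j
      using z(2)[of j] that 2 lev_a lev_p lev_q by (cases "j \<in> K") auto
    then have "z \<in> std_flag (Suc l)" by (auto simp: std_flag_def)
    then show thesis using z(1) by (intro that) auto
  next
    case 3
    then have "z $ j = 0" if "lev j > Suc l" for j
      using z(2)[of j] that lev_a lev_c lev_p lev_q by (cases "j \<in> K") auto
    then have "z \<in> std_flag (Suc l)" by (auto simp: std_flag_def)
    then show thesis using z(1) by (intro that) auto
  qed
qed

text \<open>Near the north pole the phase has no limit, but \<open>G\<close> is block diagonal there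
  off the axis and its flag is \<open>b\<close>, so the sphere continues by the constant. For
  heights from 5/8 to 7/10 both descriptions agree, which makes the smooth lifts overlap.\<close>

definition sph :: "real^3 \<Rightarrow> 'n flag" where
  "sph x = (if x $ 3 \<ge> 7/10 then b else orbit (G x))"

lemma sph_high: "x \<in> off_axis \<Longrightarrow> x $ 3 \<ge> 5/8 \<Longrightarrow> sph x = b"
  by (simp add: sph_def orbit_block G_high_block)

lemma sph_in_D:
  assumes "x \<in> sphere2"
  shows "sph x \<in> D"
proof (cases "x $ 3 \<ge> 7/10")
  case True
  then show ?thesis by (simp add: sph_def b_in_D)
next
  case False
  then have "x \<in> off_axis \<or> x $ 3 \<le> - 5/8" using sphere2_off_axis[OF assms] by fastforce
  with False show ?thesis by (simp add: sph_def orbit_in_D G_frames)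
qed

lemma std_flag_flags: "std_flag \<in> flags k rk"
  using flag_act_std_flags[OF invertible_mat_1] by simp

lemma zero_mem_flag: "F \<in> flags k rk \<Longrightarrow> 0 \<in> F j"
  using flagsD(1)[of F j] by (cases "j \<le> k") (auto simp: flags_def dest: vec.subspace_0)

lemma superhorizontal_constant:
  assumes F: "sph x \<in> flags k rk" and L: "smooth_lift_at k rk sph x (\<lambda>_. A)"
  shows "\<exists>A\<in>superhorizontal_endos k (sph x). represents_differential k rk sph x v A"
proof (rule bexI)
  show "represents_differential k rk sph x v 0"
    unfolding represents_differential_def using L zero_mem_flag[OF F]
    by (intro exI[of _ "\<lambda>_. A"]) (auto simp: flag_stab_def)
  show "0 \<in> superhorizontal_endos k (sph x)"
    using zero_mem_flag[OF F] by (auto simp: superhorizontal_endos_def)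
qed

lemma lift_mid:
  assumes x: "x \<in> off_axis" and 3: "x $ 3 < 7/10"
  shows "smooth_lift_at k rk sph x (\<lambda>y. M ** G y)"
  unfolding smooth_lift_at_def
proof (intro exI bexI conjI ballI)
  let ?W = "off_axis \<inter> {x. x $ 3 < 7/10}"
  show o: "open ?W" by (intro open_Int open_off_axis open_halfspace_component_lt_cart)
  have "bounded_linear (\<lambda>A :: complex^'n^'n. M ** A)"
    by (intro linear_conv_bounded_linear[THEN iffD1] linearI)
         (auto simp: matrix_add_ldistrib vec_eq_iff matrix_matrix_mult_def scaleR_sum_right ring_distribs sum.distrib)
  then show "smooth_on ?W (\<lambda>y. M ** G y)"
    by (rule smooth_on_linear_comp[OF o _ smooth_on_subset[OF smooth_G]]) auto
  show "x \<in> ?W" using assms by simp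
  show "std_flag \<in> flags k rk" by (rule std_flag_flags)
  fix y assume "y \<in> ?W \<inter> sphere2"
  then show "invertible (M ** G y)" "sph y = flag_act (M ** G y) std_flag"
    using split_frames_invertible[OF G_frames, of y]
    by (auto simp: sph_def orbit_def intro!: invertible_mult M_inv)
qed

lemma lift_low:
  assumes 3: "x $ 3 < - 5/8"
  shows "smooth_lift_at k rk sph x (\<lambda>_. M ** G x)"
  unfolding smooth_lift_at_def
proof (intro exI bexI conjI ballI)
  let ?W = "{x :: real^3. x $ 3 < - 5/8}"
  show o: "open ?W" by (intro open_halfspace_component_lt_cart)
  show "smooth_on ?W (\<lambda>y. M ** G x)" by (rule smooth_on_const[OF o])
  show "x \<in> ?W" using assms by simp
  show "std_flag \<in> flags k rk" by (rule std_flag_flags)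
  show "invertible (M ** G x)"
    using split_frames_invertible[OF G_frames, of x] 3 by (intro invertible_mult M_inv) auto
  fix y assume "y \<in> ?W \<inter> sphere2"
  then show "sph y = flag_act (M ** G x) std_flag"
    using G_low[of y x] 3 by (auto simp: sph_def orbit_def)
qed

lemma lift_high:
  assumes 3: "x $ 3 > 13/20"
  shows "smooth_lift_at k rk sph x (\<lambda>_. M)"
  unfolding smooth_lift_at_def
proof (intro exI bexI conjI ballI)
  let ?W = "{x :: real^3. x $ 3 > 13/20}"
  show o: "open ?W" by (intro open_halfspace_component_gt_cart)
  show "smooth_on ?W (\<lambda>y. M)" by (rule smooth_on_const[OF o])
  show "x \<in> ?W" using assms by simp
  show "std_flag \<in> flags k rk" by (rule std_flag_flags)
  show "invertible M" by (rule M_inv)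
  fix y assume y: "y \<in> ?W \<inter> sphere2"
  show "sph y = flag_act M std_flag"
  proof (cases "y $ 3 \<ge> 7/10")
    case True
    then show ?thesis unfolding sph_def b_eq[symmetric] by simp
  next
    case False
    with y have "y \<in> off_axis" by (intro sphere2_off_axis) auto
    with y show ?thesis using sph_high[of y] unfolding b_eq[symmetric] by simp
  qed
qed

lemma superhorizontal_mid:
  assumes x: "x \<in> off_axis" and 3: "x $ 3 < 7/10"
  shows "\<exists>A\<in>superhorizontal_endos k (sph x). represents_differential k rk sph x v A"
proof -
  have inv: "invertible (M ** G x)"
    using split_frames_invertible[OF G_frames, of x] x by (intro invertible_mult M_inv) auto
  have D: "frechet_derivative (\<lambda>y. M ** G y) (at x) v = M ** frechet_derivative G (at x) v"
  proof -
    have bl: "bounded_linear (\<lambda>A :: complex^'n^'n. M ** A)"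
      by (intro linear_conv_bounded_linear[THEN iffD1] linearI)
         (auto simp: matrix_add_ldistrib vec_eq_iff matrix_matrix_mult_def scaleR_sum_right ring_distribs sum.distrib)
    show ?thesis
      using frechet_derivative_at[OF bounded_linear.has_derivative[OF bl smooth_on_has_derivative[OF open_off_axis smooth_G x]]]
      by metis
  qed
  define A where "A = M ** frechet_derivative G (at x) v ** matrix_inv (M ** G x)"
  have F: "sph x l = (\<lambda>y. M *v (G x *v y)) ` std_flag l" for l
    using 3 by (auto simp: sph_def orbit_def flag_act_def matrix_vector_mul_assoc)
  have "A *v w \<in> sph x (Suc l)" if w: "w \<in> sph x l" for w l
  proof -
    obtain y where y: "y \<in> std_flag l" "w = (M ** G x) *v y"
      using w unfolding F by (auto simp: matrix_vector_mul_assoc)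
    obtain z where z: "z \<in> std_flag (Suc l)" "frechet_derivative G (at x) v *v y = G x *v z"
      using dG_std_flag[OF x y(1)] by blast
    have "A *v w = M *v (frechet_derivative G (at x) v *v (matrix_inv (M ** G x) ** (M ** G x) *v y))"
      by (simp only: A_def y(2) matrix_vector_mul_assoc matrix_mul_assoc)
    also have "\<dots> = M *v (G x *v z)" by (simp only: matrix_inv_left[OF inv] matrix_vector_mul_lid z(2))
    finally show ?thesis using z(1) by (auto simp: F)
  qed
  then have "A \<in> superhorizontal_endos k (sph x)" by (auto simp: superhorizontal_endos_def)
  moreover have "represents_differential k rk sph x v A"
  proof -
    have "sph x \<in> flags k rk"
      using 3 flag_act_std_flags[OF inv] by (simp add: sph_def orbit_def)
    then have "0 \<in> flag_stab k (sph x)" using zero_mem_flag by (auto simp: flag_stab_def)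
    then show ?thesis
      unfolding represents_differential_def
      by (intro exI[of _ "\<lambda>y. M ** G y"] conjI lift_mid[OF x 3]) (simp add: A_def D)
  qed
  ultimately show ?thesis by blast
qed

lemma superhorizontal_sph: "superhorizontal_sphere_in k rk D sph"
proof -
  have F: "sph x \<in> flags k rk" if "x \<in> sphere2" for x
    using sph_in_D[OF that] by (simp add: period_domain_def)
  have mid: "x \<in> off_axis" if "x \<in> sphere2" "\<not> x $ 3 > 13/20" "\<not> x $ 3 < - 5/8" for x
    using that by (intro sphere2_off_axis) auto
  have "\<exists>g. smooth_lift_at k rk sph x g" if "x \<in> sphere2" for x
    using lift_high[of x] lift_low[of x] lift_mid[OF mid[OF that]] by fastforce
  moreover have "\<exists>A\<in>superhorizontal_endos k (sph x). represents_differential k rk sph x v A" if "x \<in> sphere2" for x v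
    using superhorizontal_constant[OF F[OF that] lift_high] superhorizontal_constant[OF F[OF that] lift_low]
      superhorizontal_mid[OF mid[OF that]] by fastforce
  ultimately show ?thesis
    using sph_in_D by (auto simp: superhorizontal_sphere_in_def smooth_sphere_in_def)
qed

end

section \<open>Passage from the sphere to the square\<close>

definition stereographic :: "real \<Rightarrow> real \<Rightarrow> real^3" where
  "stereographic x y = (1 / (x\<^sup>2 + y\<^sup>2 + 1)) *\<^sub>R vector [2 * x, 2 * y, x\<^sup>2 + y\<^sup>2 - 1]"

lemma radius_pos: "0 < x\<^sup>2 + y\<^sup>2 + (1 :: real)"
  by (simp add: add_nonneg_pos)

lemma stereographic_nth:
  "stereographic x y $ 1 = 2 * x / (x\<^sup>2 + y\<^sup>2 + 1)" "stereographic x y $ 2 = 2 * y / (x\<^sup>2 + y\<^sup>2 + 1)"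
  "stereographic x y $ 3 = 1 - 2 / (x\<^sup>2 + y\<^sup>2 + 1)"
proof -
  show "stereographic x y $ 3 = 1 - 2 / (x\<^sup>2 + y\<^sup>2 + 1)"
    using radius_pos[of x y] by (simp add: stereographic_def field_simps)
qed (simp_all add: stereographic_def)

lemma stereographic_sphere: "stereographic x y \<in> sphere2"
proof -
  define r where "r = x\<^sup>2 + y\<^sup>2 + 1"
  have r: "r > 0" unfolding r_def by (rule radius_pos)
  have "stereographic x y \<bullet> stereographic x y = (2 * x / r)\<^sup>2 + (2 * y / r)\<^sup>2 + (1 - 2 / r)\<^sup>2"
    unfolding inner_vec_def sum_3 stereographic_nth r_def[symmetric] by (simp add: power2_eq_square)
  also have "\<dots> = (4 * x\<^sup>2 + 4 * y\<^sup>2 + (r - 2)\<^sup>2) / r\<^sup>2"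
    using r by (simp add: power_divide add_divide_distrib power_mult_distrib diff_divide_distrib)
      (simp add: power2_eq_square field_simps)
  also have "4 * x\<^sup>2 + 4 * y\<^sup>2 + (r - 2)\<^sup>2 = r\<^sup>2"
    by (simp add: r_def power2_eq_square algebra_simps)
  finally show ?thesis using r by (simp add: norm_eq_1)
qed

lemma north_nth: "north $ 1 = 0" "north $ 2 = 0" "north $ 3 = 1"
  by (simp_all add: north_def)

lemma dist_stereographic_north: "dist (stereographic x y) north = 2 / sqrt (x\<^sup>2 + y\<^sup>2 + 1)"
proof -
  define r where "r = x\<^sup>2 + y\<^sup>2 + 1"
  have r: "r > 0" unfolding r_def by (rule radius_pos)
  have "(dist (stereographic x y) north)\<^sup>2 = (2 * x / r)\<^sup>2 + (2 * y / r)\<^sup>2 + (2 / r)\<^sup>2"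
    unfolding dist_norm power2_norm_eq_inner inner_vec_def sum_3 vector_minus_component
      stereographic_nth north_nth r_def[symmetric] by (simp add: power2_eq_square)
  also have "\<dots> = 4 * (x\<^sup>2 + y\<^sup>2 + 1) / r\<^sup>2"
    by (simp add: power_divide add_divide_distrib power_mult_distrib)
  also have "\<dots> = (2 / sqrt r)\<^sup>2"
    unfolding r_def[symmetric] using r by (simp add: power_divide power2_eq_square)
  finally show ?thesis
    unfolding r_def[symmetric] using r by (subst (asm) power2_eq_iff_nonneg) auto
qed

lemma continuous_on_stereographic:
  assumes "continuous_on S f" "continuous_on S g"
  shows "continuous_on S (\<lambda>x. stereographic (f x) (g x))"
proof -
  have *: "vector [x, y, z] = x *\<^sub>R axis 1 1 + y *\<^sub>R axis 2 1 + z *\<^sub>R (axis 3 1 :: real^3)" for x y z :: real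
    by (simp add: vec_eq_iff forall_3 axis_def)
  have "(f x)\<^sup>2 + (g x)\<^sup>2 + 1 \<noteq> 0" for x using radius_pos[of "f x" "g x"] by simp
  then show ?thesis
    unfolding stereographic_def * by (intro continuous_intros assms) auto
qed

lemma square_to_sphere_interior:
  assumes "0 < s" "s < 1" "0 < t" "t < 1"
  shows "square_to_sphere (s, t) = stereographic ((2 * s - 1) / (s * (1 - s))) ((2 * t - 1) / (t * (1 - t)))"
  using assms by (simp add: square_to_sphere_def stereographic_def Let_def)

lemma square_to_sphere_boundary: "(s, t) \<in> square_boundary \<Longrightarrow> square_to_sphere (s, t) = north"
  by (auto simp: square_to_sphere_def mem_square_boundary)

lemma interior_square:
  assumes "(s, t) \<in> unit_square" "(s, t) \<notin> square_boundary"
  shows "0 < s" "s < 1" "0 < t" "t < 1"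
  using assms by (auto simp: mem_unit_square mem_square_boundary)

lemma north_sphere2: "north \<in> sphere2"
  by (simp add: norm_eq_1 inner_vec_def sum_3 north_nth)

lemma square_to_sphere_sphere: "z \<in> unit_square \<Longrightarrow> square_to_sphere z \<in> sphere2"
  using square_to_sphere_interior interior_square square_to_sphere_boundary stereographic_sphere north_sphere2
  by (metis surj_pair)

text \<open>The distance from the north pole when the other stereographic coordinate is 0, with the
  denominator \<open>s * (1 - s)\<close> cleared. It bounds the distance for every value of that
  coordinate, is continuous up to the ends and vanishes there, which gives continuity at the
  boundary by squeezing.\<close>

definition north_gap :: "real \<Rightarrow> real" where
  "north_gap s = 2 * (s * (1 - s)) / sqrt ((2 * s - 1)\<^sup>2 + (s * (1 - s))\<^sup>2)"

lemma north_gap_denominator: "0 < (2 * s - 1)\<^sup>2 + (s * (1 - s))\<^sup>2" for s :: real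
  by (cases "2 * s - 1 = 0") (auto simp: add_pos_nonneg add_nonneg_pos)

lemma dist_square_to_sphere_north:
  assumes z: "(s, t) \<in> unit_square"
  shows "dist (square_to_sphere (s, t)) north \<le> north_gap s" "dist (square_to_sphere (s, t)) north \<le> north_gap t"
proof -
  have nn: "0 \<le> north_gap u" if "0 \<le> u" "u \<le> 1" for u using that by (simp add: north_gap_def)
  have le: "2 / sqrt (x\<^sup>2 + y\<^sup>2 + 1) \<le> north_gap u" if "0 < u" "u < 1" "x = (2 * u - 1) / (u * (1 - u))" for x y u :: real
  proof -
    let ?d = "u * (1 - u)"
    have d: "?d > 0" using that by simp
    have "sqrt ((2 * u - 1)\<^sup>2 + ?d\<^sup>2) = ?d * sqrt (x\<^sup>2 + 1)"
    proof -
      have "(2 * u - 1)\<^sup>2 + ?d\<^sup>2 = ?d\<^sup>2 * (x\<^sup>2 + 1)"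
        unfolding that(3) using d by (simp only: power_divide distrib_left) (use that(1,2) in simp)
      then show ?thesis using d by (simp only: real_sqrt_mult real_sqrt_abs abs_of_pos)
    qed
    then have "north_gap u = 2 / sqrt (x\<^sup>2 + 1)" using d that(1,2) by (simp add: north_gap_def)
    moreover have "sqrt (x\<^sup>2 + 1) \<le> sqrt (x\<^sup>2 + y\<^sup>2 + 1)" by simp
    ultimately show ?thesis by (simp add: frac_le add_nonneg_pos)
  qed
  show "dist (square_to_sphere (s, t)) north \<le> north_gap s"
  proof (cases "(s, t) \<in> square_boundary")
    case False
    note i = interior_square[OF z False]
    show ?thesis unfolding square_to_sphere_interior[OF i] dist_stereographic_north by (rule le[OF i(1,2) refl])
  qed (use nn z in \<open>auto simp: square_to_sphere_boundary mem_unit_square\<close>)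
  show "dist (square_to_sphere (s, t)) north \<le> north_gap t"
  proof (cases "(s, t) \<in> square_boundary")
    case False
    note i = interior_square[OF z False]
    show ?thesis unfolding square_to_sphere_interior[OF i] dist_stereographic_north
      using le[OF i(3,4) refl] by (simp add: add.commute)
  qed (use nn z in \<open>auto simp: square_to_sphere_boundary mem_unit_square\<close>)
qed

lemma continuous_on_square_to_sphere: "continuous_on unit_square square_to_sphere"
  unfolding continuous_on_eq_continuous_within
proof
  fix z assume z: "z \<in> unit_square"
  obtain s t where st: "z = (s, t)" by fastforce
  have gap: "continuous_on UNIV north_gap"
    unfolding north_gap_def using north_gap_denominator by (intro continuous_intros) (auto simp: less_imp_neq[symmetric])
  have squeeze: "continuous (at z within unit_square) square_to_sphere"
    if "continuous (at z within unit_square) f" "f z = 0" "square_to_sphere z = north"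
      "\<And>w. w \<in> unit_square \<Longrightarrow> dist (square_to_sphere w) north \<le> f w" for f :: "real \<times> real \<Rightarrow> real"
    unfolding continuous_within that(3)
  proof (rule metric_tendsto_imp_tendsto)
    show "(f \<longlongrightarrow> 0) (at z within unit_square)" using that(1,2) by (simp add: continuous_within)
    show "\<forall>\<^sub>F w in at z within unit_square. dist (square_to_sphere w) north \<le> dist (f w) 0"
      unfolding eventually_at_filter using that(4) by (intro always_eventually) (fastforce simp: dist_real_def)
  qed
  show "continuous (at z within unit_square) square_to_sphere"
  proof (cases "z \<in> square_boundary")
    case True
    have ends: "north_gap 0 = 0" "north_gap 1 = 0" by (simp_all add: north_gap_def)
    have "continuous_on unit_square (\<lambda>w. north_gap (fst w))" "continuous_on unit_square (\<lambda>w. north_gap (snd w))"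
      by (auto intro!: continuous_on_compose2[OF gap] continuous_intros)
    then have cont: "continuous (at z within unit_square) (\<lambda>w. north_gap (fst w))"
      "continuous (at z within unit_square) (\<lambda>w. north_gap (snd w))"
      using z unfolding continuous_on_eq_continuous_within by blast+
    from True consider "s = 0 \<or> s = 1" | "t = 0 \<or> t = 1" by (auto simp: st mem_square_boundary)
    then show ?thesis
    proof cases
      case 1
      show ?thesis
        by (rule squeeze[OF cont(1)]) (use 1 ends True st square_to_sphere_boundary dist_square_to_sphere_north(1) in auto)
    next
      case 2
      show ?thesis
        by (rule squeeze[OF cont(2)]) (use 2 ends True st square_to_sphere_boundary dist_square_to_sphere_north(2) in auto)
    qed
  next
    case False
    let ?I = "{0<..<1::real} \<times> {0<..<1::real}"
    have o: "open ?I" by (intro open_Times open_greaterThanLessThan)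
    have "continuous_on ?I (\<lambda>w. stereographic ((2 * fst w - 1) / (fst w * (1 - fst w))) ((2 * snd w - 1) / (snd w * (1 - snd w))))"
      by (intro continuous_on_stereographic continuous_intros) auto
    then have "continuous_on ?I square_to_sphere"
      by (rule continuous_on_eq) (auto simp: square_to_sphere_interior)
    moreover have "z \<in> ?I" using interior_square False z by (auto simp: st)
    ultimately show ?thesis
      using continuous_on_eq_continuous_at[OF o] continuous_at_imp_continuous_within by blast
  qed
qed

context based_period_frames
begin

text \<open>A local smooth lift followed by the orbit map is continuous; the local statements are
  glued along an open cover of the sphere.\<close>

lemma continuous_map_smooth_sphere:
  assumes f: "smooth_sphere_in k rk D f"
  shows "continuous_map (top_of_set sphere2) T\<^sub>D f"
proof -
  have "\<forall>x\<in>sphere2. \<exists>W. open W \<and> x \<in> W \<and> continuous_map (top_of_set (sphere2 \<inter> W)) T\<^sub>D f"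
  proof
    fix x assume x: "x \<in> sphere2"
    then obtain g where "smooth_lift_at k rk f x g" using f unfolding smooth_sphere_in_def by blast
    then obtain W B where W: "open W" "x \<in> W" "smooth_on W g" "B \<in> flags k rk"
      and gB: "\<And>y. y \<in> W \<inter> sphere2 \<Longrightarrow> invertible (g y) \<and> f y = flag_act (g y) B"
      unfolding smooth_lift_at_def by blast
    have "continuous_map (top_of_set (sphere2 \<inter> W)) T\<^sub>D (\<lambda>y. flag_act (g y) B)"
    proof (rule continuous_map_flag_act[OF _ _ W(4)])
      show "continuous_on (sphere2 \<inter> W) g"
        by (rule continuous_on_subset[OF smooth_on_continuous[OF W(3)]]) auto
      fix y assume y: "y \<in> sphere2 \<inter> W"
      then have "f y \<in> D" using f unfolding smooth_sphere_in_def by blast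
      with y show "invertible (g y)" "flag_act (g y) B \<in> D" using gB[of y] by auto
    qed
    then have "continuous_map (top_of_set (sphere2 \<inter> W)) T\<^sub>D f"
      by (rule continuous_map_eq) (use gB in auto)
    with W(1,2) show "\<exists>W. open W \<and> x \<in> W \<and> continuous_map (top_of_set (sphere2 \<inter> W)) T\<^sub>D f" by blast
  qed
  then obtain W where W: "\<And>x. x \<in> sphere2 \<Longrightarrow> open (W x) \<and> x \<in> W x \<and> continuous_map (top_of_set (sphere2 \<inter> W x)) T\<^sub>D f"
    by metis
  show ?thesis
  proof (rule pasting_lemma[where I = sphere2 and T = "\<lambda>x. sphere2 \<inter> W x" and f = "\<lambda>_. f"])
    fix x assume x: "x \<in> sphere2"
    show "openin (top_of_set sphere2) (sphere2 \<inter> W x)" using W[OF x] by (simp add: openin_open_Int)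
    show "continuous_map (subtopology (top_of_set sphere2) (sphere2 \<inter> W x)) T\<^sub>D f"
      using W[OF x] by (simp add: subtopology_subtopology Int_absorb1)
  qed (use W in auto)
qed

lemma sphere_class_in_carrier:
  assumes "smooth_sphere_in k rk D f" "f north = b"
  shows "sphere_class T\<^sub>D b f \<in> carrier (pi2 T\<^sub>D b)"
proof -
  have "continuous_map (top_of_set unit_square) (top_of_set sphere2) square_to_sphere"
    using continuous_on_square_to_sphere square_to_sphere_sphere by (auto simp: continuous_map_subtopology_eu)
  from continuous_map_compose[OF this continuous_map_smooth_sphere[OF assms(1)]]
  have "f \<circ> square_to_sphere \<in> square_maps T\<^sub>D b"
    using square_to_sphere_boundary assms(2) by (auto simp: square_maps_iff)
  then show ?thesis by (simp add: sphere_class_def carrier_pi2)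
qed

end

text \<open>The cut-off at \<open>\<plusminus>3\<close> of the coordinate change \<open>s \<mapsto> (2 s - 1) / (s (1 - s))\<close>.\<close>

definition clamped :: "real \<Rightarrow> real" where
  "clamped s = 3 * (2 * s - 1) / max (3 * (s * (1 - s))) \<bar>2 * s - 1\<bar>"

lemma clamped_denominator: "0 < max (3 * (s * (1 - s))) \<bar>2 * s - 1\<bar>" for s :: real
proof (cases "2 * s - 1 = 0")
  case True
  then have s: "s = 1/2" by simp
  show ?thesis unfolding s by simp
qed (simp add: less_max_iff_disj)

lemma continuous_on_clamped: "continuous_on S clamped"
  unfolding clamped_def using clamped_denominator by (intro continuous_intros) (auto simp: less_imp_neq[symmetric])

lemma clamped_ends: "clamped 0 = -3" "clamped 1 = 3"
  by (simp_all add: clamped_def)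

text \<open>Either the cut-off does nothing, or both the coordinate and its cut-off have absolute
  value at least 3. In the latter case the stereographic height is at least 4/5 before and after the
  cut-off, and the sphere has the value \<open>b\<close> at both points.\<close>

lemma clamped_cases:
  assumes "0 < s" "s < 1"
  shows "clamped s = (2 * s - 1) / (s * (1 - s)) \<or> (clamped s)\<^sup>2 = 9 \<and> 9 \<le> ((2 * s - 1) / (s * (1 - s)))\<^sup>2"
proof (cases "\<bar>2 * s - 1\<bar> \<le> 3 * (s * (1 - s))")
  case True
  then have "max (3 * (s * (1 - s))) \<bar>2 * s - 1\<bar> = 3 * (s * (1 - s))" by (rule max_absorb1)
  then show ?thesis
    unfolding clamped_def by (intro disjI1) (simp only: mult_divide_mult_cancel_left_if, simp)
next
  case False
  let ?n = "2 * s - 1" and ?d = "s * (1 - s)"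
  have d: "?d > 0" using assms by simp
  have "clamped s = 3 * ?n / \<bar>?n\<bar>" using False by (simp add: clamped_def max_absorb2)
  moreover have "?n \<noteq> 0" using False d by auto
  moreover have "(3 * n / \<bar>n\<bar>)\<^sup>2 = 9" if "n \<noteq> 0" for n :: real
    using that by (simp add: power_divide power_mult_distrib)
  ultimately have "(clamped s)\<^sup>2 = 9" by metis
  moreover have "9 \<le> (?n / ?d)\<^sup>2"
  proof -
    have "3 \<le> \<bar>?n / ?d\<bar>" using False d by (simp add: abs_divide pos_le_divide_eq del: abs_mult)
    then have "3\<^sup>2 \<le> \<bar>?n / ?d\<bar>\<^sup>2" by (rule power_mono) simp
    then show ?thesis unfolding power2_abs by simp
  qed
  ultimately show ?thesis by simp
qed

lemma stereographic_far: "9 \<le> x\<^sup>2 + y\<^sup>2 \<Longrightarrow> 7/10 \<le> stereographic x y $ 3"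
  using radius_pos[of x y] by (simp add: stereographic_nth field_simps)

lemma stereographic_off_axis: "x \<noteq> 0 \<or> y \<noteq> 0 \<Longrightarrow> stereographic x y \<in> off_axis"
  using radius_pos[of x y]
  by (auto simp: off_axis_def stereographic_nth sum_power2_gt_zero_iff)

lemma phase_sgn: "phase x = sgn (Complex (x $ 1) (x $ 2))"
  by (simp add: phase_def sgn_div_norm cmod_def scaleR_conv_of_real)

lemma phase_stereographic: "phase (stereographic x y) = sgn (Complex x y)"
proof -
  have "Complex (2 * x / r) (2 * y / r) = (2 / r) *\<^sub>R Complex x y" for r
    by (simp add: complex_eq_iff)
  then have "phase (stereographic x y) = sgn ((2 / (x\<^sup>2 + y\<^sup>2 + 1)) *\<^sub>R Complex x y)"
    by (simp add: phase_sgn stereographic_nth)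
  then show ?thesis using radius_pos[of x y] by (simp add: sgn_scaleR)
qed

context higgs_step
begin

lemma sph_far:
  assumes "9 \<le> x\<^sup>2 + y\<^sup>2"
  shows "sph (stereographic x y) = b" "G (stereographic x y) \<in> block_mats lev"
    "G (stereographic x y) = diag_mat (\<lambda>j. if j = a then cnj (sgn (Complex x y)) else if j = c then 2 * sgn (Complex x y)
     else if j = p \<or> j = q then 4 else 1)"
proof -
  have 3: "stereographic x y $ 3 \<ge> 7/10" by (rule stereographic_far[OF assms])
  have "x \<noteq> 0 \<or> y \<noteq> 0" using assms by auto
  note o = stereographic_off_axis[OF this]
  show "sph (stereographic x y) = b" using 3 by (simp add: sph_def)
  show "G (stereographic x y) \<in> block_mats lev" by (rule G_high_block[OF o]) (use 3 in linarith)
  show "G (stereographic x y) = diag_mat (\<lambda>j. if j = a then cnj (sgn (Complex x y)) else if j = c then 2 * sgn (Complex x y)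
     else if j = p \<or> j = q then 4 else 1)"
    unfolding phase_stereographic[symmetric] by (rule G_high[OF o]) (use 3 in linarith)
qed

lemma stereographic_domain: "stereographic x y \<in> off_axis \<or> stereographic x y $ 3 \<le> - 5/8"
  using stereographic_off_axis[of x y] by (cases "x = 0 \<and> y = 0") (auto simp: stereographic_nth)

lemma sph_stereographic: "sph (stereographic x y) = orbit (G (stereographic x y))"
proof (cases "stereographic x y $ 3 \<ge> 7/10")
  case True
  then have "stereographic x y \<in> off_axis" using stereographic_domain[of x y] by auto
  with True show ?thesis using sph_high[of "stereographic x y"] orbit_block[OF G_high_block[of "stereographic x y"]] by simp
qed (simp add: sph_def)

text \<open>The composite of \<open>G\<close> with the collapse has no continuous extension to the
  boundary of the square, which is collapsed to the north pole. Cutting the coordinates off at 3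
  yields a continuous lift of the same sphere, because the cut-off only acts where the flag is
  \<open>b\<close>.\<close>

definition G_square :: "real \<times> real \<Rightarrow> complex^'n^'n" where
  "G_square z = G (stereographic (clamped (fst z)) (clamped (snd z)))"

lemma boundary_far:
  assumes "(s, t) \<in> square_boundary"
  shows "9 \<le> (clamped s)\<^sup>2 + (clamped t)\<^sup>2"
  using assms by (auto simp: mem_square_boundary clamped_ends)

lemma sph_square:
  assumes "z \<in> unit_square"
  shows "(sph \<circ> square_to_sphere) z = orbit (G_square z)"
proof -
  obtain s t where z: "z = (s, t)" by fastforce
  have *: "orbit (G_square z) = b" if "9 \<le> (clamped s)\<^sup>2 + (clamped t)\<^sup>2"
    using orbit_block[OF sph_far(2)[OF that]] by (simp add: z G_square_def)
  show ?thesis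
  proof (cases "z \<in> square_boundary")
    case True
    then show ?thesis using * boundary_far[of s t] by (simp add: z square_to_sphere_boundary sph_def north_nth)
  next
    case False
    note i = interior_square[OF assms[unfolded z] False[unfolded z]]
    let ?x = "(2 * s - 1) / (s * (1 - s))" and ?y = "(2 * t - 1) / (t * (1 - t))"
    show ?thesis
    proof (cases "clamped s = ?x \<and> clamped t = ?y")
      case True
      then show ?thesis by (simp add: z square_to_sphere_interior[OF i] sph_stereographic G_square_def)
    next
      case False
      then have "(clamped s)\<^sup>2 = 9 \<and> 9 \<le> ?x\<^sup>2 \<or> (clamped t)\<^sup>2 = 9 \<and> 9 \<le> ?y\<^sup>2"
        using clamped_cases[OF i(1,2)] clamped_cases[OF i(3,4)] by blast
      then have "9 \<le> (clamped s)\<^sup>2 + (clamped t)\<^sup>2" "9 \<le> ?x\<^sup>2 + ?y\<^sup>2"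
        using zero_le_power2[of ?x] zero_le_power2[of ?y]
          zero_le_power2[of "clamped s"] zero_le_power2[of "clamped t"] by linarith+
      then show ?thesis using * sph_far(1) by (simp add: z square_to_sphere_interior[OF i])
    qed
  qed
qed

lemma continuous_on_G: "continuous_on (off_axis \<union> {x. x $ 3 < - 5/8}) G"
proof (rule continuous_on_open_Un)
  show "continuous_on off_axis G" by (rule smooth_on_continuous[OF smooth_G])
  have "continuous_on {x. x $ 3 < - 5/8} (\<lambda>_. G (- north))" by (rule continuous_on_const)
  then show "continuous_on {x. x $ 3 < - 5/8} G"
    by (rule continuous_on_eq) (auto intro!: G_low simp: north_nth)
qed (auto intro: open_off_axis open_halfspace_component_lt_cart)

lemma continuous_on_G_square: "continuous_on unit_square G_square"
  unfolding G_square_def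
proof (rule continuous_on_compose2[OF continuous_on_G])
  show "continuous_on unit_square (\<lambda>z. stereographic (clamped (fst z)) (clamped (snd z)))"
    by (intro continuous_on_stereographic continuous_on_compose2[OF continuous_on_clamped[of UNIV]] continuous_intros) auto
  have "stereographic x y \<in> off_axis \<or> stereographic x y $ 3 < - 5/8" for x y
    using stereographic_off_axis[of x y] by (cases "x = 0 \<and> y = 0") (auto simp: stereographic_nth)
  then show "(\<lambda>z. stereographic (clamped (fst z)) (clamped (snd z))) ` unit_square \<subseteq> off_axis \<union> {x. x $ 3 < - 5 / 8}"
    by auto
qed

text \<open>The angle from the direction of the retracted point to that of (1, t), followed
  continuously. On the side s = 1 directions stay in the right half plane, where \<open>Arg\<close>
  is continuous. On the other three sides they avoid the positive real axis, so \<open>Arg\<close>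
  is applied to the negative. The summand \<open>pi\<close> makes the angle start at 0.\<close>

definition side_angle :: "real \<Rightarrow> real" where
  "side_angle t = Arg (Complex 3 (clamped t))
     - Arg (Complex (- clamped (fst (retract_three_sides (1, t)))) (- clamped (snd (retract_three_sides (1, t))))) + pi"

lemma three_sides_slit:
  assumes "t \<in> {0..1}"
  shows "Complex (- clamped (fst (retract_three_sides (1, t)))) (- clamped (snd (retract_three_sides (1, t)))) \<notin> \<real>\<^sub>\<le>\<^sub>0"
proof -
  have "(1, t) \<in> unit_square" using assms by (simp add: mem_unit_square)
  then obtain s' t' where "retract_three_sides (1, t) = (s', t')" "s' = 0 \<or> t' = 0 \<or> t' = 1"
    by (rule retract_three_sides)
  then show ?thesis by (auto simp: complex_nonpos_Reals_iff clamped_ends)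
qed

lemma continuous_on_side_angle: "continuous_on {0..1} side_angle"
proof -
  have r: "continuous_on {0..1} (\<lambda>t::real. retract_three_sides (1, t))"
    by (rule continuous_on_compose2[OF continuous_on_retract_three_sides]) (auto simp: mem_unit_square intro!: continuous_intros)
  have cc: "continuous_on S (\<lambda>x. Complex (f x) (g x))" if "continuous_on S f" "continuous_on S g" for S :: "real set" and f g
    using that unfolding Complex_eq by (intro continuous_intros)
  have cl: "continuous_on S (\<lambda>x. clamped (f x))" if "continuous_on S f" for S :: "real set" and f
    by (rule continuous_on_compose2[OF continuous_on_clamped[of UNIV] that]) auto
  show ?thesis
    unfolding side_angle_def
    by (intro continuous_intros cc cl r) (use three_sides_slit in \<open>auto simp: complex_nonpos_Reals_iff\<close>)
qed

lemma side_angle_ends: "side_angle 0 = 0" "side_angle 1 = 2 * pi"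
proof -
  have r: "retract_three_sides (1, 0) = (1, 0)" "retract_three_sides (1, 1) = (1, 1)"
    by (simp_all add: retract_three_sides_id mem_unit_square)
  have m: "Complex (- x) (- y) = - Complex x y" for x y by (simp add: complex_eq_iff)
  have "Arg (Complex 3 (-3)) < 0" by (simp add: Arg_neg_iff)
  then have "Arg (- Complex 3 (-3)) = Arg (Complex 3 (-3)) + pi" by (subst Arg_minus) (auto simp: complex_eq_iff)
  then show "side_angle 0 = 0" unfolding side_angle_def r fst_conv snd_conv m clamped_ends by simp
  have "\<not> Arg (Complex 3 3) \<le> 0" using Arg_pos_iff[of "Complex 3 3"] by simp
  then have "Arg (- Complex 3 3) = Arg (Complex 3 3) - pi" by (subst Arg_minus) (auto simp: complex_eq_iff)
  then show "side_angle 1 = 2 * pi" unfolding side_angle_def r fst_conv snd_conv m clamped_ends by simp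
qed

lemma sgn_side_angle:
  assumes "t \<in> {0..1}" and r: "retract_three_sides (1, t) = (s', t')"
  shows "sgn (Complex 3 (clamped t)) = cis (side_angle t) * sgn (Complex (clamped s') (clamped t'))"
proof -
  let ?z = "Complex 3 (clamped t)" and ?w = "Complex (clamped s') (clamped t')"
  have m: "Complex (- clamped s') (- clamped t') = - ?w" by (simp add: complex_eq_iff)
  have "?w \<noteq> 0" using three_sides_slit[OF assms(1)] unfolding r by (auto simp: complex_eq_iff complex_nonpos_Reals_iff)
  then have w: "cis (Arg (- ?w)) = - sgn ?w" by (subst cis_Arg) (auto simp: sgn_minus)
  have z: "cis (Arg ?z) = sgn ?z" by (rule cis_Arg) (simp add: complex_eq_iff)
  have "Arg ?z = side_angle t + (Arg (- ?w) - pi)" by (simp add: side_angle_def r m)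
  then have "sgn ?z = cis (side_angle t) * (cis (Arg (- ?w)) * cis (- pi))"
    by (simp add: z[symmetric] cis_mult)
  moreover have "cis (- pi) = - 1" by (simp add: complex_eq_iff)
  ultimately show ?thesis by (simp add: w)
qed

text \<open>On the boundary the lift is diagonal and depends only on the direction of the clamped
  point. Passing from the retracted point to (1, t) multiplies the entry at \<open>c\<close> by
  \<open>cis (side_angle t)\<close> and that at \<open>a\<close> by its conjugate. The angle runs
  from 0 to 2 pi, which gives 1 at level \<open>i + 2\<close> and -1 at level
  \<open>i\<close>.\<close>

lemma has_degrees_sph:
  "has_degrees (sph \<circ> square_to_sphere) (\<lambda>l. of_bool (l = i + 2) - of_bool (l = i))"
proof (rule has_degrees_normalise[where g = G_square and
    \<phi> = "\<lambda>l t. of_real (side_angle t) * \<i> * (of_bool (l = i + 2) - of_bool (l = i))"])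
  show "continuous_on unit_square G_square" by (rule continuous_on_G_square)
  show "G_square z \<in> frames" for z
    unfolding G_square_def by (rule G_frames[OF stereographic_domain])
  show "(sph \<circ> square_to_sphere) z = orbit (G_square z)" if "z \<in> unit_square" for z
    by (rule sph_square[OF that])
  show "G_square z \<in> block_mats lev" if "z \<in> square_boundary" for z
    using sph_far(2)[OF boundary_far] that by (cases z) (auto simp: G_square_def)
  fix l
  show "continuous_on {0..1} (\<lambda>t. of_real (side_angle t) * \<i> * (of_bool (l = i + 2) - of_bool (l = i)))"
    by (intro continuous_intros continuous_on_side_angle)
  show "of_real (side_angle 0) * \<i> * (of_bool (l = i + 2) - of_bool (l = i)) = 0" by (simp add: side_angle_ends)
  show "of_real (side_angle 1) * \<i> * (of_bool (l = i + 2) - of_bool (l = i)) =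
      2 * of_int (of_bool (l = i + 2) - of_bool (l = i)) * of_real pi * \<i>" by (simp add: side_angle_ends)
next
  fix l and t :: real assume t: "t \<in> {0..1}"
  have sq: "(1, t) \<in> unit_square" "(1, t) \<in> square_boundary" using t by (auto simp: mem_unit_square mem_square_boundary)
  obtain s' t' where r: "retract_three_sides (1, t) = (s', t')" "(s', t') \<in> unit_square" "s' = 0 \<or> t' = 0 \<or> t' = 1"
    by (rule retract_three_sides[OF sq(1)])
  then have r': "(s', t') \<in> square_boundary" by (auto simp: mem_unit_square mem_square_boundary)
  define E where "E = cis (side_angle t)"
  \<comment> \<open>The ratio of the diagonal entries at (1, t) and at its retraction; the constant
    factors 2 and 4 cancel.\<close>
  define \<epsilon> where "\<epsilon> j = (if j = a then cnj E else if j = c then E else 1)" for j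
  let ?w = "sgn (Complex (clamped s') (clamped t'))"
  let ?f = "\<lambda>j. if j = a then cnj ?w else if j = c then 2 * ?w else if j = p \<or> j = q then 4 else 1"
  have G': "G_square (s', t') = diag_mat ?f"
    using sph_far(3)[OF boundary_far[OF r']] by (simp add: G_square_def)
  have "G_square (1, t) = diag_mat (\<lambda>j. \<epsilon> j * ?f j)"
    using sph_far(3)[OF boundary_far[OF sq(2)]] sgn_side_angle[OF t r(1)]
    by (auto simp: G_square_def clamped_ends \<epsilon>_def E_def intro!: arg_cong[where f = diag_mat])
  then have "block_det (lev -` {l}) (G_square (1, t)) = (\<Prod>j\<in>lev -` {l}. \<epsilon> j) * block_det (lev -` {l}) (G_square (s', t'))"
    unfolding G' by (simp add: block_det_diagonal diag_mat_def prod.distrib)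
  also have "(\<Prod>j\<in>lev -` {l}. \<epsilon> j) = exp (of_real (side_angle t) * \<i> * (of_bool (l = i + 2) - of_bool (l = i)))"
  proof -
    have "(\<Prod>j\<in>lev -` {l}. \<epsilon> j) = (\<Prod>j\<in>lev -` {l} \<inter> {a, c}. \<epsilon> j)"
      by (intro prod.mono_neutral_right) (auto simp: \<epsilon>_def)
    also have "\<dots> = (if l = i then cnj E else if l = i + 2 then E else 1)"
    proof -
      have "lev -` {l} \<inter> {a, c} = (if l = i then {a} else if l = i + 2 then {c} else {})"
        using lev_a lev_c by auto
      then show ?thesis by (simp add: \<epsilon>_def)
    qed
    also have "\<dots> = exp (of_real (side_angle t) * \<i> * (of_bool (l = i + 2) - of_bool (l = i)))"
      by (simp add: E_def cis_conv_exp exp_cnj mult.commute)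
    finally show ?thesis .
  qed
  finally show "block_det (lev -` {l}) (G_square (1, t)) =
      exp (of_real (side_angle t) * \<i> * (of_bool (l = i + 2) - of_bool (l = i))) *
      block_det (lev -` {l}) (G_square (retract_three_sides (1, t)))"
    unfolding r(1) .
qed

lemma sph_north: "sph north = b"
  by (simp add: sph_def north_nth)

end

section \<open>Coordinates for given ranks and the conclusion\<close>

lemma sum_flag_ranks:
  fixes F :: "'n::finite flag"
  assumes F: "F \<in> flags k r"
  shows "(\<Sum>i\<le>k. r i) = CARD('n)"
proof -
  have step: "vec.dim (F i) = vec.dim (below F i) + r i" if "i \<le> k" for i
    using F that by (auto simp: flags_def)
  have "vec.dim (F i) = (\<Sum>j\<le>i. r j)" if "i \<le> k" for i
    using that
  proof (induction i)
    case 0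
    then show ?case using step[of 0] by (simp add: below_def)
  next
    case (Suc i)
    then show ?case using step[of "Suc i"] by (simp add: below_def)
  qed
  moreover have "F k = UNIV" using F by (simp add: flags_def)
  ultimately show ?thesis using vec_dim_card[where 'n = 'n and 'a = complex] by (metis order_refl)
qed

lemma levels_exist:
  assumes "(\<Sum>i\<le>k. r i) = CARD('n::finite)"
  obtains lev :: "'n::finite \<Rightarrow> nat" where "\<And>j. lev j \<le> k" "\<And>i. i \<le> k \<Longrightarrow> card {j. lev j = i} = r i"
proof -
  let ?S = "SIGMA i:{..k}. {..<r i}"
  have "card ?S = CARD('n)" using assms by simp
  then obtain f :: "'n \<Rightarrow> nat \<times> nat" where f: "bij_betw f UNIV ?S"
    using finite_same_card_bij[of "UNIV :: 'n set" ?S] by auto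
  show thesis
  proof (rule that)
    show "(fst \<circ> f) j \<le> k" for j
      using bij_betwE[OF f, rule_format, of j] by (auto simp: mem_Sigma_iff split_beta)
    fix i assume i: "i \<le> k"
    have "f ` {j. (fst \<circ> f) j = i} = {i} \<times> {..<r i}"
    proof (intro equalityI subsetI)
      fix x assume "x \<in> f ` {j. (fst \<circ> f) j = i}"
      then obtain j where "x = f j" "fst (f j) = i" by auto
      then show "x \<in> {i} \<times> {..<r i}"
        using bij_betwE[OF f, rule_format, of j] by (cases x) auto
    next
      fix x assume x: "x \<in> {i} \<times> {..<r i}"
      then have "x \<in> f ` UNIV" using bij_betw_imp_surj_on[OF f] i by auto
      then obtain j where "x = f j" by blast
      with x show "x \<in> f ` {j. (fst \<circ> f) j = i}" by (intro image_eqI[of _ _ j]) auto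
    qed
    moreover have "inj_on f {j. (fst \<circ> f) j = i}"
      using bij_betw_imp_inj_on[OF f] by (rule inj_on_subset) simp
    ultimately show "card {j. (fst \<circ> f) j = i} = r i" by (metis card_image card_cartesian_product_singleton card_lessThan)
  qed
qed

lemma generate_superhorizontal:
  fixes H :: "complex^'n::finite \<Rightarrow> complex^'n \<Rightarrow> complex"
  assumes H: "hermitian_form H"
    and r: "\<And>i. i \<le> k \<Longrightarrow> 1 \<le> r i" "\<And>i. i > k \<Longrightarrow> r i = 0" "\<And>i. 0 < i \<Longrightarrow> i < k \<Longrightarrow> r i \<noteq> 1"
    and b: "b \<in> period_domain k r H"
  shows "generate (pi2 (period_topology k r H) b)
     {sphere_class (period_topology k r H) b f | f. superhorizontal_sphere_in k r (period_domain k r H) f \<and> f north = b}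
     = carrier (pi2 (period_topology k r H) b)"
proof -
  have "(\<Sum>i\<le>k. r i) = CARD('n)" using b by (intro sum_flag_ranks) (auto simp: period_domain_def)
  then obtain lev :: "'n \<Rightarrow> nat" where lev: "\<And>j. lev j \<le> k" "\<And>i. i \<le> k \<Longrightarrow> card {j. lev j = i} = r i"
    using levels_exist[of r k] by blast
  interpret hermitian_form H by (rule H)
  interpret period_frames H k lev by unfold_locales (rule lev(1))
  have rk: "rk i = r i" for i
  proof (cases "i \<le> k")
    case False
    then have "{j. lev j = i} = {}" using lev(1) by auto
    then show ?thesis using False r(2) by (simp add: rk_def)
  qed (simp add: rk_def lev(2))
  then have rk': "r = rk" by auto
  obtain M where "invertible M" "b = flag_act M std_flag" "\<And>x y. H (M *v x) (M *v y) = split_form Q x y"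
    using normalised_frame[of b] b unfolding rk' by blast
  then interpret based_period_frames H k lev M b by unfold_locales
  show ?thesis unfolding rk'
  proof (rule generate_pi2)
    show "{sphere_class T\<^sub>D b f | f. superhorizontal_sphere_in k rk D f \<and> f north = b} \<subseteq> carrier (pi2 T\<^sub>D b)"
      using sphere_class_in_carrier by (auto simp: superhorizontal_sphere_in_def)
    fix i assume i: "i + 2 \<le> k"
    have ne: "\<exists>j. lev j = l" if "l \<le> k" for l
      using lev(2)[OF that] r(1)[OF that] by (metis (mono_tags, lifting) Collect_empty_eq card.empty not_one_le_zero)
    obtain a c where "lev a = i" "lev c = i + 2" using ne[of i] ne[of "i + 2"] i by auto
    \<comment> \<open>The index i + 1 lies strictly between 0 and \<open>k\<close>, so its rank is
      at least 1 and different from 1.\<close>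
    moreover have "\<not> card {j. lev j = i + 1} \<le> Suc 0"
      using lev(2)[of "i + 1"] r(1)[of "i + 1"] r(3)[of "i + 1"] i by simp
    then obtain p q where "lev p = i + 1" "lev q = i + 1" "p \<noteq> q"
      by (subst (asm) card_le_Suc0_iff_eq) auto
    ultimately interpret higgs_step H k lev M b i a c p q by unfold_locales
    show "\<exists>\<gamma>. has_degrees \<gamma> (\<lambda>l. of_bool (l = i + 2) - of_bool (l = i)) \<and>
        pi2_class T\<^sub>D b \<gamma> \<in> {sphere_class T\<^sub>D b f | f. superhorizontal_sphere_in k rk D f \<and> f north = b}"
      using has_degrees_sph superhorizontal_sph sph_north unfolding sphere_class_def by blast
  qed
qed

theorem theorem1p7:
  fixes X :: "'m topology"
    and Atl :: "('m, 'c::real_normed_vector) chart set"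
    and J :: "'c \<Rightarrow> 'c"
    and \<omega> :: "('m, 'c) chart \<Rightarrow> 'm \<Rightarrow> 'c \<Rightarrow> 'c \<Rightarrow> real"
    and Fr :: "('m, 'n::finite) frame set"
    and k :: nat
    and E :: "nat \<Rightarrow> 'm \<Rightarrow> (complex^'n) set"
    and nab :: "('m \<Rightarrow> complex^'n) \<Rightarrow> ('m, 'c) chart \<Rightarrow> 'c \<Rightarrow> 'm \<Rightarrow> complex^'n"
    and h :: "'m \<Rightarrow> complex^'n \<Rightarrow> complex^'n \<Rightarrow> complex"
    and \<theta> :: "('m, 'c) chart \<Rightarrow> 'c \<Rightarrow> 'm \<Rightarrow> complex^'n^'n"
    and x\<^sub>0 :: 'm
    and r :: "nat \<Rightarrow> nat"
    and D :: "'n flag set"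
    and T\<^sub>D :: "'n flag topology"
  assumes "kaehler_manifold X Atl J \<omega>"
    and "cvhs X Atl J Fr k E nab h \<theta>"
    and "k \<ge> 1"
    and "x\<^sub>0 \<in> topspace X"
    and "r = (\<lambda>i. vec.dim (E i x\<^sub>0))"
    and "D = period_domain k r (h x\<^sub>0)"
    and "T\<^sub>D = period_topology k r (h x\<^sub>0)"
    and "\<not> (\<exists>i. 0 < i \<and> i < k \<and> r i = 1)"
  shows "\<forall>b\<in>D. generate (pi2 T\<^sub>D b)
           {sphere_class T\<^sub>D b f | f. superhorizontal_sphere_in k r D f \<and> f north = b}
         = carrier (pi2 T\<^sub>D b)"
  unfolding assms(6,7)
proof (intro ballI generate_superhorizontal)
  interpret cvhs X Atl J Fr k E nab h \<theta> by (rule assms(2))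
  note x\<^sub>0 = assms(4)
  show "hermitian_form (h x\<^sub>0)"
    using h_add[OF x\<^sub>0] h_scale[OF x\<^sub>0] h_Hermitian[OF x\<^sub>0] by unfold_locales
  show "1 \<le> r i" if i: "i \<le> k" for i
  proof -
    obtain d :: nat and s where "vec.span ((\<lambda>j. s j x\<^sub>0) ` {..<d}) = E i x\<^sub>0"
      using subbundle[OF i x\<^sub>0] by blast
    then have "0 \<in> E i x\<^sub>0" using vec.span_zero by metis
    then have "\<not> E i x\<^sub>0 \<subseteq> {0}" using nonzero[OF i x\<^sub>0] by blast
    then have "vec.dim (E i x\<^sub>0) \<noteq> 0" by (simp only: vec.dim_eq_0 not_False_eq_True)
    then show ?thesis unfolding assms(5) by linarith
  qed
  show "r i = 0" if "i > k" for i using beyond[OF that x\<^sub>0] by (simp add: assms(5))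
  show "0 < i \<Longrightarrow> i < k \<Longrightarrow> r i \<noteq> 1" for i using assms(8) by blast
qed

end
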